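(* Let the distributional assumptions (A1)–(A3) of the context hold. Assume there is a constant $M>1$ with $M^{-1}\le d/n\le M$ and $\sigma_d\ge M^{-1}$, and let $\lambda\in[1/M,M]$. Then for any positive integers $k$ and $D$, if $n=\Omega_{k,M,C_x,D}(1)$, with probability $1-O_k(n^{-D+1})$ we have $$|\mathscr V_X(\lambda)-\mathsf V_n(\lambda)|=O_{k,M,C_x,D}\Big(\frac{\log^8n}{n^{1-\frac1k}}\Big)\cdot\mathsf V_n(\lambda),\qquad |\mathscr B_X(\lambda)-\mathsf B_n(\lambda)|=O_{k,M,C_x,D}\Big(\frac{\log^8n}{n^{\frac12-\frac1k}}\Big)\cdot\mathsf B_n(\lambda).$$
   Context: Setting. $d\in\mathbb N$; $x_1,\dots,x_n$ are i.i.d. random vectors in $\mathbb R^d$. $X$ is the $n\times d$ matrix with rows $x_i^T$, $\hat\Sigma=X^TX/n$. Responses are $y_i=\langle\beta,x_i\rangle+\varepsilon_i$ with $\varepsilon_i$ i.i.d., independent of $X$, mean $0$, variance $\tau^2$. $\Sigma=\mathbb E[x_1x_1^T]$. Assumptions. (A1) $\mathbb E[x_i]=0$, $\|\Sigma\|=1$, eigenvalues $1=\sigma_1\ge\cdots\ge\sigma_d$, and $\|\Sigma^{-1/2}\beta\|<\infty$. (A2) $d_\Sigma=d_\Sigma(n)\ge n$ is a number such that $\sum_{l=k}^d\sigma_l\le d_\Sigma\sigma_k$ for all $1\le k\le\min\{n,d\}$. (A3) $x_i=\Sigma^{1/2}z_i$ where, for a constant $C_x>0$, one of the following holds: (a)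 $z_i$ has independent (not necessarily identically distributed) coordinates with $\mathbb E z_{ij}=0$, $\mathrm{Var}(z_{ij})=1$ and $\sup_{p\ge1}p^{-1/2}(\mathbb E|z_{ij}|^p)^{1/p}\le C_x$; or (b) $z_i$ (mean $0$, identity covariance, possibly dependent coordinates) satisfies, for every $1$-Lipschitz convex $\varphi:\mathbb R^d\to\mathbb R$ and $t>0$, $\mathbb P(|\varphi(z_i)-\mathbb E\varphi(z_i)|\ge t)\le 2\exp(-t^2/C_x^2)$. Ridge variance and bias (conditional on $X$), for $\lambda>0$: $$\mathscr V_X(\lambda)=\frac{\tau^2}{n}\mathrm{Tr}\big(\Sigma\hat\Sigma(\hat\Sigma+\lambda I)^{-2}\big),\qquad \mathscr B_X(\lambda)=\lambda^2\langle\beta,(\hat\Sigma+\lambda I)^{-1}\Sigma(\hat\Sigma+\lambda I)^{-1}\beta\rangle .$$ Effective quantities: $\lambda_\star=\lambda_\star(\lambda)$ is the unique non-negative solution of $n(1-\lambda/\lambda_\star)=\mathrm{Tr}(\Sigma(\Sigma+\lambda_\star I)^{-1})$, and $$\mathsf V_n(\lambda)=\frac{\tau^2\mathrm{Tr}(\Sigma^2(\Sigma+\lambda_\star I)^{-2})}{n-\mathrm{Tr}(\Sigma^2(\Sigma+\lambda_\star I)^{-2})},\qquad \mathsf B_n(\lambda)=\frac{\lambda_\star^2\langle\beta,(\Sigma+\lambda_\star I)^{-2}\Sigma\beta\rangle}{1-n^{-1}\mathrm{Tr}(\Sigma^2(\Sigma+\lambda_\star I)^{-2})}.$$ Notation: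 $f=O_a(g)$ means $|f|\le C_a|g|$ with $C_a$ depending only on $a$; $n=\Omega_a(1)$ means $n\ge C_a$. $\log^8n=(\log n)^8$. *)

theory Defs
  imports
    "HOL-Probability.Probability"
    "Jordan_Normal_Form.Gauss_Jordan_Elimination"
    "Jordan_Normal_Form.Char_Poly"
begin

unbundle no vec_syntax and no inner_syntax
hide_const (open) Finite_Cartesian_Product.vec Finite_Cartesian_Product.mat
  Finite_Cartesian_Product.row Finite_Cartesian_Product.column Determinants.det

text \<open>
  The constants in the result must be uniform in the dimension \<open>d\<close> and the sample size \<open>n\<close>, so
  vectors and matrices carry their dimensions as values (\<open>real vec\<close>, \<open>real mat\<close>) rather than in
  their types.  Observations and coordinates are numbered from \<open>0\<close>, eigenvalues from \<open>1\<close>.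
\<close>

definition mat_trace :: "real mat \<Rightarrow> real" where
  "mat_trace A = (\<Sum>i<dim_row A. A $$ (i, i))"

definition minv :: "real mat \<Rightarrow> real mat" where
  "minv A = the (mat_inverse A)"

definition vec_norm :: "real vec \<Rightarrow> real" where
  "vec_norm v = sqrt (v \<bullet> v)"

definition op_norm :: "real mat \<Rightarrow> real" where
  "op_norm A = (SUP v\<in>{v \<in> carrier_vec (dim_col A). vec_norm v \<le> 1}. vec_norm (A *\<^sub>v v))"

definition pos_semidef :: "nat \<Rightarrow> real mat \<Rightarrow> bool" where
  "pos_semidef d A \<longleftrightarrow> A \<in> carrier_mat d d \<and> transpose_mat A = A \<and>
     (\<forall>v\<in>carrier_vec d. 0 \<le> v \<bullet> (A *\<^sub>v v))"

definition mat_sqrt :: "real mat \<Rightarrow> real mat" where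
  "mat_sqrt A = (THE S. pos_semidef (dim_row A) S \<and> S * S = A)"

text \<open>\<open>\<sigma> 1, \<dots>, \<sigma> d\<close> are the eigenvalues of \<open>A\<close>, with multiplicity, in decreasing order.\<close>

definition decreasing_eigenvalues :: "nat \<Rightarrow> real mat \<Rightarrow> (nat \<Rightarrow> real) \<Rightarrow> bool" where
  "decreasing_eigenvalues d A \<sigma> \<longleftrightarrow>
     char_poly A = (\<Prod>l=1..d. [:- \<sigma> l, 1:]) \<and> (\<forall>k l. 1 \<le> k \<and> k \<le> l \<and> l \<le> d \<longrightarrow> \<sigma> l \<le> \<sigma> k)"

definition vec_borel :: "nat \<Rightarrow> real vec measure" where
  "vec_borel d = vimage_algebra (carrier_vec d) (\<lambda>v. \<lambda>j\<in>{..<d}. v $ j) (PiM {..<d} (\<lambda>_. borel))"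

definition second_moment_mat :: "'a measure \<Rightarrow> nat \<Rightarrow> ('a \<Rightarrow> real vec) \<Rightarrow> real mat" where
  "second_moment_mat P d Y = Matrix.mat d d (\<lambda>(j, k). \<integral>\<omega>. Y \<omega> $ j * Y \<omega> $ k \<partial>P)"

definition mean_zero_square_integrable :: "'a measure \<Rightarrow> nat \<Rightarrow> ('a \<Rightarrow> real vec) \<Rightarrow> bool" where
  "mean_zero_square_integrable P d Y \<longleftrightarrow>
     (\<forall>j<d. integrable P (\<lambda>\<omega>. Y \<omega> $ j) \<and> integrable P (\<lambda>\<omega>. (Y \<omega> $ j)\<^sup>2) \<and>
            (\<integral>\<omega>. Y \<omega> $ j \<partial>P) = 0)"

locale linear_model = prob_space P
  for P :: "'a measure" +
  fixes n d :: nat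
    and \<beta> :: "real vec" and \<tau> :: real
    and x :: "nat \<Rightarrow> 'a \<Rightarrow> real vec"
    and \<epsilon> y :: "nat \<Rightarrow> 'a \<Rightarrow> real"
  assumes beta_carrier: "\<beta> \<in> carrier_vec d"
    and x_indep: "indep_vars (\<lambda>_. vec_borel d) x {..<n}"
    and x_ident: "\<And>i. i < n \<Longrightarrow> distr P (vec_borel d) (x i) = distr P (vec_borel d) (x 0)"
    and noise_indep: "indep_vars (\<lambda>_. borel) \<epsilon> {..<n}"
    and noise_ident: "\<And>i. i < n \<Longrightarrow> distr P borel (\<epsilon> i) = distr P borel (\<epsilon> 0)"
    and noise_indep_x:
      "indep_set
         {(\<lambda>\<omega>. \<lambda>i\<in>{..<n}. \<epsilon> i \<omega>) -` A \<inter> space P | A. A \<in> sets (PiM {..<n} (\<lambda>_. borel))}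
         {(\<lambda>\<omega>. \<lambda>i\<in>{..<n}. x i \<omega>) -` A \<inter> space P | A. A \<in> sets (PiM {..<n} (\<lambda>_. vec_borel d))}"
    and noise_moments:
      "\<And>i. i < n \<Longrightarrow> integrable P (\<epsilon> i) \<and> integrable P (\<lambda>\<omega>. (\<epsilon> i \<omega>)\<^sup>2) \<and>
                      expectation (\<epsilon> i) = 0 \<and> variance (\<epsilon> i) = \<tau>\<^sup>2"
    and response: "\<And>i \<omega>. i < n \<Longrightarrow> \<omega> \<in> space P \<Longrightarrow> y i \<omega> = \<beta> \<bullet> x i \<omega> + \<epsilon> i \<omega>"

text \<open>The condition that the norm of \<open>\<Sigma>\<^sup>-\<^sup>1\<^sup>/\<^sup>2 \<beta>\<close> be finite says that \<open>\<beta>\<close> lies in the range of the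
  square root of \<open>\<Sigma>\<close>.\<close>

definition assumption_A1 ::
  "'a measure \<Rightarrow> nat \<Rightarrow> nat \<Rightarrow> (nat \<Rightarrow> 'a \<Rightarrow> real vec) \<Rightarrow> real vec \<Rightarrow> (nat \<Rightarrow> real) \<Rightarrow> bool" where
  "assumption_A1 P n d x \<beta> \<sigma> \<longleftrightarrow>
     (let \<Sigma> = second_moment_mat P d (x 0) in
       (\<forall>i<n. mean_zero_square_integrable P d (x i)) \<and>
       op_norm \<Sigma> = 1 \<and>
       decreasing_eigenvalues d \<Sigma> \<sigma> \<and> \<sigma> 1 = 1 \<and>
       (\<exists>v\<in>carrier_vec d. mat_sqrt \<Sigma> *\<^sub>v v = \<beta>))"

definition assumption_A2 :: "nat \<Rightarrow> nat \<Rightarrow> (nat \<Rightarrow> real) \<Rightarrow> real \<Rightarrow> bool" where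
  "assumption_A2 n d \<sigma> d\<^sub>\<Sigma> \<longleftrightarrow>
     d\<^sub>\<Sigma> \<ge> real n \<and> (\<forall>k. 1 \<le> k \<and> k \<le> min n d \<longrightarrow> (\<Sum>l=k..d. \<sigma> l) \<le> d\<^sub>\<Sigma> * \<sigma> k)"

definition subgaussian_coordinates :: "'a measure \<Rightarrow> nat \<Rightarrow> real \<Rightarrow> ('a \<Rightarrow> real vec) \<Rightarrow> bool" where
  "subgaussian_coordinates P d C Z \<longleftrightarrow>
     prob_space.indep_vars P (\<lambda>_. borel) (\<lambda>j \<omega>. Z \<omega> $ j) {..<d} \<and>
     mean_zero_square_integrable P d Z \<and>
     (\<forall>j<d. prob_space.variance P (\<lambda>\<omega>. Z \<omega> $ j) = 1 \<and>
        (\<forall>p\<ge>1. integrable P (\<lambda>\<omega>. \<bar>Z \<omega> $ j\<bar> powr p) \<and>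
           p powr (- 1 / 2) * (\<integral>\<omega>. \<bar>Z \<omega> $ j\<bar> powr p \<partial>P) powr (1 / p) \<le> C))"

definition convex_fun_vec :: "nat \<Rightarrow> (real vec \<Rightarrow> real) \<Rightarrow> bool" where
  "convex_fun_vec d \<phi> \<longleftrightarrow>
     (\<forall>u\<in>carrier_vec d. \<forall>v\<in>carrier_vec d. \<forall>t\<in>{0..1}.
        \<phi> ((1 - t) \<cdot>\<^sub>v u + t \<cdot>\<^sub>v v) \<le> (1 - t) * \<phi> u + t * \<phi> v)"

definition one_lipschitz_vec :: "nat \<Rightarrow> (real vec \<Rightarrow> real) \<Rightarrow> bool" where
  "one_lipschitz_vec d \<phi> \<longleftrightarrow>
     (\<forall>u\<in>carrier_vec d. \<forall>v\<in>carrier_vec d. \<bar>\<phi> u - \<phi> v\<bar> \<le> vec_norm (u - v))"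

definition convex_concentration :: "'a measure \<Rightarrow> nat \<Rightarrow> real \<Rightarrow> ('a \<Rightarrow> real vec) \<Rightarrow> bool" where
  "convex_concentration P d C Z \<longleftrightarrow>
     mean_zero_square_integrable P d Z \<and> second_moment_mat P d Z = 1\<^sub>m d \<and>
     (\<forall>\<phi> t. convex_fun_vec d \<phi> \<and> one_lipschitz_vec d \<phi> \<and> t > 0 \<longrightarrow>
        measure P {\<omega> \<in> space P. \<bar>\<phi> (Z \<omega>) - (\<integral>\<omega>'. \<phi> (Z \<omega>') \<partial>P)\<bar> \<ge> t} \<le> 2 * exp (- t\<^sup>2 / C\<^sup>2))"

definition assumption_A3 ::
  "'a measure \<Rightarrow> nat \<Rightarrow> nat \<Rightarrow> real \<Rightarrow> (nat \<Rightarrow> 'a \<Rightarrow> real vec) \<Rightarrow> (nat \<Rightarrow> 'a \<Rightarrow> real vec) \<Rightarrow> bool" where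
  "assumption_A3 P n d C x z \<longleftrightarrow>
     (\<forall>i<n. z i \<in> measurable P (vec_borel d)) \<and>
     (\<forall>i<n. \<forall>\<omega>\<in>space P. x i \<omega> = mat_sqrt (second_moment_mat P d (x 0)) *\<^sub>v z i \<omega>) \<and>
     ((\<forall>i<n. subgaussian_coordinates P d C (z i)) \<or> (\<forall>i<n. convex_concentration P d C (z i)))"

definition design_mat :: "nat \<Rightarrow> nat \<Rightarrow> (nat \<Rightarrow> 'a \<Rightarrow> real vec) \<Rightarrow> 'a \<Rightarrow> real mat" where
  "design_mat n d x \<omega> = Matrix.mat n d (\<lambda>(i, j). x i \<omega> $ j)"

definition sample_cov :: "real mat \<Rightarrow> real mat" where
  "sample_cov X = (1 / real (dim_row X)) \<cdot>\<^sub>m (transpose_mat X * X)"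

definition resolvent :: "real mat \<Rightarrow> real \<Rightarrow> real mat" where
  "resolvent A lam = minv (A + lam \<cdot>\<^sub>m 1\<^sub>m (dim_row A))"

definition ridge_variance :: "real \<Rightarrow> real mat \<Rightarrow> real mat \<Rightarrow> real \<Rightarrow> real" where
  "ridge_variance \<tau> \<Sigma> X lam =
     \<tau>\<^sup>2 / real (dim_row X) * mat_trace (\<Sigma> * sample_cov X * (resolvent (sample_cov X) lam ^\<^sub>m 2))"

definition ridge_bias :: "real vec \<Rightarrow> real mat \<Rightarrow> real mat \<Rightarrow> real \<Rightarrow> real" where
  "ridge_bias \<beta> \<Sigma> X lam =
     lam\<^sup>2 * (\<beta> \<bullet> ((resolvent (sample_cov X) lam * \<Sigma> * resolvent (sample_cov X) lam) *\<^sub>v \<beta>))"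

text \<open>The defining equation divides by \<open>lambda_star\<close>, so its non-negative solution is positive.  The
  condition \<open>l > 0\<close> makes this explicit: as \<open>lam / 0 = 0\<close> in HOL, \<open>l = 0\<close> would otherwise be a
  spurious second solution when \<open>\<Sigma>\<close> is invertible and \<open>d = n\<close>.\<close>

definition lambda_star :: "nat \<Rightarrow> real mat \<Rightarrow> real \<Rightarrow> real" where
  "lambda_star n \<Sigma> lam = (THE l. l > 0 \<and> real n * (1 - lam / l) = mat_trace (\<Sigma> * resolvent \<Sigma> l))"

definition trace_square :: "nat \<Rightarrow> real mat \<Rightarrow> real \<Rightarrow> real" where
  "trace_square n \<Sigma> lam = mat_trace ((\<Sigma> ^\<^sub>m 2) * (resolvent \<Sigma> (lambda_star n \<Sigma> lam) ^\<^sub>m 2))"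

definition eff_variance :: "nat \<Rightarrow> real \<Rightarrow> real mat \<Rightarrow> real \<Rightarrow> real" where
  "eff_variance n \<tau> \<Sigma> lam =
     \<tau>\<^sup>2 * trace_square n \<Sigma> lam / (real n - trace_square n \<Sigma> lam)"

definition eff_bias :: "nat \<Rightarrow> real vec \<Rightarrow> real mat \<Rightarrow> real \<Rightarrow> real" where
  "eff_bias n \<beta> \<Sigma> lam =
     (lambda_star n \<Sigma> lam)\<^sup>2 * (\<beta> \<bullet> (((resolvent \<Sigma> (lambda_star n \<Sigma> lam) ^\<^sub>m 2) * \<Sigma>) *\<^sub>v \<beta>))
       / (1 - trace_square n \<Sigma> lam / real n)"

end

theory Submission
  imports Defs
begin

text \<open>
  Removing one row of the design matrix is a rank one update of the resolvent
  \<open>R = (\<Sigma>\<^sub>n + \<lambda>)\<^sup>-\<^sup>1\<close> of the sample covariance \<open>\<Sigma>\<^sub>n\<close>.  By the Sherman--Morrison formula the contribution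
  of the row to \<open>Tr(A R)\<close> or \<open>Tr(A R B R)\<close> is a function of quadratic forms in that row divided by \<open>n\<close>,
  and these deviate from their conditional means only by \<open>O(n\<^sup>-\<^sup>1\<^sup>/\<^sup>2)\<close>, in the sense of all moments.  A moment
  version of the Efron--Stein inequality then bounds all moments of the fluctuations of both traces,
  uniformly in \<open>n\<close> and \<open>d\<close>.

  Expanding \<open>(\<Sigma>\<^sub>n + \<lambda>) R = 1\<close> row by row in expectation shows that the means of the normalised traces
  satisfy, up to \<open>O(1/n)\<close>, the equations that define the effective quantities; those equations are stable
  because \<open>1 - Tr(\<Sigma>\<^sup>2 (\<Sigma> + \<lambda>\<^sub>\<star>)\<^sup>-\<^sup>2) / n\<close> is at least \<open>\<lambda> / \<lambda>\<^sub>\<star>\<close>.  The bias in the direction of a unit vector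
  \<open>b\<close> is a trace against \<open>A = \<surd>n b b\<^sup>T\<close> divided by \<open>\<surd>n\<close>, hence the rate \<open>n\<^sup>-\<^sup>1\<^sup>/\<^sup>2\<close> in place of \<open>n\<^sup>-\<^sup>1\<close>.

  Both kinds of distributional assumption enter only through the moments of centred quadratic forms.
  Markov's inequality at the moment of order \<open>2 k D\<close> costs the factor \<open>n\<^sup>1\<^sup>/\<^sup>k\<close>.
  The lower bound on the spectrum of \<open>\<Sigma>\<close> keeps the effective quantities away from zero,
  which turns absolute errors into relative ones.
\<close>

section \<open>Square matrices of a fixed dimension\<close>

text \<open>Every O(.) in the result must be uniform over laws, dimensions and sample sizes.
  Estimates are therefore stated for families: an index set of models, and one constant for each
  moment order.

  The mean equations close because of the choice of test matrix. Writing D for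
  \<open>resolvent\<close> at \<open>lambda_star\<close>, the matrix A = X D satisfies A Sigma = X -
  lambda_star A, so the equation for A contains the unknown mean for X itself and determines it. The
  choice X = Sigma isolates the difference between lambda_star and its empirical counterpart lambda
  (1 + m), where m is the normalised mean of tr(Sigma R).

  The factor sqrt n in front of b b^T is the largest scale at which the quadratic form of a rank one
  matrix still fluctuates by no more than sqrt n, like that of a matrix of bounded operator norm.
  One class of test matrices thus serves both the variance and the bias.\<close>

lemma vec_norm_eq_L2_set: "v \<in> carrier_vec d \<Longrightarrow> vec_norm v = L2_set (\<lambda>i. v $ i) {..<d}"
  by (simp add: vec_norm_def L2_set_def scalar_prod_def power2_eq_square atLeast0LessThan)

lemma scalar_prod_self_nonneg [simp]: "0 \<le> (v :: real vec) \<bullet> v"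
  by (simp add: scalar_prod_def sum_nonneg)

lemma vec_norm_nonneg [simp]: "0 \<le> vec_norm v"
  by (simp add: vec_norm_def)

lemma vec_norm_power2: "(vec_norm v)\<^sup>2 = v \<bullet> v"
  by (simp add: vec_norm_def)

lemma vec_norm_eq_0: "v \<in> carrier_vec d \<Longrightarrow> vec_norm v = 0 \<Longrightarrow> v = 0\<^sub>v d"
  by (auto simp: vec_norm_eq_L2_set L2_set_eq_0_iff)

lemma scalar_prod_comm_real:
  "u \<in> carrier_vec d \<Longrightarrow> v \<in> carrier_vec d \<Longrightarrow> (u :: real vec) \<bullet> v = v \<bullet> u"
  by (rule comm_scalar_prod)

lemma abs_scalar_prod_le:
  assumes "u \<in> carrier_vec d" "v \<in> carrier_vec d"
  shows "\<bar>u \<bullet> v\<bar> \<le> vec_norm u * vec_norm v"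
proof -
  have "\<bar>u \<bullet> v\<bar> \<le> (\<Sum>i<d. \<bar>u $ i\<bar> * \<bar>v $ i\<bar>)"
    using assms by (auto simp: scalar_prod_def atLeast0LessThan abs_mult[symmetric])
  also have "\<dots> \<le> vec_norm u * vec_norm v"
    using assms by (simp add: vec_norm_eq_L2_set L2_set_mult_ineq)
  finally show ?thesis .
qed

lemma vec_norm_add_le:
  assumes "u \<in> carrier_vec d" "v \<in> carrier_vec d"
  shows "vec_norm (u + v) \<le> vec_norm u + vec_norm v"
proof -
  have "vec_norm (u + v) = L2_set (\<lambda>i. u $ i + v $ i) {..<d}"
    using assms by (subst vec_norm_eq_L2_set[of _ d]) (auto simp: L2_set_def)
  also have "\<dots> \<le> vec_norm u + vec_norm v"
    using assms by (simp add: vec_norm_eq_L2_set L2_set_triangle_ineq)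
  finally show ?thesis .
qed

lemma vec_norm_smult: "v \<in> carrier_vec d \<Longrightarrow> vec_norm (c \<cdot>\<^sub>v v) = \<bar>c\<bar> * vec_norm v"
  by (simp add: vec_norm_def real_sqrt_mult mult.assoc[symmetric])

lemma vec_norm_unit_vec: "j < d \<Longrightarrow> vec_norm (unit_vec d j) = 1"
  by (simp add: vec_norm_def)

lemma mult_carrier_mat_square [simp]:
  "A \<in> carrier_mat d d \<Longrightarrow> B \<in> carrier_mat d d \<Longrightarrow> A * B \<in> carrier_mat d d"
  by simp

lemma mult_mat_vec_carrier_square [simp]:
  "A \<in> carrier_mat d d \<Longrightarrow> v \<in> carrier_vec d \<Longrightarrow> A *\<^sub>v v \<in> carrier_vec d"
  by simp

lemma mult_mat_vec_assoc_square [simp]: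
  "A \<in> carrier_mat d d \<Longrightarrow> B \<in> carrier_mat d d \<Longrightarrow> v \<in> carrier_vec d \<Longrightarrow>
    (A * B) *\<^sub>v v = A *\<^sub>v (B *\<^sub>v v)"
  by (rule assoc_mult_mat_vec)

lemma mult_mat_assoc_square:
  "A \<in> carrier_mat d d \<Longrightarrow> B \<in> carrier_mat d d \<Longrightarrow> C \<in> carrier_mat d d \<Longrightarrow> (A * B) * C = A * (B * C)"
  by (rule assoc_mult_mat)

lemma scalar_prod_mult_mat_vec_transpose:
  fixes A :: "real mat"
  assumes "A \<in> carrier_mat d d" "u \<in> carrier_vec d" "v \<in> carrier_vec d"
  shows "u \<bullet> (A *\<^sub>v v) = (transpose_mat A *\<^sub>v u) \<bullet> v"
  using transpose_vec_mult_scalar[OF assms(1,3,2)] by simp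

text \<open>Matrix identities are checked through their action on vectors, where products
  reassociate by simplification.\<close>

lemma eq_mat_mult_vec:
  fixes A B :: "real mat"
  assumes "A \<in> carrier_mat d d" "B \<in> carrier_mat d d"
    and "\<And>v. v \<in> carrier_vec d \<Longrightarrow> A *\<^sub>v v = B *\<^sub>v v"
  shows "A = B"
proof (rule eq_matI)
  fix i j assume *: "i < dim_row B" "j < dim_col B"
  have "(A *\<^sub>v unit_vec d j) $ i = (B *\<^sub>v unit_vec d j) $ i" using assms(3)[of "unit_vec d j"] by simp
  thus "A $$ (i, j) = B $$ (i, j)" using * assms(1,2) by simp
qed (use assms in auto)

lemma mat_entry_eq_unit_vec:
  fixes A :: "real mat"
  assumes "A \<in> carrier_mat d d" "i < d" "j < d"
  shows "A $$ (i, j) = (A *\<^sub>v unit_vec d j) $ i"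
  using assms by simp

lemma mat_trace_eq_sum_unit:
  assumes "A \<in> carrier_mat d d"
  shows "mat_trace A = (\<Sum>j<d. unit_vec d j \<bullet> (A *\<^sub>v unit_vec d j))"
  using assms by (simp add: mat_trace_def)

lemma mat_trace_mult:
  assumes "A \<in> carrier_mat d d" "B \<in> carrier_mat d d"
  shows "mat_trace (A * B) = (\<Sum>i<d. \<Sum>j<d. A $$ (i, j) * B $$ (j, i))"
  using assms by (simp add: mat_trace_def scalar_prod_def atLeast0LessThan)

lemma mat_trace_comm:
  assumes "A \<in> carrier_mat d d" "B \<in> carrier_mat d d"
  shows "mat_trace (A * B) = mat_trace (B * A)"
  unfolding mat_trace_mult[OF assms] mat_trace_mult[OF assms(2,1)]
  by (subst sum.swap) (simp add: mult.commute)

lemma mat_trace_add: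
  "A \<in> carrier_mat d d \<Longrightarrow> B \<in> carrier_mat d d \<Longrightarrow> mat_trace (A + B) = mat_trace A + mat_trace B"
  by (simp add: mat_trace_def sum.distrib)

lemma mat_trace_smult: "mat_trace (c \<cdot>\<^sub>m A) = c * mat_trace A" if "A \<in> carrier_mat d d"
  using that by (simp add: mat_trace_def sum_distrib_left)

section \<open>Outer products and operator norm bounds\<close>

definition outer_prod :: "nat \<Rightarrow> real vec \<Rightarrow> real vec \<Rightarrow> real mat" where
  "outer_prod d u v = Matrix.mat d d (\<lambda>(i, j). u $ i * v $ j)"

lemma outer_prod_carrier [simp]: "outer_prod d u v \<in> carrier_mat d d"
  by (simp add: outer_prod_def)

lemma outer_prod_mult_vec:
  assumes "v \<in> carrier_vec d" "u \<in> carrier_vec d" "w \<in> carrier_vec d"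
  shows "outer_prod d u v *\<^sub>v w = (v \<bullet> w) \<cdot>\<^sub>v u"
proof (rule eq_vecI)
  show "dim_vec (outer_prod d u v *\<^sub>v w) = dim_vec ((v \<bullet> w) \<cdot>\<^sub>v u)"
    using assms by (simp add: outer_prod_def)
  fix i assume "i < dim_vec ((v \<bullet> w) \<cdot>\<^sub>v u)"
  hence "i < d" using assms by simp
  thus "(outer_prod d u v *\<^sub>v w) $ i = ((v \<bullet> w) \<cdot>\<^sub>v u) $ i"
    using assms by (simp add: outer_prod_def scalar_prod_def sum_distrib_left mult_ac)
qed

lemma mult_outer_prod:
  assumes "A \<in> carrier_mat d d" "u \<in> carrier_vec d" "v \<in> carrier_vec d"
  shows "A * outer_prod d u v = outer_prod d (A *\<^sub>v u) v"
  by (rule eq_mat_mult_vec[where d = d])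
    (use assms in \<open>auto simp: outer_prod_mult_vec mult_mat_vec[of _ d d]\<close>)

lemma outer_prod_mult:
  assumes "A \<in> carrier_mat d d" "u \<in> carrier_vec d" "v \<in> carrier_vec d"
  shows "outer_prod d u v * A = outer_prod d u (transpose_mat A *\<^sub>v v)"
  by (rule eq_mat_mult_vec[where d = d])
    (use assms in \<open>auto simp: outer_prod_mult_vec scalar_prod_mult_mat_vec_transpose
      mult_mat_vec_assoc_square[where d = d]\<close>)

lemma mat_trace_outer_prod:
  assumes "u \<in> carrier_vec d" "v \<in> carrier_vec d"
  shows "mat_trace (outer_prod d u v) = u \<bullet> v"
  using assms by (simp add: mat_trace_def outer_prod_def scalar_prod_def atLeast0LessThan)

text \<open>A predicate instead of an inequality for \<open>op_norm\<close>, so that bounds compose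
  without any discussion of suprema. The conjunct for the sign of c is not implied by the others
  when d = 0.\<close>

definition op_bound :: "nat \<Rightarrow> real \<Rightarrow> real mat \<Rightarrow> bool" where
  "op_bound d c A \<longleftrightarrow> A \<in> carrier_mat d d \<and> 0 \<le> c \<and>
    (\<forall>v\<in>carrier_vec d. vec_norm (A *\<^sub>v v) \<le> c * vec_norm v)"

lemma op_boundD:
  assumes "op_bound d c A"
  shows "A \<in> carrier_mat d d" "0 \<le> c" "v \<in> carrier_vec d \<Longrightarrow> vec_norm (A *\<^sub>v v) \<le> c * vec_norm v"
  using assms by (auto simp: op_bound_def)

lemma op_bound_mono: "op_bound d c A \<Longrightarrow> c \<le> c' \<Longrightarrow> op_bound d c' A"
  unfolding op_bound_def by (meson mult_right_mono order_trans vec_norm_nonneg)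

lemma op_bound_mult:
  assumes "op_bound d a A" "op_bound d b B"
  shows "op_bound d (a * b) (A * B)"
proof -
  have "vec_norm (A *\<^sub>v (B *\<^sub>v v)) \<le> a * (b * vec_norm v)" if "v \<in> carrier_vec d" for v
    using op_boundD[OF assms(1)] op_boundD[OF assms(2)] that
    by (meson mult_left_mono mult_mat_vec_carrier_square order_trans)
  thus ?thesis
    using op_boundD[OF assms(1)] op_boundD[OF assms(2)]
    unfolding op_bound_def by (auto simp: mult.assoc)
qed

lemma op_bound_add:
  assumes "op_bound d a A" "op_bound d b B"
  shows "op_bound d (a + b) (A + B)"
proof -
  have "vec_norm (A *\<^sub>v v + B *\<^sub>v v) \<le> a * vec_norm v + b * vec_norm v" if "v \<in> carrier_vec d" for v
    using op_boundD[OF assms(1)] op_boundD[OF assms(2)] that vec_norm_add_le[of "A *\<^sub>v v" d "B *\<^sub>v v"]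
    by (smt (verit) mult_mat_vec_carrier_square)
  thus ?thesis
    using op_boundD(1,2)[OF assms(1)] op_boundD(1,2)[OF assms(2)]
    unfolding op_bound_def by (auto simp: distrib_right add_mult_distrib_mat_vec[of _ d d])
qed

lemma smult_mat_mult_vec:
  "A \<in> carrier_mat d d \<Longrightarrow> v \<in> carrier_vec d \<Longrightarrow> (k \<cdot>\<^sub>m A) *\<^sub>v v = (k :: real) \<cdot>\<^sub>v (A *\<^sub>v v)"
  by (rule eq_vecI) auto

lemma op_bound_smult:
  assumes "op_bound d a A" shows "op_bound d (\<bar>k\<bar> * a) (k \<cdot>\<^sub>m A)"
proof -
  have "\<bar>k\<bar> * vec_norm (A *\<^sub>v v) \<le> \<bar>k\<bar> * a * vec_norm v" if "v \<in> carrier_vec d" for v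
    using op_boundD(3)[OF assms that] by (simp add: mult.assoc mult_left_mono)
  thus ?thesis
    using op_boundD(1,2)[OF assms] unfolding op_bound_def
    by (auto simp: smult_mat_mult_vec vec_norm_smult[where d = d])
qed

lemma op_bound_one: "op_bound d 1 (1\<^sub>m d)"
  by (simp add: op_bound_def)

text \<open>With w = A^T v, the square of the norm of w is v . A w, at most |v| a |w|; one factor
  |w| cancels.\<close>

lemma op_bound_transpose:
  assumes "op_bound d a A" shows "op_bound d a (transpose_mat A)"
proof -
  have "vec_norm (transpose_mat A *\<^sub>v v) \<le> a * vec_norm v" if v: "v \<in> carrier_vec d" for v
  proof -
    define w where "w = transpose_mat A *\<^sub>v v"
    have A: "A \<in> carrier_mat d d" using op_boundD(1)[OF assms] .
    have w: "w \<in> carrier_vec d" using A v by (simp add: w_def)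
    have "(vec_norm w)\<^sup>2 = v \<bullet> (A *\<^sub>v w)"
      unfolding vec_norm_power2 using scalar_prod_mult_mat_vec_transpose[OF A v w] w_def by simp
    also have "\<dots> \<le> vec_norm v * vec_norm (A *\<^sub>v w)"
      using abs_scalar_prod_le[OF v, of "A *\<^sub>v w"] A w by simp
    also have "\<dots> \<le> vec_norm v * (a * vec_norm w)"
      by (intro mult_left_mono op_boundD(3)[OF assms w]) simp
    finally have "vec_norm w * vec_norm w \<le> (a * vec_norm v) * vec_norm w"
      by (simp add: power2_eq_square mult_ac)
    thus ?thesis
      using op_boundD(2)[OF assms] unfolding w_def[symmetric]
      by (smt (verit) mult_le_cancel_right mult_nonneg_nonneg vec_norm_nonneg)
  qed
  thus ?thesis using op_boundD[OF assms] unfolding op_bound_def by auto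
qed

lemma op_bound_trace:
  assumes "op_bound d a A" shows "\<bar>mat_trace A\<bar> \<le> real d * a"
proof -
  have A: "A \<in> carrier_mat d d" using op_boundD(1)[OF assms] .
  have "\<bar>unit_vec d j \<bullet> (A *\<^sub>v unit_vec d j)\<bar> \<le> a" if j: "j < d" for j
    using abs_scalar_prod_le[OF unit_vec_carrier[of d j] mult_mat_vec_carrier_square[OF A unit_vec_carrier[of d j]]]
      op_boundD(3)[OF assms unit_vec_carrier[of d j]] unfolding vec_norm_unit_vec[OF j] by linarith
  hence "(\<Sum>j<d. \<bar>unit_vec d j \<bullet> (A *\<^sub>v unit_vec d j)\<bar>) \<le> (\<Sum>j<d. a)"
    by (intro sum_mono) (simp del: scalar_prod_left_unit)
  thus ?thesis
    unfolding mat_trace_eq_sum_unit[OF A] by (intro order_trans[OF sum_abs]) simp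
qed

text \<open>Cauchy-Schwarz in each row. It supplies some finite bound for an arbitrary matrix: for
  the supremum in \<open>op_norm\<close>, and for an inverse about which nothing else is
  known.\<close>

lemma op_bound_Frobenius:
  assumes A: "A \<in> carrier_mat d d"
  shows "op_bound d (sqrt (\<Sum>i<d. \<Sum>j<d. (A $$ (i, j))\<^sup>2)) A"
proof -
  have "vec_norm (A *\<^sub>v v) \<le> sqrt (\<Sum>i<d. \<Sum>j<d. (A $$ (i, j))\<^sup>2) * vec_norm v"
    if v: "v \<in> carrier_vec d" for v
  proof -
    have row: "(vec_norm (row A i))\<^sup>2 = (\<Sum>j<d. (A $$ (i, j))\<^sup>2)" if "i < d" for i
      unfolding vec_norm_power2 using A that by (simp add: scalar_prod_def power2_eq_square atLeast0LessThan)
    have "(vec_norm (A *\<^sub>v v))\<^sup>2 = (\<Sum>i<d. (row A i \<bullet> v)\<^sup>2)"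
      unfolding vec_norm_power2 using A v
      by (simp add: scalar_prod_def[of "A *\<^sub>v v"] power2_eq_square atLeast0LessThan)
    also have "\<dots> \<le> (\<Sum>i<d. (vec_norm (row A i) * vec_norm v)\<^sup>2)"
      using A v by (intro sum_mono abs_le_square_iff[THEN iffD1])
        (auto intro!: abs_scalar_prod_le[where d = d] simp: abs_mult)
    also have "\<dots> = (\<Sum>i<d. \<Sum>j<d. (A $$ (i, j))\<^sup>2) * (vec_norm v)\<^sup>2"
      by (simp add: power_mult_distrib row sum_distrib_right)
    also have "\<dots> = (sqrt (\<Sum>i<d. \<Sum>j<d. (A $$ (i, j))\<^sup>2) * vec_norm v)\<^sup>2"
      by (simp add: power_mult_distrib sum_nonneg)
    finally show ?thesis
      by (rule power2_le_imp_le) (simp add: sum_nonneg)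
  qed
  thus ?thesis using A by (simp add: op_bound_def sum_nonneg)
qed

section \<open>Inverses of positive definite matrices\<close>

lemma minv_inverse:
  fixes W :: "real mat"
  assumes W: "W \<in> carrier_mat d d" and inj: "\<And>v. v \<in> carrier_vec d \<Longrightarrow> W *\<^sub>v v = 0\<^sub>v d \<Longrightarrow> v = 0\<^sub>v d"
  shows "minv W \<in> carrier_mat d d" "W * minv W = 1\<^sub>m d" "minv W * W = 1\<^sub>m d"
proof -
  have "det W \<noteq> 0" using det_0_iff_vec_prod_zero_field[OF W] inj by auto
  hence "W \<in> Units (ring_mat TYPE(real) d ())" by (rule det_non_zero_imp_unit[OF W])
  then obtain B where "mat_inverse W = Some B"
    using mat_inverse(1)[OF W, of "()"] by (cases "mat_inverse W") auto
  with mat_inverse(2)[OF W this]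
  show "minv W \<in> carrier_mat d d" "W * minv W = 1\<^sub>m d" "minv W * W = 1\<^sub>m d"
    by (auto simp: minv_def)
qed

text \<open>The lower bound l is explicit because it is the regularisation: 1 / l then bounds the
  inverse independently of the data.\<close>

locale posdef_mat =
  fixes d :: nat and l :: real and W :: "real mat"
  assumes l_pos: "0 < l" and W_carrier [simp]: "W \<in> carrier_mat d d" and W_sym: "transpose_mat W = W"
    and W_lower: "\<And>v. v \<in> carrier_vec d \<Longrightarrow> l * (v \<bullet> v) \<le> v \<bullet> (W *\<^sub>v v)"
begin

lemma W_inj: "v = 0\<^sub>v d" if "v \<in> carrier_vec d" "W *\<^sub>v v = 0\<^sub>v d"
proof -
  have "l * (v \<bullet> v) \<le> 0" using W_lower[OF that(1)] that by simp
  hence "v \<bullet> v \<le> 0" using l_pos by (simp add: mult_le_0_iff)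
  hence "vec_norm v = 0" by (simp add: vec_norm_def order_antisym)
  thus ?thesis by (rule vec_norm_eq_0[OF that(1)])
qed

lemma minv_W: "minv W \<in> carrier_mat d d" "W * minv W = 1\<^sub>m d" "minv W * W = 1\<^sub>m d"
  using W_inj by (auto intro!: minv_inverse)

lemma minv_carrier [simp]: "minv W \<in> carrier_mat d d"
  using minv_W(1) .

lemmas minv_dim [simp] = carrier_matD[OF minv_carrier]

lemmas mult_vec_assoc [simp] = mult_mat_vec_assoc_square[where d = d]

lemma W_minv_vec [simp]: "v \<in> carrier_vec d \<Longrightarrow> W *\<^sub>v (minv W *\<^sub>v v) = v"
  using mult_mat_vec_assoc_square[OF W_carrier minv_carrier, of v] minv_W(2) by simp

lemma minv_W_vec [simp]: "v \<in> carrier_vec d \<Longrightarrow> minv W *\<^sub>v (W *\<^sub>v v) = v"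
  using mult_mat_vec_assoc_square[OF minv_carrier W_carrier, of v] minv_W(3) by simp

lemma W_adj: "u \<in> carrier_vec d \<Longrightarrow> v \<in> carrier_vec d \<Longrightarrow> u \<bullet> (W *\<^sub>v v) = (W *\<^sub>v u) \<bullet> v"
  using scalar_prod_mult_mat_vec_transpose[OF W_carrier, of u v] W_sym by simp

lemma minv_adj:
  assumes "u \<in> carrier_vec d" "v \<in> carrier_vec d"
  shows "u \<bullet> (minv W *\<^sub>v v) = (minv W *\<^sub>v u) \<bullet> v"
  using W_adj[of "minv W *\<^sub>v u" "minv W *\<^sub>v v"] assms by simp

lemma minv_nonneg: "v \<in> carrier_vec d \<Longrightarrow> 0 \<le> v \<bullet> (minv W *\<^sub>v v)"
  using W_lower[of "minv W *\<^sub>v v"] l_pos minv_adj[of v v] scalar_prod_comm_real[of v d "minv W *\<^sub>v v"]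
  by (simp add: order_trans[OF mult_nonneg_nonneg[OF less_imp_le scalar_prod_self_nonneg]])

text \<open>Coercivity: for w = W^(-1) v, l |w|^2 is at most w . W w = w . v, hence at most |w|
  |v|.\<close>

lemma op_bound_minv: "op_bound d (1 / l) (minv W)"
proof -
  have "vec_norm (minv W *\<^sub>v v) \<le> 1 / l * vec_norm v" if v: "v \<in> carrier_vec d" for v
  proof -
    define w where "w = minv W *\<^sub>v v"
    have w: "w \<in> carrier_vec d" using v by (simp add: w_def)
    have "l * (vec_norm w)\<^sup>2 \<le> w \<bullet> v"
      using W_lower[OF w] v by (simp add: w_def vec_norm_power2)
    also have "\<dots> \<le> vec_norm w * vec_norm v" using abs_scalar_prod_le[OF w v] by simp
    finally have "vec_norm w * (l * vec_norm w) \<le> vec_norm w * vec_norm v"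
      by (simp add: power2_eq_square mult_ac)
    hence "l * vec_norm w \<le> vec_norm v"
      by (metis mult_le_cancel_left mult_zero_right not_le order_antisym vec_norm_nonneg)
    thus ?thesis using l_pos by (simp add: w_def field_simps)
  qed
  thus ?thesis using l_pos by (simp add: op_bound_def)
qed

end

section \<open>Rank one updates of the inverse\<close>

locale rank_one_update = posdef_mat d l W for d l W +
  fixes c :: real and y :: "real vec" and W' :: "real mat"
  assumes c_nonneg: "0 \<le> c" and y_carrier [simp]: "y \<in> carrier_vec d"
    and W'_carrier [simp]: "W' \<in> carrier_mat d d" and W'_sym: "transpose_mat W' = W'"
    and W'_vec: "\<And>v. v \<in> carrier_vec d \<Longrightarrow> W' *\<^sub>v v = W *\<^sub>v v + (c * (y \<bullet> v)) \<cdot>\<^sub>v y"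
begin

sublocale upd: posdef_mat d l W'
proof
  fix v :: "real vec" assume v: "v \<in> carrier_vec d"
  have "v \<bullet> (W' *\<^sub>v v) = v \<bullet> (W *\<^sub>v v) + c * (y \<bullet> v)\<^sup>2"
    using v W'_vec[OF v] scalar_prod_comm_real[OF v y_carrier]
    by (simp add: scalar_prod_add_distrib[of _ d] power2_eq_square)
  thus "l * (v \<bullet> v) \<le> v \<bullet> (W' *\<^sub>v v)" using W_lower[OF v] c_nonneg mult_nonneg_nonneg[OF c_nonneg zero_le_power2[of "y \<bullet> v"]] by linarith
qed (use l_pos W'_sym in auto)

definition "N = minv W"
definition "R = minv W'"
definition "q = c * (y \<bullet> (N *\<^sub>v y))"
definition "r = N *\<^sub>v y"

lemma N_carrier [simp]: "N \<in> carrier_mat d d" and R_carrier [simp]: "R \<in> carrier_mat d d"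
  and r_carrier [simp]: "r \<in> carrier_vec d"
  by (auto simp: N_def R_def r_def)

lemmas update_dims [simp] = carrier_matD[OF N_carrier] carrier_matD[OF R_carrier] carrier_vecD[OF r_carrier]

lemma q_nonneg: "0 \<le> q"
  using minv_nonneg[OF y_carrier] c_nonneg by (simp add: q_def N_def)

text \<open>The updated matrix sends r = N y to (1 + q) y, so on the added vector itself the new
  inverse is the old one divided by 1 + q. This is the source of all denominators below.\<close>

lemma R_y: "R *\<^sub>v y = (1 / (1 + q)) \<cdot>\<^sub>v r"
proof -
  have "W' *\<^sub>v r = (1 + q) \<cdot>\<^sub>v y"
    using W'_vec[of r] by (simp add: r_def q_def N_def add_smult_distrib_vec)
  hence "r = (1 + q) \<cdot>\<^sub>v (R *\<^sub>v y)"
    using upd.minv_W_vec[of r] mult_mat_vec[of "minv W'" d d y "1 + q"] by (simp add: R_def)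
  thus ?thesis using q_nonneg by (simp add: smult_smult_assoc)
qed

text \<open>Sherman-Morrison: apply R to \<open>W'\<close> z = w + c (y . z) y with z = N w, and
  evaluate R y by \<open>R_y\<close>.\<close>

lemma R_vec:
  assumes w: "w \<in> carrier_vec d"
  shows "R *\<^sub>v w = N *\<^sub>v w - (c / (1 + q) * (r \<bullet> w)) \<cdot>\<^sub>v r"
proof -
  define z where "z = N *\<^sub>v w"
  have z: "z \<in> carrier_vec d" using w by (simp add: z_def)
  have "W' *\<^sub>v z = w + (c * (y \<bullet> z)) \<cdot>\<^sub>v y"
    using W'_vec[OF z] w by (simp add: z_def N_def)
  hence "z = R *\<^sub>v w + (c * (y \<bullet> z)) \<cdot>\<^sub>v (R *\<^sub>v y)"
    using upd.minv_W_vec[OF z] w by (simp add: R_def mult_add_distrib_mat_vec[of _ d d] mult_mat_vec[of _ d d])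
  hence "z = R *\<^sub>v w + (c * (y \<bullet> z) / (1 + q)) \<cdot>\<^sub>v r"
    by (simp add: R_y smult_smult_assoc)
  moreover have "y \<bullet> z = r \<bullet> w" using minv_adj[of y w] w by (simp add: z_def r_def N_def)
  ultimately have *: "z = R *\<^sub>v w + (c / (1 + q) * (r \<bullet> w)) \<cdot>\<^sub>v r" by simp
  show ?thesis
  proof (rule eq_vecI)
    fix i assume "i < dim_vec (N *\<^sub>v w - (c / (1 + q) * (r \<bullet> w)) \<cdot>\<^sub>v r)"
    hence i: "i < d" by simp
    have "z $ i = (R *\<^sub>v w) $ i + (c / (1 + q) * (r \<bullet> w)) * r $ i"
      using arg_cong[OF *, of "\<lambda>v. v $ i"] i by simp
    thus "(R *\<^sub>v w) $ i = (N *\<^sub>v w - (c / (1 + q) * (r \<bullet> w)) \<cdot>\<^sub>v r) $ i"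
      using i by (simp add: z_def)
  qed simp
qed

lemma R_entry:
  assumes "a < d" "b < d"
  shows "R $$ (a, b) = N $$ (a, b) - c / (1 + q) * (r $ b * r $ a)"
proof -
  have "R $$ (a, b) = (R *\<^sub>v unit_vec d b) $ a"
    by (rule mat_entry_eq_unit_vec[OF R_carrier assms])
  also have "\<dots> = (N *\<^sub>v unit_vec d b) $ a - (c / (1 + q) * (r \<bullet> unit_vec d b)) * r $ a"
    unfolding R_vec[OF unit_vec_carrier] using assms by simp
  also have "(N *\<^sub>v unit_vec d b) $ a = N $$ (a, b)"
    by (rule mat_entry_eq_unit_vec[OF N_carrier assms, symmetric])
  finally show ?thesis using assms by simp
qed

lemma trace_mult_R:
  assumes X: "X \<in> carrier_mat d d"
  shows "mat_trace (X * R) = mat_trace (X * N) - c / (1 + q) * (r \<bullet> (X *\<^sub>v r))"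
proof -
  have "mat_trace (X * R) = (\<Sum>i<d. \<Sum>j<d. X $$ (i, j) * N $$ (j, i)) -
      (\<Sum>i<d. \<Sum>j<d. c / (1 + q) * (r $ i * (X $$ (i, j) * r $ j)))"
    unfolding mat_trace_mult[OF X R_carrier] sum_subtractf[symmetric]
    by (intro sum.cong) (auto simp: R_entry algebra_simps)
  also have "(\<Sum>i<d. \<Sum>j<d. c / (1 + q) * (r $ i * (X $$ (i, j) * r $ j))) = c / (1 + q) * (r \<bullet> (X *\<^sub>v r))"
    using X by (simp add: scalar_prod_def atLeast0LessThan sum_distrib_left sum_divide_distrib)
  finally show ?thesis by (simp add: mat_trace_mult[OF X N_carrier])
qed

lemma r_sandwich: "X \<in> carrier_mat d d \<Longrightarrow> r \<bullet> (X *\<^sub>v r) = y \<bullet> ((N * X * N) *\<^sub>v y)"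
  using minv_adj[of y "X *\<^sub>v r"] by (simp add: mult_mat_assoc_square[where d = d] r_def N_def)

text \<open>The two factors R are replaced one after the other. The correction produced by the first
  still contains an R, and expanding that one gives the quadratic term.\<close>

lemma trace_mult_R_mult_R:
  assumes A: "A \<in> carrier_mat d d" and B: "B \<in> carrier_mat d d"
  shows "mat_trace (A * R * B * R) = mat_trace (A * N * B * N)
    - c / (1 + q) * (r \<bullet> ((B * N * A) *\<^sub>v r) + r \<bullet> ((A * N * B) *\<^sub>v r))
    + (c / (1 + q))\<^sup>2 * ((r \<bullet> (A *\<^sub>v r)) * (r \<bullet> (B *\<^sub>v r)))"
proof -
  have "mat_trace (A * R * B * R) = mat_trace (A * R * B * N) - c / (1 + q) * (r \<bullet> ((A * R * B) *\<^sub>v r))"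
    using A B by (intro trace_mult_R) auto
  also have "mat_trace (A * R * B * N) = mat_trace ((B * N * A) * R)"
    using A B mat_trace_comm[of "A * R" d "B * N"] by (simp add: mult_mat_assoc_square[where d = d])
  also have "\<dots> = mat_trace ((B * N * A) * N) - c / (1 + q) * (r \<bullet> ((B * N * A) *\<^sub>v r))"
    using A B by (intro trace_mult_R) auto
  also have "mat_trace ((B * N * A) * N) = mat_trace (A * N * B * N)"
    using A B mat_trace_comm[of "B * N" d "A * N"] by (simp add: mult_mat_assoc_square[where d = d])
  also have "r \<bullet> ((A * R * B) *\<^sub>v r) = r \<bullet> ((A * N * B) *\<^sub>v r) - c / (1 + q) * ((r \<bullet> (A *\<^sub>v r)) * (r \<bullet> (B *\<^sub>v r)))"
    using A B
    by (simp add: R_vec mult_minus_distrib_mat_vec[of _ d d] mult_mat_vec[of _ d d] scalar_prod_minus_distrib[of _ d])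
  finally show ?thesis by (simp add: algebra_simps power2_eq_square)
qed

text \<open>By symmetry the leading R can be moved onto y, where \<open>R_y\<close> evaluates it;
  the form in R becomes a form in N with a single denominator.\<close>

lemma quad_R:
  assumes A: "A \<in> carrier_mat d d"
  shows "y \<bullet> ((R * A) *\<^sub>v y) = 1 / (1 + q) * (y \<bullet> ((N * A) *\<^sub>v y))"
proof -
  have "y \<bullet> ((R * A) *\<^sub>v y) = (R *\<^sub>v y) \<bullet> (A *\<^sub>v y)"
    using A upd.minv_adj[of y "A *\<^sub>v y"] by (simp add: R_def)
  also have "\<dots> = 1 / (1 + q) * (r \<bullet> (A *\<^sub>v y))" using A by (simp add: R_y)
  also have "r \<bullet> (A *\<^sub>v y) = y \<bullet> ((N * A) *\<^sub>v y)"
    using A minv_adj[of y "A *\<^sub>v y"] by (simp add: r_def N_def)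
  finally show ?thesis .
qed

lemma quad_R_mult_R:
  assumes A: "A \<in> carrier_mat d d" and B: "B \<in> carrier_mat d d"
  shows "y \<bullet> ((R * B * R * A) *\<^sub>v y) = 1 / (1 + q) * (y \<bullet> ((N * B * N * A) *\<^sub>v y)
     - c / (1 + q) * ((y \<bullet> ((N * A) *\<^sub>v y)) * (y \<bullet> ((N * B * N) *\<^sub>v y))))"
proof -
  have rA: "r \<bullet> (A *\<^sub>v y) = y \<bullet> ((N * A) *\<^sub>v y)"
    using A minv_adj[of y "A *\<^sub>v y"] by (simp add: r_def N_def)
  have "y \<bullet> ((R * B * R * A) *\<^sub>v y) = y \<bullet> ((R * (B * R * A)) *\<^sub>v y)"
    using A B by simp
  also have "\<dots> = 1 / (1 + q) * (y \<bullet> ((N * (B * R * A)) *\<^sub>v y))"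
    using A B by (intro quad_R) auto
  also have "y \<bullet> ((N * (B * R * A)) *\<^sub>v y) = r \<bullet> (B *\<^sub>v (R *\<^sub>v (A *\<^sub>v y)))"
    using A B minv_adj[of y "B *\<^sub>v (R *\<^sub>v (A *\<^sub>v y))"] by (simp add: r_def N_def)
  also have "\<dots> = r \<bullet> (B *\<^sub>v (N *\<^sub>v (A *\<^sub>v y))) - c / (1 + q) * ((r \<bullet> (A *\<^sub>v y)) * (r \<bullet> (B *\<^sub>v r)))"
    using A B
    by (simp add: R_vec mult_minus_distrib_mat_vec[of _ d d] mult_mat_vec[of _ d d] scalar_prod_minus_distrib[of _ d])
  also have "r \<bullet> (B *\<^sub>v (N *\<^sub>v (A *\<^sub>v y))) = y \<bullet> ((N * B * N * A) *\<^sub>v y)"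
    using A B minv_adj[of y "B *\<^sub>v (N *\<^sub>v (A *\<^sub>v y))"] by (simp add: r_def N_def)
  also have "r \<bullet> (B *\<^sub>v r) = y \<bullet> ((N * B * N) *\<^sub>v y)"
    using B r_sandwich[of B] by simp
  finally show ?thesis by (simp add: rA)
qed

end

section \<open>Moments and the Efron--Stein inequality\<close>

lemma power_even_add_le: "((a :: real) + b) ^ (2 * p) \<le> 4 ^ p * (a ^ (2 * p) + b ^ (2 * p))"
proof -
  have *: "(2 * x) ^ (2 * p) = 4 ^ p * x ^ (2 * p)" for x :: real
    by (simp add: power_mult_distrib power_mult)
  have nn: "0 \<le> x ^ (2 * p)" for x :: real by (simp add: power_mult)
  have "\<bar>a + b\<bar> \<le> \<bar>2 * a\<bar> \<or> \<bar>a + b\<bar> \<le> \<bar>2 * b\<bar>" by linarith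
  hence "(a + b) ^ (2 * p) \<le> (2 * a) ^ (2 * p) \<or> (a + b) ^ (2 * p) \<le> (2 * b) ^ (2 * p)"
    using power_mono_even[of "2 * p" "a + b" "2 * a"] power_mono_even[of "2 * p" "a + b" "2 * b"] by auto
  moreover have "4 ^ p * a ^ (2 * p) \<le> 4 ^ p * (a ^ (2 * p) + b ^ (2 * p))"
    "4 ^ p * b ^ (2 * p) \<le> 4 ^ p * (a ^ (2 * p) + b ^ (2 * p))"
    using nn by (auto intro!: mult_left_mono)
  ultimately show ?thesis unfolding * by linarith
qed

lemma power_even_mult_le: "((a :: real) * b) ^ (2 * p) \<le> a ^ (2 * (2 * p)) + b ^ (2 * (2 * p))"
proof -
  define u v where "u = a ^ (2 * p)" and "v = b ^ (2 * p)"
  have "0 \<le> u" "0 \<le> v" by (simp_all add: u_def v_def power_mult)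
  have "u * v \<le> u\<^sup>2 + v\<^sup>2"
    using sum_squares_bound[of u v] mult_nonneg_nonneg[OF \<open>0 \<le> u\<close> \<open>0 \<le> v\<close>] by linarith
  moreover have "u\<^sup>2 = a ^ (2 * (2 * p))" "v\<^sup>2 = b ^ (2 * (2 * p))"
    by (simp_all add: u_def v_def power_mult[symmetric] mult_ac)
  ultimately show ?thesis by (simp add: u_def v_def power_mult_distrib)
qed

text \<open>If b is the smaller one in absolute value, all but two factors b are traded for a;
  otherwise all factors a are traded for b.\<close>

lemma power_interpolate:
  fixes a b :: real assumes "2 \<le> k" "k \<le> m" "even m"
  shows "b ^ k * a ^ (m - k) \<le> a ^ (m - 2) * b\<^sup>2 + b ^ m"
proof -
  have "b ^ k * a ^ (m - k) \<le> \<bar>b\<bar> ^ k * \<bar>a\<bar> ^ (m - k)"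
    by (metis abs_ge_self abs_mult power_abs)
  also have "\<dots> \<le> \<bar>a\<bar> ^ (m - 2) * \<bar>b\<bar>\<^sup>2 + \<bar>b\<bar> ^ m"
  proof (cases "\<bar>b\<bar> \<le> \<bar>a\<bar>")
    case True
    have "\<bar>b\<bar> ^ k = \<bar>b\<bar> ^ (k - 2) * \<bar>b\<bar>\<^sup>2"
      using assms by (metis power_add le_add_diff_inverse2)
    also have "\<dots> \<le> \<bar>a\<bar> ^ (k - 2) * \<bar>b\<bar>\<^sup>2" by (intro mult_right_mono power_mono True) auto
    finally have "\<bar>b\<bar> ^ k * \<bar>a\<bar> ^ (m - k) \<le> \<bar>a\<bar> ^ (k - 2) * \<bar>b\<bar>\<^sup>2 * \<bar>a\<bar> ^ (m - k)"
      by (intro mult_right_mono) auto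
    also have "\<dots> = \<bar>a\<bar> ^ ((k - 2) + (m - k)) * \<bar>b\<bar>\<^sup>2" by (simp add: power_add mult_ac)
    also have "(k - 2) + (m - k) = m - 2" using assms by simp
    finally show ?thesis by (simp add: add_increasing2)
  next
    case False
    have "\<bar>b\<bar> ^ k * \<bar>a\<bar> ^ (m - k) \<le> \<bar>b\<bar> ^ k * \<bar>b\<bar> ^ (m - k)"
      using False by (intro mult_left_mono power_mono) auto
    also have "\<dots> = \<bar>b\<bar> ^ m" using assms by (simp flip: power_add)
    finally show ?thesis by (simp add: add_increasing)
  qed
  finally show ?thesis using assms by (simp add: power_even_abs)
qed

text \<open>The first order term is kept exactly, since it will integrate to zero. Every later term
  lies between those of orders 2 and 2 p, and the binomial coefficients add up to at most 2^(2 p) =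
  4^p.\<close>

lemma power_even_add_expand:
  fixes a b :: real assumes p: "1 \<le> p"
  shows "(a + b) ^ (2 * p) \<le> a ^ (2 * p) + real (2 * p) * (a ^ (2 * p - 1) * b)
           + 4 ^ p * (a ^ (2 * p - 2) * b\<^sup>2 + b ^ (2 * p))"
proof -
  define m where "m = 2 * p"
  have m: "2 \<le> m" "even m" using p by (auto simp: m_def)
  have "(a + b) ^ m = (\<Sum>k\<le>m. real (m choose k) * b ^ k * a ^ (m - k))"
    unfolding add.commute[of a b] by (rule binomial_ring)
  also have "{..m} = {0, 1} \<union> {2..m}" using m by auto
  also have "(\<Sum>k\<in>{0, 1} \<union> {2..m}. real (m choose k) * b ^ k * a ^ (m - k)) =
      a ^ m + real m * b * a ^ (m - 1) + (\<Sum>k=2..m. real (m choose k) * b ^ k * a ^ (m - k))"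
    by (subst sum.union_disjoint) auto
  also have "(\<Sum>k=2..m. real (m choose k) * b ^ k * a ^ (m - k)) \<le>
      (\<Sum>k=2..m. real (m choose k) * (a ^ (m - 2) * b\<^sup>2 + b ^ m))"
    using power_interpolate[OF _ _ m(2)] by (intro sum_mono) (auto simp: mult.assoc intro!: mult_left_mono)
  also have "\<dots> = (\<Sum>k=2..m. real (m choose k)) * (a ^ (m - 2) * b\<^sup>2 + b ^ m)"
    by (simp add: sum_distrib_right)
  also have "\<dots> \<le> 2 ^ m * (a ^ (m - 2) * b\<^sup>2 + b ^ m)"
  proof (rule mult_right_mono)
    have "(\<Sum>k=2..m. real (m choose k)) \<le> (\<Sum>k\<le>m. real (m choose k))"
      by (intro sum_mono2) auto
    also have "\<dots> = 2 ^ m" using choose_row_sum[of m] by (metis of_nat_numeral of_nat_power of_nat_sum)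
    finally show "(\<Sum>k=2..m. real (m choose k)) \<le> 2 ^ m" .
    show "0 \<le> a ^ (m - 2) * b\<^sup>2 + b ^ m"
      using m by (intro add_nonneg_nonneg mult_nonneg_nonneg zero_le_even_power) auto
  qed
  finally have "(a + b) ^ m \<le> a ^ m + real m * b * a ^ (m - 1) + 2 ^ m * (a ^ (m - 2) * b\<^sup>2 + b ^ m)" by simp
  moreover have "(2 :: real) ^ m = 4 ^ p" by (simp add: m_def power_mult)
  ultimately show ?thesis by (simp add: m_def mult_ac)
qed

context prob_space
begin

lemma integrable_power_even_imp_integrable:
  fixes f :: "'a \<Rightarrow> real"
  assumes "f \<in> borel_measurable M" "integrable M (\<lambda>x. f x ^ (2 * p))" "1 \<le> p"
  shows "integrable M f"
proof (rule Bochner_Integration.integrable_bound)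
  show "integrable M (\<lambda>x. 1 + f x ^ (2 * p))" using assms by simp
  show "AE x in M. norm (f x) \<le> norm (1 + f x ^ (2 * p))"
  proof (rule AE_I2)
    fix x
    have "\<bar>f x\<bar> \<le> 1 + \<bar>f x\<bar> ^ (2 * p)"
    proof (cases "\<bar>f x\<bar> \<le> 1")
      case False
      thus ?thesis using power_increasing[of 1 "2 * p" "\<bar>f x\<bar>"] assms(3) by simp
    qed (simp add: add_increasing2)
    thus "norm (f x) \<le> norm (1 + f x ^ (2 * p))" by (simp add: power_even_abs)
  qed
qed (use assms in auto)

lemma integrable_power_evenI:
  fixes f :: "'a \<Rightarrow> real"
  assumes "f \<in> borel_measurable M" "(\<integral>\<^sup>+x. ennreal (f x ^ (2 * p)) \<partial>M) < \<infinity>"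
  shows "integrable M (\<lambda>x. f x ^ (2 * p))"
  using assms by (intro integrableI_nonneg) (auto simp: power_mult)

text \<open>Jensen's inequality, with a nonnegative integral on the right so that it also holds when
  the moment is infinite.\<close>

lemma expectation_power_even_le:
  fixes f :: "'a \<Rightarrow> real"
  assumes f: "f \<in> borel_measurable M" and p: "1 \<le> p"
  shows "ennreal (expectation f ^ (2 * p)) \<le> (\<integral>\<^sup>+x. ennreal (f x ^ (2 * p)) \<partial>M)"
proof (cases "(\<integral>\<^sup>+x. ennreal (f x ^ (2 * p)) \<partial>M) < \<infinity>")
  case True
  have i: "integrable M (\<lambda>x. f x ^ (2 * p))" by (rule integrable_power_evenI[OF f True])
  have "convex_on UNIV (\<lambda>x :: real. x ^ (2 * p))" by (rule convex_power_even) simp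
  hence "expectation f ^ (2 * p) \<le> expectation (\<lambda>x. f x ^ (2 * p))"
    using integrable_power_even_imp_integrable[OF f i p] i
    by (intro jensens_inequality[where I = UNIV and q = "\<lambda>x. x ^ (2 * p)"]) auto
  thus ?thesis
    by (subst nn_integral_eq_integral[OF i]) (auto simp: power_mult ennreal_leI)
qed (auto simp: less_top[symmetric])

text \<open>One step of the martingale square-function bound: an increment of conditional mean zero adds
  its squared \<open>2 p\<close>-norm to the squared \<open>2 p\<close>-norm of the sum.\<close>

lemma moment_add_increment:
  fixes a b :: "'a \<Rightarrow> real"
  assumes p: "1 \<le> p" and s: "0 < s" and t: "0 < t"
    and [measurable]: "a \<in> borel_measurable M" "b \<in> borel_measurable M"
    and a: "(\<integral>\<^sup>+x. ennreal (a x ^ (2 * p)) \<partial>M) \<le> ennreal (s ^ p)"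
    and b: "(\<integral>\<^sup>+x. ennreal (b x ^ (2 * p)) \<partial>M) \<le> ennreal (t ^ p)"
    and ab: "expectation (\<lambda>x. a x ^ (2 * p - 1) * b x) = 0"
  shows "(\<integral>\<^sup>+x. ennreal ((a x + b x) ^ (2 * p)) \<partial>M) \<le> ennreal ((s + 4 ^ (p + 1) * t) ^ p)"
proof -
  have ia: "integrable M (\<lambda>x. a x ^ (2 * p))" by (rule integrable_power_evenI) (use a in \<open>auto simp: le_less_trans\<close>)
  have ib: "integrable M (\<lambda>x. b x ^ (2 * p))" by (rule integrable_power_evenI) (use b in \<open>auto simp: le_less_trans\<close>)
  have Ea: "expectation (\<lambda>x. a x ^ (2 * p)) \<le> s ^ p"
    using a s by (subst (asm) nn_integral_eq_integral[OF ia]) (auto simp: power_mult ennreal_le_iff)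
  have Eb: "expectation (\<lambda>x. b x ^ (2 * p)) \<le> t ^ p"
    using b t by (subst (asm) nn_integral_eq_integral[OF ib]) (auto simp: power_mult ennreal_le_iff)
  have pw: "x ^ p = x ^ (p - 1) * x" for x :: real using p by (cases p) auto
  have young: "u ^ (p - 1) * v \<le> u ^ p + v ^ p" if "0 \<le> u" "0 \<le> v" for u v :: real
  proof (cases "v \<le> u")
    case True
    hence "u ^ (p - 1) * v \<le> u ^ (p - 1) * u" using that by (intro mult_left_mono) auto
    also have "\<dots> = u ^ p" by (rule pw[symmetric])
    finally show ?thesis using that by (simp add: add_increasing2)
  next
    case False
    hence "u ^ (p - 1) * v \<le> v ^ (p - 1) * v" using that by (intro mult_right_mono power_mono) auto
    also have "\<dots> = v ^ p" by (rule pw[symmetric])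
    finally show ?thesis using that by (simp add: add_increasing)
  qed
  note sp = pw[of s] and tp = pw[of t]
  \<comment> \<open>Scaling by s and t makes both terms of the bracket integrate to at most
    1.\<close>
  have mid: "a x ^ (2 * p - 2) * (b x)\<^sup>2 \<le> s ^ (p - 1) * t * (a x ^ (2 * p) / s ^ p + b x ^ (2 * p) / t ^ p)" for x
  proof -
    have e: "2 * p - 2 = 2 * (p - 1)" by simp
    have "a x ^ (2 * p - 2) * (b x)\<^sup>2 = s ^ (p - 1) * t * (((a x)\<^sup>2 / s) ^ (p - 1) * ((b x)\<^sup>2 / t))"
      using s t by (simp add: e power_mult power_divide)
    also have "\<dots> \<le> s ^ (p - 1) * t * (((a x)\<^sup>2 / s) ^ p + ((b x)\<^sup>2 / t) ^ p)"
      using s t by (intro mult_left_mono young) auto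
    finally show ?thesis by (simp add: power_mult power_divide)
  qed
  have iab: "integrable M (\<lambda>x. a x ^ (2 * p - 1) * b x)"
  proof (rule Bochner_Integration.integrable_bound)
    show "integrable M (\<lambda>x. a x ^ (2 * p) + b x ^ (2 * p))" using ia ib by simp
    have "\<bar>a x ^ (2 * p - 1) * b x\<bar> \<le> a x ^ (2 * p) + b x ^ (2 * p)" for x
    proof (cases "\<bar>b x\<bar> \<le> \<bar>a x\<bar>")
      case True
      have "\<bar>a x ^ (2 * p - 1) * b x\<bar> \<le> \<bar>a x\<bar> ^ (2 * p - 1) * \<bar>a x\<bar>"
        using True by (simp add: abs_mult power_abs mult_left_mono)
      also have "\<dots> = a x ^ (2 * p)" using p by (simp flip: power_Suc2 add: power_even_abs)
      finally show ?thesis by (simp add: power_mult add_increasing2)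
    next
      case False
      have "\<bar>a x ^ (2 * p - 1) * b x\<bar> \<le> \<bar>b x\<bar> ^ (2 * p - 1) * \<bar>b x\<bar>"
        using False by (auto simp: abs_mult power_abs intro!: mult_right_mono power_mono)
      also have "\<dots> = b x ^ (2 * p)" using p by (simp flip: power_Suc2 add: power_even_abs)
      finally show ?thesis by (simp add: power_mult add_increasing)
    qed
    thus "AE x in M. norm (a x ^ (2 * p - 1) * b x) \<le> norm (a x ^ (2 * p) + b x ^ (2 * p))"
      by (auto simp: power_mult)
  qed auto
  let ?U = "\<lambda>x. a x ^ (2 * p) + real (2 * p) * (a x ^ (2 * p - 1) * b x)
    + 4 ^ p * (s ^ (p - 1) * t * (a x ^ (2 * p) / s ^ p + b x ^ (2 * p) / t ^ p) + b x ^ (2 * p))"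
  have U: "(a x + b x) ^ (2 * p) \<le> ?U x" for x
    by (rule order_trans[OF power_even_add_expand[OF p]])
      (intro add_left_mono mult_left_mono add_right_mono mid, simp)
  have iU: "integrable M ?U" using ia ib iab by simp
  have U0: "0 \<le> ?U x" for x using U[of x] by (rule order_trans[rotated]) (simp add: power_mult)
  have "(\<integral>\<^sup>+x. ennreal ((a x + b x) ^ (2 * p)) \<partial>M) \<le> (\<integral>\<^sup>+x. ennreal (?U x) \<partial>M)"
    by (intro nn_integral_mono ennreal_leI U)
  also have "\<dots> = ennreal (expectation ?U)"
    using U0 by (intro nn_integral_eq_integral iU) auto
  also have "expectation ?U = expectation (\<lambda>x. a x ^ (2 * p)) + 4 ^ p * (s ^ (p - 1) * t *
      (expectation (\<lambda>x. a x ^ (2 * p)) / s ^ p + expectation (\<lambda>x. b x ^ (2 * p)) / t ^ p)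
      + expectation (\<lambda>x. b x ^ (2 * p)))"
    using ia ib iab ab by simp
  also have "ennreal \<dots> \<le> ennreal (s ^ p + 4 ^ p * (s ^ (p - 1) * t * (1 + 1) + t ^ p))"
    using Ea Eb s t
    by (intro ennreal_leI add_mono mult_left_mono) (auto simp: divide_le_eq)
  also have "\<dots> \<le> ennreal ((s + 4 ^ (p + 1) * t) ^ p)"
  proof (rule ennreal_leI)
    \<comment> \<open>Powers of s and t are bounded by powers of the target base z; the constant 3
      times 4^p that appears is rounded up to 4^(p + 1).\<close>
    define z where "z = s + 4 ^ (p + 1) * t"
    have "1 * t \<le> 4 ^ (p + 1) * t" using t by (intro mult_right_mono one_le_power) auto
    moreover have "0 \<le> 4 ^ (p + 1) * t" using t by simp
    ultimately have z: "s \<le> z" "t \<le> z" "0 < z" using s t unfolding z_def by linarith+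
    have zs: "s ^ (p - 1) \<le> z ^ (p - 1)" "t ^ (p - 1) \<le> z ^ (p - 1)" using z s t by (auto intro: power_mono)
    have "s ^ p + 4 ^ p * (s ^ (p - 1) * t * (1 + 1) + t ^ p) =
        s ^ (p - 1) * s + 4 ^ p * t * (2 * s ^ (p - 1) + t ^ (p - 1))"
      by (simp add: sp tp algebra_simps)
    also have "\<dots> \<le> z ^ (p - 1) * s + 4 ^ p * t * (2 * z ^ (p - 1) + z ^ (p - 1))"
      using zs s t by (intro add_mono mult_left_mono mult_right_mono) auto
    also have "\<dots> \<le> z ^ (p - 1) * s + 4 ^ p * t * (4 * z ^ (p - 1))"
      using z t by (intro add_mono mult_left_mono) auto
    also have "\<dots> = z ^ (p - 1) * z" by (simp add: z_def algebra_simps)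
    also have "\<dots> = z ^ p" by (rule pw[symmetric])
    finally show "s ^ p + 4 ^ p * (s ^ (p - 1) * t * (1 + 1) + t ^ p) \<le> z ^ p" .
  qed
  finally show ?thesis .
qed

end

text \<open>Integrating out one coordinate splits F into its average and an increment of conditional
  mean zero, to which \<open>moment_add_increment\<close> applies. Each \<open>G i\<close> stands in
  for the conditional mean: being free of coordinate i, it controls the increment up to a constant.
  The positive \<open>\<eta>\<close> starts the recursion, which requires a positive first
  bound.\<close>

theorem moment_Efron_Stein:
  fixes S :: "'i \<Rightarrow> 'b measure" and F :: "('i \<Rightarrow> 'b) \<Rightarrow> real" and G :: "'i \<Rightarrow> ('i \<Rightarrow> 'b) \<Rightarrow> real"
  assumes "finite I" and p: "1 \<le> p" and \<eta>: "0 < \<eta>"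
    and S: "\<And>i. prob_space (S i)"
    and "F \<in> borel_measurable (PiM I S)"
    and "(\<integral>\<^sup>+x. ennreal (F x ^ (2 * p)) \<partial>PiM I S) < \<infinity>"
    and "\<And>i. i \<in> I \<Longrightarrow> G i \<in> borel_measurable (PiM I S)"
    and "\<And>i x y. i \<in> I \<Longrightarrow> x \<in> space (PiM I S) \<Longrightarrow> y \<in> space (S i) \<Longrightarrow> G i (x(i := y)) = G i x"
    and "\<And>i. i \<in> I \<Longrightarrow> 0 < t i"
    and "\<And>i. i \<in> I \<Longrightarrow> (\<integral>\<^sup>+x. ennreal ((F x - G i x) ^ (2 * p)) \<partial>PiM I S) \<le> ennreal (t i ^ p)"
  shows "(\<integral>\<^sup>+x. ennreal ((F x - (\<integral>x. F x \<partial>PiM I S)) ^ (2 * p)) \<partial>PiM I S)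
    \<le> ennreal ((\<eta> + 4 ^ (2 * p + 2) * (\<Sum>i\<in>I. t i)) ^ p)"
  using \<open>finite I\<close> assms(5-)
proof (induction I arbitrary: F G rule: finite_induct)
  case empty
  interpret P: prob_space "PiM {} S" by (rule prob_space_PiM) (rule S)
  have "F x - (\<integral>x. F x \<partial>PiM {} S) = 0" if "x \<in> space (PiM {} S)" for x
  proof -
    have "(\<integral>x. F x \<partial>PiM {} S) = (\<integral>y. F x \<partial>PiM {} S)"
      using that by (intro Bochner_Integration.integral_cong) (auto simp: space_PiM)
    thus ?thesis by (simp add: P.prob_space)
  qed
  hence "(\<integral>\<^sup>+x. ennreal ((F x - (\<integral>x. F x \<partial>PiM {} S)) ^ (2 * p)) \<partial>PiM {} S) = (\<integral>\<^sup>+x. 0 \<partial>PiM {} S)"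
    using p by (intro nn_integral_cong) auto
  thus ?case by simp
next
  case (insert i I)
  define Q where "Q = PiM (insert i I) S"
  interpret Q: prob_space Q unfolding Q_def by (rule prob_space_PiM) (rule S)
  interpret PI: prob_space "PiM I S" by (rule prob_space_PiM) (rule S)
  interpret Si: prob_space "S i" by (rule S)
  interpret PP: product_prob_space S "insert i I" by (rule product_prob_spaceI) (rule S)
  note Fm [measurable] = insert.prems(1) and Fint = insert.prems(2) and Gm = insert.prems(3)
    and Gind = insert.prems(4) and tpos = insert.prems(5) and Gbd = insert.prems(6)
  have Gm' [measurable]: "G j \<in> borel_measurable (PiM (insert i I) S)" if "j = i \<or> j \<in> I" for j
    using Gm that by auto
  have upd_space: "x(i := y) \<in> space (PiM (insert i I) S)" if "x \<in> space (PiM I S)" "y \<in> space (S i)" for x y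
    using that by (auto simp: space_PiM PiE_def extensional_def)
  have meas2: "(\<lambda>(x, y). f (x(i := y))) \<in> borel_measurable (PiM I S \<Otimes>\<^sub>M S i)"
    if "f \<in> borel_measurable (PiM (insert i I) S)" for f :: "('i \<Rightarrow> 'b) \<Rightarrow> real"
    using measurable_compose[OF measurable_add_dim that] by (simp add: case_prod_unfold)
  have meas1: "(\<lambda>y. f (x(i := y))) \<in> borel_measurable (S i)"
    if "f \<in> borel_measurable (PiM (insert i I) S)" "x \<in> space (PiM I S)" for f :: "('i \<Rightarrow> 'b) \<Rightarrow> real" and x
    using measurable_Pair2[OF meas2[OF that(1)] that(2)] by simp
  \<comment> \<open>The average over coordinate i. It is 0 wherever the section is not integrable,
    so linearity in f is available only almost everywhere.\<close>
  define av where "av f x = (\<integral>y. f (x(i := y)) \<partial>S i)" for f :: "('i \<Rightarrow> 'b) \<Rightarrow> real" and x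
  have av_meas: "av f \<in> borel_measurable (PiM I S)" if "f \<in> borel_measurable (PiM (insert i I) S)" for f
    unfolding av_def using meas2[OF that] by (intro Si.borel_measurable_lebesgue_integral) (simp add: case_prod_unfold)
  have fub: "(\<integral>\<^sup>+x. f x \<partial>Q) = (\<integral>\<^sup>+x. (\<integral>\<^sup>+y. f (x(i := y)) \<partial>S i) \<partial>PiM I S)"
    if "f \<in> borel_measurable (PiM (insert i I) S)" for f
    unfolding Q_def using insert.hyps that by (intro PP.product_nn_integral_insert) auto
  have av_Q: "av f \<in> borel_measurable Q" if "f \<in> borel_measurable (PiM (insert i I) S)" for f
  proof -
    have "(\<lambda>x. av f (restrict x I)) \<in> borel_measurable Q"
      unfolding Q_def by (rule measurable_compose[OF measurable_restrict_subset av_meas[OF that]]) auto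
    moreover have "av f (restrict x I) = av f x" if "x \<in> space Q" for x
    proof -
      have "(restrict x I)(i := y) = x(i := y)" for y
        using that by (auto simp: Q_def space_PiM PiE_def extensional_def)
      thus ?thesis by (simp add: av_def)
    qed
    ultimately show ?thesis using measurable_cong[of Q "\<lambda>x. av f (restrict x I)" "av f"] by simp
  qed
  have av_upd: "av f (x(i := y)) = av f x" for f x y by (simp add: av_def)
  have jensen: "(\<integral>\<^sup>+x. ennreal (av f x ^ (2 * p)) \<partial>PiM I S) \<le> (\<integral>\<^sup>+x. ennreal (f x ^ (2 * p)) \<partial>Q)"
    if [measurable]: "f \<in> borel_measurable (PiM (insert i I) S)" for f
  proof -
    have "(\<integral>\<^sup>+x. ennreal (av f x ^ (2 * p)) \<partial>PiM I S)
        \<le> (\<integral>\<^sup>+x. (\<integral>\<^sup>+y. ennreal (f (x(i := y)) ^ (2 * p)) \<partial>S i) \<partial>PiM I S)"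
      unfolding av_def by (intro nn_integral_mono Si.expectation_power_even_le meas1 that p)
    also have "\<dots> = (\<integral>\<^sup>+x. ennreal (f x ^ (2 * p)) \<partial>Q)"
      by (rule fub[symmetric]) measurable
    finally show ?thesis .
  qed
  have AE_int: "AE x in PiM I S. integrable (S i) (\<lambda>y. f (x(i := y)))"
    if [measurable]: "f \<in> borel_measurable (PiM (insert i I) S)"
      and fin: "(\<integral>\<^sup>+x. ennreal (f x ^ (2 * p)) \<partial>Q) < \<infinity>" for f
  proof -
    have "(\<integral>\<^sup>+x. (\<integral>\<^sup>+y. ennreal (f (x(i := y)) ^ (2 * p)) \<partial>S i) \<partial>PiM I S) < \<infinity>"
      using fin by (subst (asm) fub) auto
    moreover have "(\<lambda>x. \<integral>\<^sup>+y. ennreal (f (x(i := y)) ^ (2 * p)) \<partial>S i) \<in> borel_measurable (PiM I S)"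
      using meas2[OF that(1)] by (intro Si.borel_measurable_nn_integral) (simp add: case_prod_unfold)
    ultimately have "AE x in PiM I S. (\<integral>\<^sup>+y. ennreal (f (x(i := y)) ^ (2 * p)) \<partial>S i) \<noteq> \<infinity>"
      by (intro nn_integral_PInf_AE) auto
    moreover have "AE x in PiM I S. x \<in> space (PiM I S)" by (rule AE_space)
    ultimately show ?thesis
    proof eventually_elim
      case (elim x)
      have m: "(\<lambda>y. f (x(i := y))) \<in> borel_measurable (S i)" by (rule meas1[OF that(1) elim(2)])
      show ?case
        by (rule Si.integrable_power_even_imp_integrable[OF m Si.integrable_power_evenI[OF m] p])
          (use elim(1) in \<open>simp add: less_top\<close>)
    qed
  qed
  have fin_add: "(\<integral>\<^sup>+x. ennreal ((f x + g x) ^ (2 * p)) \<partial>Q) \<le>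
      4 ^ p * ((\<integral>\<^sup>+x. ennreal (f x ^ (2 * p)) \<partial>Q) + (\<integral>\<^sup>+x. ennreal (g x ^ (2 * p)) \<partial>Q))"
    if [measurable]: "f \<in> borel_measurable Q" "g \<in> borel_measurable Q" for f g :: "('i \<Rightarrow> 'b) \<Rightarrow> real"
  proof -
    have "(\<integral>\<^sup>+x. ennreal ((f x + g x) ^ (2 * p)) \<partial>Q) \<le> (\<integral>\<^sup>+x. 4 ^ p * (ennreal (f x ^ (2 * p)) + ennreal (g x ^ (2 * p))) \<partial>Q)"
    proof (intro nn_integral_mono)
      fix x
      have nn: "0 \<le> f x ^ (2 * p)" "0 \<le> g x ^ (2 * p)" by (simp_all add: power_mult)
      have "ennreal ((f x + g x) ^ (2 * p)) \<le> ennreal (4 ^ p * (f x ^ (2 * p) + g x ^ (2 * p)))"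
        by (intro ennreal_leI power_even_add_le)
      also have "\<dots> = ennreal (4 ^ p) * (ennreal (f x ^ (2 * p)) + ennreal (g x ^ (2 * p)))"
        using nn by (subst ennreal_mult) (auto simp: ennreal_plus)
      also have "ennreal (4 ^ p) = 4 ^ p" by (simp add: ennreal_power[symmetric])
      finally show "ennreal ((f x + g x) ^ (2 * p)) \<le> 4 ^ p * (ennreal (f x ^ (2 * p)) + ennreal (g x ^ (2 * p)))" .
    qed
    also have "\<dots> = 4 ^ p * ((\<integral>\<^sup>+x. ennreal (f x ^ (2 * p)) \<partial>Q) + (\<integral>\<^sup>+x. ennreal (g x ^ (2 * p)) \<partial>Q))"
      by (simp add: nn_integral_cmult nn_integral_add)
    finally show ?thesis .
  qed
  have [measurable]: "F \<in> borel_measurable Q" "G i \<in> borel_measurable Q" using Fm Gm' by (auto simp: Q_def)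
  have [measurable]: "G j \<in> borel_measurable Q" if "j \<in> I" for j using that Gm' by (auto simp: Q_def)
  have iF: "integrable Q F"
    by (rule Q.integrable_power_even_imp_integrable[OF _ Q.integrable_power_evenI p]) (use Fint Q_def in auto)
  have EF: "(\<integral>x. F x \<partial>Q) = (\<integral>x. av F x \<partial>PiM I S)"
    unfolding Q_def av_def using insert.hyps iF[unfolded Q_def] by (intro PP.product_integral_insert) auto
  \<comment> \<open>Writing G j as F minus (F - G j) gives it a finite moment, hence integrable
    sections for almost every choice of the other coordinates.\<close>
  have diff_av: "AE x in PiM I S. av F x - av (G j) x = av (\<lambda>x. F x - G j x) x" if j: "j = i \<or> j \<in> I" for j
  proof -
    have [measurable]: "G j \<in> borel_measurable Q" using Gm' j by (auto simp: Q_def)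
    have fin: "(\<integral>\<^sup>+x. ennreal ((F x - G j x) ^ (2 * p)) \<partial>Q) < \<infinity>"
      using Gbd[of j] j by (auto simp: Q_def le_less_trans)
    have even_neg: "(- u) ^ (2 * p) = u ^ (2 * p)" for u :: real by simp
    have "(\<integral>\<^sup>+x. ennreal ((F x + - (F x - G j x)) ^ (2 * p)) \<partial>Q) \<le> 4 ^ p *
        ((\<integral>\<^sup>+x. ennreal (F x ^ (2 * p)) \<partial>Q) + (\<integral>\<^sup>+x. ennreal ((- (F x - G j x)) ^ (2 * p)) \<partial>Q))"
      by (rule fin_add) measurable
    moreover have "4 ^ p * ((\<integral>\<^sup>+x. ennreal (F x ^ (2 * p)) \<partial>Q) + (\<integral>\<^sup>+x. ennreal ((F x - G j x) ^ (2 * p)) \<partial>Q)) < \<infinity>"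
      using Fint fin by (auto simp: Q_def ennreal_mult_less_top power_less_top_ennreal)
    ultimately have "(\<integral>\<^sup>+x. ennreal ((F x + - (F x - G j x)) ^ (2 * p)) \<partial>Q) < \<infinity>"
      unfolding even_neg by (rule le_less_trans)
    hence fG: "(\<integral>\<^sup>+x. ennreal (G j x ^ (2 * p)) \<partial>Q) < \<infinity>" by simp
    show ?thesis
      using AE_int[OF Fm Fint[folded Q_def]] AE_int[OF Gm'[OF j] fG]
    proof eventually_elim
      case (elim x)
      show ?case unfolding av_def by (rule Bochner_Integration.integral_diff[symmetric]) (rule elim)+
    qed
  qed
  \<comment> \<open>By Jensen, averaging contracts the differences F - G j, so the averaged
    functions satisfy the hypotheses with the same t j.\<close>
  have IH: "(\<integral>\<^sup>+x. ennreal ((av F x - (\<integral>x. F x \<partial>Q)) ^ (2 * p)) \<partial>PiM I S)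
      \<le> ennreal ((\<eta> + 4 ^ (2 * p + 2) * (\<Sum>i\<in>I. t i)) ^ p)"
    unfolding EF
  proof (rule insert.IH[where G = "\<lambda>j. av (G j)"])
    show "(\<integral>\<^sup>+x. ennreal (av F x ^ (2 * p)) \<partial>PiM I S) < \<infinity>"
      using jensen[OF Fm] Fint by (simp add: Q_def le_less_trans)
    fix j assume j: "j \<in> I"
    show "av (G j) \<in> borel_measurable (PiM I S)" using Gm'[of j] j by (intro av_meas) auto
    show "0 < t j" using tpos j by auto
    show "av (G j) (x(j := y)) = av (G j) x" if "x \<in> space (PiM I S)" "y \<in> space (S j)" for x y
    proof -
      have "G j (x(j := y, i := z)) = G j (x(i := z))" if "z \<in> space (S i)" for z
      proof -
        have tw: "x(j := y, i := z) = x(i := z, j := y)"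
          by (rule fun_upd_twist) (use j insert.hyps in auto)
        show ?thesis
          unfolding tw
          by (rule Gind[OF insertI2[OF j] upd_space[OF \<open>x \<in> space (PiM I S)\<close> \<open>z \<in> space (S i)\<close>] \<open>y \<in> space (S j)\<close>])
      qed
      thus ?thesis unfolding av_def by (intro Bochner_Integration.integral_cong) auto
    qed
    have "(\<integral>\<^sup>+x. ennreal ((av F x - av (G j) x) ^ (2 * p)) \<partial>PiM I S) =
        (\<integral>\<^sup>+x. ennreal ((av (\<lambda>x. F x - G j x) x) ^ (2 * p)) \<partial>PiM I S)"
      using diff_av[of j] j by (intro nn_integral_cong_AE) auto
    also have "\<dots> \<le> (\<integral>\<^sup>+x. ennreal ((F x - G j x) ^ (2 * p)) \<partial>Q)"
      using Gm'[of j] j Fm by (intro jensen) auto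
    also have "\<dots> \<le> ennreal (t j ^ p)" using Gbd[of j] j by (simp add: Q_def)
    finally show "(\<integral>\<^sup>+x. ennreal ((av F x - av (G j) x) ^ (2 * p)) \<partial>PiM I S) \<le> ennreal (t j ^ p)" .
  qed (use Fm av_meas in auto)
  \<comment> \<open>The martingale split: a no longer depends on coordinate i, and b has mean zero
    in it.\<close>
  define a where "a x = av F x - (\<integral>x. F x \<partial>Q)" for x
  define b where "b x = F x - av F x" for x
  have [measurable]: "av F \<in> borel_measurable Q" "av (G i) \<in> borel_measurable Q" using av_Q Fm Gm' by auto
  have [measurable]: "a \<in> borel_measurable Q" "b \<in> borel_measurable Q"
    unfolding a_def b_def by measurable
  have am: "a \<in> borel_measurable (PiM (insert i I) S)" "b \<in> borel_measurable (PiM (insert i I) S)"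
    using \<open>a \<in> borel_measurable Q\<close> \<open>b \<in> borel_measurable Q\<close> by (simp_all add: Q_def)
  have a_upd: "a (x(i := y)) = a x" for x y by (simp add: a_def av_upd)
  have a_bd: "(\<integral>\<^sup>+x. ennreal (a x ^ (2 * p)) \<partial>Q) \<le> ennreal ((\<eta> + 4 ^ (2 * p + 2) * (\<Sum>i\<in>I. t i)) ^ p)"
  proof -
    have "(\<integral>\<^sup>+x. ennreal (a x ^ (2 * p)) \<partial>Q) = (\<integral>\<^sup>+x. (\<integral>\<^sup>+y. ennreal (a x ^ (2 * p)) \<partial>S i) \<partial>PiM I S)"
      using am by (subst fub, measurable) (simp add: a_upd)
    also have "\<dots> \<le> ennreal ((\<eta> + 4 ^ (2 * p + 2) * (\<Sum>i\<in>I. t i)) ^ p)"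
      using IH by (simp add: Si.emeasure_space_1 a_def)
    finally show ?thesis .
  qed
  \<comment> \<open>With e = F - G i, the increment b equals e minus its average, because averaging
    leaves G i unchanged. Both terms have the moment bound of e.\<close>
  have b_bd: "(\<integral>\<^sup>+x. ennreal (b x ^ (2 * p)) \<partial>Q) \<le> ennreal ((2 * 4 ^ p * t i) ^ p)"
  proof -
    define e where "e x = F x - G i x" for x
    have [measurable]: "e \<in> borel_measurable (PiM (insert i I) S)" "e \<in> borel_measurable Q"
      unfolding e_def using Gm'[of i] Fm by (auto simp: Q_def)
    have [measurable]: "av e \<in> borel_measurable Q" by (rule av_Q) measurable
    have avG: "av (G i) x = G i x" if "x \<in> space Q" for x
    proof -
      have "(\<integral>y. G i (x(i := y)) \<partial>S i) = (\<integral>y. G i x \<partial>S i)"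
        using that by (intro Bochner_Integration.integral_cong Gind) (auto simp: Q_def)
      thus ?thesis by (simp add: av_def Si.prob_space)
    qed
    have e_bd: "(\<integral>\<^sup>+x. ennreal (e x ^ (2 * p)) \<partial>Q) \<le> ennreal (t i ^ p)"
      using Gbd[of i] by (simp add: Q_def e_def)
    have ave: "(\<integral>\<^sup>+x. ennreal (av e x ^ (2 * p)) \<partial>Q) \<le> ennreal (t i ^ p)"
    proof -
      have "(\<integral>\<^sup>+x. ennreal (av e x ^ (2 * p)) \<partial>Q) = (\<integral>\<^sup>+x. (\<integral>\<^sup>+y. ennreal (av e x ^ (2 * p)) \<partial>S i) \<partial>PiM I S)"
        using av_Q[of e, unfolded Q_def] by (subst fub, measurable) (simp add: av_upd)
      also have "\<dots> = (\<integral>\<^sup>+x. ennreal (av e x ^ (2 * p)) \<partial>PiM I S)" by (simp add: Si.emeasure_space_1)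
      also have "\<dots> \<le> (\<integral>\<^sup>+x. ennreal (e x ^ (2 * p)) \<partial>Q)" by (rule jensen) measurable
      finally show ?thesis using e_bd by simp
    qed
    have "AE x in PiM I S. x \<in> space (PiM I S) \<and> (\<forall>y\<in>space (S i). b (x(i := y)) = e (x(i := y)) + - av e (x(i := y)))"
      using diff_av[of i, simplified] AE_space
    proof eventually_elim
      case (elim x)
      have "av (G i) x = G i (x(i := y))" if "y \<in> space (S i)" for y
        using avG[of "x(i := y)"] upd_space[OF elim(2) that] by (simp add: Q_def av_upd)
      thus ?case using elim by (auto simp: b_def e_def[abs_def] av_upd)
    qed
    hence "(\<integral>\<^sup>+x. (\<integral>\<^sup>+y. ennreal (b (x(i := y)) ^ (2 * p)) \<partial>S i) \<partial>PiM I S) =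
        (\<integral>\<^sup>+x. (\<integral>\<^sup>+y. ennreal ((e (x(i := y)) + - av e (x(i := y))) ^ (2 * p)) \<partial>S i) \<partial>PiM I S)"
    proof (intro nn_integral_cong_AE, eventually_elim)
      case (elim x)
      show ?case by (rule nn_integral_cong) (use elim in \<open>simp only:\<close>)
    qed
    hence "(\<integral>\<^sup>+x. ennreal (b x ^ (2 * p)) \<partial>Q) = (\<integral>\<^sup>+x. ennreal ((e x + - av e x) ^ (2 * p)) \<partial>Q)"
      using am av_Q[of e, unfolded Q_def] by (subst (1 2) fub; measurable)
    also have "\<dots> \<le> 4 ^ p * (ennreal (t i ^ p) + ennreal (t i ^ p))"
    proof -
      have even_neg: "(- u) ^ (2 * p) = u ^ (2 * p)" for u :: real by simp
      have "(\<integral>\<^sup>+x. ennreal ((e x + - av e x) ^ (2 * p)) \<partial>Q) \<le> 4 ^ p *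
          ((\<integral>\<^sup>+x. ennreal (e x ^ (2 * p)) \<partial>Q) + (\<integral>\<^sup>+x. ennreal ((- av e x) ^ (2 * p)) \<partial>Q))"
        by (rule fin_add) measurable
      also have "\<dots> \<le> 4 ^ p * (ennreal (t i ^ p) + ennreal (t i ^ p))"
        unfolding even_neg by (intro mult_left_mono add_mono e_bd ave) simp
      finally show ?thesis .
    qed
    also have "\<dots> = ennreal (2 * 4 ^ p * t i ^ p)"
    proof -
      have t0: "0 \<le> t i ^ p" using tpos[of i] by (simp add: less_imp_le)
      have "ennreal (2 * 4 ^ p * t i ^ p) = ennreal (4 ^ p * (t i ^ p + t i ^ p))" by (simp add: algebra_simps)
      also have "\<dots> = ennreal (4 ^ p) * (ennreal (t i ^ p) + ennreal (t i ^ p))"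
        unfolding ennreal_plus[OF t0 t0, symmetric] by (rule ennreal_mult) (use t0 in auto)
      also have "ennreal (4 ^ p) = 4 ^ p" by (simp add: ennreal_power[symmetric])
      finally show ?thesis by simp
    qed
    also have "\<dots> \<le> ennreal ((2 * 4 ^ p * t i) ^ p)"
    proof (rule ennreal_leI)
      have "(1 :: real) \<le> 2 * 4 ^ p" using one_le_power[of "4 :: real" p] by linarith
      hence "2 * 4 ^ p \<le> (2 * 4 ^ p :: real) ^ p" using p self_le_power[of "2 * 4 ^ p :: real" p] by simp
      thus "2 * 4 ^ p * t i ^ p \<le> (2 * 4 ^ p * t i) ^ p"
        using tpos[of i] by (simp add: power_mult_distrib mult_right_mono)
    qed
    finally show ?thesis .
  qed
  \<comment> \<open>Integrating over coordinate i first annihilates b. Where something is not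
    integrable, the Bochner integral is 0 by convention and the claim still holds.\<close>
  have cross: "(\<integral>x. a x ^ (2 * p - 1) * b x \<partial>Q) = 0"
  proof (cases "integrable Q (\<lambda>x. a x ^ (2 * p - 1) * b x)")
    case True
    have "(\<integral>x. a x ^ (2 * p - 1) * b x \<partial>Q) = (\<integral>x. (\<integral>y. a (x(i := y)) ^ (2 * p - 1) * b (x(i := y)) \<partial>S i) \<partial>PiM I S)"
      unfolding Q_def using insert.hyps True[unfolded Q_def] by (intro PP.product_integral_insert) auto
    also have "\<dots> = (\<integral>x. a x ^ (2 * p - 1) * (\<integral>y. F (x(i := y)) - av F x \<partial>S i) \<partial>PiM I S)"
      by (simp only: a_upd b_def av_upd integral_mult_right_zero)
    also have "\<dots> = (\<integral>x. 0 \<partial>PiM I S)"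
    proof (intro Bochner_Integration.integral_cong refl)
      fix x
      have "(\<integral>y. F (x(i := y)) - av F x \<partial>S i) = 0"
      proof (cases "integrable (S i) (\<lambda>y. F (x(i := y)))")
        case True thus ?thesis by (simp add: av_def Si.prob_space)
      next
        case False
        hence "\<not> integrable (S i) (\<lambda>y. F (x(i := y)) - av F x)"
          using Bochner_Integration.integrable_add[of "S i" "\<lambda>y. F (x(i := y)) - av F x" "\<lambda>_. av F x"] by auto
        thus ?thesis by (rule not_integrable_integral_eq)
      qed
      thus "a x ^ (2 * p - 1) * (\<integral>y. F (x(i := y)) - av F x \<partial>S i) = 0" by simp
    qed
    finally show ?thesis by simp
  qed (rule not_integrable_integral_eq)
  have tsum: "0 \<le> (\<Sum>i\<in>I. t i)" using tpos by (intro sum_nonneg less_imp_le) auto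
  have "(\<integral>\<^sup>+x. ennreal ((a x + b x) ^ (2 * p)) \<partial>Q)
      \<le> ennreal ((\<eta> + 4 ^ (2 * p + 2) * (\<Sum>i\<in>I. t i) + 4 ^ (p + 1) * (2 * 4 ^ p * t i)) ^ p)"
    using \<eta> tpos[of i] tsum
    by (intro Q.moment_add_increment a_bd b_bd p cross) (auto simp: add_pos_nonneg)
  also have "\<dots> \<le> ennreal ((\<eta> + 4 ^ (2 * p + 2) * (\<Sum>i\<in>insert i I. t i)) ^ p)"
  proof (intro ennreal_leI power_mono)
    \<comment> \<open>The constant: 4^(p + 1) from adding an increment, times 2 4^p from comparing
      the increment with F - G i, is at most 4^(2 p + 2).\<close>
    have e: "2 * p + 2 = (p + 1) + (p + 1)" by simp
    have "4 ^ (p + 1) * (2 * 4 ^ p) \<le> (4 ^ (2 * p + 2) :: real)"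
      unfolding e power_add[of _ "p + 1" "p + 1"] by (rule mult_left_mono) simp_all
    from mult_right_mono[OF this, of "t i"]
    have "4 ^ (p + 1) * (2 * 4 ^ p * t i) \<le> 4 ^ (2 * p + 2) * t i"
      using less_imp_le[OF tpos[OF insertI1]] unfolding mult.assoc by blast
    thus "\<eta> + 4 ^ (2 * p + 2) * (\<Sum>i\<in>I. t i) + 4 ^ (p + 1) * (2 * 4 ^ p * t i)
        \<le> \<eta> + 4 ^ (2 * p + 2) * (\<Sum>i\<in>insert i I. t i)"
      unfolding sum.insert[OF insert.hyps] distrib_left by linarith
    show "0 \<le> \<eta> + 4 ^ (2 * p + 2) * (\<Sum>i\<in>I. t i) + 4 ^ (p + 1) * (2 * 4 ^ p * t i)"
      using \<eta> tsum tpos[OF insertI1] by (intro add_nonneg_nonneg mult_nonneg_nonneg) auto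
  qed
  finally show ?case by (simp add: a_def b_def Q_def)
qed

section \<open>Families of random variables with uniformly bounded moments\<close>

text \<open>The meaning of O(1): the bound depends on the order of the moment but not on the index.
  Even powers avoid absolute values, and the nonnegative integral makes finiteness part of the
  claim.\<close>

definition moments_bounded :: "'c set \<Rightarrow> ('c \<Rightarrow> 'w measure) \<Rightarrow> ('c \<Rightarrow> 'w \<Rightarrow> real) \<Rightarrow> bool" where
  "moments_bounded C S X \<longleftrightarrow> (\<forall>c\<in>C. prob_space (S c) \<and> X c \<in> borel_measurable (S c)) \<and>
     (\<forall>p. \<exists>K\<ge>0. \<forall>c\<in>C. (\<integral>\<^sup>+w. ennreal (X c w ^ (2 * p)) \<partial>S c) \<le> ennreal K)"

lemma moments_boundedI:
  assumes "\<And>c. c \<in> C \<Longrightarrow> prob_space (S c)" "\<And>c. c \<in> C \<Longrightarrow> X c \<in> borel_measurable (S c)"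
    and "\<And>p. \<exists>K\<ge>0. \<forall>c\<in>C. (\<integral>\<^sup>+w. ennreal (X c w ^ (2 * p)) \<partial>S c) \<le> ennreal K"
  shows "moments_bounded C S X"
  using assms by (auto simp: moments_bounded_def)

lemma moments_boundedD:
  assumes "moments_bounded C S X"
  shows "c \<in> C \<Longrightarrow> prob_space (S c)" "c \<in> C \<Longrightarrow> X c \<in> borel_measurable (S c)"
    and "\<exists>K\<ge>0. \<forall>c\<in>C. (\<integral>\<^sup>+w. ennreal (X c w ^ (2 * p)) \<partial>S c) \<le> ennreal K"
  using assms by (auto simp: moments_bounded_def)

lemma moments_bounded_mono:
  assumes Y: "moments_bounded C S Y"
    and X: "\<And>c. c \<in> C \<Longrightarrow> X c \<in> borel_measurable (S c)"
    and le: "\<And>c w. c \<in> C \<Longrightarrow> w \<in> space (S c) \<Longrightarrow> \<bar>X c w\<bar> \<le> \<bar>Y c w\<bar>"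
  shows "moments_bounded C S X"
proof (rule moments_boundedI)
  fix p
  from moments_boundedD(3)[OF Y, of p] obtain K where
    K: "0 \<le> K" "\<And>c. c \<in> C \<Longrightarrow> (\<integral>\<^sup>+w. ennreal (Y c w ^ (2 * p)) \<partial>S c) \<le> ennreal K" by auto
  have "(\<integral>\<^sup>+w. ennreal (X c w ^ (2 * p)) \<partial>S c) \<le> ennreal K" if "c \<in> C" for c
    by (rule order_trans[OF nn_integral_mono K(2)[OF that]])
      (auto intro!: ennreal_leI power_mono_even le[OF that])
  thus "\<exists>K\<ge>0. \<forall>c\<in>C. (\<integral>\<^sup>+w. ennreal (X c w ^ (2 * p)) \<partial>S c) \<le> ennreal K" using K(1) by blast
qed (use X moments_boundedD(1)[OF Y] in auto)

lemma moments_bounded_cong: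
  assumes "moments_bounded C S Y" "\<And>c w. c \<in> C \<Longrightarrow> w \<in> space (S c) \<Longrightarrow> X c w = Y c w"
  shows "moments_bounded C S X"
  by (rule moments_bounded_mono[OF assms(1)])
    (use assms moments_boundedD(2)[OF assms(1)] in \<open>auto cong: measurable_cong\<close>)

lemma moments_bounded_const:
  assumes "\<And>c. c \<in> C \<Longrightarrow> prob_space (S c)" and k: "\<And>c. c \<in> C \<Longrightarrow> \<bar>k c\<bar> \<le> K"
  shows "moments_bounded C S (\<lambda>c w. k c)"
proof (rule moments_boundedI)
  fix p
  have "(\<integral>\<^sup>+w. ennreal (k c ^ (2 * p)) \<partial>S c) \<le> ennreal (\<bar>K\<bar> ^ (2 * p))" if "c \<in> C" for c
  proof -
    interpret prob_space "S c" by (rule assms(1)[OF that])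
    have "k c ^ (2 * p) \<le> \<bar>K\<bar> ^ (2 * p)" using k[OF that] by (intro power_mono_even) auto
    thus ?thesis by (simp add: emeasure_space_1 ennreal_leI)
  qed
  thus "\<exists>K\<ge>0. \<forall>c\<in>C. (\<integral>\<^sup>+w. ennreal (k c ^ (2 * p)) \<partial>S c) \<le> ennreal K"
    by (intro exI[of _ "\<bar>K\<bar> ^ (2 * p)"]) auto
qed (use assms in auto)

lemma moments_bounded_bounded:
  assumes "\<And>c. c \<in> C \<Longrightarrow> prob_space (S c)" "\<And>c. c \<in> C \<Longrightarrow> X c \<in> borel_measurable (S c)"
    and "\<And>c w. c \<in> C \<Longrightarrow> w \<in> space (S c) \<Longrightarrow> \<bar>X c w\<bar> \<le> K"
  shows "moments_bounded C S X"
proof (rule moments_bounded_mono)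
  show "moments_bounded C S (\<lambda>c w. \<bar>K\<bar>)"
    using assms(1) by (rule moments_bounded_const[where K = "\<bar>K\<bar>"]) auto
  show "\<bar>X c w\<bar> \<le> \<bar>\<bar>K\<bar>\<bar>" if "c \<in> C" "w \<in> space (S c)" for c w
    using assms(3)[OF that] by simp
qed (rule assms(2))

lemma moments_bounded_add:
  assumes X: "moments_bounded C S X" and Y: "moments_bounded C S Y"
  shows "moments_bounded C S (\<lambda>c w. X c w + Y c w)"
proof (rule moments_boundedI)
  fix p
  from moments_boundedD(3)[OF X, of p] obtain K where
    K: "0 \<le> K" "\<And>c. c \<in> C \<Longrightarrow> (\<integral>\<^sup>+w. ennreal (X c w ^ (2 * p)) \<partial>S c) \<le> ennreal K" by auto
  from moments_boundedD(3)[OF Y, of p] obtain L where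
    L: "0 \<le> L" "\<And>c. c \<in> C \<Longrightarrow> (\<integral>\<^sup>+w. ennreal (Y c w ^ (2 * p)) \<partial>S c) \<le> ennreal L" by auto
  have "(\<integral>\<^sup>+w. ennreal ((X c w + Y c w) ^ (2 * p)) \<partial>S c) \<le> ennreal (4 ^ p * (K + L))" if c: "c \<in> C" for c
  proof -
    note [measurable] = moments_boundedD(2)[OF X c] moments_boundedD(2)[OF Y c]
    have "(\<integral>\<^sup>+w. ennreal ((X c w + Y c w) ^ (2 * p)) \<partial>S c)
        \<le> (\<integral>\<^sup>+w. ennreal (4 ^ p) * (ennreal (X c w ^ (2 * p)) + ennreal (Y c w ^ (2 * p))) \<partial>S c)"
    proof (intro nn_integral_mono)
      fix w
      have nn: "0 \<le> X c w ^ (2 * p)" "0 \<le> Y c w ^ (2 * p)" by (simp_all add: power_mult)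
      show "ennreal ((X c w + Y c w) ^ (2 * p)) \<le> ennreal (4 ^ p) * (ennreal (X c w ^ (2 * p)) + ennreal (Y c w ^ (2 * p)))"
        unfolding ennreal_plus[OF nn, symmetric] using nn
        by (subst ennreal_mult[symmetric]) (auto intro!: ennreal_leI power_even_add_le)
    qed
    also have "\<dots> = ennreal (4 ^ p) * ((\<integral>\<^sup>+w. ennreal (X c w ^ (2 * p)) \<partial>S c) + (\<integral>\<^sup>+w. ennreal (Y c w ^ (2 * p)) \<partial>S c))"
      by (simp add: nn_integral_cmult nn_integral_add)
    also have "\<dots> \<le> ennreal (4 ^ p) * (ennreal K + ennreal L)"
      by (intro mult_left_mono add_mono K L c) simp
    also have "\<dots> = ennreal (4 ^ p * (K + L))"
      unfolding ennreal_plus[OF K(1) L(1), symmetric] using K(1) L(1) by (subst ennreal_mult[symmetric]) auto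
    finally show ?thesis .
  qed
  thus "\<exists>K\<ge>0. \<forall>c\<in>C. (\<integral>\<^sup>+w. ennreal ((X c w + Y c w) ^ (2 * p)) \<partial>S c) \<le> ennreal K"
    using K(1) L(1) by (intro exI[of _ "4 ^ p * (K + L)"]) auto
qed (use moments_boundedD(1,2)[OF X] moments_boundedD(2)[OF Y] in auto)

text \<open>The moment of order 2 p of a product is paid for with moments of order 4 p of the
  factors; this is why all orders are required at once.\<close>

lemma moments_bounded_mult:
  assumes X: "moments_bounded C S X" and Y: "moments_bounded C S Y"
  shows "moments_bounded C S (\<lambda>c w. X c w * Y c w)"
proof (rule moments_boundedI)
  fix p
  from moments_boundedD(3)[OF X, of "2 * p"] obtain K where
    K: "0 \<le> K" "\<And>c. c \<in> C \<Longrightarrow> (\<integral>\<^sup>+w. ennreal (X c w ^ (2 * (2 * p))) \<partial>S c) \<le> ennreal K" by auto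
  from moments_boundedD(3)[OF Y, of "2 * p"] obtain L where
    L: "0 \<le> L" "\<And>c. c \<in> C \<Longrightarrow> (\<integral>\<^sup>+w. ennreal (Y c w ^ (2 * (2 * p))) \<partial>S c) \<le> ennreal L" by auto
  have "(\<integral>\<^sup>+w. ennreal ((X c w * Y c w) ^ (2 * p)) \<partial>S c) \<le> ennreal (K + L)" if c: "c \<in> C" for c
  proof -
    note [measurable] = moments_boundedD(2)[OF X c] moments_boundedD(2)[OF Y c]
    have "(\<integral>\<^sup>+w. ennreal ((X c w * Y c w) ^ (2 * p)) \<partial>S c)
        \<le> (\<integral>\<^sup>+w. ennreal (X c w ^ (2 * (2 * p))) + ennreal (Y c w ^ (2 * (2 * p))) \<partial>S c)"
    proof (intro nn_integral_mono)
      fix w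
      have nn: "0 \<le> X c w ^ (2 * (2 * p))" "0 \<le> Y c w ^ (2 * (2 * p))" by (simp_all add: power_mult)
      show "ennreal ((X c w * Y c w) ^ (2 * p)) \<le> ennreal (X c w ^ (2 * (2 * p))) + ennreal (Y c w ^ (2 * (2 * p)))"
        unfolding ennreal_plus[OF nn, symmetric] by (intro ennreal_leI power_even_mult_le)
    qed
    also have "\<dots> = (\<integral>\<^sup>+w. ennreal (X c w ^ (2 * (2 * p))) \<partial>S c) + (\<integral>\<^sup>+w. ennreal (Y c w ^ (2 * (2 * p))) \<partial>S c)"
      by (simp add: nn_integral_add)
    also have "\<dots> \<le> ennreal K + ennreal L" by (intro add_mono K L c)
    finally show ?thesis using K(1) L(1) by simp
  qed
  thus "\<exists>K\<ge>0. \<forall>c\<in>C. (\<integral>\<^sup>+w. ennreal ((X c w * Y c w) ^ (2 * p)) \<partial>S c) \<le> ennreal K"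
    using K(1) L(1) by (intro exI[of _ "K + L"]) auto
qed (use moments_boundedD(1,2)[OF X] moments_boundedD(2)[OF Y] in auto)

lemma moments_bounded_cmult:
  assumes "moments_bounded C S X" "\<And>c. c \<in> C \<Longrightarrow> \<bar>k c\<bar> \<le> K"
  shows "moments_bounded C S (\<lambda>c w. k c * X c w)"
  by (rule moments_bounded_mult[OF moments_bounded_const[OF moments_boundedD(1)[OF assms(1)] assms(2)] assms(1)])

lemma moments_bounded_minus:
  assumes "moments_bounded C S X" shows "moments_bounded C S (\<lambda>c w. - X c w)"
  using moments_bounded_cmult[OF assms, of "\<lambda>_. - 1" 1] by simp

lemma moments_bounded_diff:
  assumes "moments_bounded C S X" "moments_bounded C S Y"
  shows "moments_bounded C S (\<lambda>c w. X c w - Y c w)"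
  using moments_bounded_add[OF assms(1) moments_bounded_minus[OF assms(2)]] by simp

lemma moments_bounded_reindex:
  assumes "moments_bounded C S X" "\<And>e. e \<in> E \<Longrightarrow> f e \<in> C"
  shows "moments_bounded E (\<lambda>e. S (f e)) (\<lambda>e. X (f e))"
  using assms unfolding moments_bounded_def by (meson in_mono)

lemma moments_bounded_integrable:
  assumes "moments_bounded C S X" "c \<in> C" shows "integrable (S c) (X c)"
proof -
  interpret prob_space "S c" by (rule moments_boundedD(1)[OF assms])
  from moments_boundedD(3)[OF assms(1), of 1] obtain K where
    "(\<integral>\<^sup>+w. ennreal (X c w ^ (2 * 1)) \<partial>S c) \<le> ennreal K" using assms(2) by blast
  hence "(\<integral>\<^sup>+w. ennreal (X c w ^ (2 * 1)) \<partial>S c) < \<infinity>" by (rule le_less_trans) simp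
  from integrable_power_evenI[OF moments_boundedD(2)[OF assms] this]
  show ?thesis by (rule integrable_power_even_imp_integrable[OF moments_boundedD(2)[OF assms]]) simp
qed

text \<open>Jensen at the second moment, together with the inequality |z| <= 1 + z^2.\<close>

lemma moments_bounded_expectation:
  assumes X: "moments_bounded C S X"
  shows "\<exists>K\<ge>0. \<forall>c\<in>C. \<bar>\<integral>w. X c w \<partial>S c\<bar> \<le> K"
proof -
  from moments_boundedD(3)[OF X, of 1] obtain K where
    K: "0 \<le> K" "\<And>c. c \<in> C \<Longrightarrow> (\<integral>\<^sup>+w. ennreal (X c w ^ (2 * 1)) \<partial>S c) \<le> ennreal K" by auto
  have "\<bar>\<integral>w. X c w \<partial>S c\<bar> \<le> 1 + K" if c: "c \<in> C" for c
  proof -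
    interpret prob_space "S c" by (rule moments_boundedD(1)[OF X c])
    have "ennreal (expectation (X c) ^ (2 * 1)) \<le> ennreal K"
      by (rule order_trans[OF expectation_power_even_le K(2)[OF c]]) (use moments_boundedD(2)[OF X c] in auto)
    hence "(expectation (X c))\<^sup>2 \<le> K" using K(1) by (simp add: ennreal_le_iff)
    moreover have "\<bar>z\<bar> \<le> 1 + z\<^sup>2" for z :: real
      using sum_squares_bound[of "\<bar>z\<bar>" 1] zero_le_power2[of z] by (simp add: power2_eq_square)
    ultimately show ?thesis by (smt (verit))
  qed
  thus ?thesis using K(1) by (intro exI[of _ "1 + K"]) auto
qed

lemma moments_bounded_tail:
  assumes X: "moments_bounded C S X"
  shows "\<exists>K\<ge>0. \<forall>c\<in>C. \<forall>t>0. measure (S c) {w \<in> space (S c). t < \<bar>X c w\<bar>} \<le> K / t ^ (2 * p)"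
proof -
  from moments_boundedD(3)[OF X, of p] obtain K where
    K: "0 \<le> K" "\<And>c. c \<in> C \<Longrightarrow> (\<integral>\<^sup>+w. ennreal (X c w ^ (2 * p)) \<partial>S c) \<le> ennreal K" by auto
  have "measure (S c) {w \<in> space (S c). t < \<bar>X c w\<bar>} \<le> K / t ^ (2 * p)" if c: "c \<in> C" and t: "0 < t" for c t
  proof -
    interpret prob_space "S c" by (rule moments_boundedD(1)[OF X c])
    note [measurable] = moments_boundedD(2)[OF X c]
    let ?A = "{w \<in> space (S c). t < \<bar>X c w\<bar>}"
    have "ennreal (t ^ (2 * p)) * emeasure (S c) ?A = (\<integral>\<^sup>+w. ennreal (t ^ (2 * p)) * indicator ?A w \<partial>S c)"
      by (simp add: nn_integral_cmult_indicator)
    also have "\<dots> \<le> (\<integral>\<^sup>+w. ennreal (X c w ^ (2 * p)) \<partial>S c)"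
    proof (intro nn_integral_mono)
      fix w
      have "t ^ (2 * p) \<le> X c w ^ (2 * p)" if "t < \<bar>X c w\<bar>"
        using that t by (intro power_mono_even) auto
      thus "ennreal (t ^ (2 * p)) * indicator ?A w \<le> ennreal (X c w ^ (2 * p))"
        by (auto simp: indicator_def intro!: ennreal_leI)
    qed
    also have "\<dots> \<le> ennreal K" by (rule K(2)[OF c])
    finally have "ennreal (t ^ (2 * p) * measure (S c) ?A) \<le> ennreal K"
      using t by (simp add: emeasure_eq_measure ennreal_mult)
    hence "t ^ (2 * p) * measure (S c) ?A \<le> K" using K(1) by (simp add: ennreal_le_iff)
    thus ?thesis using t by (simp add: field_simps)
  qed
  thus ?thesis using K(1) by blast
qed

text \<open>The linear part \<open>L\<close> is kept separate because it disappears in expectation, so that the expectation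
  of \<open>X\<close> agrees with \<open>x\<close> to order \<open>1 / n\<close>, although \<open>X\<close> fluctuates at order \<open>1 / sqrt n\<close>.\<close>

definition second_order :: "'c set \<Rightarrow> ('c \<Rightarrow> nat) \<Rightarrow> ('c \<Rightarrow> 'w measure) \<Rightarrow> ('c \<Rightarrow> 'w \<Rightarrow> real) \<Rightarrow> ('c \<Rightarrow> real) \<Rightarrow> bool" where
  "second_order C n S X x \<longleftrightarrow> (\<forall>c\<in>C. 1 \<le> n c \<and> prob_space (S c)) \<and> (\<exists>K. \<forall>c\<in>C. \<bar>x c\<bar> \<le> K) \<and>
     (\<exists>L. (\<forall>c\<in>C. (\<integral>w. L c w \<partial>S c) = 0) \<and> moments_bounded C S (\<lambda>c w. sqrt (n c) * L c w) \<and>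
       moments_bounded C S (\<lambda>c w. real (n c) * (X c w - x c - L c w)))"

lemma second_orderE:
  assumes "second_order C n S X x"
  obtains K L where "0 \<le> K" "\<And>c. c \<in> C \<Longrightarrow> 1 \<le> n c" "\<And>c. c \<in> C \<Longrightarrow> prob_space (S c)"
    "\<And>c. c \<in> C \<Longrightarrow> \<bar>x c\<bar> \<le> K" "\<And>c. c \<in> C \<Longrightarrow> (\<integral>w. L c w \<partial>S c) = 0"
    "moments_bounded C S (\<lambda>c w. sqrt (n c) * L c w)"
    "moments_bounded C S (\<lambda>c w. real (n c) * (X c w - x c - L c w))"
proof -
  from assms obtain K L where *: "\<And>c. c \<in> C \<Longrightarrow> 1 \<le> n c" "\<And>c. c \<in> C \<Longrightarrow> prob_space (S c)"
    "\<And>c. c \<in> C \<Longrightarrow> \<bar>x c\<bar> \<le> K" "\<And>c. c \<in> C \<Longrightarrow> (\<integral>w. L c w \<partial>S c) = 0"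
    "moments_bounded C S (\<lambda>c w. sqrt (n c) * L c w)"
    "moments_bounded C S (\<lambda>c w. real (n c) * (X c w - x c - L c w))"
    unfolding second_order_def by blast
  show ?thesis by (rule that[of "\<bar>K\<bar>" L]) (use * in \<open>force simp: abs_le_iff\<close>)+
qed

lemma second_orderI:
  assumes "\<And>c. c \<in> C \<Longrightarrow> 1 \<le> n c" "\<And>c. c \<in> C \<Longrightarrow> prob_space (S c)"
    "\<And>c. c \<in> C \<Longrightarrow> \<bar>x c\<bar> \<le> K" "\<And>c. c \<in> C \<Longrightarrow> (\<integral>w. L c w \<partial>S c) = 0"
    "moments_bounded C S (\<lambda>c w. sqrt (n c) * L c w)"
    "moments_bounded C S (\<lambda>c w. real (n c) * (X c w - x c - L c w))"
  shows "second_order C n S X x"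
  using assms unfolding second_order_def by blast

lemma inverse_sqrt_le_1: "1 \<le> (n :: nat) \<Longrightarrow> \<bar>1 / sqrt n\<bar> \<le> 1"
  by simp

lemma second_order_deviation:
  assumes "second_order C n S X x"
  shows "moments_bounded C S (\<lambda>c w. sqrt (n c) * (X c w - x c))"
proof -
  obtain K L where *:
    "0 \<le> K" "\<And>c. c \<in> C \<Longrightarrow> 1 \<le> n c" "\<And>c. c \<in> C \<Longrightarrow> prob_space (S c)"
    "\<And>c. c \<in> C \<Longrightarrow> \<bar>x c\<bar> \<le> K" "\<And>c. c \<in> C \<Longrightarrow> (\<integral>w. L c w \<partial>S c) = 0"
    "moments_bounded C S (\<lambda>c w. sqrt (n c) * L c w)"
    "moments_bounded C S (\<lambda>c w. real (n c) * (X c w - x c - L c w))"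
    by (rule second_orderE[OF assms], rule that)
  have "moments_bounded C S (\<lambda>c w. sqrt (n c) * L c w + 1 / sqrt (n c) * (real (n c) * (X c w - x c - L c w)))"
    using *(2) by (intro moments_bounded_add *(6) moments_bounded_cmult[where K = 1] *(7) inverse_sqrt_le_1) auto
  thus ?thesis
  proof (rule moments_bounded_cong)
    fix c w assume "c \<in> C"
    hence *: "1 / sqrt (n c) * real (n c) = sqrt (n c)" using *(2)[of c] by (simp add: real_div_sqrt)
    have "sqrt (n c) * L c w + 1 / sqrt (n c) * (real (n c) * (X c w - x c - L c w)) =
        sqrt (n c) * L c w + sqrt (n c) * (X c w - x c - L c w)"
      unfolding mult.assoc[symmetric] * ..
    thus "sqrt (n c) * (X c w - x c) = sqrt (n c) * L c w + 1 / sqrt (n c) * (real (n c) * (X c w - x c - L c w))"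
      by (simp add: algebra_simps)
  qed
qed

lemma second_order_moments_bounded:
  assumes "second_order C n S X x" shows "moments_bounded C S X"
proof -
  obtain K L where *:
    "0 \<le> K" "\<And>c. c \<in> C \<Longrightarrow> 1 \<le> n c" "\<And>c. c \<in> C \<Longrightarrow> prob_space (S c)"
    "\<And>c. c \<in> C \<Longrightarrow> \<bar>x c\<bar> \<le> K" "\<And>c. c \<in> C \<Longrightarrow> (\<integral>w. L c w \<partial>S c) = 0"
    "moments_bounded C S (\<lambda>c w. sqrt (n c) * L c w)"
    "moments_bounded C S (\<lambda>c w. real (n c) * (X c w - x c - L c w))"
    by (rule second_orderE[OF assms], rule that)
  have "moments_bounded C S (\<lambda>c w. x c + 1 / sqrt (n c) * (sqrt (n c) * (X c w - x c)))"
    using * by (intro moments_bounded_add moments_bounded_const[where K = K] second_order_deviation[OF assms]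
        moments_bounded_cmult[where K = 1] inverse_sqrt_le_1) auto
  thus ?thesis
    by (rule moments_bounded_cong) (use *(2) in fastforce)
qed

lemma second_order_expectation:
  assumes "second_order C n S X x"
  shows "\<exists>K\<ge>0. \<forall>c\<in>C. \<bar>(\<integral>w. X c w \<partial>S c) - x c\<bar> \<le> K / n c"
proof -
  obtain K0 L where *:
    "0 \<le> K0" "\<And>c. c \<in> C \<Longrightarrow> 1 \<le> n c" "\<And>c. c \<in> C \<Longrightarrow> prob_space (S c)"
    "\<And>c. c \<in> C \<Longrightarrow> \<bar>x c\<bar> \<le> K0" "\<And>c. c \<in> C \<Longrightarrow> (\<integral>w. L c w \<partial>S c) = 0"
    "moments_bounded C S (\<lambda>c w. sqrt (n c) * L c w)"
    "moments_bounded C S (\<lambda>c w. real (n c) * (X c w - x c - L c w))"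
    by (rule second_orderE[OF assms], rule that)
  from moments_bounded_expectation[OF *(7)] obtain K where
    K: "0 \<le> K" "\<And>c. c \<in> C \<Longrightarrow> \<bar>\<integral>w. real (n c) * (X c w - x c - L c w) \<partial>S c\<bar> \<le> K" by auto
  have "\<bar>(\<integral>w. X c w \<partial>S c) - x c\<bar> \<le> K / n c" if c: "c \<in> C" for c
  proof -
    interpret prob_space "S c" by (rule *(3)[OF c])
    have n: "0 < real (n c)" using *(2)[OF c] by simp
    have "integrable (S c) (\<lambda>w. sqrt (n c) * L c w)" by (rule moments_bounded_integrable[OF *(6) c])
    hence L: "integrable (S c) (L c)" using n by simp
    have X: "integrable (S c) (X c)" by (rule moments_bounded_integrable[OF second_order_moments_bounded[OF assms] c])
    have "(\<integral>w. real (n c) * (X c w - x c - L c w) \<partial>S c) = real (n c) * ((\<integral>w. X c w \<partial>S c) - x c)"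
      using X L *(5)[OF c] by (simp add: prob_space)
    hence "\<bar>\<integral>w. real (n c) * (X c w - x c - L c w) \<partial>S c\<bar> = real (n c) * \<bar>(\<integral>w. X c w \<partial>S c) - x c\<bar>"
      by (simp only: abs_mult abs_of_nat)
    with K(2)[OF c] have "real (n c) * \<bar>(\<integral>w. X c w \<partial>S c) - x c\<bar> \<le> K" by simp
    thus ?thesis using n by (simp add: pos_le_divide_eq mult.commute)
  qed
  thus ?thesis using K(1) by blast
qed

lemma second_order_const:
  assumes "\<And>c. c \<in> C \<Longrightarrow> 1 \<le> n c" "\<And>c. c \<in> C \<Longrightarrow> prob_space (S c)" "\<And>c. c \<in> C \<Longrightarrow> \<bar>x c\<bar> \<le> K"
  shows "second_order C n S (\<lambda>c w. x c) x"
  by (rule second_orderI[where L = "\<lambda>_ _. 0" and K = K]) (use assms in \<open>auto intro: moments_bounded_const[where K = 0]\<close>)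

lemma second_order_add:
  assumes "second_order C n S X x" "second_order C n S Y y"
  shows "second_order C n S (\<lambda>c w. X c w + Y c w) (\<lambda>c. x c + y c)"
proof -
  obtain K L where X:
    "0 \<le> K" "\<And>c. c \<in> C \<Longrightarrow> 1 \<le> n c" "\<And>c. c \<in> C \<Longrightarrow> prob_space (S c)"
    "\<And>c. c \<in> C \<Longrightarrow> \<bar>x c\<bar> \<le> K" "\<And>c. c \<in> C \<Longrightarrow> (\<integral>w. L c w \<partial>S c) = 0"
    "moments_bounded C S (\<lambda>c w. sqrt (n c) * L c w)"
    "moments_bounded C S (\<lambda>c w. real (n c) * (X c w - x c - L c w))"
    by (rule second_orderE[OF assms(1)], rule that)
  obtain K' L' where Y:
    "0 \<le> K'" "\<And>c. c \<in> C \<Longrightarrow> 1 \<le> n c" "\<And>c. c \<in> C \<Longrightarrow> prob_space (S c)"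
    "\<And>c. c \<in> C \<Longrightarrow> \<bar>y c\<bar> \<le> K'" "\<And>c. c \<in> C \<Longrightarrow> (\<integral>w. L' c w \<partial>S c) = 0"
    "moments_bounded C S (\<lambda>c w. sqrt (n c) * L' c w)"
    "moments_bounded C S (\<lambda>c w. real (n c) * (Y c w - y c - L' c w))"
    by (rule second_orderE[OF assms(2)], rule that)
  show ?thesis
  proof (rule second_orderI[where L = "\<lambda>c w. L c w + L' c w" and K = "K + K'"])
    fix c assume c: "c \<in> C"
    have n: "sqrt (real (n c)) \<noteq> 0" using X(2)[OF c] by simp
    have "integrable (S c) (L c)" "integrable (S c) (L' c)"
      using moments_bounded_integrable[OF X(6) c] moments_bounded_integrable[OF Y(6) c] n by auto
    thus "(\<integral>w. L c w + L' c w \<partial>S c) = 0" using X(5)[OF c] Y(5)[OF c] by simp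
    show "\<bar>x c + y c\<bar> \<le> K + K'" using X(4)[OF c] Y(4)[OF c] by linarith
  next
    show "moments_bounded C S (\<lambda>c w. sqrt (n c) * (L c w + L' c w))"
      using moments_bounded_add[OF X(6) Y(6)] by (simp add: algebra_simps)
    show "moments_bounded C S (\<lambda>c w. real (n c) * (X c w + Y c w - (x c + y c) - (L c w + L' c w)))"
      using moments_bounded_add[OF X(7) Y(7)] by (simp add: algebra_simps)
  qed (use X in auto)
qed

text \<open>The linear part is x L' + y L. What remains is the product of the two deviations, each
  of order n^(-1/2), plus the two remainders with bounded coefficients.\<close>

lemma second_order_mult:
  assumes "second_order C n S X x" "second_order C n S Y y"
  shows "second_order C n S (\<lambda>c w. X c w * Y c w) (\<lambda>c. x c * y c)"
proof -
  obtain K L where X: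
    "0 \<le> K" "\<And>c. c \<in> C \<Longrightarrow> 1 \<le> n c" "\<And>c. c \<in> C \<Longrightarrow> prob_space (S c)"
    "\<And>c. c \<in> C \<Longrightarrow> \<bar>x c\<bar> \<le> K" "\<And>c. c \<in> C \<Longrightarrow> (\<integral>w. L c w \<partial>S c) = 0"
    "moments_bounded C S (\<lambda>c w. sqrt (n c) * L c w)"
    "moments_bounded C S (\<lambda>c w. real (n c) * (X c w - x c - L c w))"
    by (rule second_orderE[OF assms(1)], rule that)
  obtain K' L' where Y:
    "0 \<le> K'" "\<And>c. c \<in> C \<Longrightarrow> 1 \<le> n c" "\<And>c. c \<in> C \<Longrightarrow> prob_space (S c)"
    "\<And>c. c \<in> C \<Longrightarrow> \<bar>y c\<bar> \<le> K'" "\<And>c. c \<in> C \<Longrightarrow> (\<integral>w. L' c w \<partial>S c) = 0"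
    "moments_bounded C S (\<lambda>c w. sqrt (n c) * L' c w)"
    "moments_bounded C S (\<lambda>c w. real (n c) * (Y c w - y c - L' c w))"
    by (rule second_orderE[OF assms(2)], rule that)
  show ?thesis
  proof (rule second_orderI[where L = "\<lambda>c w. x c * L' c w + y c * L c w" and K = "K * K'"])
    fix c assume c: "c \<in> C"
    have n: "sqrt (real (n c)) \<noteq> 0" using X(2)[OF c] by simp
    have "integrable (S c) (L c)" "integrable (S c) (L' c)"
      using moments_bounded_integrable[OF X(6) c] moments_bounded_integrable[OF Y(6) c] n by auto
    thus "(\<integral>w. x c * L' c w + y c * L c w \<partial>S c) = 0" using X(5)[OF c] Y(5)[OF c] by simp
    show "\<bar>x c * y c\<bar> \<le> K * K'" using X(4)[OF c] Y(4)[OF c] X(1) by (simp add: abs_mult mult_mono)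
  next
    have "moments_bounded C S (\<lambda>c w. x c * (sqrt (n c) * L' c w) + y c * (sqrt (n c) * L c w))"
      using X(4) Y(4) by (intro moments_bounded_add moments_bounded_cmult[where K = K] moments_bounded_cmult[where K = K'] X(6) Y(6))
    thus "moments_bounded C S (\<lambda>c w. sqrt (n c) * (x c * L' c w + y c * L c w))"
      by (simp add: algebra_simps)
    have "moments_bounded C S (\<lambda>c w. (sqrt (n c) * (X c w - x c)) * (sqrt (n c) * (Y c w - y c))
       + (x c * (real (n c) * (Y c w - y c - L' c w)) + y c * (real (n c) * (X c w - x c - L c w))))"
      using X(4) Y(4)
      by (intro moments_bounded_add moments_bounded_mult second_order_deviation[OF assms(1)] second_order_deviation[OF assms(2)]
          moments_bounded_cmult[where K = K] moments_bounded_cmult[where K = K'] X(7) Y(7))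
    thus "moments_bounded C S (\<lambda>c w. real (n c) * (X c w * Y c w - x c * y c - (x c * L' c w + y c * L c w)))"
    proof (rule moments_bounded_cong)
      fix c w
      have "(sqrt (n c) * (X c w - x c)) * (sqrt (n c) * (Y c w - y c)) = real (n c) * ((X c w - x c) * (Y c w - y c))"
        by (metis (no_types, opaque_lifting) mult.assoc mult.left_commute of_nat_0_le_iff real_sqrt_mult_self abs_of_nat)
      thus "real (n c) * (X c w * Y c w - x c * y c - (x c * L' c w + y c * L c w)) =
        (sqrt (n c) * (X c w - x c)) * (sqrt (n c) * (Y c w - y c))
       + (x c * (real (n c) * (Y c w - y c - L' c w)) + y c * (real (n c) * (X c w - x c - L c w)))"
        by (simp add: algebra_simps)
    qed
  qed (use X in auto)
qed

lemma second_order_cmult: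
  assumes "second_order C n S X x" "\<And>c. c \<in> C \<Longrightarrow> \<bar>k c\<bar> \<le> K"
  shows "second_order C n S (\<lambda>c w. k c * X c w) (\<lambda>c. k c * x c)"
proof -
  have "\<And>c. c \<in> C \<Longrightarrow> 1 \<le> n c" "\<And>c. c \<in> C \<Longrightarrow> prob_space (S c)"
    using assms(1) by (auto simp: second_order_def)
  from second_order_mult[OF second_order_const[OF this assms(2)] assms(1)] show ?thesis .
qed

lemma second_order_diff:
  assumes "second_order C n S X x" "second_order C n S Y y"
  shows "second_order C n S (\<lambda>c w. X c w - Y c w) (\<lambda>c. x c - y c)"
  using second_order_add[OF assms(1) second_order_cmult[OF assms(2), of "\<lambda>_. - 1" 1]] by simp

lemma second_order_cong:
  assumes "second_order C n S Y y" "\<And>c w. c \<in> C \<Longrightarrow> w \<in> space (S c) \<Longrightarrow> X c w = Y c w" "\<And>c. c \<in> C \<Longrightarrow> x c = y c"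
  shows "second_order C n S X x"
proof -
  obtain K L where Y:
    "0 \<le> K" "\<And>c. c \<in> C \<Longrightarrow> 1 \<le> n c" "\<And>c. c \<in> C \<Longrightarrow> prob_space (S c)"
    "\<And>c. c \<in> C \<Longrightarrow> \<bar>y c\<bar> \<le> K" "\<And>c. c \<in> C \<Longrightarrow> (\<integral>w. L c w \<partial>S c) = 0"
    "moments_bounded C S (\<lambda>c w. sqrt (n c) * L c w)"
    "moments_bounded C S (\<lambda>c w. real (n c) * (Y c w - y c - L c w))"
    by (rule second_orderE[OF assms(1)], rule that)
  show ?thesis
  proof (rule second_orderI)
    show "moments_bounded C S (\<lambda>c w. real (n c) * (X c w - x c - L c w))"
      by (rule moments_bounded_cong[OF Y(7)]) (simp add: assms(2,3))
    show "\<bar>x c\<bar> \<le> K" if "c \<in> C" for c using Y(4)[OF that] assms(3)[OF that] by simp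
  qed (use Y in auto)
qed

text \<open>Expansion of 1 / (1 + X) around 1 / (1 + x). Nonnegativity keeps both denominators at
  least 1, so the quadratic remainder has bounded coefficients on the whole space, not just on a
  likely event.\<close>

lemma second_order_inverse:
  assumes X: "second_order C n S X x"
    and nn: "\<And>c w. c \<in> C \<Longrightarrow> w \<in> space (S c) \<Longrightarrow> 0 \<le> X c w" "\<And>c. c \<in> C \<Longrightarrow> 0 \<le> x c"
  shows "second_order C n S (\<lambda>c w. 1 / (1 + X c w)) (\<lambda>c. 1 / (1 + x c))"
proof -
  obtain K L where L:
    "0 \<le> K" "\<And>c. c \<in> C \<Longrightarrow> 1 \<le> n c" "\<And>c. c \<in> C \<Longrightarrow> prob_space (S c)"
    "\<And>c. c \<in> C \<Longrightarrow> \<bar>x c\<bar> \<le> K" "\<And>c. c \<in> C \<Longrightarrow> (\<integral>w. L c w \<partial>S c) = 0"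
    "moments_bounded C S (\<lambda>c w. sqrt (n c) * L c w)"
    "moments_bounded C S (\<lambda>c w. real (n c) * (X c w - x c - L c w))"
    by (rule second_orderE[OF X], rule that)
  define v where "v c = 1 / (1 + x c)" for c
  have v: "\<bar>v c\<bar> \<le> 1" "\<bar>- (v c)\<^sup>2\<bar> \<le> 1" "\<bar>(v c)\<^sup>2\<bar> \<le> 1" if "c \<in> C" for c
    using nn(2)[OF that] by (auto simp: v_def power_le_one)
  note Xm = moments_boundedD(2)[OF second_order_moments_bounded[OF X]]
  have u: "moments_bounded C S (\<lambda>c w. 1 / (1 + X c w))"
    by (rule moments_bounded_bounded[where K = 1]) (use L(3) Xm nn(1) in \<open>auto simp: divide_le_eq_1\<close>)
  show ?thesis
    unfolding v_def[symmetric]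
  proof (rule second_orderI[where L = "\<lambda>c w. - (v c)\<^sup>2 * L c w" and K = 1])
    show "(\<integral>w. - (v c)\<^sup>2 * L c w \<partial>S c) = 0" if "c \<in> C" for c using L(5)[OF that] by simp
    show "moments_bounded C S (\<lambda>c w. sqrt (n c) * (- (v c)\<^sup>2 * L c w))"
      by (rule moments_bounded_cong[OF moments_bounded_cmult[OF L(6), of "\<lambda>c. - (v c)\<^sup>2" 1]])
        (use v(2) in auto)
    have "moments_bounded C S (\<lambda>c w. - (v c)\<^sup>2 * (real (n c) * (X c w - x c - L c w)) +
        ((v c)\<^sup>2 * (1 / (1 + X c w))) * ((sqrt (n c) * (X c w - x c)) * (sqrt (n c) * (X c w - x c))))"
      by (intro moments_bounded_add moments_bounded_mult[OF moments_bounded_cmult] moments_bounded_cmult[where K = 1] L(7) u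
          moments_bounded_mult second_order_deviation[OF X]) (use v in auto)
    thus "moments_bounded C S (\<lambda>c w. real (n c) * (1 / (1 + X c w) - v c - - (v c)\<^sup>2 * L c w))"
    proof (rule moments_bounded_cong)
      fix c w assume c: "c \<in> C" "w \<in> space (S c)"
      define a where "a = 1 + x c" define b where "b = 1 + X c w"
      have ab: "0 < a" "0 < b" using nn(1)[OF c] nn(2)[OF c(1)] by (auto simp: a_def b_def)
      have va: "v c = 1 / a" by (simp add: v_def a_def)
      have sq: "(sqrt (n c) * (X c w - x c)) * (sqrt (n c) * (X c w - x c)) = real (n c) * (b - a)\<^sup>2"
        by (simp add: a_def b_def power2_eq_square[symmetric] power_mult_distrib)
      \<comment> \<open>The exact Taylor formula with second order remainder for the
        reciprocal.\<close>
      have "1 / b - 1 / a = - (1 / a)\<^sup>2 * (b - a) + (1 / a)\<^sup>2 * (1 / b) * (b - a)\<^sup>2"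
        using ab by (simp add: field_simps power2_eq_square)
      hence e: "1 / b - 1 / a - - (1 / a)\<^sup>2 * L c w = - (1 / a)\<^sup>2 * (b - a - L c w) + (1 / a)\<^sup>2 * (1 / b) * (b - a)\<^sup>2"
        by (simp add: algebra_simps)
      have d: "X c w - x c - L c w = b - a - L c w" by (simp add: a_def b_def)
      show "real (n c) * (1 / (1 + X c w) - v c - - (v c)\<^sup>2 * L c w) = - (v c)\<^sup>2 * (real (n c) * (X c w - x c - L c w)) +
        ((v c)\<^sup>2 * (1 / (1 + X c w))) * ((sqrt (n c) * (X c w - x c)) * (sqrt (n c) * (X c w - x c)))"
        unfolding sq d b_def[symmetric] va e by (simp add: algebra_simps)
    qed
  qed (use L v in auto)
qed

section \<open>Quadratic forms in one observation\<close>

lemma space_vec_borel [simp]: "space (vec_borel d) = carrier_vec d"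
  by (simp add: vec_borel_def)

lemma measurable_vec_index [measurable]:
  assumes "j < d" shows "(\<lambda>v. v $ j) \<in> borel_measurable (vec_borel d)"
proof -
  have "(\<lambda>v. \<lambda>j\<in>{..<d}. v $ j) \<in> vec_borel d \<rightarrow>\<^sub>M PiM {..<d} (\<lambda>_. borel :: real measure)"
    unfolding vec_borel_def by (rule measurable_vimage_algebra1) (auto simp: space_PiM)
  from measurable_compose[OF this measurable_component_singleton[of j "{..<d}" "\<lambda>_. borel"]] assms
  show ?thesis by simp
qed

lemma measurable_vec_borelI:
  assumes "\<And>w. w \<in> space S \<Longrightarrow> f w \<in> carrier_vec d" "\<And>j. j < d \<Longrightarrow> (\<lambda>w. f w $ j) \<in> borel_measurable S"
  shows "f \<in> S \<rightarrow>\<^sub>M vec_borel d"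
  unfolding vec_borel_def
proof (rule measurable_vimage_algebra2)
  show "f \<in> space S \<rightarrow> carrier_vec d" using assms(1) by auto
  show "(\<lambda>w. \<lambda>j\<in>{..<d}. f w $ j) \<in> S \<rightarrow>\<^sub>M PiM {..<d} (\<lambda>_. borel :: real measure)"
    using assms(2) by (intro measurable_restrict) auto
qed

lemma quad_form_eq_sum:
  fixes A :: "real mat"
  assumes "A \<in> carrier_mat d d" "y \<in> carrier_vec d"
  shows "y \<bullet> (A *\<^sub>v y) = (\<Sum>a<d. \<Sum>b<d. A $$ (a, b) * (y $ a * y $ b))"
proof -
  have "y \<bullet> (A *\<^sub>v y) = (\<Sum>a<d. \<Sum>b<d. y $ a * (A $$ (a, b) * y $ b))"
    using assms by (simp add: scalar_prod_def atLeast0LessThan sum_distrib_left)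
  also have "\<dots> = (\<Sum>a<d. \<Sum>b<d. A $$ (a, b) * (y $ a * y $ b))"
    by (intro sum.cong refl) (rule mult.left_commute)
  finally show ?thesis .
qed

definition cov_mat :: "nat \<Rightarrow> real vec measure \<Rightarrow> real mat" where
  "cov_mat d \<mu> = second_moment_mat \<mu> d (\<lambda>y. y)"

lemma cov_mat_carrier [simp]: "cov_mat d \<mu> \<in> carrier_mat d d"
  by (simp add: cov_mat_def second_moment_mat_def)

lemma transpose_cov_mat: "transpose_mat (cov_mat d \<mu>) = cov_mat d \<mu>"
  by (rule eq_matI) (auto simp: cov_mat_def second_moment_mat_def mult.commute)

text \<open>In both cases the quadratic form of one observation fluctuates by O(sqrt n): in the
  second it is sqrt n times a product of two linear forms of order 1. The class is stable under
  multiplication by bounded matrices on either side, which is all that the resolvent expansions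
  require.\<close>

definition test_mat :: "nat \<Rightarrow> nat \<Rightarrow> real \<Rightarrow> real mat \<Rightarrow> bool" where
  "test_mat n d K A \<longleftrightarrow> op_bound d K A \<or>
    (\<exists>u\<in>carrier_vec d. \<exists>v\<in>carrier_vec d. vec_norm u * vec_norm v \<le> K \<and> A = sqrt n \<cdot>\<^sub>m outer_prod d u v)"

lemma test_mat_carrier [simp]: "test_mat n d K A \<Longrightarrow> A \<in> carrier_mat d d"
  by (auto simp: test_mat_def dest: op_boundD(1))

lemma test_mat_nonneg: "test_mat n d K A \<Longrightarrow> 0 \<le> K"
  by (auto simp: test_mat_def dest: op_boundD(2) intro: order_trans[rotated])

lemma test_mat_op_bound: "op_bound d K A \<Longrightarrow> test_mat n d K A"
  by (simp add: test_mat_def)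

lemma test_mat_mult_left:
  assumes N: "op_bound d c N" and A: "test_mat n d K A"
  shows "test_mat n d (c * K) (N * A)"
  using A unfolding test_mat_def
proof (elim disjE bexE conjE)
  assume "op_bound d K A"
  from op_bound_mult[OF N this]
  show "op_bound d (c * K) (N * A) \<or> (\<exists>u\<in>carrier_vec d. \<exists>v\<in>carrier_vec d.
    vec_norm u * vec_norm v \<le> c * K \<and> N * A = sqrt n \<cdot>\<^sub>m outer_prod d u v)" ..
next
  fix u v assume uv: "u \<in> carrier_vec d" "v \<in> carrier_vec d" "vec_norm u * vec_norm v \<le> K"
    and A: "A = sqrt n \<cdot>\<^sub>m outer_prod d u v"
  have "N * A = sqrt n \<cdot>\<^sub>m outer_prod d (N *\<^sub>v u) v"
    unfolding A mult_smult_distrib[OF op_boundD(1)[OF N] outer_prod_carrier]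
      mult_outer_prod[OF op_boundD(1)[OF N] uv(1,2)] ..
  moreover have "vec_norm (N *\<^sub>v u) * vec_norm v \<le> c * vec_norm u * vec_norm v"
    by (intro mult_right_mono op_boundD(3)[OF N uv(1)]) simp
  moreover have "c * (vec_norm u * vec_norm v) \<le> c * K"
    by (intro mult_left_mono uv op_boundD(2)[OF N])
  ultimately show "op_bound d (c * K) (N * A) \<or> (\<exists>u\<in>carrier_vec d. \<exists>v\<in>carrier_vec d.
    vec_norm u * vec_norm v \<le> c * K \<and> N * A = sqrt n \<cdot>\<^sub>m outer_prod d u v)"
    using op_boundD(1)[OF N] uv by (intro disjI2 bexI[of _ "N *\<^sub>v u"] bexI[of _ v]) (auto simp: mult.assoc)
qed

lemma test_mat_mult_right:
  assumes A: "test_mat n d K A" and N: "op_bound d c N"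
  shows "test_mat n d (K * c) (A * N)"
  using A unfolding test_mat_def
proof (elim disjE bexE conjE)
  assume "op_bound d K A"
  from op_bound_mult[OF this N]
  show "op_bound d (K * c) (A * N) \<or> (\<exists>u\<in>carrier_vec d. \<exists>v\<in>carrier_vec d.
    vec_norm u * vec_norm v \<le> K * c \<and> A * N = sqrt n \<cdot>\<^sub>m outer_prod d u v)" ..
next
  fix u v assume uv: "u \<in> carrier_vec d" "v \<in> carrier_vec d" "vec_norm u * vec_norm v \<le> K"
    and A: "A = sqrt n \<cdot>\<^sub>m outer_prod d u v"
  have "A * N = sqrt n \<cdot>\<^sub>m outer_prod d u (transpose_mat N *\<^sub>v v)"
    unfolding A mult_smult_assoc_mat[OF outer_prod_carrier op_boundD(1)[OF N]]
      outer_prod_mult[OF op_boundD(1)[OF N] uv(1,2)] ..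
  moreover have "vec_norm u * vec_norm (transpose_mat N *\<^sub>v v) \<le> vec_norm u * (c * vec_norm v)"
    by (intro mult_left_mono op_boundD(3)[OF op_bound_transpose[OF N] uv(2)]) simp
  moreover have "c * (vec_norm u * vec_norm v) \<le> c * K"
    by (intro mult_left_mono uv op_boundD(2)[OF N])
  ultimately show "op_bound d (K * c) (A * N) \<or> (\<exists>u\<in>carrier_vec d. \<exists>v\<in>carrier_vec d.
    vec_norm u * vec_norm v \<le> K * c \<and> A * N = sqrt n \<cdot>\<^sub>m outer_prod d u v)"
    using op_boundD(1)[OF N] uv
    by (intro disjI2 bexI[of _ u] bexI[of _ "transpose_mat N *\<^sub>v v"]) (auto simp: mult_ac)
qed

lemma test_mat_trace:
  assumes A: "test_mat n d K A" and n: "1 \<le> n"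
  shows "\<bar>mat_trace A\<bar> \<le> K * (real d + real n)"
  using A unfolding test_mat_def
proof (elim disjE bexE conjE)
  assume "op_bound d K A"
  from op_bound_trace[OF this] op_boundD(2)[OF this] show ?thesis
    by (simp add: algebra_simps add_increasing2)
next
  fix u v assume uv: "u \<in> carrier_vec d" "v \<in> carrier_vec d" "vec_norm u * vec_norm v \<le> K"
    and A': "A = sqrt n \<cdot>\<^sub>m outer_prod d u v"
  have "\<bar>mat_trace A\<bar> = sqrt n * \<bar>u \<bullet> v\<bar>"
    unfolding A' using uv by (simp add: mat_trace_smult[of _ d] mat_trace_outer_prod abs_mult)
  also have "\<dots> \<le> real n * K"
  proof (rule mult_mono)
    show "sqrt n \<le> real n" using n by (simp add: sqrt_le_D real_le_lsqrt self_le_power)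
  qed (use abs_scalar_prod_le[OF uv(1,2)] uv(3) in auto)
  finally show ?thesis using test_mat_nonneg[OF A] by (simp add: algebra_simps add_increasing)
qed

text \<open>What the random matrix argument retains of the law of an observation. H is an explicit
  envelope for the moments of centred quadratic forms, so that one H can serve all members of a
  family.\<close>

definition sample_model :: "real \<Rightarrow> (real \<Rightarrow> nat \<Rightarrow> real) \<Rightarrow> nat \<Rightarrow> nat \<Rightarrow> real vec measure \<Rightarrow> real \<Rightarrow> bool" where
  "sample_model M H n d \<mu> lam \<longleftrightarrow> 1 \<le> M \<and> 1 \<le> n \<and> real d \<le> M * real n \<and> 1 / M \<le> lam \<and> lam \<le> M \<and>
     prob_space \<mu> \<and> sets \<mu> = sets (vec_borel d) \<and> (\<forall>j<d. \<forall>k<d. integrable \<mu> (\<lambda>y. y $ j * y $ k)) \<and>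
     op_bound d 1 (cov_mat d \<mu>) \<and>
     (\<forall>p K A. test_mat n d K A \<longrightarrow>
       (\<integral>\<^sup>+y. ennreal (((y \<bullet> (A *\<^sub>v y) - mat_trace (cov_mat d \<mu> * A)) / sqrt n) ^ (2 * p)) \<partial>\<mu>) \<le> ennreal (H K p))"

lemma sample_modelD:
  assumes "sample_model M H n d \<mu> lam"
  shows "1 \<le> M" "1 \<le> n" "real d \<le> M * real n" "1 / M \<le> lam" "lam \<le> M" "prob_space \<mu>"
    "sets \<mu> = sets (vec_borel d)" "op_bound d 1 (cov_mat d \<mu>)" "space \<mu> = carrier_vec d" "0 < lam" "1 / lam \<le> M"
    and "\<And>j k. j < d \<Longrightarrow> k < d \<Longrightarrow> integrable \<mu> (\<lambda>y. y $ j * y $ k)"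
    and "\<And>p K A. test_mat n d K A \<Longrightarrow>
       (\<integral>\<^sup>+y. ennreal (((y \<bullet> (A *\<^sub>v y) - mat_trace (cov_mat d \<mu> * A)) / sqrt n) ^ (2 * p)) \<partial>\<mu>) \<le> ennreal (H K p)"
proof -
  show *: "1 \<le> M" "1 \<le> n" "real d \<le> M * real n" "1 / M \<le> lam" "lam \<le> M" "prob_space \<mu>"
    "sets \<mu> = sets (vec_borel d)" "op_bound d 1 (cov_mat d \<mu>)"
    "\<And>j k. j < d \<Longrightarrow> k < d \<Longrightarrow> integrable \<mu> (\<lambda>y. y $ j * y $ k)"
    "\<And>p K A. test_mat n d K A \<Longrightarrow>
       (\<integral>\<^sup>+y. ennreal (((y \<bullet> (A *\<^sub>v y) - mat_trace (cov_mat d \<mu> * A)) / sqrt n) ^ (2 * p)) \<partial>\<mu>) \<le> ennreal (H K p)"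
    using assms by (auto simp: sample_model_def)
  show "space \<mu> = carrier_vec d" using sets_eq_imp_space_eq[OF *(7)] by simp
  have "0 < 1 / M" using *(1) by simp
  thus l: "0 < lam" using *(4) by linarith
  show "1 / lam \<le> M" using *(1,4) l by (simp add: field_simps)
qed

lemma measurable_quad_form:
  assumes "sets \<mu> = sets (vec_borel d)" "A \<in> carrier_mat d d"
  shows "(\<lambda>y. y \<bullet> (A *\<^sub>v y)) \<in> borel_measurable \<mu>"
proof -
  have [measurable]: "(\<lambda>y. y $ a) \<in> borel_measurable \<mu>" if "a < d" for a
    using measurable_vec_index[OF that] measurable_cong_sets[OF assms(1) refl] by blast
  have "(\<lambda>y. \<Sum>a<d. \<Sum>b<d. A $$ (a, b) * (y $ a * y $ b)) \<in> borel_measurable \<mu>" by measurable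
  moreover have "y \<bullet> (A *\<^sub>v y) = (\<Sum>a<d. \<Sum>b<d. A $$ (a, b) * (y $ a * y $ b))" if "y \<in> space \<mu>" for y
    using that sets_eq_imp_space_eq[OF assms(1)] by (intro quad_form_eq_sum[OF assms(2)]) auto
  ultimately show ?thesis
    using measurable_cong[of \<mu> "\<lambda>y. \<Sum>a<d. \<Sum>b<d. A $$ (a, b) * (y $ a * y $ b)" "\<lambda>y. y \<bullet> (A *\<^sub>v y)"] by simp
qed

lemma expectation_quad_form:
  assumes sp: "space \<mu> = carrier_vec d" and A: "A \<in> carrier_mat d d"
    and int: "\<And>j k. j < d \<Longrightarrow> k < d \<Longrightarrow> integrable \<mu> (\<lambda>y. y $ j * y $ k)"
  shows "integrable \<mu> (\<lambda>y. y \<bullet> (A *\<^sub>v y))" "(\<integral>y. y \<bullet> (A *\<^sub>v y) \<partial>\<mu>) = mat_trace (cov_mat d \<mu> * A)"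
proof -
  have eq: "y \<bullet> (A *\<^sub>v y) = (\<Sum>a<d. \<Sum>b<d. A $$ (a, b) * (y $ a * y $ b))" if "y \<in> space \<mu>" for y
    using that sp by (intro quad_form_eq_sum[OF A]) auto
  have "integrable \<mu> (\<lambda>y. \<Sum>a<d. \<Sum>b<d. A $$ (a, b) * (y $ a * y $ b))"
    using int by (intro Bochner_Integration.integrable_sum) auto
  thus "integrable \<mu> (\<lambda>y. y \<bullet> (A *\<^sub>v y))"
    using eq by (simp cong: Bochner_Integration.integrable_cong)
  have "(\<integral>y. y \<bullet> (A *\<^sub>v y) \<partial>\<mu>) = (\<integral>y. (\<Sum>a<d. \<Sum>b<d. A $$ (a, b) * (y $ a * y $ b)) \<partial>\<mu>)"
    by (intro Bochner_Integration.integral_cong eq) auto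
  also have "\<dots> = (\<Sum>a<d. \<Sum>b<d. A $$ (a, b) * (\<integral>y. y $ a * y $ b \<partial>\<mu>))"
  proof -
    have i: "integrable \<mu> (\<lambda>y. A $$ (a, b) * (y $ a * y $ b))" if "a < d" "b < d" for a b
      using int that by simp
    have "(\<integral>y. (\<Sum>a<d. \<Sum>b<d. A $$ (a, b) * (y $ a * y $ b)) \<partial>\<mu>) =
        (\<Sum>a<d. \<integral>y. (\<Sum>b<d. A $$ (a, b) * (y $ a * y $ b)) \<partial>\<mu>)"
      using i by (intro Bochner_Integration.integral_sum Bochner_Integration.integrable_sum) auto
    also have "\<dots> = (\<Sum>a<d. \<Sum>b<d. \<integral>y. A $$ (a, b) * (y $ a * y $ b) \<partial>\<mu>)"
      using i by (intro sum.cong refl Bochner_Integration.integral_sum) auto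
    finally show ?thesis by simp
  qed
  also have "\<dots> = (\<Sum>a<d. \<Sum>b<d. A $$ (a, b) * cov_mat d \<mu> $$ (b, a))"
    by (simp add: cov_mat_def second_moment_mat_def mult.commute)
  also have "\<dots> = mat_trace (cov_mat d \<mu> * A)"
    using A by (simp add: mat_trace_comm[of "cov_mat d \<mu>" d A] mat_trace_mult)
  finally show "(\<integral>y. y \<bullet> (A *\<^sub>v y) \<partial>\<mu>) = mat_trace (cov_mat d \<mu> * A)" .
qed

text \<open>The whole centred form is taken as the linear part, so the second order remainder is
  zero.\<close>

lemma second_order_quad_form:
  assumes good: "\<And>c. c \<in> C \<Longrightarrow> sample_model M H (n c) (d c) (\<mu> c) (lam c)"
    and test: "\<And>c. c \<in> C \<Longrightarrow> test_mat (n c) (d c) K (A c)"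
  shows "second_order C n \<mu> (\<lambda>c y. 1 / real (n c) * (y \<bullet> (A c *\<^sub>v y)))
           (\<lambda>c. 1 / real (n c) * mat_trace (cov_mat (d c) (\<mu> c) * A c))"
proof (rule second_orderI[where L = "\<lambda>c y. 1 / real (n c) * (y \<bullet> (A c *\<^sub>v y) - mat_trace (cov_mat (d c) (\<mu> c) * A c))"
      and K = "K * (M + 1)"])
  fix c assume c: "c \<in> C"
  note g = sample_modelD[OF good[OF c]] and A = test_mat_carrier[OF test[OF c]]
  interpret prob_space "\<mu> c" by (rule g(6))
  show "1 \<le> n c" "prob_space (\<mu> c)" by (rule g)+
  show "(\<integral>y. 1 / real (n c) * (y \<bullet> (A c *\<^sub>v y) - mat_trace (cov_mat (d c) (\<mu> c) * A c)) \<partial>\<mu> c) = 0"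
    using expectation_quad_form[OF g(9) A g(12)] by (simp add: prob_space)
  have "\<bar>mat_trace (cov_mat (d c) (\<mu> c) * A c)\<bar> \<le> K * (real (d c) + real (n c))"
    using test_mat_trace[OF test_mat_mult_left[OF g(8) test[OF c]] g(2)] by simp
  also have "\<dots> \<le> K * (M * real (n c) + real (n c))"
    using g(3) test_mat_nonneg[OF test[OF c]] by (intro mult_left_mono) auto
  also have "\<dots> = K * (M + 1) * real (n c)" by (simp add: algebra_simps)
  finally show "\<bar>1 / real (n c) * mat_trace (cov_mat (d c) (\<mu> c) * A c)\<bar> \<le> K * (M + 1)"
    using g(2) by (simp add: abs_mult divide_le_eq)
next
  show "moments_bounded C \<mu> (\<lambda>c y. sqrt (n c) * (1 / real (n c) * (y \<bullet> (A c *\<^sub>v y) - mat_trace (cov_mat (d c) (\<mu> c) * A c))))"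
  proof (rule moments_boundedI)
    fix p
    have "(\<integral>\<^sup>+y. ennreal ((sqrt (n c) * (1 / real (n c) * (y \<bullet> (A c *\<^sub>v y) - mat_trace (cov_mat (d c) (\<mu> c) * A c)))) ^ (2 * p)) \<partial>\<mu> c)
       \<le> ennreal \<bar>H K p\<bar>" if c: "c \<in> C" for c
    proof -
      note g = sample_modelD[OF good[OF c]]
      have n: "0 < real (n c)" using g(2) by simp
      have "sqrt (n c) * (1 / real (n c) * z) = z / sqrt (n c)" for z
        using n by (simp add: field_simps)
      thus ?thesis using g(13)[OF test[OF c], of p] by (simp add: order_trans[OF _ ennreal_leI[OF abs_ge_self]])
    qed
    thus "\<exists>L\<ge>0. \<forall>c\<in>C. (\<integral>\<^sup>+y. ennreal ((sqrt (n c) * (1 / real (n c) * (y \<bullet> (A c *\<^sub>v y) - mat_trace (cov_mat (d c) (\<mu> c) * A c)))) ^ (2 * p)) \<partial>\<mu> c) \<le> ennreal L"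
      by (intro exI[of _ "\<bar>H K p\<bar>"]) auto
  next
    fix c assume c: "c \<in> C"
    note g = sample_modelD[OF good[OF c]]
    show "prob_space (\<mu> c)" by (rule g)
    show "(\<lambda>y. sqrt (n c) * (1 / real (n c) * (y \<bullet> (A c *\<^sub>v y) - mat_trace (cov_mat (d c) (\<mu> c) * A c)))) \<in> borel_measurable (\<mu> c)"
      using measurable_quad_form[OF g(7) test_mat_carrier[OF test[OF c]]] by measurable
  qed
  have "moments_bounded C \<mu> (\<lambda>c y. 0)"
    by (rule moments_bounded_const[where K = 0]) (use sample_modelD(6)[OF good] in auto)
  thus "moments_bounded C \<mu> (\<lambda>c y. real (n c) * (1 / real (n c) * (y \<bullet> (A c *\<^sub>v y)) - 1 / real (n c) * mat_trace (cov_mat (d c) (\<mu> c) * A c) -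
         1 / real (n c) * (y \<bullet> (A c *\<^sub>v y) - mat_trace (cov_mat (d c) (\<mu> c) * A c))))"
    by (rule moments_bounded_cong) (simp add: algebra_simps)
qed

definition add_obs :: "nat \<Rightarrow> nat \<Rightarrow> real mat \<Rightarrow> real vec \<Rightarrow> real mat" where
  "add_obs n d W y = W + (1 / real n) \<cdot>\<^sub>m outer_prod d y y"

lemma rank_one_update_add_obs:
  assumes "posdef_mat d l W" "y \<in> carrier_vec d"
  shows "rank_one_update d l W (1 / real n) y (add_obs n d W y)"
proof -
  interpret posdef_mat d l W by fact
  have "transpose_mat (outer_prod d y y) = outer_prod d y y"
    by (rule eq_matI) (auto simp: outer_prod_def)
  moreover have "transpose_mat (k \<cdot>\<^sub>m X) = k \<cdot>\<^sub>m transpose_mat X" for k :: real and X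
    by (rule eq_matI) auto
  ultimately have "transpose_mat (add_obs n d W y) = add_obs n d W y"
    by (simp add: add_obs_def transpose_add[of _ d d] W_sym)
  moreover have "add_obs n d W y *\<^sub>v v = W *\<^sub>v v + (1 / real n * (y \<bullet> v)) \<cdot>\<^sub>v y" if "v \<in> carrier_vec d" for v
    using that assms(2)
    by (simp add: add_obs_def add_mult_distrib_mat_vec[of _ d d] smult_mat_mult_vec[of _ d] outer_prod_mult_vec smult_smult_assoc)
  ultimately show ?thesis
    by unfold_locales (use assms(2) in \<open>auto simp: add_obs_def\<close>)
qed

text \<open>One fresh observation y against a fixed matrix W built from the others. The index c may
  contain the data that determine W, which makes the estimates below conditional ones, uniform in
  those data.\<close>

locale one_sample =
  fixes C :: "'c set" and M :: real and H :: "real \<Rightarrow> nat \<Rightarrow> real" and n d :: "'c \<Rightarrow> nat"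
    and \<mu> :: "'c \<Rightarrow> real vec measure" and lam :: "'c \<Rightarrow> real" and W A B :: "'c \<Rightarrow> real mat" and K :: real
  assumes good: "\<And>c. c \<in> C \<Longrightarrow> sample_model M H (n c) (d c) (\<mu> c) (lam c)"
    and W: "\<And>c. c \<in> C \<Longrightarrow> posdef_mat (d c) (lam c) (W c)"
    and A: "\<And>c. c \<in> C \<Longrightarrow> test_mat (n c) (d c) K (A c)"
    and B: "\<And>c. c \<in> C \<Longrightarrow> op_bound (d c) K (B c)"
begin

abbreviation "N c \<equiv> minv (W c)"
abbreviation "Q X c y \<equiv> 1 / real (n c) * (y \<bullet> (X c *\<^sub>v y))"
abbreviation "q X c \<equiv> 1 / real (n c) * mat_trace (cov_mat (d c) (\<mu> c) * X c)"
abbreviation "R c y \<equiv> minv (add_obs (n c) (d c) (W c) y)"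

lemma N: "c \<in> C \<Longrightarrow> op_bound (d c) M (N c)"
  by (rule op_bound_mono[OF posdef_mat.op_bound_minv[OF W]]) (use sample_modelD(11)[OF good] in auto)

lemma carriers [simp]:
  "c \<in> C \<Longrightarrow> N c \<in> carrier_mat (d c) (d c)" "c \<in> C \<Longrightarrow> A c \<in> carrier_mat (d c) (d c)"
  "c \<in> C \<Longrightarrow> B c \<in> carrier_mat (d c) (d c)"
  using op_boundD(1)[OF N] test_mat_carrier[OF A] op_boundD(1)[OF B] by auto

lemma space_mu: "c \<in> C \<Longrightarrow> y \<in> space (\<mu> c) \<Longrightarrow> y \<in> carrier_vec (d c)"
  using sample_modelD(9)[OF good] by auto

lemma upd: "c \<in> C \<Longrightarrow> y \<in> space (\<mu> c) \<Longrightarrow>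
    rank_one_update (d c) (lam c) (W c) (1 / real (n c)) y (add_obs (n c) (d c) (W c) y)"
  by (intro rank_one_update_add_obs W space_mu)

lemma quad:
  assumes "\<And>c. c \<in> C \<Longrightarrow> test_mat (n c) (d c) L (X c)"
  shows "second_order C n \<mu> (Q X) (q X)"
  by (rule second_order_quad_form[OF good assms])

lemma second_order_N: "second_order C n \<mu> (Q N) (q N)"
  by (rule quad[where L = M]) (use N in \<open>auto intro: test_mat_op_bound\<close>)

lemma Q_N_nonneg: "c \<in> C \<Longrightarrow> y \<in> space (\<mu> c) \<Longrightarrow> 0 \<le> Q N c y"
  by (simp add: posdef_mat.minv_nonneg[OF W] space_mu)

text \<open>This trace is the mean of the nonnegative quadratic form of N in the fresh
  observation.\<close>

lemma q_N_nonneg: assumes "c \<in> C" shows "0 \<le> q N c"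
proof -
  note g = sample_modelD[OF good[OF assms]]
  have "(\<integral>y. Q N c y \<partial>\<mu> c) = q N c"
    using expectation_quad_form(2)[OF g(9) carriers(1)[OF assms] g(12)] by simp
  moreover have "0 \<le> (\<integral>y. Q N c y \<partial>\<mu> c)"
    using Q_N_nonneg[OF assms] by (intro Bochner_Integration.integral_nonneg_AE AE_I2) auto
  ultimately show ?thesis by (rule subst)
qed

lemma second_order_inv: "second_order C n \<mu> (\<lambda>c y. 1 / (1 + Q N c y)) (\<lambda>c. 1 / (1 + q N c))"
  by (rule second_order_inverse[OF second_order_N Q_N_nonneg q_N_nonneg])

lemma second_order_NAN: "second_order C n \<mu> (Q (\<lambda>c. N c * A c * N c)) (q (\<lambda>c. N c * A c * N c))"
  by (rule quad, rule test_mat_mult_right[OF test_mat_mult_left[OF N A] N])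

lemma second_order_NBN: "second_order C n \<mu> (Q (\<lambda>c. N c * B c * N c)) (q (\<lambda>c. N c * B c * N c))"
  by (rule quad, rule test_mat_op_bound[OF op_bound_mult[OF op_bound_mult[OF N B] N]])

lemma second_order_NA: "second_order C n \<mu> (Q (\<lambda>c. N c * A c)) (q (\<lambda>c. N c * A c))"
  by (rule quad, rule test_mat_mult_left[OF N A])

lemma second_order_NBNA: "second_order C n \<mu> (Q (\<lambda>c. N c * B c * N c * A c)) (q (\<lambda>c. N c * B c * N c * A c))"
  by (rule quad, rule test_mat_mult_left[OF op_bound_mult[OF op_bound_mult[OF N B] N] A])

lemma second_order_N_BNA_N:
  "second_order C n \<mu> (Q (\<lambda>c. N c * (B c * N c * A c) * N c)) (q (\<lambda>c. N c * (B c * N c * A c) * N c))"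
  by (rule quad, rule test_mat_mult_right[OF test_mat_mult_left[OF N test_mat_mult_left[OF op_bound_mult[OF B N] A]] N])

lemma second_order_N_ANB_N:
  "second_order C n \<mu> (Q (\<lambda>c. N c * (A c * N c * B c) * N c)) (q (\<lambda>c. N c * (A c * N c * B c) * N c))"
  by (rule quad, rule test_mat_mult_right[OF test_mat_mult_left[OF N test_mat_mult_right[OF test_mat_mult_right[OF A N] B]] N])

text \<open>After the rank one update formula the change of the trace is a rational function of
  quadratic forms in y, so the closure rules of \<open>second_order\<close> apply term by
  term.\<close>

lemma second_order_trace_R:
  "second_order C n \<mu> (\<lambda>c y. mat_trace (A c * R c y) - mat_trace (A c * N c))
     (\<lambda>c. - 1 * (1 / (1 + q N c) * q (\<lambda>c. N c * A c * N c) c))"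
proof (rule second_order_cong)
  show "second_order C n \<mu> (\<lambda>c y. - 1 * (1 / (1 + Q N c y) * Q (\<lambda>c. N c * A c * N c) c y))
      (\<lambda>c. - 1 * (1 / (1 + q N c) * q (\<lambda>c. N c * A c * N c) c))"
    by (intro second_order_cmult[where K = 1 and k = "\<lambda>_. - 1"] second_order_mult second_order_inv second_order_NAN) auto
  fix c y assume c: "c \<in> C" "y \<in> space (\<mu> c)"
  interpret U: rank_one_update "d c" "lam c" "W c" "1 / real (n c)" y "add_obs (n c) (d c) (W c) y"
    by (rule upd[OF c])
  show "mat_trace (A c * R c y) - mat_trace (A c * N c) = - 1 * (1 / (1 + Q N c y) * Q (\<lambda>c. N c * A c * N c) c y)"
    using U.trace_mult_R[of "A c"] U.r_sandwich[of "A c"] c(1) by (simp add: U.R_def U.N_def U.q_def)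
qed simp

lemma second_order_trace_RBR:
  "second_order C n \<mu> (\<lambda>c y. mat_trace (A c * R c y * B c * R c y) - mat_trace (A c * N c * B c * N c))
     (\<lambda>c. - 1 * (1 / (1 + q N c) * (q (\<lambda>c. N c * (B c * N c * A c) * N c) c + q (\<lambda>c. N c * (A c * N c * B c) * N c) c))
       + (1 / (1 + q N c) * (1 / (1 + q N c))) * (q (\<lambda>c. N c * A c * N c) c * q (\<lambda>c. N c * B c * N c) c))"
proof (rule second_order_cong)
  show "second_order C n \<mu> (\<lambda>c y. - 1 * (1 / (1 + Q N c y) * (Q (\<lambda>c. N c * (B c * N c * A c) * N c) c y + Q (\<lambda>c. N c * (A c * N c * B c) * N c) c y))
       + (1 / (1 + Q N c y) * (1 / (1 + Q N c y))) * (Q (\<lambda>c. N c * A c * N c) c y * Q (\<lambda>c. N c * B c * N c) c y))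
     (\<lambda>c. - 1 * (1 / (1 + q N c) * (q (\<lambda>c. N c * (B c * N c * A c) * N c) c + q (\<lambda>c. N c * (A c * N c * B c) * N c) c))
       + (1 / (1 + q N c) * (1 / (1 + q N c))) * (q (\<lambda>c. N c * A c * N c) c * q (\<lambda>c. N c * B c * N c) c))"
    by (intro second_order_cmult[where K = 1 and k = "\<lambda>_. - 1"] second_order_mult second_order_add
        second_order_inv second_order_NAN second_order_NBN second_order_N_BNA_N second_order_N_ANB_N) auto
  fix c y assume c: "c \<in> C" "y \<in> space (\<mu> c)"
  interpret U: rank_one_update "d c" "lam c" "W c" "1 / real (n c)" y "add_obs (n c) (d c) (W c) y"
    by (rule upd[OF c])
  show "mat_trace (A c * R c y * B c * R c y) - mat_trace (A c * N c * B c * N c) =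
      - 1 * (1 / (1 + Q N c y) * (Q (\<lambda>c. N c * (B c * N c * A c) * N c) c y + Q (\<lambda>c. N c * (A c * N c * B c) * N c) c y))
       + (1 / (1 + Q N c y) * (1 / (1 + Q N c y))) * (Q (\<lambda>c. N c * A c * N c) c y * Q (\<lambda>c. N c * B c * N c) c y)"
    using U.trace_mult_R_mult_R[of "A c" "B c"] c(1)
    by (simp only: U.r_sandwich carriers mult_carrier_mat_square U.N_carrier U.R_carrier flip: U.R_def U.N_def U.q_def)
      (simp add: power2_eq_square algebra_simps)
qed simp

text \<open>Forms in which y meets the resolvent that contains y itself: the summands of the mean
  equations.\<close>

lemma second_order_quad_RA:
  "second_order C n \<mu> (\<lambda>c y. 1 / real (n c) * (y \<bullet> ((R c y * A c) *\<^sub>v y))) (\<lambda>c. 1 / (1 + q N c) * q (\<lambda>c. N c * A c) c)"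
proof (rule second_order_cong)
  show "second_order C n \<mu> (\<lambda>c y. 1 / (1 + Q N c y) * Q (\<lambda>c. N c * A c) c y) (\<lambda>c. 1 / (1 + q N c) * q (\<lambda>c. N c * A c) c)"
    by (intro second_order_mult second_order_inv second_order_NA)
  fix c y assume c: "c \<in> C" "y \<in> space (\<mu> c)"
  interpret U: rank_one_update "d c" "lam c" "W c" "1 / real (n c)" y "add_obs (n c) (d c) (W c) y"
    by (rule upd[OF c])
  show "1 / real (n c) * (y \<bullet> ((R c y * A c) *\<^sub>v y)) = 1 / (1 + Q N c y) * Q (\<lambda>c. N c * A c) c y"
    using U.quad_R[of "A c"] c(1)
    by (simp only: carriers flip: U.R_def U.N_def U.q_def) simp
qed simp

lemma second_order_quad_RBRA:
  "second_order C n \<mu> (\<lambda>c y. 1 / real (n c) * (y \<bullet> ((R c y * B c * R c y * A c) *\<^sub>v y)))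
    (\<lambda>c. 1 / (1 + q N c) * (q (\<lambda>c. N c * B c * N c * A c) c -
       1 / (1 + q N c) * (q (\<lambda>c. N c * A c) c * q (\<lambda>c. N c * B c * N c) c)))"
proof (rule second_order_cong)
  show "second_order C n \<mu> (\<lambda>c y. 1 / (1 + Q N c y) * (Q (\<lambda>c. N c * B c * N c * A c) c y -
       1 / (1 + Q N c y) * (Q (\<lambda>c. N c * A c) c y * Q (\<lambda>c. N c * B c * N c) c y)))
     (\<lambda>c. 1 / (1 + q N c) * (q (\<lambda>c. N c * B c * N c * A c) c -
       1 / (1 + q N c) * (q (\<lambda>c. N c * A c) c * q (\<lambda>c. N c * B c * N c) c)))"
    by (intro second_order_mult second_order_diff second_order_inv second_order_NA second_order_NBNA second_order_NBN)
  fix c y assume c: "c \<in> C" "y \<in> space (\<mu> c)"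
  interpret U: rank_one_update "d c" "lam c" "W c" "1 / real (n c)" y "add_obs (n c) (d c) (W c) y"
    by (rule upd[OF c])
  show "1 / real (n c) * (y \<bullet> ((R c y * B c * R c y * A c) *\<^sub>v y)) = 1 / (1 + Q N c y) * (Q (\<lambda>c. N c * B c * N c * A c) c y -
       1 / (1 + Q N c y) * (Q (\<lambda>c. N c * A c) c y * Q (\<lambda>c. N c * B c * N c) c y))"
    using U.quad_R_mult_R[of "A c" "B c"] c(1)
    by (simp only: carriers flip: U.R_def U.N_def U.q_def) (simp add: algebra_simps)
qed simp

end

section \<open>The resolvent of the sample covariance\<close>

text \<open>The sum runs over the observations in J but is always divided by n, so that removing an
  index is a pure rank one change. The entrywise form makes this immediate.\<close>

definition ridge_mat :: "nat \<Rightarrow> nat \<Rightarrow> real \<Rightarrow> (nat \<Rightarrow> real vec) \<Rightarrow> nat set \<Rightarrow> real mat" where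
  "ridge_mat n d l x J =
     Matrix.mat d d (\<lambda>(a, b). (if a = b then l else 0) + (\<Sum>j\<in>J. x j $ a * x j $ b) / real n)"

lemma ridge_mat_carrier [simp]: "ridge_mat n d l x J \<in> carrier_mat d d"
  by (simp add: ridge_mat_def)

lemma ridge_mat_empty: "ridge_mat n d l x {} = l \<cdot>\<^sub>m 1\<^sub>m d"
  by (rule eq_matI) (auto simp: ridge_mat_def)

lemma ridge_mat_insert:
  "finite J \<Longrightarrow> i \<notin> J \<Longrightarrow> ridge_mat n d l x (insert i J) = add_obs n d (ridge_mat n d l x J) (x i)"
  by (rule eq_matI) (auto simp: ridge_mat_def add_obs_def outer_prod_def add_divide_distrib)

lemma ridge_mat_cong: "(\<And>j. j \<in> J \<Longrightarrow> x j = x' j) \<Longrightarrow> ridge_mat n d l x J = ridge_mat n d l x' J"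
  by (simp add: ridge_mat_def)

lemma posdef_smult_one: "0 < l \<Longrightarrow> posdef_mat d l (l \<cdot>\<^sub>m 1\<^sub>m d)"
proof
  fix v :: "real vec" assume v: "v \<in> carrier_vec d"
  have "(l \<cdot>\<^sub>m 1\<^sub>m d) *\<^sub>v v = l \<cdot>\<^sub>v v" using v by (simp add: smult_mat_mult_vec[of _ d])
  thus "l * (v \<bullet> v) \<le> v \<bullet> ((l \<cdot>\<^sub>m 1\<^sub>m d) *\<^sub>v v)" using v by simp
qed (auto intro!: eq_matI)

lemma posdef_ridge_mat:
  assumes "finite J" "0 < l" "\<And>j. j \<in> J \<Longrightarrow> x j \<in> carrier_vec d"
  shows "posdef_mat d l (ridge_mat n d l x J)"
  using assms(1,3)
proof (induction J rule: finite_induct)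
  case empty
  show ?case using posdef_smult_one[OF assms(2)] by (simp add: ridge_mat_empty)
next
  case (insert i J)
  interpret rank_one_update d l "ridge_mat n d l x J" "1 / real n" "x i" "add_obs n d (ridge_mat n d l x J) (x i)"
    using insert by (intro rank_one_update_add_obs) auto
  show ?case using insert.hyps upd.posdef_mat_axioms by (simp add: ridge_mat_insert)
qed

lemma trace_mult_ridge_mat:
  assumes "finite J" "\<And>j. j \<in> J \<Longrightarrow> x j \<in> carrier_vec d" and X: "X \<in> carrier_mat d d"
  shows "mat_trace (X * ridge_mat n d l x J) = l * mat_trace X + (\<Sum>j\<in>J. 1 / real n * (x j \<bullet> (X *\<^sub>v x j)))"
  using assms(1,2)
proof (induction J rule: finite_induct)
  case empty
  have "X * (l \<cdot>\<^sub>m 1\<^sub>m d) = l \<cdot>\<^sub>m X" using X by (simp add: mult_smult_distrib[OF X one_carrier_mat])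
  thus ?case by (simp add: ridge_mat_empty mat_trace_smult[OF X])
next
  case (insert i J)
  have xi: "x i \<in> carrier_vec d" using insert by auto
  have "X * add_obs n d (ridge_mat n d l x J) (x i)
      = X * ridge_mat n d l x J + (1 / real n) \<cdot>\<^sub>m outer_prod d (X *\<^sub>v x i) (x i)"
    unfolding add_obs_def mult_add_distrib_mat[OF X ridge_mat_carrier smult_carrier_mat[OF outer_prod_carrier]]
      mult_smult_distrib[OF X outer_prod_carrier] mult_outer_prod[OF X xi xi] ..
  hence "mat_trace (X * add_obs n d (ridge_mat n d l x J) (x i))
      = mat_trace (X * ridge_mat n d l x J) + 1 / real n * ((X *\<^sub>v x i) \<bullet> x i)"
    using X xi by (simp add: mat_trace_add[of _ d] mat_trace_smult[OF outer_prod_carrier] mat_trace_outer_prod[of _ d])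
  also have "(X *\<^sub>v x i) \<bullet> x i = x i \<bullet> (X *\<^sub>v x i)" using X xi by (intro scalar_prod_comm_real[of _ d]) auto
  finally show ?case using insert by (simp add: ridge_mat_insert)
qed

definition measurable_mat :: "'w measure \<Rightarrow> nat \<Rightarrow> ('w \<Rightarrow> real mat) \<Rightarrow> bool" where
  "measurable_mat S d F \<longleftrightarrow> (\<forall>w\<in>space S. F w \<in> carrier_mat d d) \<and>
     (\<forall>a<d. \<forall>b<d. (\<lambda>w. F w $$ (a, b)) \<in> borel_measurable S)"

lemma measurable_mat_const: "X \<in> carrier_mat d d \<Longrightarrow> measurable_mat S d (\<lambda>w. X)"
  by (simp add: measurable_mat_def)

lemma measurable_mat_mult:
  assumes "measurable_mat S d F" "measurable_mat S d G"
  shows "measurable_mat S d (\<lambda>w. F w * G w)"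
  unfolding measurable_mat_def
proof (intro conjI ballI allI impI)
  fix a b assume ab: "a < d" "b < d"
  have "(\<lambda>w. \<Sum>k<d. F w $$ (a, k) * G w $$ (k, b)) \<in> borel_measurable S"
    using assms ab by (intro borel_measurable_sum borel_measurable_times) (auto simp: measurable_mat_def)
  moreover have "(F w * G w) $$ (a, b) = (\<Sum>k<d. F w $$ (a, k) * G w $$ (k, b))" if "w \<in> space S" for w
  proof -
    have "F w \<in> carrier_mat d d" "G w \<in> carrier_mat d d" using assms that by (auto simp: measurable_mat_def)
    thus ?thesis using ab by (simp add: scalar_prod_def atLeast0LessThan)
  qed
  ultimately show "(\<lambda>w. (F w * G w) $$ (a, b)) \<in> borel_measurable S"
    by (simp cong: measurable_cong)
qed (use assms in \<open>auto simp: measurable_mat_def\<close>)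

lemma measurable_mat_trace:
  assumes "measurable_mat S d F" shows "(\<lambda>w. mat_trace (F w)) \<in> borel_measurable S"
proof -
  have "(\<lambda>w. \<Sum>k<d. F w $$ (k, k)) \<in> borel_measurable S"
    using assms by (intro borel_measurable_sum) (auto simp: measurable_mat_def)
  moreover have "mat_trace (F w) = (\<Sum>k<d. F w $$ (k, k))" if "w \<in> space S" for w
  proof -
    have "F w \<in> carrier_mat d d" using assms that by (auto simp: measurable_mat_def)
    thus ?thesis by (simp add: mat_trace_def)
  qed
  ultimately show ?thesis by (simp cong: measurable_cong)
qed

lemma measurable_mat_vec_index:
  assumes F: "measurable_mat S d F" and X: "\<And>w. w \<in> space S \<Longrightarrow> X w \<in> carrier_vec d"
    "\<And>a. a < d \<Longrightarrow> (\<lambda>w. X w $ a) \<in> borel_measurable S" and "a < d"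
  shows "(\<lambda>w. (F w *\<^sub>v X w) $ a) \<in> borel_measurable S"
proof -
  have "(\<lambda>w. \<Sum>k<d. F w $$ (a, k) * X w $ k) \<in> borel_measurable S"
    using assms by (intro borel_measurable_sum borel_measurable_times) (auto simp: measurable_mat_def)
  moreover have "(F w *\<^sub>v X w) $ a = (\<Sum>k<d. F w $$ (a, k) * X w $ k)" if "w \<in> space S" for w
  proof -
    have "F w \<in> carrier_mat d d" using assms that by (auto simp: measurable_mat_def)
    thus ?thesis using X(1)[OF that] \<open>a < d\<close> by (simp add: scalar_prod_def atLeast0LessThan)
  qed
  ultimately show ?thesis by (simp cong: measurable_cong)
qed

lemma measurable_mat_quad:
  assumes F: "measurable_mat S d F" and X: "\<And>w. w \<in> space S \<Longrightarrow> X w \<in> carrier_vec d"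
    "\<And>a. a < d \<Longrightarrow> (\<lambda>w. X w $ a) \<in> borel_measurable S"
  shows "(\<lambda>w. X w \<bullet> (F w *\<^sub>v X w)) \<in> borel_measurable S"
proof -
  have "(\<lambda>w. \<Sum>a<d. X w $ a * (F w *\<^sub>v X w) $ a) \<in> borel_measurable S"
    using X(2) measurable_mat_vec_index[OF F X] by (intro borel_measurable_sum borel_measurable_times) auto
  moreover have "X w \<bullet> (F w *\<^sub>v X w) = (\<Sum>a<d. X w $ a * (F w *\<^sub>v X w) $ a)" if "w \<in> space S" for w
  proof -
    have "F w \<in> carrier_mat d d" using F that by (auto simp: measurable_mat_def)
    hence "dim_vec (F w *\<^sub>v X w) = d" by simp
    thus ?thesis unfolding scalar_prod_def atLeast0LessThan by simp
  qed
  ultimately show ?thesis by (simp cong: measurable_cong)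
qed

text \<open>Induction over the observations: the inverse of a multiple of the identity is constant,
  and each update expresses the new entries rationally in measurable quantities with denominators at
  least 1.\<close>

lemma measurable_mat_resolvent:
  assumes "finite J" and l: "0 < l" and "\<And>j w. j \<in> J \<Longrightarrow> w \<in> space S \<Longrightarrow> X j w \<in> carrier_vec d"
    and "\<And>j a. j \<in> J \<Longrightarrow> a < d \<Longrightarrow> (\<lambda>w. X j w $ a) \<in> borel_measurable S"
  shows "measurable_mat S d (\<lambda>w. minv (ridge_mat n d l (\<lambda>j. X j w) J))"
  using assms(1,3,4)
proof (induction J rule: finite_induct)
  case empty
  interpret posdef_mat d l "l \<cdot>\<^sub>m 1\<^sub>m d" by (rule posdef_smult_one[OF l])
  show ?case by (simp add: ridge_mat_empty measurable_mat_const)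
next
  case (insert i J)
  define N where "N w = minv (ridge_mat n d l (\<lambda>j. X j w) J)" for w
  have N: "measurable_mat S d N" unfolding N_def using insert by auto
  have Xi: "w \<in> space S \<Longrightarrow> X i w \<in> carrier_vec d" "a < d \<Longrightarrow> (\<lambda>w. X i w $ a) \<in> borel_measurable S" for w a
    using insert.prems by auto
  define r where "r a w = (N w *\<^sub>v X i w) $ a" for a w
  define q where "q w = 1 / real n * (X i w \<bullet> (N w *\<^sub>v X i w))" for w
  have [measurable]: "r a \<in> borel_measurable S" if "a < d" for a
    unfolding r_def by (rule measurable_mat_vec_index[OF N Xi that])
  have [measurable]: "q \<in> borel_measurable S"
    using measurable_mat_quad[OF N Xi] unfolding q_def by measurable
  have upd: "rank_one_update d l (ridge_mat n d l (\<lambda>j. X j w) J) (1 / real n) (X i w) (ridge_mat n d l (\<lambda>j. X j w) (insert i J))"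
    if "w \<in> space S" for w
    unfolding ridge_mat_insert[OF insert.hyps]
    using insert.prems that insert.hyps l by (intro rank_one_update_add_obs posdef_ridge_mat) auto
  have entry: "minv (ridge_mat n d l (\<lambda>j. X j w) (insert i J)) $$ (a, b) = N w $$ (a, b) - 1 / real n / (1 + q w) * (r b w * r a w)"
    if "w \<in> space S" "a < d" "b < d" for w a b
  proof -
    interpret U: rank_one_update d l "ridge_mat n d l (\<lambda>j. X j w) J" "1 / real n" "X i w" "ridge_mat n d l (\<lambda>j. X j w) (insert i J)"
      by (rule upd[OF that(1)])
    show ?thesis
      using U.R_entry[OF that(2,3)] unfolding U.R_def U.q_def U.r_def U.N_def by (simp only: N_def q_def r_def)
  qed
  show ?case
    unfolding measurable_mat_def
  proof (intro conjI ballI allI impI)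
    fix w assume "w \<in> space S"
    interpret U: rank_one_update d l "ridge_mat n d l (\<lambda>j. X j w) J" "1 / real n" "X i w" "ridge_mat n d l (\<lambda>j. X j w) (insert i J)"
      by (rule upd) fact
    show "minv (ridge_mat n d l (\<lambda>j. X j w) (insert i J)) \<in> carrier_mat d d"
      using U.R_carrier by (simp add: U.R_def)
  next
    fix a b assume ab: "a < d" "b < d"
    have [measurable]: "(\<lambda>w. N w $$ (a, b)) \<in> borel_measurable S" using N ab by (auto simp: measurable_mat_def)
    have "(\<lambda>w. N w $$ (a, b) - 1 / real n / (1 + q w) * (r b w * r a w)) \<in> borel_measurable S" using ab by measurable
    thus "(\<lambda>w. minv (ridge_mat n d l (\<lambda>j. X j w) (insert i J)) $$ (a, b)) \<in> borel_measurable S"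
      using entry[OF _ ab] by (simp cong: measurable_cong)
  qed
qed

section \<open>Conditioning on all observations but one\<close>

lemma insert_diff_lessThan: "i < n \<Longrightarrow> insert i ({..<n} - {i}) = {..<(n :: nat)}"
  by auto

lemma moments_bounded_condition:
  fixes Y :: "'c \<Rightarrow> nat \<Rightarrow> (nat \<Rightarrow> 'b) \<Rightarrow> real"
  assumes \<mu>: "\<And>c. c \<in> C \<Longrightarrow> prob_space (\<mu> c)"
    and Y: "\<And>c i. c \<in> C \<Longrightarrow> i < n c \<Longrightarrow> Y c i \<in> borel_measurable (PiM {..<n c} (\<lambda>_. \<mu> c))"
    and mb: "moments_bounded {e. fst e \<in> C \<and> fst (snd e) < n (fst e) \<and> snd (snd e) \<in> space (PiM ({..<n (fst e)} - {fst (snd e)}) (\<lambda>_. \<mu> (fst e)))}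
       (\<lambda>e. \<mu> (fst e)) (\<lambda>e y. Y (fst e) (fst (snd e)) ((snd (snd e))(fst (snd e) := y)))"
  shows "moments_bounded {e. fst e \<in> C \<and> snd e < n (fst e)} (\<lambda>e. PiM {..<n (fst e)} (\<lambda>_. \<mu> (fst e))) (\<lambda>e. Y (fst e) (snd e))"
proof (rule moments_boundedI)
  fix p
  from moments_boundedD(3)[OF mb, of p] obtain K where K: "0 \<le> K"
    "\<And>c i x. c \<in> C \<Longrightarrow> i < n c \<Longrightarrow> x \<in> space (PiM ({..<n c} - {i}) (\<lambda>_. \<mu> c)) \<Longrightarrow>
       (\<integral>\<^sup>+y. ennreal (Y c i (x(i := y)) ^ (2 * p)) \<partial>\<mu> c) \<le> ennreal K"
    by fastforce
  have "(\<integral>\<^sup>+x. ennreal (Y c i x ^ (2 * p)) \<partial>PiM {..<n c} (\<lambda>_. \<mu> c)) \<le> ennreal K" if c: "c \<in> C" "i < n c" for c i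
  proof -
    interpret PP: product_prob_space "\<lambda>_::nat. \<mu> c" by (rule product_prob_spaceI) (rule \<mu>[OF c(1)])
    interpret P': prob_space "PiM ({..<n c} - {i}) (\<lambda>_. \<mu> c)" by (rule prob_space_PiM) (rule \<mu>[OF c(1)])
    note [measurable] = Y[OF c]
    have "(\<integral>\<^sup>+x. ennreal (Y c i x ^ (2 * p)) \<partial>PiM (insert i ({..<n c} - {i})) (\<lambda>_. \<mu> c)) =
        (\<integral>\<^sup>+x. (\<integral>\<^sup>+y. ennreal (Y c i (x(i := y)) ^ (2 * p)) \<partial>\<mu> c) \<partial>PiM ({..<n c} - {i}) (\<lambda>_. \<mu> c))"
    proof (rule PP.product_nn_integral_insert)
      show "(\<lambda>x. ennreal (Y c i x ^ (2 * p))) \<in> borel_measurable (PiM (insert i ({..<n c} - {i})) (\<lambda>_. \<mu> c))"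
        unfolding insert_diff_lessThan[OF c(2)] by measurable
    qed auto
    also have "\<dots> \<le> (\<integral>\<^sup>+x. ennreal K \<partial>PiM ({..<n c} - {i}) (\<lambda>_. \<mu> c))"
      by (intro nn_integral_mono K c)
    also have "\<dots> = ennreal K" by (simp add: P'.emeasure_space_1)
    finally show ?thesis unfolding insert_diff_lessThan[OF c(2)] .
  qed
  thus "\<exists>K\<ge>0. \<forall>e\<in>{e. fst e \<in> C \<and> snd e < n (fst e)}.
      (\<integral>\<^sup>+x. ennreal (Y (fst e) (snd e) x ^ (2 * p)) \<partial>PiM {..<n (fst e)} (\<lambda>_. \<mu> (fst e))) \<le> ennreal K"
    using K(1) by (intro exI[of _ K]) auto
qed (use \<mu> Y in \<open>auto intro!: prob_space_PiM\<close>)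

lemma expectation_condition:
  fixes Y :: "(nat \<Rightarrow> 'b) \<Rightarrow> real"
  assumes \<mu>: "prob_space \<mu>" and i: "i < n"
    and Y: "integrable (PiM {..<n} (\<lambda>_. \<mu>)) Y"
    and le: "\<And>x. x \<in> space (PiM ({..<n} - {i}) (\<lambda>_. \<mu>)) \<Longrightarrow> \<bar>\<integral>y. Y (x(i := y)) \<partial>\<mu>\<bar> \<le> k"
  shows "\<bar>\<integral>x. Y x \<partial>PiM {..<n} (\<lambda>_. \<mu>)\<bar> \<le> k"
proof -
  interpret PP: product_prob_space "\<lambda>_::nat. \<mu>" by (rule product_prob_spaceI) (rule \<mu>)
  interpret P': prob_space "PiM ({..<n} - {i}) (\<lambda>_. \<mu>)" by (rule prob_space_PiM) (rule \<mu>)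
  \<comment> \<open>The sign of k is needed below, where a non-integrable inner integral makes the
    outer one 0.\<close>
  obtain x0 where "x0 \<in> space (PiM ({..<n} - {i}) (\<lambda>_. \<mu>))" using P'.not_empty by blast
  hence k: "0 \<le> k" using le[of x0] by linarith
  have "(\<integral>x. Y x \<partial>PiM (insert i ({..<n} - {i})) (\<lambda>_. \<mu>)) = (\<integral>x. (\<integral>y. Y (x(i := y)) \<partial>\<mu>) \<partial>PiM ({..<n} - {i}) (\<lambda>_. \<mu>))"
    by (rule PP.product_integral_insert) (use Y in \<open>simp_all only: insert_diff_lessThan[OF i], auto\<close>)
  hence "(\<integral>x. Y x \<partial>PiM {..<n} (\<lambda>_. \<mu>)) = (\<integral>x. (\<integral>y. Y (x(i := y)) \<partial>\<mu>) \<partial>PiM ({..<n} - {i}) (\<lambda>_. \<mu>))"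
    unfolding insert_diff_lessThan[OF i] .
  also have "\<bar>\<dots>\<bar> \<le> k"
  proof (cases "integrable (PiM ({..<n} - {i}) (\<lambda>_. \<mu>)) (\<lambda>x. \<integral>y. Y (x(i := y)) \<partial>\<mu>)")
    case True
    have "\<bar>\<integral>x. (\<integral>y. Y (x(i := y)) \<partial>\<mu>) \<partial>PiM ({..<n} - {i}) (\<lambda>_. \<mu>)\<bar> \<le>
        (\<integral>x. \<bar>\<integral>y. Y (x(i := y)) \<partial>\<mu>\<bar> \<partial>PiM ({..<n} - {i}) (\<lambda>_. \<mu>))"
      by (rule integral_abs_bound)
    also have "\<dots> \<le> (\<integral>x. k \<partial>PiM ({..<n} - {i}) (\<lambda>_. \<mu>))"
      using True by (intro integral_mono) (auto intro: le)
    finally show ?thesis by (simp add: P'.prob_space)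
  qed (simp add: not_integrable_integral_eq k)
  finally show ?thesis .
qed

text \<open>Influence i may have squared size of order t i; only the sum of the weights has to be
  bounded uniformly. The case p = 0 is separate because the inequality behind it starts at p =
  1.\<close>

lemma moments_bounded_Efron_Stein_weighted:
  fixes F :: "'c \<Rightarrow> (nat \<Rightarrow> 'b) \<Rightarrow> real" and G :: "'c \<Rightarrow> nat \<Rightarrow> (nat \<Rightarrow> 'b) \<Rightarrow> real"
    and \<mu> :: "'c \<Rightarrow> nat \<Rightarrow> 'b measure"
  assumes \<mu>: "\<And>c i. c \<in> C \<Longrightarrow> prob_space (\<mu> c i)"
    and F: "\<And>c. c \<in> C \<Longrightarrow> F c \<in> borel_measurable (PiM {..<n c} (\<mu> c))"
    and fin: "\<And>c p. c \<in> C \<Longrightarrow> (\<integral>\<^sup>+x. ennreal (F c x ^ (2 * p)) \<partial>PiM {..<n c} (\<mu> c)) < \<infinity>"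
    and G: "\<And>c i. c \<in> C \<Longrightarrow> i < n c \<Longrightarrow> G c i \<in> borel_measurable (PiM {..<n c} (\<mu> c))"
    and Gind: "\<And>c i x y. c \<in> C \<Longrightarrow> i < n c \<Longrightarrow> G c i (x(i := y)) = G c i x"
    and t: "\<And>c i. c \<in> C \<Longrightarrow> i < n c \<Longrightarrow> 0 < t c i" "\<And>c. c \<in> C \<Longrightarrow> (\<Sum>i<n c. t c i) \<le> T"
    and mb: "moments_bounded {e. fst e \<in> C \<and> snd e < n (fst e)} (\<lambda>e. PiM {..<n (fst e)} (\<mu> (fst e)))
       (\<lambda>e x. (F (fst e) x - G (fst e) (snd e) x) / sqrt (t (fst e) (snd e)))"
  shows "moments_bounded C (\<lambda>c. PiM {..<n c} (\<mu> c)) (\<lambda>c x. F c x - (\<integral>x. F c x \<partial>PiM {..<n c} (\<mu> c)))"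
proof (rule moments_boundedI)
  fix p
  show "\<exists>K\<ge>0. \<forall>c\<in>C. (\<integral>\<^sup>+x. ennreal ((F c x - (\<integral>x. F c x \<partial>PiM {..<n c} (\<mu> c))) ^ (2 * p))
          \<partial>PiM {..<n c} (\<mu> c)) \<le> ennreal K"
  proof (cases "p = 0")
    case True
    have "(\<integral>\<^sup>+x. 1 \<partial>PiM {..<n c} (\<mu> c)) = 1" if "c \<in> C" for c
    proof -
      interpret prob_space "PiM {..<n c} (\<mu> c)" by (rule prob_space_PiM) (rule \<mu>[OF that])
      show ?thesis by (simp add: emeasure_space_1)
    qed
    thus ?thesis using True by (intro exI[of _ 1]) auto
  next
    case False
    hence p: "1 \<le> p" by simp
    from moments_boundedD(3)[OF mb, of p] obtain K where K: "0 \<le> K"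
      "\<And>c i. c \<in> C \<Longrightarrow> i < n c \<Longrightarrow> (\<integral>\<^sup>+x. ennreal (((F c x - G c i x) / sqrt (t c i)) ^ (2 * p)) \<partial>PiM {..<n c} (\<mu> c)) \<le> ennreal K"
      by fastforce
    define L where "L = (1 + 4 ^ (2 * p + 2) * ((1 + K) * \<bar>T\<bar>)) ^ p"
    have "(\<integral>\<^sup>+x. ennreal ((F c x - (\<integral>x. F c x \<partial>PiM {..<n c} (\<mu> c))) ^ (2 * p)) \<partial>PiM {..<n c} (\<mu> c)) \<le> ennreal L"
      if c: "c \<in> C" for c
    proof -
      note [measurable] = F[OF c]
      have "(\<integral>\<^sup>+x. ennreal ((F c x - (\<integral>x. F c x \<partial>PiM {..<n c} (\<mu> c))) ^ (2 * p)) \<partial>PiM {..<n c} (\<mu> c))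
          \<le> ennreal ((1 + 4 ^ (2 * p + 2) * (\<Sum>i<n c. (1 + K) * t c i)) ^ p)"
      proof (rule moment_Efron_Stein[where G = "G c"])
        fix i assume "i \<in> {..<n c}"
        hence i: "i < n c" by simp
        note [measurable] = G[OF c i]
        note tpos = t(1)[OF c i]
        show "0 < (1 + K) * t c i" using K(1) tpos by simp
        have sq: "z ^ (2 * p) = t c i ^ p * (z / sqrt (t c i)) ^ (2 * p)" for z
          using tpos by (simp add: power_divide power_mult)
        have "(\<integral>\<^sup>+x. ennreal ((F c x - G c i x) ^ (2 * p)) \<partial>PiM {..<n c} (\<mu> c)) =
            ennreal (t c i ^ p) * (\<integral>\<^sup>+x. ennreal (((F c x - G c i x) / sqrt (t c i)) ^ (2 * p)) \<partial>PiM {..<n c} (\<mu> c))"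
          unfolding sq[of "F c _ - G c i _"] using tpos
          by (subst nn_integral_cmult[symmetric]) (auto intro!: nn_integral_cong simp: ennreal_mult power_mult)
        also have "\<dots> \<le> ennreal (t c i ^ p) * ennreal K" by (intro mult_left_mono K(2)[OF c i]) simp
        also have "\<dots> = ennreal (t c i ^ p * K)" using tpos K(1) by (intro ennreal_mult[symmetric]) auto
        also have "\<dots> \<le> ennreal (((1 + K) * t c i) ^ p)"
        proof (rule ennreal_leI)
          \<comment> \<open>A bound K on a p-th power has to be rewritten as a p-th power; 1 + K is
            used because it is at least 1.\<close>
          have "K \<le> (1 + K) ^ p" using K(1) p self_le_power[of "1 + K" p] by simp
          thus "t c i ^ p * K \<le> ((1 + K) * t c i) ^ p"
            using tpos by (simp add: power_mult_distrib mult.commute mult_left_mono)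
        qed
        finally show "(\<integral>\<^sup>+x. ennreal ((F c x - G c i x) ^ (2 * p)) \<partial>PiM {..<n c} (\<mu> c)) \<le> ennreal (((1 + K) * t c i) ^ p)" .
      qed (use p \<mu>[OF c] G[OF c] Gind[OF c] fin[OF c] in auto)
      also have "\<dots> \<le> ennreal L"
        unfolding L_def sum_distrib_left[symmetric]
      proof (intro ennreal_leI power_mono add_left_mono mult_left_mono)
        show "(\<Sum>i<n c. t c i) \<le> \<bar>T\<bar>" using t(2)[OF c] by linarith
        have "0 \<le> (\<Sum>i<n c. t c i)" using t(1)[OF c] by (intro sum_nonneg less_imp_le) auto
        thus "0 \<le> 1 + 4 ^ (2 * p + 2) * ((1 + K) * (\<Sum>i<n c. t c i))" using K(1) by (intro add_nonneg_nonneg mult_nonneg_nonneg) auto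
      qed (use K(1) in auto)
      finally show ?thesis .
    qed
    moreover have "0 \<le> L" using K(1) by (simp add: L_def)
    ultimately show ?thesis by blast
  qed
qed (use \<mu> F in \<open>auto intro!: prob_space_PiM\<close>)

text \<open>Equal weights 1 / n: n influences of size n^(-1/2) add up to fluctuations of order 1.
  The bound in \<open>bdd\<close> may depend on c, as it only secures finite moments.\<close>

lemma moments_bounded_Efron_Stein:
  fixes F :: "'c \<Rightarrow> (nat \<Rightarrow> 'b) \<Rightarrow> real" and G :: "'c \<Rightarrow> nat \<Rightarrow> (nat \<Rightarrow> 'b) \<Rightarrow> real"
  assumes \<mu>: "\<And>c. c \<in> C \<Longrightarrow> prob_space (\<mu> c)" and n: "\<And>c. c \<in> C \<Longrightarrow> 1 \<le> n c"
    and F: "\<And>c. c \<in> C \<Longrightarrow> F c \<in> borel_measurable (PiM {..<n c} (\<lambda>_. \<mu> c))"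
    and bdd: "\<And>c. c \<in> C \<Longrightarrow> \<exists>L. \<forall>x\<in>space (PiM {..<n c} (\<lambda>_. \<mu> c)). \<bar>F c x\<bar> \<le> L"
    and G: "\<And>c i. c \<in> C \<Longrightarrow> i < n c \<Longrightarrow> G c i \<in> borel_measurable (PiM {..<n c} (\<lambda>_. \<mu> c))"
    and Gind: "\<And>c i x y. c \<in> C \<Longrightarrow> i < n c \<Longrightarrow> G c i (x(i := y)) = G c i x"
    and mb: "moments_bounded {e. fst e \<in> C \<and> snd e < n (fst e)} (\<lambda>e. PiM {..<n (fst e)} (\<lambda>_. \<mu> (fst e)))
       (\<lambda>e x. sqrt (n (fst e)) * (F (fst e) x - G (fst e) (snd e) x))"
  shows "moments_bounded C (\<lambda>c. PiM {..<n c} (\<lambda>_. \<mu> c)) (\<lambda>c x. F c x - (\<integral>x. F c x \<partial>PiM {..<n c} (\<lambda>_. \<mu> c)))"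
proof (rule moments_bounded_Efron_Stein_weighted[where G = G and t = "\<lambda>c _. 1 / real (n c)" and T = 1])
  fix c p assume c: "c \<in> C"
  interpret S: prob_space "PiM {..<n c} (\<lambda>_. \<mu> c)" by (rule prob_space_PiM) (rule \<mu>[OF c])
  from bdd[OF c] obtain L where L: "\<And>x. x \<in> space (PiM {..<n c} (\<lambda>_. \<mu> c)) \<Longrightarrow> \<bar>F c x\<bar> \<le> L" by blast
  have "(\<integral>\<^sup>+x. ennreal (F c x ^ (2 * p)) \<partial>PiM {..<n c} (\<lambda>_. \<mu> c)) \<le> (\<integral>\<^sup>+x. ennreal (\<bar>L\<bar> ^ (2 * p)) \<partial>PiM {..<n c} (\<lambda>_. \<mu> c))"
  proof (intro nn_integral_mono ennreal_leI)
    fix x assume "x \<in> space (PiM {..<n c} (\<lambda>_. \<mu> c))"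
    from L[OF this] show "F c x ^ (2 * p) \<le> \<bar>L\<bar> ^ (2 * p)" by (intro power_mono_even) auto
  qed
  also have "\<dots> < \<infinity>" by (simp add: S.emeasure_space_1)
  finally show "(\<integral>\<^sup>+x. ennreal (F c x ^ (2 * p)) \<partial>PiM {..<n c} (\<lambda>_. \<mu> c)) < \<infinity>" .
next
  show "moments_bounded {e. fst e \<in> C \<and> snd e < n (fst e)} (\<lambda>e. PiM {..<n (fst e)} (\<lambda>_. \<mu> (fst e)))
     (\<lambda>e x. (F (fst e) x - G (fst e) (snd e) x) / sqrt (1 / real (n (fst e))))"
    by (rule moments_bounded_cong[OF mb]) (simp add: real_sqrt_divide)
qed (use assms in \<open>auto simp: Suc_le_eq\<close>)

section \<open>Concentration and mean equations for traces of the resolvent\<close>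

lemma trace_cov_minv_nonneg:
  assumes good: "sample_model M H n d \<mu> l" and W: "posdef_mat d l W"
  shows "0 \<le> 1 / real n * mat_trace (cov_mat d \<mu> * minv W)"
proof -
  interpret one_sample "{()}" M H "\<lambda>_. n" "\<lambda>_. d" "\<lambda>_. \<mu>" "\<lambda>_. l" "\<lambda>_. W" "\<lambda>_. 1\<^sub>m d" "\<lambda>_. 1\<^sub>m d" 1
    by (rule one_sample.intro) (use good W op_bound_one test_mat_op_bound[OF op_bound_one] in auto)
  show ?thesis using q_N_nonneg[of "()"] by simp
qed

locale n_sample =
  fixes C :: "'c set" and M :: real and H :: "real \<Rightarrow> nat \<Rightarrow> real" and n d :: "'c \<Rightarrow> nat"
    and \<mu> :: "'c \<Rightarrow> real vec measure" and lam :: "'c \<Rightarrow> real" and A B :: "'c \<Rightarrow> real mat" and K :: real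
  assumes good: "\<And>c. c \<in> C \<Longrightarrow> sample_model M H (n c) (d c) (\<mu> c) (lam c)"
    and A: "\<And>c. c \<in> C \<Longrightarrow> test_mat (n c) (d c) K (A c)"
    and B: "\<And>c. c \<in> C \<Longrightarrow> op_bound (d c) K (B c)"
begin

abbreviation "S c \<equiv> PiM {..<n c} (\<lambda>_. \<mu> c)"
abbreviation "R c x \<equiv> minv (ridge_mat (n c) (d c) (lam c) x {..<n c})"
abbreviation "RL c i x \<equiv> minv (ridge_mat (n c) (d c) (lam c) x ({..<n c} - {i}))"
abbreviation "q c X \<equiv> 1 / real (n c) * mat_trace (cov_mat (d c) (\<mu> c) * X)"
text \<open>An element of E1 names one observation of a model; an element of E2 fixes in addition
  the values of all the others.\<close>

abbreviation "E1 \<equiv> {e. fst e \<in> C \<and> snd e < n (fst e)}"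
abbreviation "E2 \<equiv> {e. fst e \<in> C \<and> fst (snd e) < n (fst e) \<and>
    snd (snd e) \<in> space (PiM ({..<n (fst e)} - {fst (snd e)}) (\<lambda>_. \<mu> (fst e)))}"

lemmas g = sample_modelD[OF good]

lemma prob_S: "c \<in> C \<Longrightarrow> prob_space (S c)"
  by (rule prob_space_PiM) (rule g)

lemma x_carrier: "c \<in> C \<Longrightarrow> x \<in> space (PiM J (\<lambda>_. \<mu> c)) \<Longrightarrow> j \<in> J \<Longrightarrow> x j \<in> carrier_vec (d c)"
  using g(9) by (auto simp: space_PiM)

lemma x_measurable:
  assumes "c \<in> C" "j \<in> J" "a < d c" shows "(\<lambda>x. x j $ a) \<in> borel_measurable (PiM J (\<lambda>_. \<mu> c))"
proof -
  have "(\<lambda>v. v $ a) \<in> borel_measurable (\<mu> c)"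
    using measurable_vec_index[OF assms(3)] measurable_cong_sets[OF g(7)[OF assms(1)] refl] by blast
  from measurable_compose[OF measurable_component_singleton[OF assms(2)] this] show ?thesis .
qed

lemma meas_res: "c \<in> C \<Longrightarrow> J \<subseteq> {..<n c} \<Longrightarrow> measurable_mat (S c) (d c) (\<lambda>x. minv (ridge_mat (n c) (d c) (lam c) x J))"
  by (rule measurable_mat_resolvent[where X = "\<lambda>j x. x j"])
    (use g(10) in \<open>auto intro: finite_subset x_measurable x_carrier\<close>)

lemma meas_R: "c \<in> C \<Longrightarrow> measurable_mat (S c) (d c) (R c)"
  by (rule meas_res) auto

lemma meas_RL: "c \<in> C \<Longrightarrow> measurable_mat (S c) (d c) (RL c i)"
  by (rule meas_res) auto

lemma A_carrier: "c \<in> C \<Longrightarrow> A c \<in> carrier_mat (d c) (d c)"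
  and B_carrier: "c \<in> C \<Longrightarrow> B c \<in> carrier_mat (d c) (d c)"
  using test_mat_carrier[OF A] op_boundD(1)[OF B] by auto

lemma meas_const: "c \<in> C \<Longrightarrow> measurable_mat (S c) (d c) (\<lambda>_. A c)" "c \<in> C \<Longrightarrow> measurable_mat (S c) (d c) (\<lambda>_. B c)"
  "measurable_mat (S c) (d c) (\<lambda>_. cov_mat (d c) (\<mu> c))"
  using A_carrier B_carrier by (auto intro: measurable_mat_const)

lemma meas_trace: "measurable_mat (S c) (d c) F \<Longrightarrow> (\<lambda>x. mat_trace (F x)) \<in> borel_measurable (S c)"
  by (rule measurable_mat_trace)

lemmas meas_intros = borel_measurable_add borel_measurable_diff borel_measurable_times borel_measurable_divide
  borel_measurable_const meas_trace measurable_mat_mult meas_R meas_RL meas_const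

lemma posdef: "c \<in> C \<Longrightarrow> x \<in> space (PiM I (\<lambda>_. \<mu> c)) \<Longrightarrow> J \<subseteq> I \<Longrightarrow> finite J \<Longrightarrow>
    posdef_mat (d c) (lam c) (ridge_mat (n c) (d c) (lam c) x J)"
  by (rule posdef_ridge_mat) (use g(10) x_carrier[OF _ _ subsetD] in auto)

lemma posdef_R: "c \<in> C \<Longrightarrow> x \<in> space (S c) \<Longrightarrow> posdef_mat (d c) (lam c) (ridge_mat (n c) (d c) (lam c) x {..<n c})"
  by (rule posdef[where I = "{..<n c}"]) auto

lemma op_bound_R: "c \<in> C \<Longrightarrow> x \<in> space (S c) \<Longrightarrow> op_bound (d c) M (R c x)"
  by (rule op_bound_mono[OF posdef_mat.op_bound_minv[OF posdef_R]]) (use g(11) in auto)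

text \<open>Instantiation at frozen observations, which turns every expansion in a fresh observation
  into a conditional expansion uniform in the rest.\<close>

sublocale one: one_sample E2 M H "\<lambda>e. n (fst e)" "\<lambda>e. d (fst e)" "\<lambda>e. \<mu> (fst e)" "\<lambda>e. lam (fst e)"
  "\<lambda>e. ridge_mat (n (fst e)) (d (fst e)) (lam (fst e)) (snd (snd e)) ({..<n (fst e)} - {fst (snd e)})"
  "\<lambda>e. A (fst e)" "\<lambda>e. B (fst e)" K
  by (rule one_sample.intro) (use good A B in \<open>auto intro!: posdef\<close>)

lemma ridge_full:
  "i < n c \<Longrightarrow> ridge_mat (n c) (d c) (lam c) (x(i := y)) {..<n c} =
     add_obs (n c) (d c) (ridge_mat (n c) (d c) (lam c) x ({..<n c} - {i})) y"
proof -
  assume i: "i < n c"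
  have "ridge_mat (n c) (d c) (lam c) (x(i := y)) (insert i ({..<n c} - {i})) =
     add_obs (n c) (d c) (ridge_mat (n c) (d c) (lam c) (x(i := y)) ({..<n c} - {i})) ((x(i := y)) i)"
    by (rule ridge_mat_insert) auto
  also have "ridge_mat (n c) (d c) (lam c) (x(i := y)) ({..<n c} - {i}) = ridge_mat (n c) (d c) (lam c) x ({..<n c} - {i})"
    by (rule ridge_mat_cong) auto
  finally show ?thesis unfolding insert_diff_lessThan[OF i] fun_upd_same .
qed

lemma ridge_loo: "ridge_mat (n c) (d c) (lam c) (x(i := y)) ({..<n c} - {i}) = ridge_mat (n c) (d c) (lam c) x ({..<n c} - {i})"
  by (rule ridge_mat_cong) auto

text \<open>Transfers a conditional bound to the full sample. The premises on Y only ask that it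
  agree with the one-observation quantity once observation i is singled out.\<close>

lemma moments_bounded_loo:
  assumes "\<And>c i. c \<in> C \<Longrightarrow> i < n c \<Longrightarrow> Y c i \<in> borel_measurable (S c)"
    and "moments_bounded E2 (\<lambda>e. \<mu> (fst e)) Z"
    and "\<And>e y. e \<in> E2 \<Longrightarrow> Y (fst e) (fst (snd e)) ((snd (snd e))(fst (snd e) := y)) = Z e y"
  shows "moments_bounded E1 (\<lambda>e. S (fst e)) (\<lambda>e. Y (fst e) (snd e))"
  by (rule moments_bounded_condition[OF g(6) assms(1)], assumption, assumption, assumption)
    (rule moments_bounded_cong[OF assms(2)], rule assms(3))

abbreviation "T1 c N \<equiv> mat_trace (A c * N)"
abbreviation "T2 c N \<equiv> mat_trace (A c * N * B c * N)"
text \<open>D1 and D2 are the predicted changes of the traces when the missing observation is added: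
  every quadratic form is replaced by its conditional mean.\<close>

abbreviation "D1 c N \<equiv> - 1 * (1 / (1 + q c N) * q c (N * A c * N))"
abbreviation "D2 c N \<equiv> - 1 * (1 / (1 + q c N) * (q c (N * (B c * N * A c) * N) + q c (N * (A c * N * B c) * N)))
       + (1 / (1 + q c N) * (1 / (1 + q c N))) * (q c (N * A c * N) * q c (N * B c * N))"

lemma trace_test_bound:
  assumes "c \<in> C" "test_mat (n c) (d c) L X" shows "\<bar>mat_trace X\<bar> \<le> L * (M + 1) * real (n c)"
proof -
  have "\<bar>mat_trace X\<bar> \<le> L * (real (d c) + real (n c))" by (rule test_mat_trace[OF assms(2) g(2)[OF assms(1)]])
  also have "\<dots> \<le> L * (M * real (n c) + real (n c))"
    using g(3)[OF assms(1)] test_mat_nonneg[OF assms(2)] by (intro mult_left_mono) auto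
  finally show ?thesis by (simp add: algebra_simps)
qed

lemma T1_bound: "c \<in> C \<Longrightarrow> x \<in> space (S c) \<Longrightarrow> \<bar>T1 c (R c x)\<bar> \<le> K * M * (M + 1) * real (n c)"
  by (rule trace_test_bound[OF _ test_mat_mult_right[OF A op_bound_R]])

lemma T2_bound: "c \<in> C \<Longrightarrow> x \<in> space (S c) \<Longrightarrow> \<bar>T2 c (R c x)\<bar> \<le> K * M * K * M * (M + 1) * real (n c)"
  by (rule trace_test_bound[OF _ test_mat_mult_right[OF test_mat_mult_right[OF test_mat_mult_right[OF A op_bound_R] B] op_bound_R]])

text \<open>A single observation moves the unnormalised trace by O(1).\<close>

lemma loo_T1: "moments_bounded E1 (\<lambda>e. S (fst e)) (\<lambda>e x. T1 (fst e) (R (fst e) x) - T1 (fst e) (RL (fst e) (snd e) x))"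
  by (rule moments_bounded_loo[OF _ second_order_moments_bounded[OF one.second_order_trace_R],
        where Y = "\<lambda>c i x. T1 c (R c x) - T1 c (RL c i x)"])
    (auto intro!: meas_intros simp: ridge_full ridge_loo)

lemma loo_T2: "moments_bounded E1 (\<lambda>e. S (fst e)) (\<lambda>e x. T2 (fst e) (R (fst e) x) - T2 (fst e) (RL (fst e) (snd e) x))"
  by (rule moments_bounded_loo[OF _ second_order_moments_bounded[OF one.second_order_trace_RBR],
        where Y = "\<lambda>c i x. T2 c (R c x) - T2 c (RL c i x)"])
    (auto intro!: meas_intros simp: ridge_full ridge_loo)

text \<open>After the predicted change D1 is accounted for, only O(n^(-1/2)) of the influence of one
  observation is left.\<close>

lemma dev_T1: "moments_bounded E1 (\<lambda>e. S (fst e)) (\<lambda>e x. sqrt (n (fst e)) *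
    (T1 (fst e) (R (fst e) x) - (T1 (fst e) (RL (fst e) (snd e) x) + D1 (fst e) (RL (fst e) (snd e) x))))"
  by (rule moments_bounded_loo[OF _ second_order_deviation[OF one.second_order_trace_R],
        where Y = "\<lambda>c i x. sqrt (n c) * (T1 c (R c x) - (T1 c (RL c i x) + D1 c (RL c i x)))"])
    (auto intro!: meas_intros simp: ridge_full ridge_loo algebra_simps)

lemma dev_T2: "moments_bounded E1 (\<lambda>e. S (fst e)) (\<lambda>e x. sqrt (n (fst e)) *
    (T2 (fst e) (R (fst e) x) - (T2 (fst e) (RL (fst e) (snd e) x) + D2 (fst e) (RL (fst e) (snd e) x))))"
proof (rule moments_bounded_loo[OF _ second_order_deviation[OF one.second_order_trace_RBR],
        where Y = "\<lambda>c i x. sqrt (n c) * (T2 c (R c x) - (T2 c (RL c i x) + D2 c (RL c i x)))"])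
  fix c i assume "c \<in> C" "i < n c"
  thus "(\<lambda>x. sqrt (n c) * (T2 c (R c x) - (T2 c (RL c i x) + D2 c (RL c i x)))) \<in> borel_measurable (S c)"
    by (intro meas_intros)
qed (simp only: mem_Collect_eq ridge_full ridge_loo diff_diff_eq)

text \<open>The competitor for observation i is the leave-one-out trace plus its predicted change.
  The leave-one-out trace alone would be off by O(1) and give fluctuations of order sqrt n.\<close>

lemma concentration_T1: "moments_bounded C S (\<lambda>c x. T1 c (R c x) - (\<integral>x. T1 c (R c x) \<partial>S c))"
proof (rule moments_bounded_Efron_Stein[where G = "\<lambda>c i x. T1 c (RL c i x) + D1 c (RL c i x)"])
  show "T1 c (RL c i (x(i := y))) + D1 c (RL c i (x(i := y))) = T1 c (RL c i x) + D1 c (RL c i x)" for c i x y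
    by (simp only: ridge_loo)
  show "\<exists>L. \<forall>x\<in>space (S c). \<bar>T1 c (R c x)\<bar> \<le> L" if "c \<in> C" for c using T1_bound[OF that] by blast
  show "(\<lambda>x. T1 c (R c x)) \<in> borel_measurable (S c)" if "c \<in> C" for c
    using that by (intro meas_intros)
  show "(\<lambda>x. T1 c (RL c i x) + D1 c (RL c i x)) \<in> borel_measurable (S c)" if "c \<in> C" "i < n c" for c i
    using that by (intro meas_intros)
  show "moments_bounded E1 (\<lambda>e. S (fst e)) (\<lambda>e x. sqrt (n (fst e)) *
      (T1 (fst e) (R (fst e) x) - (T1 (fst e) (RL (fst e) (snd e) x) + D1 (fst e) (RL (fst e) (snd e) x))))"
    by (rule dev_T1)
qed (use g in auto)

lemma concentration_T2: "moments_bounded C S (\<lambda>c x. T2 c (R c x) - (\<integral>x. T2 c (R c x) \<partial>S c))"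
proof (rule moments_bounded_Efron_Stein[where G = "\<lambda>c i x. T2 c (RL c i x) + D2 c (RL c i x)"])
  show "T2 c (RL c i (x(i := y))) + D2 c (RL c i (x(i := y))) = T2 c (RL c i x) + D2 c (RL c i x)" for c i x y
    by (simp only: ridge_loo)
  show "\<exists>L. \<forall>x\<in>space (S c). \<bar>T2 c (R c x)\<bar> \<le> L" if "c \<in> C" for c using T2_bound[OF that] by blast
  show "(\<lambda>x. T2 c (R c x)) \<in> borel_measurable (S c)" if "c \<in> C" for c
    using that by (intro meas_intros)
  show "(\<lambda>x. T2 c (RL c i x) + D2 c (RL c i x)) \<in> borel_measurable (S c)" if "c \<in> C" "i < n c" for c i
    using that by (intro meas_intros)
  show "moments_bounded E1 (\<lambda>e. S (fst e)) (\<lambda>e x. sqrt (n (fst e)) *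
      (T2 (fst e) (R (fst e) x) - (T2 (fst e) (RL (fst e) (snd e) x) + D2 (fst e) (RL (fst e) (snd e) x))))"
    by (rule dev_T2)
qed (use g in auto)

lemma integrable_T1: "c \<in> C \<Longrightarrow> integrable (S c) (\<lambda>x. T1 c (R c x))"
proof -
  assume c: "c \<in> C"
  interpret prob_space "S c" by (rule prob_S[OF c])
  show ?thesis
  proof (rule integrable_const_bound[where B = "K * M * (M + 1) * real (n c)"])
    show "AE x in S c. norm (T1 c (R c x)) \<le> K * M * (M + 1) * real (n c)"
      using T1_bound[OF c] by (intro AE_I2) simp
    show "(\<lambda>x. T1 c (R c x)) \<in> borel_measurable (S c)" using c by (intro meas_intros)
  qed
qed

lemma integrable_T2: "c \<in> C \<Longrightarrow> integrable (S c) (\<lambda>x. T2 c (R c x))"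
proof -
  assume c: "c \<in> C"
  interpret prob_space "S c" by (rule prob_S[OF c])
  show ?thesis
  proof (rule integrable_const_bound[where B = "K * M * K * M * (M + 1) * real (n c)"])
    show "AE x in S c. norm (T2 c (R c x)) \<le> K * M * K * M * (M + 1) * real (n c)"
      using T2_bound[OF c] by (intro AE_I2) simp
    show "(\<lambda>x. T2 c (R c x)) \<in> borel_measurable (S c)" using c by (intro meas_intros)
  qed
qed

lemma abs_mean_le:
  assumes c: "c \<in> C" and le: "\<And>x. x \<in> space (S c) \<Longrightarrow> \<bar>f x\<bar> \<le> L * real (n c)" and f: "integrable (S c) f"
  shows "\<bar>1 / real (n c) * (\<integral>x. f x \<partial>S c)\<bar> \<le> L"
proof -
  interpret prob_space "S c" by (rule prob_S[OF c])
  have n: "0 < real (n c)" using g(2)[OF c] by simp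
  have "\<bar>\<integral>x. f x \<partial>S c\<bar> \<le> (\<integral>x. \<bar>f x\<bar> \<partial>S c)" by (rule integral_abs_bound)
  also have "\<dots> \<le> (\<integral>x. L * real (n c) \<partial>S c)" using f le by (intro integral_mono) auto
  finally show ?thesis using n by (simp add: prob_space abs_mult divide_le_eq)
qed

text \<open>A quantity that already deviates by only O(1 / n) can be expanded with zero linear
  part.\<close>

lemma second_order_zero:
  assumes "moments_bounded E1 (\<lambda>e. S (fst e)) (\<lambda>e w. real (n (fst e)) * (X e w - x e))" "\<And>e. e \<in> E1 \<Longrightarrow> \<bar>x e\<bar> \<le> L"
  shows "second_order E1 (\<lambda>e. n (fst e)) (\<lambda>e. S (fst e)) X x"
proof (rule second_orderI[where L = "\<lambda>_ _. 0" and K = L])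
  show "moments_bounded E1 (\<lambda>e. S (fst e)) (\<lambda>e w. sqrt (n (fst e)) * 0)"
    using prob_S by (auto intro!: moments_bounded_const[where K = 0])
qed (use assms g(2) prob_S in auto)

text \<open>Concentration and the removal of one observation both cost O(1) before the division by
  n, so the random normalised leave-one-out trace may be replaced by its full-sample mean.\<close>

lemma second_order_loo_T1: "second_order E1 (\<lambda>e. n (fst e)) (\<lambda>e. S (fst e))
   (\<lambda>e x. 1 / real (n (fst e)) * T1 (fst e) (RL (fst e) (snd e) x))
   (\<lambda>e. 1 / real (n (fst e)) * (\<integral>x. T1 (fst e) (R (fst e) x) \<partial>S (fst e)))"
proof (rule second_order_zero)
  have "moments_bounded E1 (\<lambda>e. S (fst e)) (\<lambda>e x. (T1 (fst e) (R (fst e) x) - (\<integral>x. T1 (fst e) (R (fst e) x) \<partial>S (fst e))) -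
      (T1 (fst e) (R (fst e) x) - T1 (fst e) (RL (fst e) (snd e) x)))"
    by (rule moments_bounded_diff[OF moments_bounded_reindex[OF concentration_T1, where f = fst] loo_T1]) auto
  thus "moments_bounded E1 (\<lambda>e. S (fst e)) (\<lambda>e x. real (n (fst e)) * (1 / real (n (fst e)) * T1 (fst e) (RL (fst e) (snd e) x) -
      1 / real (n (fst e)) * (\<integral>x. T1 (fst e) (R (fst e) x) \<partial>S (fst e))))"
  proof (rule moments_bounded_cong)
    fix e x assume "e \<in> E1"
    hence "real (n (fst e)) \<noteq> 0" by auto
    hence "real (n (fst e)) * (1 / real (n (fst e)) * a - 1 / real (n (fst e)) * b) = (z - b) - (z - a)" for a b z
      by (simp add: field_simps)
    thus "real (n (fst e)) * (1 / real (n (fst e)) * T1 (fst e) (RL (fst e) (snd e) x) -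
        1 / real (n (fst e)) * (\<integral>x. T1 (fst e) (R (fst e) x) \<partial>S (fst e))) =
        (T1 (fst e) (R (fst e) x) - (\<integral>x. T1 (fst e) (R (fst e) x) \<partial>S (fst e))) - (T1 (fst e) (R (fst e) x) - T1 (fst e) (RL (fst e) (snd e) x))" .
  qed
  show "\<bar>1 / real (n (fst e)) * (\<integral>x. T1 (fst e) (R (fst e) x) \<partial>S (fst e))\<bar> \<le> K * M * (M + 1)" if "e \<in> E1" for e
    using that T1_bound by (intro abs_mean_le integrable_T1) auto
qed

lemma second_order_loo_T2: "second_order E1 (\<lambda>e. n (fst e)) (\<lambda>e. S (fst e))
   (\<lambda>e x. 1 / real (n (fst e)) * T2 (fst e) (RL (fst e) (snd e) x))
   (\<lambda>e. 1 / real (n (fst e)) * (\<integral>x. T2 (fst e) (R (fst e) x) \<partial>S (fst e)))"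
proof (rule second_order_zero)
  have "moments_bounded E1 (\<lambda>e. S (fst e)) (\<lambda>e x. (T2 (fst e) (R (fst e) x) - (\<integral>x. T2 (fst e) (R (fst e) x) \<partial>S (fst e))) -
      (T2 (fst e) (R (fst e) x) - T2 (fst e) (RL (fst e) (snd e) x)))"
    by (rule moments_bounded_diff[OF moments_bounded_reindex[OF concentration_T2, where f = fst] loo_T2]) auto
  thus "moments_bounded E1 (\<lambda>e. S (fst e)) (\<lambda>e x. real (n (fst e)) * (1 / real (n (fst e)) * T2 (fst e) (RL (fst e) (snd e) x) -
      1 / real (n (fst e)) * (\<integral>x. T2 (fst e) (R (fst e) x) \<partial>S (fst e))))"
  proof (rule moments_bounded_cong)
    fix e x assume "e \<in> E1"
    hence "real (n (fst e)) \<noteq> 0" by auto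
    hence "real (n (fst e)) * (1 / real (n (fst e)) * a - 1 / real (n (fst e)) * b) = (z - b) - (z - a)" for a b z
      by (simp add: field_simps)
    thus "real (n (fst e)) * (1 / real (n (fst e)) * T2 (fst e) (RL (fst e) (snd e) x) -
        1 / real (n (fst e)) * (\<integral>x. T2 (fst e) (R (fst e) x) \<partial>S (fst e))) =
        (T2 (fst e) (R (fst e) x) - (\<integral>x. T2 (fst e) (R (fst e) x) \<partial>S (fst e))) - (T2 (fst e) (R (fst e) x) - T2 (fst e) (RL (fst e) (snd e) x))" .
  qed
  show "\<bar>1 / real (n (fst e)) * (\<integral>x. T2 (fst e) (R (fst e) x) \<partial>S (fst e))\<bar> \<le> K * M * K * M * (M + 1)" if "e \<in> E1" for e
    using that T2_bound by (intro abs_mean_le integrable_T2) auto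
qed

abbreviation "Y1 c i x \<equiv> 1 / real (n c) * (x i \<bullet> ((R c x * A c) *\<^sub>v x i))"
abbreviation "Y2 c i x \<equiv> 1 / real (n c) * (x i \<bullet> ((R c x * B c * R c x * A c) *\<^sub>v x i))"
abbreviation "y1 c N \<equiv> 1 / (1 + q c N) * q c (N * A c)"
abbreviation "y2 c N \<equiv> 1 / (1 + q c N) * (q c (N * B c * N * A c) - 1 / (1 + q c N) * (q c (N * A c) * q c (N * B c * N)))"

lemma Y1_measurable: "c \<in> C \<Longrightarrow> i < n c \<Longrightarrow> Y1 c i \<in> borel_measurable (S c)"
  by (intro borel_measurable_times borel_measurable_const measurable_mat_quad[where d = "d c"], (intro meas_intros; assumption), auto intro: x_measurable x_carrier)

lemma Y2_measurable: "c \<in> C \<Longrightarrow> i < n c \<Longrightarrow> Y2 c i \<in> borel_measurable (S c)"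
  by (intro borel_measurable_times borel_measurable_const measurable_mat_quad[where d = "d c"], (intro meas_intros; assumption), auto intro: x_measurable x_carrier)

lemma moments_bounded_Y1: "moments_bounded E1 (\<lambda>e. S (fst e)) (\<lambda>e. Y1 (fst e) (snd e))"
  by (rule moments_bounded_loo[OF Y1_measurable second_order_moments_bounded[OF one.second_order_quad_RA]])
    (simp_all only: mem_Collect_eq ridge_full ridge_loo fun_upd_same)

lemma moments_bounded_Y2: "moments_bounded E1 (\<lambda>e. S (fst e)) (\<lambda>e. Y2 (fst e) (snd e))"
  by (rule moments_bounded_loo[OF Y2_measurable second_order_moments_bounded[OF one.second_order_quad_RBRA]])
    (simp_all only: mem_Collect_eq ridge_full ridge_loo fun_upd_same)

text \<open>Taking the expectation in observation i first removes the linear part, so the error is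
  O(1 / n) and not O(n^(-1/2)). The integrability premise is discharged later, from the expansion of
  y1.\<close>

lemma mean_Y1:
  "\<exists>L\<ge>0. \<forall>c\<in>C. \<forall>i<n c. integrable (S c) (\<lambda>x. y1 c (RL c i x)) \<longrightarrow>
     \<bar>(\<integral>x. Y1 c i x \<partial>S c) - (\<integral>x. y1 c (RL c i x) \<partial>S c)\<bar> \<le> L / real (n c)"
proof -
  from second_order_expectation[OF one.second_order_quad_RA] obtain L where L: "0 \<le> L"
    "\<And>e. e \<in> E2 \<Longrightarrow> \<bar>(\<integral>y. 1 / real (n (fst e)) * (y \<bullet> ((one.R e y * A (fst e)) *\<^sub>v y)) \<partial>\<mu> (fst e)) - y1 (fst e) (one.N e)\<bar> \<le> L / real (n (fst e))"
    by blast
  have "\<bar>(\<integral>x. Y1 c i x \<partial>S c) - (\<integral>x. y1 c (RL c i x) \<partial>S c)\<bar> \<le> L / real (n c)"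
    if c: "c \<in> C" and i: "i < n c" and int: "integrable (S c) (\<lambda>x. y1 c (RL c i x))" for c i
  proof -
    have Y: "integrable (S c) (Y1 c i)" using moments_bounded_integrable[OF moments_bounded_Y1, of "(c, i)"] c i by simp
    interpret mu: prob_space "\<mu> c" by (rule g(6)[OF c])
    have "\<bar>\<integral>x. Y1 c i x - y1 c (RL c i x) \<partial>S c\<bar> \<le> L / real (n c)"
    proof (rule expectation_condition[OF g(6)[OF c] i])
      show "integrable (S c) (\<lambda>x. Y1 c i x - y1 c (RL c i x))" using Y int by (rule Bochner_Integration.integrable_diff)
      fix x assume x: "x \<in> space (PiM ({..<n c} - {i}) (\<lambda>_. \<mu> c))"
      have e: "(c, i, x) \<in> E2" using c i x by simp
      have "(\<integral>y. Y1 c i (x(i := y)) - y1 c (RL c i (x(i := y))) \<partial>\<mu> c) =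
          (\<integral>y. 1 / real (n c) * (y \<bullet> ((one.R (c, i, x) y * A c) *\<^sub>v y)) - y1 c (one.N (c, i, x)) \<partial>\<mu> c)"
        using i by (simp only: ridge_full ridge_loo fun_upd_same fst_conv snd_conv)
      also have "\<dots> = (\<integral>y. 1 / real (n c) * (y \<bullet> ((one.R (c, i, x) y * A c) *\<^sub>v y)) \<partial>\<mu> c) - y1 c (one.N (c, i, x))"
        using moments_bounded_integrable[OF second_order_moments_bounded[OF one.second_order_quad_RA] e]
        by (subst Bochner_Integration.integral_diff) (auto simp: mu.prob_space)
      finally show "\<bar>\<integral>y. Y1 c i (x(i := y)) - y1 c (RL c i (x(i := y))) \<partial>\<mu> c\<bar> \<le> L / real (n c)"
        using L(2)[OF e] by simp
    qed
    thus ?thesis by (subst (asm) Bochner_Integration.integral_diff[OF Y int])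
  qed
  thus ?thesis using L(1) by blast
qed

lemma mean_Y2:
  "\<exists>L\<ge>0. \<forall>c\<in>C. \<forall>i<n c. integrable (S c) (\<lambda>x. y2 c (RL c i x)) \<longrightarrow>
     \<bar>(\<integral>x. Y2 c i x \<partial>S c) - (\<integral>x. y2 c (RL c i x) \<partial>S c)\<bar> \<le> L / real (n c)"
proof -
  from second_order_expectation[OF one.second_order_quad_RBRA] obtain L where L: "0 \<le> L"
    "\<And>e. e \<in> E2 \<Longrightarrow> \<bar>(\<integral>y. 1 / real (n (fst e)) * (y \<bullet> ((one.R e y * B (fst e) * one.R e y * A (fst e)) *\<^sub>v y)) \<partial>\<mu> (fst e)) - y2 (fst e) (one.N e)\<bar> \<le> L / real (n (fst e))"
    by blast
  have "\<bar>(\<integral>x. Y2 c i x \<partial>S c) - (\<integral>x. y2 c (RL c i x) \<partial>S c)\<bar> \<le> L / real (n c)"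
    if c: "c \<in> C" and i: "i < n c" and int: "integrable (S c) (\<lambda>x. y2 c (RL c i x))" for c i
  proof -
    have Y: "integrable (S c) (Y2 c i)" using moments_bounded_integrable[OF moments_bounded_Y2, of "(c, i)"] c i by simp
    interpret mu: prob_space "\<mu> c" by (rule g(6)[OF c])
    have "\<bar>\<integral>x. Y2 c i x - y2 c (RL c i x) \<partial>S c\<bar> \<le> L / real (n c)"
    proof (rule expectation_condition[OF g(6)[OF c] i])
      show "integrable (S c) (\<lambda>x. Y2 c i x - y2 c (RL c i x))" using Y int by (rule Bochner_Integration.integrable_diff)
      fix x assume x: "x \<in> space (PiM ({..<n c} - {i}) (\<lambda>_. \<mu> c))"
      have e: "(c, i, x) \<in> E2" using c i x by simp
      have "(\<integral>y. Y2 c i (x(i := y)) - y2 c (RL c i (x(i := y))) \<partial>\<mu> c) =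
          (\<integral>y. 1 / real (n c) * (y \<bullet> ((one.R (c, i, x) y * B c * one.R (c, i, x) y * A c) *\<^sub>v y)) - y2 c (one.N (c, i, x)) \<partial>\<mu> c)"
        using i by (simp only: ridge_full ridge_loo fun_upd_same fst_conv snd_conv)
      also have "\<dots> = (\<integral>y. 1 / real (n c) * (y \<bullet> ((one.R (c, i, x) y * B c * one.R (c, i, x) y * A c) *\<^sub>v y)) \<partial>\<mu> c) - y2 c (one.N (c, i, x))"
        using moments_bounded_integrable[OF second_order_moments_bounded[OF one.second_order_quad_RBRA] e]
        by (subst Bochner_Integration.integral_diff) (auto simp: mu.prob_space)
      finally show "\<bar>\<integral>y. Y2 c i (x(i := y)) - y2 c (RL c i (x(i := y))) \<partial>\<mu> c\<bar> \<le> L / real (n c)"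
        using L(2)[OF e] by simp
    qed
    thus ?thesis by (subst (asm) Bochner_Integration.integral_diff[OF Y int])
  qed
  thus ?thesis using L(1) by blast
qed

end

text \<open>The trace of A X with the identity inserted as the ridge matrix times its inverse,
  expanded over observations. It is used with X = 1, with X a product of B and the resolvent, and
  once to prove positivity.\<close>

lemma trace_mult_ridge_resolvent:
  assumes l: "0 < l" and x: "\<And>j. j < n \<Longrightarrow> x j \<in> carrier_vec d" and A: "A \<in> carrier_mat d d" and X: "X \<in> carrier_mat d d"
    and N: "N = minv (ridge_mat n d l x {..<n})"
  shows "mat_trace (A * X) = l * mat_trace (A * N * X) + (\<Sum>i<n. 1 / real n * (x i \<bullet> ((N * X * A) *\<^sub>v x i)))"
proof -
  interpret posdef_mat d l "ridge_mat n d l x {..<n}"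
    by (rule posdef_ridge_mat) (use l x in auto)
  have Nc: "N \<in> carrier_mat d d" by (simp add: N)
  have "mat_trace ((N * X * A) * ridge_mat n d l x {..<n}) = mat_trace (ridge_mat n d l x {..<n} * (N * X * A))"
    using Nc X A by (intro mat_trace_comm) auto
  also have "ridge_mat n d l x {..<n} * (N * X * A) = (ridge_mat n d l x {..<n} * N) * (X * A)"
    using Nc X A by (simp add: mult_mat_assoc_square[where d = d])
  also have "\<dots> = X * A" using minv_W(2) X A by (simp add: N)
  also have "mat_trace (X * A) = mat_trace (A * X)" by (rule mat_trace_comm[OF X A])
  finally have 1: "mat_trace (A * X) = mat_trace ((N * X * A) * ridge_mat n d l x {..<n})" by simp
  have "mat_trace (N * X * A) = mat_trace (A * (N * X))"
    using Nc X A by (intro mat_trace_comm) auto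
  also have "A * (N * X) = A * N * X" using Nc X A by (simp add: mult_mat_assoc_square[where d = d])
  finally have 2: "mat_trace (N * X * A) = mat_trace (A * N * X)" .
  show ?thesis
    unfolding 1 2[symmetric] by (rule trace_mult_ridge_mat) (use x Nc X A in auto)
qed

text \<open>Defined outside the locale so that equations obtained from different interpretations,
  with different test matrices, refer to the same quantities.\<close>

definition mean1 :: "nat \<Rightarrow> nat \<Rightarrow> real vec measure \<Rightarrow> real \<Rightarrow> real mat \<Rightarrow> real" where
  "mean1 n d \<mu> l X = 1 / real n * (\<integral>x. mat_trace (X * minv (ridge_mat n d l x {..<n})) \<partial>PiM {..<n} (\<lambda>_. \<mu>))"

definition mean2 :: "nat \<Rightarrow> nat \<Rightarrow> real vec measure \<Rightarrow> real \<Rightarrow> real mat \<Rightarrow> real mat \<Rightarrow> real" where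
  "mean2 n d \<mu> l X Y = 1 / real n * (\<integral>x. mat_trace (X * minv (ridge_mat n d l x {..<n}) * Y * minv (ridge_mat n d l x {..<n}))
     \<partial>PiM {..<n} (\<lambda>_. \<mu>))"

context n_sample
begin

text \<open>Re-entry into the locale with another test matrix: the equation for A also involves the
  means for A times the covariance and for the covariance itself.\<close>

lemma n_sample_test:
  assumes "\<And>c. c \<in> C \<Longrightarrow> test_mat (n c) (d c) L (A' c)"
  shows "n_sample C M H n d \<mu> lam A' B (max K L)"
proof
  fix c assume c: "c \<in> C"
  show "sample_model M H (n c) (d c) (\<mu> c) (lam c)" by (rule good[OF c])
  show "op_bound (d c) (max K L) (B c)" by (rule op_bound_mono[OF B[OF c]]) simp
  show "test_mat (n c) (d c) (max K L) (A' c)"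
    using assms[OF c] unfolding test_mat_def by (meson max.cobounded2 op_bound_mono order_trans)
qed

lemma test_A_cov: "c \<in> C \<Longrightarrow> test_mat (n c) (d c) (K * 1) (A c * cov_mat (d c) (\<mu> c))"
  by (rule test_mat_mult_right[OF A g(8)])

lemma test_cov: "c \<in> C \<Longrightarrow> test_mat (n c) (d c) 1 (cov_mat (d c) (\<mu> c))"
  by (rule test_mat_op_bound[OF g(8)])

lemma res_nonneg: "c \<in> C \<Longrightarrow> x \<in> space (S c) \<Longrightarrow> J \<subseteq> {..<n c} \<Longrightarrow>
    0 \<le> q c (minv (ridge_mat (n c) (d c) (lam c) x J))"
  by (rule trace_cov_minv_nonneg[OF good posdef]) (auto intro: finite_subset)

lemma RL_carrier: "c \<in> C \<Longrightarrow> x \<in> space (S c) \<Longrightarrow> RL c i x \<in> carrier_mat (d c) (d c)"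
  and R_carrier: "c \<in> C \<Longrightarrow> x \<in> space (S c) \<Longrightarrow> R c x \<in> carrier_mat (d c) (d c)"
  using meas_R[of c] meas_RL[of c] by (auto simp: measurable_mat_def)

lemma mean_cov_nonneg: "c \<in> C \<Longrightarrow> 0 \<le> mean1 (n c) (d c) (\<mu> c) (lam c) (cov_mat (d c) (\<mu> c))"
  unfolding mean1_def
  by (subst integral_mult_right_zero[symmetric], rule Bochner_Integration.integral_nonneg_AE)
    (auto intro!: AE_I2 res_nonneg[of _ _ "{..<n c}" for c, simplified])

text \<open>The random denominators of the rank one formula may be replaced by one deterministic
  denominator.\<close>

lemma second_order_inv_cov:
  "second_order E1 (\<lambda>e. n (fst e)) (\<lambda>e. S (fst e))
    (\<lambda>e x. 1 / (1 + q (fst e) (RL (fst e) (snd e) x)))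
    (\<lambda>e. 1 / (1 + mean1 (n (fst e)) (d (fst e)) (\<mu> (fst e)) (lam (fst e)) (cov_mat (d (fst e)) (\<mu> (fst e)))))"
proof -
  interpret CO: n_sample C M H n d \<mu> lam "\<lambda>c. cov_mat (d c) (\<mu> c)" B "max K 1"
    by (rule n_sample_test[OF test_cov])
  show ?thesis
  proof (rule second_order_inverse[OF CO.second_order_loo_T1[folded mean1_def]])
    fix e x assume "e \<in> E1" "x \<in> space (S (fst e))"
    thus "0 \<le> q (fst e) (RL (fst e) (snd e) x)" by (intro res_nonneg) auto
  qed (auto intro: mean_cov_nonneg)
qed

lemma abs_average_le:
  assumes "1 \<le> N" "\<And>i. i < N \<Longrightarrow> \<bar>f i - a\<bar> \<le> k"
  shows "\<bar>1 / real N * (\<Sum>i<N. f i) - a\<bar> \<le> k"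
proof -
  have "1 / real N * (\<Sum>i<N. f i) - a = 1 / real N * (\<Sum>i<N. f i - a)"
    using assms(1) by (simp add: sum_subtractf algebra_simps)
  also have "\<bar>\<dots>\<bar> \<le> 1 / real N * (\<Sum>i<N. k)"
    unfolding abs_mult using assms(2) by (intro mult_mono order_trans[OF sum_abs] sum_mono) auto
  also have "\<dots> = k" using assms(1) by simp
  finally show ?thesis .
qed

text \<open>Expectation of the row expansion of tr A. Each row term is first replaced by its
  conditional prediction y1 (error L1), then by the product of full-sample means (error L2).\<close>

lemma mean_equation1:
  "\<exists>L\<ge>0. \<forall>c\<in>C. \<bar>1 / real (n c) * mat_trace (A c) - lam c * mean1 (n c) (d c) (\<mu> c) (lam c) (A c)
     - 1 / (1 + mean1 (n c) (d c) (\<mu> c) (lam c) (cov_mat (d c) (\<mu> c))) *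
        mean1 (n c) (d c) (\<mu> c) (lam c) (A c * cov_mat (d c) (\<mu> c))\<bar> \<le> L / real (n c)"
proof -
  interpret AC: n_sample C M H n d \<mu> lam "\<lambda>c. A c * cov_mat (d c) (\<mu> c)" B "max K (K * 1)"
    by (rule n_sample_test[OF test_A_cov])
  define v where "v c = 1 / (1 + mean1 (n c) (d c) (\<mu> c) (lam c) (cov_mat (d c) (\<mu> c))) *
        mean1 (n c) (d c) (\<mu> c) (lam c) (A c * cov_mat (d c) (\<mu> c))" for c
  have so: "second_order E1 (\<lambda>e. n (fst e)) (\<lambda>e. S (fst e)) (\<lambda>e x. y1 (fst e) (RL (fst e) (snd e) x)) (\<lambda>e. v (fst e))"
  proof (rule second_order_cong[OF second_order_mult[OF second_order_inv_cov AC.second_order_loo_T1[folded mean1_def]]])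
    fix e x assume "e \<in> E1" and x: "x \<in> space (S (fst e))"
    hence c: "fst e \<in> C" by simp
    have "mat_trace (cov_mat (d (fst e)) (\<mu> (fst e)) * (RL (fst e) (snd e) x * A (fst e))) =
        mat_trace (A (fst e) * (cov_mat (d (fst e)) (\<mu> (fst e)) * RL (fst e) (snd e) x))"
      using A_carrier[OF c] RL_carrier[OF c x]
        mat_trace_comm[of "cov_mat (d (fst e)) (\<mu> (fst e)) * RL (fst e) (snd e) x" "d (fst e)" "A (fst e)"]
      by (simp add: mult_mat_assoc_square[where d = "d (fst e)"])
    thus "y1 (fst e) (RL (fst e) (snd e) x) = 1 / (1 + q (fst e) (RL (fst e) (snd e) x)) *
        (1 / real (n (fst e)) * mat_trace (A (fst e) * cov_mat (d (fst e)) (\<mu> (fst e)) * RL (fst e) (snd e) x))"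
      using A_carrier[OF c] RL_carrier[OF c x] by (simp add: mult_mat_assoc_square[where d = "d (fst e)"])
  qed (simp add: v_def)
  from mean_Y1 obtain L1 where L1: "0 \<le> L1" "\<And>c i. c \<in> C \<Longrightarrow> i < n c \<Longrightarrow> integrable (S c) (\<lambda>x. y1 c (RL c i x)) \<Longrightarrow>
     \<bar>(\<integral>x. Y1 c i x \<partial>S c) - (\<integral>x. y1 c (RL c i x) \<partial>S c)\<bar> \<le> L1 / real (n c)" by blast
  from second_order_expectation[OF so] obtain L2 where L2: "0 \<le> L2"
    "\<And>c i. c \<in> C \<Longrightarrow> i < n c \<Longrightarrow> \<bar>(\<integral>x. y1 c (RL c i x) \<partial>S c) - v c\<bar> \<le> L2 / real (n c)" by force
  have "\<bar>1 / real (n c) * mat_trace (A c) - lam c * mean1 (n c) (d c) (\<mu> c) (lam c) (A c) - v c\<bar> \<le> (L1 + L2) / real (n c)"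
    if c: "c \<in> C" for c
  proof -
    interpret prob_space "S c" by (rule prob_S[OF c])
    have Y: "integrable (S c) (Y1 c i)" if "i < n c" for i
      using moments_bounded_integrable[OF moments_bounded_Y1, of "(c, i)"] c that by simp
    have "mat_trace (A c) = (\<integral>x. mat_trace (A c) \<partial>S c)" by (simp add: prob_space)
    also have "\<dots> = (\<integral>x. lam c * T1 c (R c x) + (\<Sum>i<n c. Y1 c i x) \<partial>S c)"
    proof (rule Bochner_Integration.integral_cong[OF refl])
      fix x assume x: "x \<in> space (S c)"
      show "mat_trace (A c) = lam c * T1 c (R c x) + (\<Sum>i<n c. Y1 c i x)"
        using trace_mult_ridge_resolvent[OF g(10)[OF c] x_carrier[OF c x] A_carrier[OF c] one_carrier_mat refl]
          A_carrier[OF c] R_carrier[OF c x] by simp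
    qed
    also have "\<dots> = lam c * (\<integral>x. T1 c (R c x) \<partial>S c) + (\<Sum>i<n c. \<integral>x. Y1 c i x \<partial>S c)"
      using integrable_T1[OF c] Y by (subst Bochner_Integration.integral_add) (auto simp: Bochner_Integration.integral_sum)
    finally have "1 / real (n c) * mat_trace (A c) - lam c * mean1 (n c) (d c) (\<mu> c) (lam c) (A c) - v c =
        1 / real (n c) * (\<Sum>i<n c. \<integral>x. Y1 c i x \<partial>S c) - v c"
      by (simp add: mean1_def algebra_simps add_divide_distrib)
    also have "\<bar>\<dots>\<bar> \<le> (L1 + L2) / real (n c)"
    proof (rule abs_average_le[OF g(2)[OF c]])
      fix i assume i: "i < n c"
      have "integrable (S c) (\<lambda>x. y1 c (RL c i x))"
        using moments_bounded_integrable[OF second_order_moments_bounded[OF so], of "(c, i)"] c i by simp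
      from L1(2)[OF c i this] L2(2)[OF c i] show "\<bar>(\<integral>x. Y1 c i x \<partial>S c) - v c\<bar> \<le> (L1 + L2) / real (n c)"
        unfolding add_divide_distrib by linarith
    qed
    finally show ?thesis .
  qed
  thus ?thesis unfolding v_def using L1(1) L2(1) by (intro exI[of _ "L1 + L2"]) auto
qed

text \<open>The same expansion of the trace of A B R. The observation sits in both resolvents, and
  the product term comes from updating the inner one.\<close>

lemma mean_equation2:
  "\<exists>L\<ge>0. \<forall>c\<in>C. \<bar>mean1 (n c) (d c) (\<mu> c) (lam c) (A c * B c) - lam c * mean2 (n c) (d c) (\<mu> c) (lam c) (A c) (B c)
     - 1 / (1 + mean1 (n c) (d c) (\<mu> c) (lam c) (cov_mat (d c) (\<mu> c))) *
        (mean2 (n c) (d c) (\<mu> c) (lam c) (A c * cov_mat (d c) (\<mu> c)) (B c) -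
         1 / (1 + mean1 (n c) (d c) (\<mu> c) (lam c) (cov_mat (d c) (\<mu> c))) *
          (mean1 (n c) (d c) (\<mu> c) (lam c) (A c * cov_mat (d c) (\<mu> c)) *
           mean2 (n c) (d c) (\<mu> c) (lam c) (cov_mat (d c) (\<mu> c)) (B c)))\<bar> \<le> L / real (n c)"
proof -
  interpret AC: n_sample C M H n d \<mu> lam "\<lambda>c. A c * cov_mat (d c) (\<mu> c)" B "max K (K * 1)"
    by (rule n_sample_test[OF test_A_cov])
  interpret CO: n_sample C M H n d \<mu> lam "\<lambda>c. cov_mat (d c) (\<mu> c)" B "max K 1"
    by (rule n_sample_test[OF test_cov])
  define v where "v c = 1 / (1 + mean1 (n c) (d c) (\<mu> c) (lam c) (cov_mat (d c) (\<mu> c))) *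
        (mean2 (n c) (d c) (\<mu> c) (lam c) (A c * cov_mat (d c) (\<mu> c)) (B c) -
         1 / (1 + mean1 (n c) (d c) (\<mu> c) (lam c) (cov_mat (d c) (\<mu> c))) *
          (mean1 (n c) (d c) (\<mu> c) (lam c) (A c * cov_mat (d c) (\<mu> c)) *
           mean2 (n c) (d c) (\<mu> c) (lam c) (cov_mat (d c) (\<mu> c)) (B c)))" for c
  have so: "second_order E1 (\<lambda>e. n (fst e)) (\<lambda>e. S (fst e)) (\<lambda>e x. y2 (fst e) (RL (fst e) (snd e) x)) (\<lambda>e. v (fst e))"
  proof (rule second_order_cong[OF second_order_mult[OF second_order_inv_cov second_order_diff[OF
        AC.second_order_loo_T2[folded mean2_def] second_order_mult[OF second_order_inv_cov
        second_order_mult[OF AC.second_order_loo_T1[folded mean1_def] CO.second_order_loo_T2[folded mean2_def]]]]]])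
    fix e x assume "e \<in> E1" and x: "x \<in> space (S (fst e))"
    hence c: "fst e \<in> C" by simp
    define \<Sigma> N where "\<Sigma> = cov_mat (d (fst e)) (\<mu> (fst e))" and "N = RL (fst e) (snd e) x"
    have car: "\<Sigma> \<in> carrier_mat (d (fst e)) (d (fst e))" "N \<in> carrier_mat (d (fst e)) (d (fst e))"
      "A (fst e) \<in> carrier_mat (d (fst e)) (d (fst e))" "B (fst e) \<in> carrier_mat (d (fst e)) (d (fst e))"
      using A_carrier[OF c] B_carrier[OF c] RL_carrier[OF c x] by (auto simp: \<Sigma>_def N_def)
    note assoc = mult_mat_assoc_square[where d = "d (fst e)"]
    have "mat_trace (\<Sigma> * (N * A (fst e))) = mat_trace (A (fst e) * \<Sigma> * N)"
      using car mat_trace_comm[of "\<Sigma> * N" "d (fst e)" "A (fst e)"] by (simp add: assoc)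
    moreover have "mat_trace (\<Sigma> * (N * B (fst e) * N * A (fst e))) = mat_trace (A (fst e) * \<Sigma> * N * B (fst e) * N)"
      using car mat_trace_comm[of "\<Sigma> * (N * B (fst e) * N)" "d (fst e)" "A (fst e)"] by (simp add: assoc)
    moreover have "mat_trace (\<Sigma> * (N * B (fst e) * N)) = mat_trace (\<Sigma> * N * B (fst e) * N)"
      using car by (simp add: assoc)
    ultimately show "y2 (fst e) (RL (fst e) (snd e) x) = 1 / (1 + q (fst e) (RL (fst e) (snd e) x)) *
        (1 / real (n (fst e)) * mat_trace (A (fst e) * cov_mat (d (fst e)) (\<mu> (fst e)) * RL (fst e) (snd e) x * B (fst e) * RL (fst e) (snd e) x) -
         1 / (1 + q (fst e) (RL (fst e) (snd e) x)) *
          (1 / real (n (fst e)) * mat_trace (A (fst e) * cov_mat (d (fst e)) (\<mu> (fst e)) * RL (fst e) (snd e) x) *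
           (1 / real (n (fst e)) * mat_trace (cov_mat (d (fst e)) (\<mu> (fst e)) * RL (fst e) (snd e) x * B (fst e) * RL (fst e) (snd e) x))))"
      unfolding \<Sigma>_def[symmetric] N_def[symmetric] by (simp only:)
  qed (simp only: v_def)
  from mean_Y2 obtain L1 where L1: "0 \<le> L1" "\<And>c i. c \<in> C \<Longrightarrow> i < n c \<Longrightarrow> integrable (S c) (\<lambda>x. y2 c (RL c i x)) \<Longrightarrow>
     \<bar>(\<integral>x. Y2 c i x \<partial>S c) - (\<integral>x. y2 c (RL c i x) \<partial>S c)\<bar> \<le> L1 / real (n c)" by blast
  from second_order_expectation[OF so] obtain L2 where L2: "0 \<le> L2"
    "\<And>c i. c \<in> C \<Longrightarrow> i < n c \<Longrightarrow> \<bar>(\<integral>x. y2 c (RL c i x) \<partial>S c) - v c\<bar> \<le> L2 / real (n c)" by force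
  have "\<bar>mean1 (n c) (d c) (\<mu> c) (lam c) (A c * B c) - lam c * mean2 (n c) (d c) (\<mu> c) (lam c) (A c) (B c) - v c\<bar> \<le> (L1 + L2) / real (n c)"
    if c: "c \<in> C" for c
  proof -
    interpret prob_space "S c" by (rule prob_S[OF c])
    have Y: "integrable (S c) (Y2 c i)" if "i < n c" for i
      using moments_bounded_integrable[OF moments_bounded_Y2, of "(c, i)"] c that by simp
    \<comment> \<open>The row expansion is applied with X = B R, so that its left side is a
      one-resolvent trace.\<close>
    have "(\<integral>x. mat_trace (A c * B c * R c x) \<partial>S c) = (\<integral>x. lam c * T2 c (R c x) + (\<Sum>i<n c. Y2 c i x) \<partial>S c)"
    proof (rule Bochner_Integration.integral_cong[OF refl])
      fix x assume x: "x \<in> space (S c)"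
      note car = A_carrier[OF c] B_carrier[OF c] R_carrier[OF c x]
      show "mat_trace (A c * B c * R c x) = lam c * T2 c (R c x) + (\<Sum>i<n c. Y2 c i x)"
        using trace_mult_ridge_resolvent[OF g(10)[OF c] x_carrier[OF c x] car(1) mult_carrier_mat_square[OF car(2,3)] refl]
          car by (simp add: mult_mat_assoc_square[where d = "d c"])
    qed
    also have "\<dots> = lam c * (\<integral>x. T2 c (R c x) \<partial>S c) + (\<Sum>i<n c. \<integral>x. Y2 c i x \<partial>S c)"
      using integrable_T2[OF c] Y by (subst Bochner_Integration.integral_add) (auto simp: Bochner_Integration.integral_sum)
    finally have "mean1 (n c) (d c) (\<mu> c) (lam c) (A c * B c) - lam c * mean2 (n c) (d c) (\<mu> c) (lam c) (A c) (B c) - v c =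
        1 / real (n c) * (\<Sum>i<n c. \<integral>x. Y2 c i x \<partial>S c) - v c"
      by (simp add: mean1_def mean2_def algebra_simps add_divide_distrib)
    also have "\<bar>\<dots>\<bar> \<le> (L1 + L2) / real (n c)"
    proof (rule abs_average_le[OF g(2)[OF c]])
      fix i assume i: "i < n c"
      have "integrable (S c) (\<lambda>x. y2 c (RL c i x))"
        using moments_bounded_integrable[OF second_order_moments_bounded[OF so], of "(c, i)"] c i by simp
      from L1(2)[OF c i this] L2(2)[OF c i] show "\<bar>(\<integral>x. Y2 c i x \<partial>S c) - v c\<bar> \<le> (L1 + L2) / real (n c)"
        unfolding add_divide_distrib by linarith
    qed
    finally show ?thesis .
  qed
  thus ?thesis unfolding v_def using L1(1) L2(1) by (intro exI[of _ "L1 + L2"]) auto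
qed

end

section \<open>The effective regularisation\<close>

lemma mat_trace_nonneg:
  assumes "P \<in> carrier_mat d d" "\<And>v. v \<in> carrier_vec d \<Longrightarrow> 0 \<le> v \<bullet> (P *\<^sub>v v)"
  shows "0 \<le> mat_trace P"
  unfolding mat_trace_eq_sum_unit[OF assms(1)] by (intro sum_nonneg assms(2)) auto

locale psd_contraction =
  fixes d :: nat and \<Sigma> :: "real mat"
  assumes Sig_bound: "op_bound d 1 \<Sigma>" and Sig_sym: "transpose_mat \<Sigma> = \<Sigma>"
    and Sig_psd: "\<And>v. v \<in> carrier_vec d \<Longrightarrow> 0 \<le> v \<bullet> (\<Sigma> *\<^sub>v v)"
begin

lemma Sig_carrier [simp]: "\<Sigma> \<in> carrier_mat d d"
  by (rule op_boundD(1)[OF Sig_bound])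

lemma Sig_adj: "u \<in> carrier_vec d \<Longrightarrow> v \<in> carrier_vec d \<Longrightarrow> u \<bullet> (\<Sigma> *\<^sub>v v) = (\<Sigma> *\<^sub>v u) \<bullet> v"
  using scalar_prod_mult_mat_vec_transpose[OF Sig_carrier, of u v] Sig_sym by simp

definition "W l = \<Sigma> + l \<cdot>\<^sub>m 1\<^sub>m d"

lemma resolvent_eq: "resolvent \<Sigma> l = minv (W l)"
  by (simp add: resolvent_def W_def carrier_matD[OF Sig_carrier])

lemma W_carrier [simp]: "W l \<in> carrier_mat d d"
  by (simp add: W_def)

lemma W_vec: "v \<in> carrier_vec d \<Longrightarrow> W l *\<^sub>v v = \<Sigma> *\<^sub>v v + l \<cdot>\<^sub>v v"
  by (simp add: W_def add_mult_distrib_mat_vec[OF Sig_carrier smult_carrier_mat[OF one_carrier_mat]] smult_mat_mult_vec[OF one_carrier_mat])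

lemma posdef_W: assumes "0 < l" shows "posdef_mat d l (W l)"
proof
  show "0 < l" by fact
  show "W l \<in> carrier_mat d d" by simp
  show "transpose_mat (W l) = W l"
  proof (rule eq_matI)
    fix i j assume ij: "i < dim_row (W l)" "j < dim_col (W l)"
    hence "i < d" "j < d" using carrier_matD[OF W_carrier[of l]] by auto
    moreover have "\<Sigma> $$ (j, i) = \<Sigma> $$ (i, j)"
      using arg_cong[OF Sig_sym, of "\<lambda>X. X $$ (i, j)"] \<open>i < d\<close> \<open>j < d\<close> carrier_matD[OF Sig_carrier] by simp
    ultimately show "transpose_mat (W l) $$ (i, j) = W l $$ (i, j)"
      using carrier_matD[OF Sig_carrier] by (simp add: W_def)
  qed (use carrier_matD[OF W_carrier[of l]] in auto)
  fix v :: "real vec" assume v: "v \<in> carrier_vec d"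
  have "v \<bullet> (W l *\<^sub>v v) = v \<bullet> (\<Sigma> *\<^sub>v v) + l * (v \<bullet> v)"
    using v by (simp add: W_vec scalar_prod_add_distrib[of _ d])
  thus "l * (v \<bullet> v) \<le> v \<bullet> (W l *\<^sub>v v)" using Sig_psd[OF v] by simp
qed

abbreviation "D l \<equiv> minv (W l)"

lemma D_carrier [simp]: "0 < l \<Longrightarrow> D l \<in> carrier_mat d d"
  by (rule posdef_mat.minv_carrier[OF posdef_W])

lemma D_bound: "0 < l \<Longrightarrow> op_bound d (1 / l) (D l)"
  by (rule posdef_mat.op_bound_minv[OF posdef_W])

text \<open>Both orders of the product give the same vector; this is how the commutation of the
  covariance with its resolvent enters.\<close>

lemma D_Sig_vec:
  assumes "0 < l" "v \<in> carrier_vec d"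
  shows "D l *\<^sub>v (\<Sigma> *\<^sub>v v) = v - l \<cdot>\<^sub>v (D l *\<^sub>v v)" "\<Sigma> *\<^sub>v (D l *\<^sub>v v) = v - l \<cdot>\<^sub>v (D l *\<^sub>v v)"
proof -
  interpret posdef_mat d l "W l" by (rule posdef_W) fact
  have cancel: "a + b = v \<Longrightarrow> a \<in> carrier_vec d \<Longrightarrow> b \<in> carrier_vec d \<Longrightarrow> a = v - b" for a b :: "real vec"
    by (auto intro!: eq_vecI)
  have "D l *\<^sub>v (\<Sigma> *\<^sub>v v) + l \<cdot>\<^sub>v (D l *\<^sub>v v) = v"
    using minv_W_vec[OF assms(2)] assms(2)
    by (simp add: W_vec mult_add_distrib_mat_vec[OF minv_carrier] mult_mat_vec[OF minv_carrier])
  thus "D l *\<^sub>v (\<Sigma> *\<^sub>v v) = v - l \<cdot>\<^sub>v (D l *\<^sub>v v)" using assms(2) by (intro cancel) auto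
  have "\<Sigma> *\<^sub>v (D l *\<^sub>v v) + l \<cdot>\<^sub>v (D l *\<^sub>v v) = v"
    using W_minv_vec[OF assms(2)] W_vec[of "D l *\<^sub>v v" l] assms(2) by simp
  thus "\<Sigma> *\<^sub>v (D l *\<^sub>v v) = v - l \<cdot>\<^sub>v (D l *\<^sub>v v)" using assms(2) by (intro cancel) auto
qed

lemma D_Sig: "0 < l \<Longrightarrow> D l * \<Sigma> = 1\<^sub>m d - l \<cdot>\<^sub>m D l"
proof (rule eq_mat_mult_vec[where d = d])
  fix v :: "real vec" assume l: "0 < l" and v: "v \<in> carrier_vec d"
  show "(D l * \<Sigma>) *\<^sub>v v = (1\<^sub>m d - l \<cdot>\<^sub>m D l) *\<^sub>v v"
    using l v unfolding minus_mult_distrib_mat_vec[OF one_carrier_mat smult_carrier_mat[OF D_carrier[OF l]] v]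
    by (simp add: mult_mat_vec_assoc_square[where d = d] D_Sig_vec smult_mat_mult_vec[where d = d])
qed (auto intro!: minus_carrier_mat smult_carrier_mat D_carrier)

text \<open>Substituting v = W w turns the form into |Sigma w|^2 + l (w . Sigma w).\<close>

lemma Sig_D_psd:
  assumes "0 < l" "v \<in> carrier_vec d" shows "0 \<le> v \<bullet> ((\<Sigma> * D l) *\<^sub>v v)"
proof -
  interpret posdef_mat d l "W l" by (rule posdef_W) fact
  define w where "w = D l *\<^sub>v v"
  have w: "w \<in> carrier_vec d" using assms by (simp add: w_def)
  have "v \<bullet> ((\<Sigma> * D l) *\<^sub>v v) = (W l *\<^sub>v w) \<bullet> (\<Sigma> *\<^sub>v w)"
    using assms by (simp add: w_def mult_mat_vec_assoc_square[where d = d])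
  also have "\<dots> = (\<Sigma> *\<^sub>v w) \<bullet> (\<Sigma> *\<^sub>v w) + l * (w \<bullet> (\<Sigma> *\<^sub>v w))"
    using w by (simp add: W_vec add_scalar_prod_distrib[of _ d])
  also have "0 \<le> \<dots>" using Sig_psd[OF w] assms(1) by simp
  finally show ?thesis .
qed

text \<open>The same substitution for two resolvents; after one factor is moved across by symmetry,
  every term of the expansion is visibly nonnegative.\<close>

lemma Sig_D_D_psd:
  assumes "0 < l" "0 < l'" "v \<in> carrier_vec d" shows "0 \<le> v \<bullet> ((\<Sigma> * D l * D l') *\<^sub>v v)"
proof -
  interpret P: posdef_mat d l "W l" by (rule posdef_W) fact
  interpret P': posdef_mat d l' "W l'" by (rule posdef_W) fact
  define w where "w = D l *\<^sub>v (D l' *\<^sub>v v)"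
  have w: "w \<in> carrier_vec d" using assms by (simp add: w_def)
  define u where "u = \<Sigma> *\<^sub>v w"
  have u: "u \<in> carrier_vec d" using w by (simp add: u_def)
  have "v = W l' *\<^sub>v (W l *\<^sub>v w)" using assms by (simp add: w_def)
  hence "v \<bullet> ((\<Sigma> * D l * D l') *\<^sub>v v) = (W l' *\<^sub>v (W l *\<^sub>v w)) \<bullet> u"
    using assms by (simp add: w_def u_def mult_mat_vec_assoc_square[where d = d])
  also have "\<dots> = (W l *\<^sub>v w) \<bullet> (W l' *\<^sub>v u)"
    using P'.W_adj[of "W l *\<^sub>v w" u] w u by simp
  also have "\<dots> = u \<bullet> (\<Sigma> *\<^sub>v u) + l' * (u \<bullet> u) + l * (w \<bullet> (\<Sigma> *\<^sub>v u)) + l * l' * (w \<bullet> u)"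
    using w u
    by (simp add: W_vec u_def[symmetric] add_scalar_prod_distrib[of _ d] scalar_prod_add_distrib[of _ d] algebra_simps)
  also have "w \<bullet> (\<Sigma> *\<^sub>v u) = u \<bullet> u" using Sig_adj[OF w u] by (simp add: u_def)
  also have "0 \<le> u \<bullet> (\<Sigma> *\<^sub>v u) + l' * (u \<bullet> u) + l * (u \<bullet> u) + l * l' * (w \<bullet> u)"
    using Sig_psd[OF u] Sig_psd[OF w] assms by (simp add: u_def)
  finally show ?thesis .
qed

lemma trace_Sig_D_D_nonneg: "0 < l \<Longrightarrow> 0 < l' \<Longrightarrow> 0 \<le> mat_trace (\<Sigma> * D l * D l')"
  by (rule mat_trace_nonneg[where d = d]) (use Sig_D_D_psd in auto)

text \<open>The resolvent identity under the trace. It yields both monotonicity and continuity of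
  the right side of the equation for \<open>lambda_star\<close>.\<close>

lemma trace_resolvent_identity:
  assumes "0 < l" "0 < l'"
  shows "mat_trace (\<Sigma> * D l) - mat_trace (\<Sigma> * D l') = (l' - l) * mat_trace (\<Sigma> * D l * D l')"
proof -
  interpret P: posdef_mat d l "W l" by (rule posdef_W) fact
  interpret P': posdef_mat d l' "W l'" by (rule posdef_W) fact
  have "D l *\<^sub>v v = D l' *\<^sub>v v + (l' - l) \<cdot>\<^sub>v (D l *\<^sub>v (D l' *\<^sub>v v))" if v: "v \<in> carrier_vec d" for v
  proof -
    define w where "w = D l' *\<^sub>v v"
    have w: "w \<in> carrier_vec d" using v assms by (simp add: w_def)
    have "v = W l' *\<^sub>v w" using v by (simp add: w_def)
    also have "\<dots> = W l *\<^sub>v w + (l' - l) \<cdot>\<^sub>v w"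
      using w carrier_matD[OF Sig_carrier] by (auto intro!: eq_vecI simp: W_vec algebra_simps)
    finally have "D l *\<^sub>v v = D l *\<^sub>v (W l *\<^sub>v w) + (l' - l) \<cdot>\<^sub>v (D l *\<^sub>v w)"
      using w assms by (simp add: mult_add_distrib_mat_vec[OF D_carrier] mult_mat_vec[OF D_carrier])
    thus ?thesis using w by (simp add: w_def)
  qed
  hence "D l = D l' + (l' - l) \<cdot>\<^sub>m (D l * D l')"
    using assms by (intro eq_mat_mult_vec[where d = d])
      (auto simp: add_mult_distrib_mat_vec[of _ d d] smult_mat_mult_vec[where d = d] mult_mat_vec_assoc_square[where d = d])
  hence "\<Sigma> * D l = \<Sigma> * (D l' + (l' - l) \<cdot>\<^sub>m (D l * D l'))" by (rule arg_cong)
  also have "\<dots> = \<Sigma> * D l' + (l' - l) \<cdot>\<^sub>m (\<Sigma> * D l * D l')"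
    unfolding mult_add_distrib_mat[OF Sig_carrier D_carrier[OF assms(2)]
        smult_carrier_mat[OF mult_carrier_mat_square[OF D_carrier[OF assms(1)] D_carrier[OF assms(2)]]]]
      mult_smult_distrib[OF Sig_carrier mult_carrier_mat_square[OF D_carrier[OF assms(1)] D_carrier[OF assms(2)]]]
      mult_mat_assoc_square[OF Sig_carrier D_carrier[OF assms(1)] D_carrier[OF assms(2)]] ..
  finally have eq: "\<Sigma> * D l = \<Sigma> * D l' + (l' - l) \<cdot>\<^sub>m (\<Sigma> * D l * D l')" .
  note SD = mult_carrier_mat_square[OF Sig_carrier D_carrier]
  note SDD = mult_carrier_mat_square[OF SD[OF assms(1)] D_carrier[OF assms(2)]]
  have "mat_trace (\<Sigma> * D l) = mat_trace (\<Sigma> * D l') + (l' - l) * mat_trace (\<Sigma> * D l * D l')"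
    using arg_cong[OF eq, of mat_trace]
    unfolding mat_trace_add[OF SD[OF assms(2)] smult_carrier_mat[OF SDD]] mat_trace_smult[OF SDD] .
  thus ?thesis by simp
qed

lemma abs_trace_Sig_D: "0 < l \<Longrightarrow> \<bar>mat_trace (\<Sigma> * D l)\<bar> \<le> real d / l"
  using op_bound_trace[OF op_bound_mult[OF Sig_bound D_bound]] by simp

lemma continuous_trace_Sig_D: "continuous_on {0<..} (\<lambda>l. mat_trace (\<Sigma> * D l))"
proof (rule continuous_at_imp_continuous_on, rule ballI)
  fix l :: real assume "l \<in> {0<..}"
  hence l: "0 < l" by simp
  have bd: "\<bar>mat_trace (\<Sigma> * D l') - mat_trace (\<Sigma> * D l)\<bar> \<le> \<bar>l' - l\<bar> * (real d * (2 / l\<^sup>2))" if "\<bar>l' - l\<bar> < l / 2" for l'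
  proof -
    have l': "l / 2 < l'" "0 < l'" using that l unfolding abs_less_iff by auto
    have "\<bar>mat_trace (\<Sigma> * D l * D l')\<bar> \<le> real d * (1 * (1 / l) * (1 / l'))"
      using op_bound_trace[OF op_bound_mult[OF op_bound_mult[OF Sig_bound D_bound[OF l]] D_bound[OF l'(2)]]] .
    \<comment> \<open>The factor 2 comes from l' > l / 2.\<close>
    also have "\<dots> \<le> real d * (2 / l\<^sup>2)"
      using l l' by (intro mult_left_mono) (auto simp: field_simps power2_eq_square)
    finally have "\<bar>l' - l\<bar> * \<bar>mat_trace (\<Sigma> * D l * D l')\<bar> \<le> \<bar>l' - l\<bar> * (real d * (2 / l\<^sup>2))"
      by (rule mult_left_mono) simp
    thus ?thesis
      unfolding abs_mult[symmetric] trace_resolvent_identity[OF l l'(2), symmetric] by (simp only: abs_minus_commute)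
  qed
  have "((\<lambda>l'. mat_trace (\<Sigma> * D l')) \<longlongrightarrow> mat_trace (\<Sigma> * D l)) (at l)"
  proof (rule LIM_zero_cancel, rule tendsto_rabs_zero_cancel,
      rule tendsto_sandwich[where f = "\<lambda>_. 0" and h = "\<lambda>l'. \<bar>l' - l\<bar> * (real d * (2 / l\<^sup>2))"])
    have "eventually (\<lambda>l'. \<bar>l' - l\<bar> < l / 2) (at l)"
      using l by (auto simp: eventually_at dist_real_def intro!: exI[of _ "l / 2"])
    thus "eventually (\<lambda>l'. \<bar>mat_trace (\<Sigma> * D l') - mat_trace (\<Sigma> * D l)\<bar> \<le> \<bar>l' - l\<bar> * (real d * (2 / l\<^sup>2))) (at l)"
      by eventually_elim (rule bd)
    have "((\<lambda>l'. \<bar>l' - l\<bar> * (real d * (2 / l\<^sup>2))) \<longlongrightarrow> \<bar>l - l\<bar> * (real d * (2 / l\<^sup>2))) (at l)"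
      by (intro tendsto_intros)
    thus "((\<lambda>l'. \<bar>l' - l\<bar> * (real d * (2 / l\<^sup>2))) \<longlongrightarrow> 0) (at l)" by simp
  qed (auto intro: tendsto_const)
  thus "isCont (\<lambda>l. mat_trace (\<Sigma> * D l)) l" by (simp add: isCont_def)
qed

text \<open>The difference G of the two sides is strictly increasing and changes sign on the stated
  interval. This gives existence and uniqueness, so the definite description denotes the
  solution.\<close>

lemma lambda_star_props:
  assumes n: "1 \<le> n" and lam: "0 < lam"
  defines "ls \<equiv> lambda_star n \<Sigma> lam"
  shows "lam \<le> ls" "ls \<le> lam + real d / real n" "real n * (1 - lam / ls) = mat_trace (\<Sigma> * D ls)"
proof -
  define G where "G l = real n * (1 - lam / l) - mat_trace (\<Sigma> * D l)" for l
  have n': "0 < real n" using n by simp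
  have mono: "G l < G l'" if "0 < l" "l < l'" for l l'
  proof -
    have "mat_trace (\<Sigma> * D l') \<le> mat_trace (\<Sigma> * D l)"
      using trace_resolvent_identity[of l l'] mult_nonneg_nonneg[of "l' - l" "mat_trace (\<Sigma> * D l * D l')"]
        trace_Sig_D_D_nonneg[of l l'] that by linarith
    moreover have "real n * (1 - lam / l) < real n * (1 - lam / l')"
      using that lam n' by (simp add: divide_strict_left_mono)
    ultimately show ?thesis unfolding G_def by linarith
  qed
  \<comment> \<open>The right end is chosen so that n (1 - lam / b) equals d / b exactly, which is
    the crude upper bound for the trace at b.\<close>
  define b where "b = lam + real d / real n"
  have b: "lam \<le> b" "0 < b" using lam n' by (auto simp: b_def add_pos_nonneg)
  have "\<exists>l\<ge>lam. l \<le> b \<and> G l = 0"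
  proof (rule IVT')
    have "0 \<le> mat_trace (\<Sigma> * D lam)" by (rule mat_trace_nonneg[where d = d]) (use Sig_D_psd lam in auto)
    thus "G lam \<le> 0" using lam by (simp add: G_def)
    have "real n * (1 - lam / b) = real d / b"
      using b(2) n' by (simp add: b_def field_simps)
    thus "0 \<le> G b" using abs_trace_Sig_D[OF b(2)] unfolding G_def by linarith
    show "continuous_on {lam..b} G"
      unfolding G_def using lam
      by (intro continuous_intros continuous_on_subset[OF continuous_trace_Sig_D]) auto
  qed (rule b)
  then obtain l where l: "lam \<le> l" "l \<le> b" "G l = 0" by blast
  have l0: "0 < l" using l lam by simp
  have "ls = l"
    unfolding ls_def lambda_star_def resolvent_eq
  proof (rule the_equality)
    show "0 < l \<and> real n * (1 - lam / l) = mat_trace (\<Sigma> * D l)" using l0 l(3) by (simp add: G_def)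
    fix l' assume "0 < l' \<and> real n * (1 - lam / l') = mat_trace (\<Sigma> * D l')"
    hence "0 < l'" "G l' = 0" by (auto simp: G_def)
    thus "l' = l" using mono[of l l'] mono[of l' l] l0 l(3) by (cases l l' rule: linorder_cases) auto
  qed
  thus "lam \<le> ls" "ls \<le> lam + real d / real n" "real n * (1 - lam / ls) = mat_trace (\<Sigma> * D ls)"
    using l by (auto simp: b_def G_def)
qed

text \<open>The factors commute, so the squares in the effective quantities can be written in the
  alternating order that the mean equations produce.\<close>

lemma trace_square_eq:
  assumes "0 < l" shows "mat_trace ((\<Sigma> ^\<^sub>m 2) * (D l ^\<^sub>m 2)) = mat_trace (\<Sigma> * D l * \<Sigma> * D l)"
proof -
  have sq: "X ^\<^sub>m 2 = X * X" if "X \<in> carrier_mat d d" for X :: "real mat"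
    using that by (simp add: numeral_2_eq_2 left_mult_one_mat[OF that])
  have comm: "D l *\<^sub>v (\<Sigma> *\<^sub>v u) = \<Sigma> *\<^sub>v (D l *\<^sub>v u)" if "u \<in> carrier_vec d" for u
    using D_Sig_vec[OF assms that] by simp
  have "\<Sigma> * \<Sigma> * (D l * D l) = \<Sigma> * D l * \<Sigma> * D l"
    using assms
    by (intro eq_mat_mult_vec[where d = d]) (auto simp: mult_mat_vec_assoc_square[where d = d] comm)
  thus ?thesis using assms by (simp add: sq)
qed

text \<open>Insert D Sigma = 1 - l D. This relates the second order trace to the one fixed by the
  equation for \<open>lambda_star\<close>.\<close>

lemma trace_square_split:
  assumes "0 < l" shows "mat_trace (\<Sigma> * D l * \<Sigma> * D l) = mat_trace (\<Sigma> * D l) - l * mat_trace (\<Sigma> * D l * D l)"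
proof -
  have "\<Sigma> * D l * \<Sigma> * D l = \<Sigma> * (D l * \<Sigma>) * D l" using assms by (simp add: mult_mat_assoc_square[where d = d])
  also have "\<dots> = (\<Sigma> - l \<cdot>\<^sub>m (\<Sigma> * D l)) * D l"
    unfolding D_Sig[OF assms] mult_minus_distrib_mat[OF Sig_carrier one_carrier_mat smult_carrier_mat[OF D_carrier[OF assms]]]
      right_mult_one_mat[OF Sig_carrier] mult_smult_distrib[OF Sig_carrier D_carrier[OF assms]] ..
  also have "\<dots> = \<Sigma> * D l - l \<cdot>\<^sub>m (\<Sigma> * D l * D l)"
    unfolding minus_mult_distrib_mat[OF Sig_carrier smult_carrier_mat[OF mult_carrier_mat_square[OF Sig_carrier D_carrier[OF assms]]] D_carrier[OF assms]]
      mult_smult_assoc_mat[OF mult_carrier_mat_square[OF Sig_carrier D_carrier[OF assms]] D_carrier[OF assms]] ..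
  also have "mat_trace (\<Sigma> * D l - l \<cdot>\<^sub>m (\<Sigma> * D l * D l)) = mat_trace (\<Sigma> * D l) - l * mat_trace (\<Sigma> * D l * D l)"
    using assms carrier_matD[OF D_carrier[OF assms]] carrier_matD[OF Sig_carrier]
    by (simp add: mat_trace_def sum_subtractf sum_distrib_left)
  finally show ?thesis .
qed

end

section \<open>Deterministic equivalents\<close>

text \<open>Deterministic O(1); \<open>small_family\<close> below is deterministic O(1 / n). Closure
  rules for the two let error terms be combined without explicit constants.\<close>

definition bounded_family :: "'c set \<Rightarrow> ('c \<Rightarrow> real) \<Rightarrow> bool" where
  "bounded_family C f \<longleftrightarrow> (\<exists>L. \<forall>c\<in>C. \<bar>f c\<bar> \<le> L)"

definition small_family :: "'c set \<Rightarrow> ('c \<Rightarrow> nat) \<Rightarrow> ('c \<Rightarrow> real) \<Rightarrow> bool" where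
  "small_family C n f \<longleftrightarrow> bounded_family C (\<lambda>c. real (n c) * f c)"

lemma bounded_familyI: "(\<And>c. c \<in> C \<Longrightarrow> \<bar>f c\<bar> \<le> L) \<Longrightarrow> bounded_family C f"
  by (auto simp: bounded_family_def)

lemma bounded_family_add: "bounded_family C f \<Longrightarrow> bounded_family C g \<Longrightarrow> bounded_family C (\<lambda>c. f c + g c)"
  unfolding bounded_family_def by (elim exE) (rule exI, rule ballI, rule order_trans[OF abs_triangle_ineq add_mono], auto)

lemma bounded_family_mult: "bounded_family C f \<Longrightarrow> bounded_family C g \<Longrightarrow> bounded_family C (\<lambda>c. f c * g c)"
  unfolding bounded_family_def abs_mult
  by (elim exE, rule exI, rule ballI, rule mult_mono) (auto intro: order_trans[OF abs_ge_zero])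

lemma bounded_family_minus: "bounded_family C f \<Longrightarrow> bounded_family C (\<lambda>c. - f c)"
  by (simp add: bounded_family_def)

lemma bounded_family_diff: "bounded_family C f \<Longrightarrow> bounded_family C g \<Longrightarrow> bounded_family C (\<lambda>c. f c - g c)"
  using bounded_family_add[OF _ bounded_family_minus, of C f g] by simp

lemma bounded_family_const: "bounded_family C (\<lambda>c. k)"
  by (rule bounded_familyI[where L = "\<bar>k\<bar>"]) simp

lemmas bounded_family_intros = bounded_family_add bounded_family_mult bounded_family_minus bounded_family_diff bounded_family_const

lemma small_family_add: "small_family C n f \<Longrightarrow> small_family C n g \<Longrightarrow> small_family C n (\<lambda>c. f c + g c)"
  unfolding small_family_def by (drule (1) bounded_family_add) (simp add: distrib_left)

lemma small_family_minus: "small_family C n f \<Longrightarrow> small_family C n (\<lambda>c. - f c)"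
  unfolding small_family_def by (drule bounded_family_minus) simp

lemma small_family_diff: "small_family C n f \<Longrightarrow> small_family C n g \<Longrightarrow> small_family C n (\<lambda>c. f c - g c)"
  using small_family_add[OF _ small_family_minus, of C n f g] by simp

lemma small_family_mult: "bounded_family C g \<Longrightarrow> small_family C n f \<Longrightarrow> small_family C n (\<lambda>c. g c * f c)"
  unfolding small_family_def by (drule (1) bounded_family_mult) (simp add: mult_ac)

lemma small_family_cong: "small_family C n f \<Longrightarrow> (\<And>c. c \<in> C \<Longrightarrow> g c = f c) \<Longrightarrow> small_family C n g"
  by (simp add: small_family_def bounded_family_def)

lemma small_familyI:
  assumes "\<exists>L\<ge>0. \<forall>c\<in>C. \<bar>f c\<bar> \<le> L / real (n c)" "\<And>c. c \<in> C \<Longrightarrow> 1 \<le> n c"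
  shows "small_family C n f"
proof -
  from assms(1) obtain L where L: "\<And>c. c \<in> C \<Longrightarrow> \<bar>f c\<bar> \<le> L / real (n c)" by blast
  have "\<bar>real (n c) * f c\<bar> \<le> L" if "c \<in> C" for c
    using L[OF that] assms(2)[OF that] by (simp add: abs_mult field_simps)
  thus ?thesis unfolding small_family_def by (rule bounded_familyI)
qed

lemma scale_difference: "(a :: real) = b - l * e \<Longrightarrow> k * a = k * b - l * (k * e)"
  by (simp only: right_diff_distrib mult.left_commute)

locale effective =
  fixes C :: "'c set" and M :: real and H :: "real \<Rightarrow> nat \<Rightarrow> real" and n d :: "'c \<Rightarrow> nat"
    and \<mu> :: "'c \<Rightarrow> real vec measure" and lam :: "'c \<Rightarrow> real"
  assumes good: "\<And>c. c \<in> C \<Longrightarrow> sample_model M H (n c) (d c) (\<mu> c) (lam c)"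
    and cov_psd: "\<And>c v. c \<in> C \<Longrightarrow> v \<in> carrier_vec (d c) \<Longrightarrow> 0 \<le> v \<bullet> (cov_mat (d c) (\<mu> c) *\<^sub>v v)"
begin

abbreviation "\<Sigma> c \<equiv> cov_mat (d c) (\<mu> c)"
abbreviation "ls c \<equiv> lambda_star (n c) (\<Sigma> c) (lam c)"
abbreviation "D c \<equiv> resolvent (\<Sigma> c) (ls c)"
abbreviation "h c X \<equiv> mean1 (n c) (d c) (\<mu> c) (lam c) X"
abbreviation "g2 c X Y \<equiv> mean2 (n c) (d c) (\<mu> c) (lam c) X Y"
abbreviation "tr c X \<equiv> 1 / real (n c) * mat_trace X"
abbreviation "m c \<equiv> h c (\<Sigma> c)"
text \<open>The empirical counterpart of \<open>lambda_star\<close>: in the mean equations 1 / (1 +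
  m) equals lam / kap.\<close>

abbreviation "kap c \<equiv> lam c * (1 + m c)"
abbreviation "t c \<equiv> tr c (\<Sigma> c * D c * \<Sigma> c * D c)"

lemmas g = sample_modelD[OF good]

lemma psdc: "c \<in> C \<Longrightarrow> psd_contraction (d c) (\<Sigma> c)"
  by unfold_locales (use g(8) transpose_cov_mat cov_psd in auto)

lemma n_pos: "c \<in> C \<Longrightarrow> 0 < real (n c)"
  using g(2) by fastforce

lemma d_le: "c \<in> C \<Longrightarrow> real (d c) / real (n c) \<le> M"
  using g(3) n_pos by (simp add: divide_le_eq)

text \<open>The bound 2 M adds lam <= M and d / n <= M. The lower bound for 1 - t holds because 1 -
  t exceeds lam / ls by ls times a nonnegative trace.\<close>

lemma ls_props:
  assumes c: "c \<in> C"
  shows "0 < ls c" "lam c \<le> ls c" "ls c \<le> 2 * M" "1 / ls c \<le> M"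
    "1 - lam c / ls c = tr c (\<Sigma> c * D c)" "lam c / ls c \<le> 1 - t c" "0 \<le> t c"
    "t c = tr c (\<Sigma> c * D c) - ls c * tr c (\<Sigma> c * D c * D c)"
    "t c = trace_square (n c) (\<Sigma> c) (lam c) / real (n c)"
proof -
  interpret psd: psd_contraction "d c" "\<Sigma> c" by (rule psdc[OF c])
  note p = psd.lambda_star_props[OF g(2)[OF c] g(10)[OF c]]
  show l: "lam c \<le> ls c" by (rule p)
  with g(10)[OF c] show l0: "0 < ls c" by simp
  show "ls c \<le> 2 * M" using p(2) d_le[OF c] g(5)[OF c] by simp
  have "1 / ls c \<le> 1 / lam c" using l g(10)[OF c] by (simp add: frac_le)
  thus "1 / ls c \<le> M" using g(11)[OF c] by linarith
  show e: "1 - lam c / ls c = tr c (\<Sigma> c * D c)" using p(3) n_pos[OF c] by (simp add: psd.resolvent_eq field_simps)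
  show s: "t c = tr c (\<Sigma> c * D c) - ls c * tr c (\<Sigma> c * D c * D c)"
    unfolding psd.resolvent_eq by (rule scale_difference[OF psd.trace_square_split[OF l0]])
  have "0 \<le> ls c * tr c (\<Sigma> c * D c * D c)"
    using l0 psd.trace_Sig_D_D_nonneg[OF l0 l0] by (simp add: psd.resolvent_eq)
  with s e show "lam c / ls c \<le> 1 - t c" by linarith
  show "t c = trace_square (n c) (\<Sigma> c) (lam c) / real (n c)"
    using psd.trace_square_eq[OF l0] by (simp add: trace_square_def psd.resolvent_eq)
  have "0 \<le> mat_trace (\<Sigma> c * D c * \<Sigma> c * D c)"
  proof (rule mat_trace_nonneg)
    show "\<Sigma> c * D c * \<Sigma> c * D c \<in> carrier_mat (d c) (d c)" using l0 by (simp add: psd.resolvent_eq)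
    fix v :: "real vec" assume v: "v \<in> carrier_vec (d c)"
    interpret P: posdef_mat "d c" "ls c" "psd.W (ls c)" by (rule psd.posdef_W[OF l0])
    define u where "u = \<Sigma> c *\<^sub>v (minv (psd.W (ls c)) *\<^sub>v v)"
    have u: "u \<in> carrier_vec (d c)" using v l0 by (simp add: u_def)
    have "v \<bullet> ((\<Sigma> c * D c * \<Sigma> c * D c) *\<^sub>v v) = v \<bullet> (\<Sigma> c *\<^sub>v (minv (psd.W (ls c)) *\<^sub>v u))"
      using v l0 by (simp add: psd.resolvent_eq u_def)
    also have "\<dots> = (minv (psd.W (ls c)) *\<^sub>v (\<Sigma> c *\<^sub>v v)) \<bullet> u"
      using v u psd.Sig_adj[of v "minv (psd.W (ls c)) *\<^sub>v u"] P.minv_adj[of "\<Sigma> c *\<^sub>v v" u] by simp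
    also have "minv (psd.W (ls c)) *\<^sub>v (\<Sigma> c *\<^sub>v v) = u"
      using psd.D_Sig_vec[OF l0 v] by (simp add: u_def)
    finally show "0 \<le> v \<bullet> ((\<Sigma> c * D c * \<Sigma> c * D c) *\<^sub>v v)" by simp
  qed
  thus "0 \<le> t c" by simp
qed

lemma D_bound: "c \<in> C \<Longrightarrow> op_bound (d c) M (D c)"
proof -
  assume c: "c \<in> C"
  interpret psd: psd_contraction "d c" "\<Sigma> c" by (rule psdc[OF c])
  show ?thesis
    unfolding psd.resolvent_eq by (rule op_bound_mono[OF psd.D_bound[OF ls_props(1)[OF c]] ls_props(4)[OF c]])
qed

lemma D_carrier [simp]: "c \<in> C \<Longrightarrow> D c \<in> carrier_mat (d c) (d c)"
  by (rule op_boundD(1)[OF D_bound])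

lemma n_sampleI:
  assumes "\<And>c. c \<in> C \<Longrightarrow> test_mat (n c) (d c) K (X c)" "\<And>c. c \<in> C \<Longrightarrow> op_bound (d c) K' (Y c)"
  shows "n_sample C M H n d \<mu> lam X Y (max K K')"
proof
  fix c assume c: "c \<in> C"
  show "sample_model M H (n c) (d c) (\<mu> c) (lam c)" by (rule good[OF c])
  show "op_bound (d c) (max K K') (Y c)" by (rule op_bound_mono[OF assms(2)[OF c]]) simp
  show "test_mat (n c) (d c) (max K K') (X c)"
    using assms(1)[OF c] unfolding test_mat_def by (meson max.cobounded1 op_bound_mono order_trans)
qed

lemma test_cov: "c \<in> C \<Longrightarrow> test_mat (n c) (d c) 1 (\<Sigma> c)"
  by (rule test_mat_op_bound[OF g(8)])

lemma bounded_tr: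
  assumes "\<And>c. c \<in> C \<Longrightarrow> test_mat (n c) (d c) K (X c)" shows "bounded_family C (\<lambda>c. tr c (X c))"
proof -
  interpret n_sample C M H n d \<mu> lam X "\<lambda>c. 1\<^sub>m (d c)" "max K 1" by (rule n_sampleI[OF assms op_bound_one])
  show ?thesis
  proof (rule bounded_familyI)
    fix c assume c: "c \<in> C"
    from trace_test_bound[OF c A[OF c]] n_pos[OF c]
    show "\<bar>tr c (X c)\<bar> \<le> max K 1 * (M + 1)" by (simp add: abs_mult divide_le_eq)
  qed
qed

lemma bounded_h:
  assumes "\<And>c. c \<in> C \<Longrightarrow> test_mat (n c) (d c) K (X c)" shows "bounded_family C (\<lambda>c. h c (X c))"
proof -
  interpret n_sample C M H n d \<mu> lam X "\<lambda>c. 1\<^sub>m (d c)" "max K 1" by (rule n_sampleI[OF assms op_bound_one])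
  show ?thesis unfolding mean1_def by (rule bounded_familyI, rule abs_mean_le[OF _ T1_bound integrable_T1])
qed

lemma bounded_g2:
  assumes "\<And>c. c \<in> C \<Longrightarrow> test_mat (n c) (d c) K (X c)" "\<And>c. c \<in> C \<Longrightarrow> op_bound (d c) K' (Y c)"
  shows "bounded_family C (\<lambda>c. g2 c (X c) (Y c))"
proof -
  interpret n_sample C M H n d \<mu> lam X Y "max K K'" by (rule n_sampleI[OF assms])
  show ?thesis unfolding mean2_def by (rule bounded_familyI, rule abs_mean_le[OF _ T2_bound integrable_T2])
qed

text \<open>The identity that closes the mean equations: a covariance factor next to D is traded for
  the bare test matrix.\<close>

lemma X_D_Sig:
  assumes c: "c \<in> C" and X: "X \<in> carrier_mat (d c) (d c)"
  shows "X * D c * \<Sigma> c = X - ls c \<cdot>\<^sub>m (X * D c)"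
proof -
  interpret psd: psd_contraction "d c" "\<Sigma> c" by (rule psdc[OF c])
  note l0 = ls_props(1)[OF c]
  have "X * D c * \<Sigma> c = X * (D c * \<Sigma> c)" using X c by (simp add: mult_mat_assoc_square[where d = "d c"])
  also have "D c * \<Sigma> c = 1\<^sub>m (d c) - ls c \<cdot>\<^sub>m D c" unfolding psd.resolvent_eq by (rule psd.D_Sig[OF l0])
  also have "X * \<dots> = X - ls c \<cdot>\<^sub>m (X * D c)"
    unfolding mult_minus_distrib_mat[OF X one_carrier_mat smult_carrier_mat[OF D_carrier[OF c]]]
      right_mult_one_mat[OF X] mult_smult_distrib[OF X D_carrier[OF c]] ..
  finally show ?thesis .
qed

lemma trace_diff_smult_mult:
  assumes "X \<in> carrier_mat k k" "Y \<in> carrier_mat k k" "Z \<in> carrier_mat k k"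
  shows "mat_trace ((X - l \<cdot>\<^sub>m Y) * Z) = mat_trace (X * Z) - l * mat_trace (Y * Z)"
proof -
  have "mat_trace ((X - l \<cdot>\<^sub>m Y) * Z) = (\<Sum>i<k. \<Sum>j<k. (X - l \<cdot>\<^sub>m Y) $$ (i, j) * Z $$ (j, i))"
    using assms by (intro mat_trace_mult) (auto intro!: minus_carrier_mat smult_carrier_mat)
  also have "\<dots> = (\<Sum>i<k. \<Sum>j<k. X $$ (i, j) * Z $$ (j, i) - l * (Y $$ (i, j) * Z $$ (j, i)))"
    using assms by (intro sum.cong refl) (auto simp: algebra_simps)
  finally show ?thesis by (simp add: mat_trace_mult[OF assms(1,3)] mat_trace_mult[OF assms(2,3)] sum_subtractf sum_distrib_left)
qed

lemma h_X_D_Sig: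
  assumes X: "\<And>c. c \<in> C \<Longrightarrow> test_mat (n c) (d c) K (X c)" and c: "c \<in> C"
  shows "h c (X c * D c * \<Sigma> c) = h c (X c) - ls c * h c (X c * D c)"
proof -
  interpret X: n_sample C M H n d \<mu> lam X "\<lambda>c. 1\<^sub>m (d c)" "max K 1" by (rule n_sampleI[OF X op_bound_one])
  interpret XD: n_sample C M H n d \<mu> lam "\<lambda>c. X c * D c" "\<lambda>c. 1\<^sub>m (d c)" "max (K * M) 1"
    by (rule n_sampleI[OF test_mat_mult_right[OF X D_bound] op_bound_one])
  have "(\<integral>x. mat_trace (X c * D c * \<Sigma> c * X.R c x) \<partial>X.S c) = (\<integral>x. X.T1 c (X.R c x) - ls c * XD.T1 c (X.R c x) \<partial>X.S c)"
    unfolding X_D_Sig[OF c X.A_carrier[OF c]]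
    using X.A_carrier[OF c] X.R_carrier[OF c] D_carrier[OF c]
    by (intro Bochner_Integration.integral_cong refl trace_diff_smult_mult[where k = "d c"]) auto
  also have "\<dots> = (\<integral>x. X.T1 c (X.R c x) \<partial>X.S c) - ls c * (\<integral>x. XD.T1 c (X.R c x) \<partial>X.S c)"
    using X.integrable_T1[OF c] XD.integrable_T1[OF c] by simp
  finally show ?thesis unfolding mean1_def by (rule scale_difference)
qed

lemma g2_X_D_Sig:
  assumes X: "\<And>c. c \<in> C \<Longrightarrow> test_mat (n c) (d c) K (X c)" and Y: "\<And>c. c \<in> C \<Longrightarrow> op_bound (d c) K' (Y c)" and c: "c \<in> C"
  shows "g2 c (X c * D c * \<Sigma> c) (Y c) = g2 c (X c) (Y c) - ls c * g2 c (X c * D c) (Y c)"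
proof -
  interpret X: n_sample C M H n d \<mu> lam X Y "max K K'" by (rule n_sampleI[OF X Y])
  interpret XD: n_sample C M H n d \<mu> lam "\<lambda>c. X c * D c" Y "max (K * M) K'"
    by (rule n_sampleI[OF test_mat_mult_right[OF X D_bound] Y])
  have "(\<integral>x. mat_trace (X c * D c * \<Sigma> c * X.R c x * Y c * X.R c x) \<partial>X.S c) = (\<integral>x. X.T2 c (X.R c x) - ls c * XD.T2 c (X.R c x) \<partial>X.S c)"
  proof (intro Bochner_Integration.integral_cong refl)
    fix x assume x: "x \<in> space (X.S c)"
    note car = X.A_carrier[OF c] X.B_carrier[OF c] X.R_carrier[OF c x] D_carrier[OF c]
    have "mat_trace ((X c - ls c \<cdot>\<^sub>m (X c * D c)) * (X.R c x * Y c * X.R c x)) =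
        mat_trace (X c * (X.R c x * Y c * X.R c x)) - ls c * mat_trace (X c * D c * (X.R c x * Y c * X.R c x))"
      using car by (intro trace_diff_smult_mult[where k = "d c"]) auto
    moreover have "(X c - ls c \<cdot>\<^sub>m (X c * D c)) \<in> carrier_mat (d c) (d c)"
      using car by (intro minus_carrier_mat smult_carrier_mat) auto
    ultimately show "mat_trace (X c * D c * \<Sigma> c * X.R c x * Y c * X.R c x) = X.T2 c (X.R c x) - ls c * XD.T2 c (X.R c x)"
      unfolding X_D_Sig[OF c car(1)] using car by (simp add: mult_mat_assoc_square[where d = "d c"])
  qed
  also have "\<dots> = (\<integral>x. X.T2 c (X.R c x) \<partial>X.S c) - ls c * (\<integral>x. XD.T2 c (X.R c x) \<partial>X.S c)"
    using X.integrable_T2[OF c] XD.integrable_T2[OF c] by simp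
  finally show ?thesis unfolding mean2_def by (rule scale_difference)
qed

end

text \<open>Pure algebra. If the defect is the residual of the first mean equation for the test
  matrix Sigma D, it equals -(k - s) l / (k s) times 1 + s h. The last factor is at least 1, so a
  small residual forces k close to s.\<close>

lemma kappa_perturbation:
  fixes l s k m h :: real
  assumes "0 < l" "0 < s" "0 < 1 + m" "0 \<le> h" "k = l * (1 + m)"
  shows "k - s = - (k * s / l * (1 / (1 + s * h))) * ((1 - l / s) - l * h - 1 / (1 + m) * (m - s * h))"
proof -
  have k: "0 < k" using assms by simp
  have p: "0 < 1 + s * h" using assms by (simp add: add_pos_nonneg)
  have m: "m = k / l - 1" using assms by simp
  have v: "1 / (1 + m) = l / k" using assms k by simp
  have "(1 - l / s) - l * h - 1 / (1 + m) * (m - s * h) = - ((k - s) * (l / (k * s)) * (1 + s * h))"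
    unfolding v using assms(1,2) k by (simp add: m field_simps)
  also have "- (k * s / l * (1 / (1 + s * h))) * \<dots> = (k - s) * ((k * s / l) * (l / (k * s))) * ((1 / (1 + s * h)) * (1 + s * h))"
    by (simp only: minus_mult_minus mult_ac)
  also have "\<dots> = k - s" using assms(1,2) k p by simp
  finally show ?thesis by simp
qed

context effective
begin

lemma bounded_lam: "bounded_family C lam"
  by (rule bounded_familyI[where L = M]) (use g(5,10) in \<open>fastforce simp: abs_of_pos\<close>)

lemma bounded_inv_lam: "bounded_family C (\<lambda>c. 1 / lam c)"
  by (rule bounded_familyI[where L = M]) (use g(10,11) in fastforce)

lemma bounded_ls: "bounded_family C ls"
  by (rule bounded_familyI[where L = "2 * M"]) (use ls_props(1,3) in \<open>fastforce simp: abs_of_pos\<close>)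

lemma m_nonneg: "c \<in> C \<Longrightarrow> 0 \<le> m c"
proof -
  assume c: "c \<in> C"
  interpret n_sample C M H n d \<mu> lam \<Sigma> "\<lambda>c. 1\<^sub>m (d c)" "max 1 1" by (rule n_sampleI[OF test_cov op_bound_one])
  show ?thesis by (rule mean_cov_nonneg[OF c])
qed

lemma kap_pos: "c \<in> C \<Longrightarrow> 0 < kap c"
  using m_nonneg g(10) by (simp add: add_pos_nonneg)

lemma bounded_kap: "bounded_family C kap"
  by (intro bounded_family_intros bounded_lam bounded_h[OF test_cov])

lemma bounded_inv_kap: "bounded_family C (\<lambda>c. 1 / kap c)"
proof (rule bounded_familyI[where L = M])
  fix c assume c: "c \<in> C"
  have "lam c * 1 \<le> kap c" using m_nonneg[OF c] g(10)[OF c] by (intro mult_left_mono) auto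
  hence "1 / kap c \<le> 1 / lam c" using g(10)[OF c] by (intro frac_le) auto
  thus "\<bar>1 / kap c\<bar> \<le> M" using g(11)[OF c] kap_pos[OF c] by simp
qed

lemma test_Sig_D: "c \<in> C \<Longrightarrow> test_mat (n c) (d c) (1 * M) (\<Sigma> c * D c)"
  by (rule test_mat_mult_right[OF test_cov D_bound])

text \<open>Both matrices are positive semidefinite but need not commute. The row expansion rewrites
  the trace through N P N with P = Sigma D, which is a congruence of P and so positive
  semidefinite.\<close>

lemma trace_Sig_D_ridge_nonneg:
  assumes c: "c \<in> C" and x: "\<And>j. j < n c \<Longrightarrow> x j \<in> carrier_vec (d c)"
  shows "0 \<le> mat_trace (\<Sigma> c * D c * minv (ridge_mat (n c) (d c) (lam c) x {..<n c}))"
proof -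
  define N where "N = minv (ridge_mat (n c) (d c) (lam c) x {..<n c})"
  define P where "P = \<Sigma> c * D c"
  interpret R: posdef_mat "d c" "lam c" "ridge_mat (n c) (d c) (lam c) x {..<n c}"
    by (rule posdef_ridge_mat) (use g(10)[OF c] x in auto)
  interpret psd: psd_contraction "d c" "\<Sigma> c" by (rule psdc[OF c])
  have Nc: "N \<in> carrier_mat (d c) (d c)" by (simp add: N_def)
  have Pc: "P \<in> carrier_mat (d c) (d c)" using c by (simp add: P_def)
  have psd: "0 \<le> v \<bullet> ((N * P * N) *\<^sub>v v)" if v: "v \<in> carrier_vec (d c)" for v
  proof -
    have "v \<bullet> ((N * P * N) *\<^sub>v v) = (N *\<^sub>v v) \<bullet> (P *\<^sub>v (N *\<^sub>v v))"
      using R.minv_adj[of v "P *\<^sub>v (N *\<^sub>v v)"] v Nc Pc by (simp add: N_def[symmetric] mult_mat_vec_assoc_square[where d = "d c"])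
    also have "0 \<le> \<dots>" unfolding P_def psd.resolvent_eq using v Nc by (intro psd.Sig_D_psd ls_props(1)[OF c]) auto
    finally show ?thesis .
  qed
  have "mat_trace (N * P) = lam c * mat_trace (N * N * P) + (\<Sum>i<n c. 1 / real (n c) * (x i \<bullet> ((N * P * N) *\<^sub>v x i)))"
    by (rule trace_mult_ridge_resolvent[OF g(10)[OF c] x Nc Pc N_def])
  moreover have "mat_trace (N * N * P) = mat_trace (N * P * N)"
    using mat_trace_comm[of N "d c" "N * P"] Nc Pc by (simp add: mult_mat_assoc_square[where d = "d c"])
  moreover have "0 \<le> mat_trace (N * P * N)" by (rule mat_trace_nonneg[where d = "d c"]) (use Nc Pc psd in auto)
  moreover have "0 \<le> (\<Sum>i<n c. 1 / real (n c) * (x i \<bullet> ((N * P * N) *\<^sub>v x i)))"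
    by (intro sum_nonneg mult_nonneg_nonneg psd x) auto
  moreover have "mat_trace (P * N) = mat_trace (N * P)" by (rule mat_trace_comm[OF Pc Nc])
  ultimately show ?thesis using g(10)[OF c] unfolding N_def P_def by simp
qed

lemma h_Sig_D_nonneg: "c \<in> C \<Longrightarrow> 0 \<le> h c (\<Sigma> c * D c)"
  unfolding mean1_def
proof (intro mult_nonneg_nonneg Bochner_Integration.integral_nonneg_AE AE_I2)
  fix x assume c: "c \<in> C" and x: "x \<in> space (PiM {..<n c} (\<lambda>_. \<mu> c))"
  have "x j \<in> carrier_vec (d c)" if "j < n c" for j using x that g(9)[OF c] by (auto simp: space_PiM)
  thus "0 \<le> mat_trace (\<Sigma> c * D c * minv (ridge_mat (n c) (d c) (lam c) x {..<n c}))"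
    by (rule trace_Sig_D_ridge_nonneg[OF c])
qed auto

text \<open>Stability of the equation for \<open>lambda_star\<close>: the mean equation at Sigma D
  is that equation up to O(1 / n), and the perturbation formula inverts it.\<close>

lemma small_kap: "small_family C n (\<lambda>c. kap c - ls c)"
proof -
  interpret n_sample C M H n d \<mu> lam "\<lambda>c. \<Sigma> c * D c" "\<lambda>c. 1\<^sub>m (d c)" "max (1 * M) 1"
    by (rule n_sampleI[OF test_Sig_D op_bound_one])
  have "small_family C n (\<lambda>c. tr c (\<Sigma> c * D c) - lam c * h c (\<Sigma> c * D c) - 1 / (1 + m c) * h c (\<Sigma> c * D c * \<Sigma> c))"
    by (rule small_familyI[OF mean_equation1 g(2)])
  moreover have "bounded_family C (\<lambda>c. - (kap c * ls c * (1 / lam c) * (1 / (1 + ls c * h c (\<Sigma> c * D c)))))"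
  proof -
    have "bounded_family C (\<lambda>c. 1 / (1 + ls c * h c (\<Sigma> c * D c)))"
    proof (rule bounded_familyI)
      fix c assume c: "c \<in> C"
      have "0 \<le> ls c * h c (\<Sigma> c * D c)" using ls_props(1)[OF c] h_Sig_D_nonneg[OF c] by simp
      thus "\<bar>1 / (1 + ls c * h c (\<Sigma> c * D c))\<bar> \<le> 1" by simp
    qed
    thus ?thesis by (intro bounded_family_intros bounded_kap bounded_ls bounded_inv_lam)
  qed
  ultimately have "small_family C n (\<lambda>c. - (kap c * ls c * (1 / lam c) * (1 / (1 + ls c * h c (\<Sigma> c * D c)))) *
      (tr c (\<Sigma> c * D c) - lam c * h c (\<Sigma> c * D c) - 1 / (1 + m c) * h c (\<Sigma> c * D c * \<Sigma> c)))"
    by (rule small_family_mult[rotated])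
  thus ?thesis
  proof (rule small_family_cong)
    fix c assume c: "c \<in> C"
    have "kap c - ls c = - (kap c * ls c / lam c * (1 / (1 + ls c * h c (\<Sigma> c * D c)))) *
        ((1 - lam c / ls c) - lam c * h c (\<Sigma> c * D c) - 1 / (1 + m c) * (m c - ls c * h c (\<Sigma> c * D c)))"
      using g(10)[OF c] ls_props(1)[OF c] m_nonneg[OF c] h_Sig_D_nonneg[OF c]
      by (intro kappa_perturbation) auto
    also have "m c - ls c * h c (\<Sigma> c * D c) = h c (\<Sigma> c * D c * \<Sigma> c)"
      by (rule h_X_D_Sig[OF test_cov c, symmetric])
    finally show "kap c - ls c = - (kap c * ls c * (1 / lam c) * (1 / (1 + ls c * h c (\<Sigma> c * D c)))) *
        (tr c (\<Sigma> c * D c) - lam c * h c (\<Sigma> c * D c) - 1 / (1 + m c) * h c (\<Sigma> c * D c * \<Sigma> c))"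
      unfolding ls_props(5)[OF c, symmetric] by simp
  qed
qed

text \<open>The first deterministic equivalent: under normalised traces, lam R behaves like ls D. It
  is the mean equation for X D multiplied by kap, with the difference of kap and ls absorbed into
  the error.\<close>

lemma small_h:
  assumes X: "\<And>c. c \<in> C \<Longrightarrow> test_mat (n c) (d c) K (X c)"
  shows "small_family C n (\<lambda>c. lam c * h c (X c) - ls c * tr c (X c * D c))"
proof -
  note XD = test_mat_mult_right[OF X D_bound]
  interpret n_sample C M H n d \<mu> lam "\<lambda>c. X c * D c" "\<lambda>c. 1\<^sub>m (d c)" "max (K * M) 1"
    by (rule n_sampleI[OF XD op_bound_one])
  have eq: "small_family C n (\<lambda>c. tr c (X c * D c) - lam c * h c (X c * D c) - 1 / (1 + m c) * h c (X c * D c * \<Sigma> c))"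
    by (rule small_familyI[OF mean_equation1 g(2)])
  have "small_family C n (\<lambda>c. (tr c (X c * D c) - lam c * h c (X c * D c)) * (kap c - ls c) -
      kap c * (tr c (X c * D c) - lam c * h c (X c * D c) - 1 / (1 + m c) * h c (X c * D c * \<Sigma> c)))"
    by (intro small_family_diff small_family_mult small_kap eq bounded_family_intros bounded_kap bounded_lam bounded_tr[OF XD] bounded_h[OF XD])
  thus ?thesis
  proof (rule small_family_cong)
    fix c assume c: "c \<in> C"
    have "kap c * (1 / (1 + m c)) = lam c" using m_nonneg[OF c] by simp
    have hx: "h c (X c * D c * \<Sigma> c) = h c (X c) - ls c * h c (X c * D c)" by (rule h_X_D_Sig[OF X c])
    have *: "kap c * (1 / (1 + m c) * z) = lam c * z" for z using \<open>kap c * (1 / (1 + m c)) = lam c\<close> by (simp only: mult.assoc[symmetric])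
    show "lam c * h c (X c) - ls c * tr c (X c * D c) = (tr c (X c * D c) - lam c * h c (X c * D c)) * (kap c - ls c) -
      kap c * (tr c (X c * D c) - lam c * h c (X c * D c) - 1 / (1 + m c) * h c (X c * D c * \<Sigma> c))"
      unfolding right_diff_distrib[of "kap c" "tr c (X c * D c) - lam c * h c (X c * D c)"] * hx
      by (simp add: algebra_simps)
  qed
qed

text \<open>The second mean equation for X D. Unlike the one-resolvent case it does not determine
  the mean by itself: the mean for the covariance in place of X remains, and the choice X = Sigma
  then solves for it.\<close>

lemma small_g2:
  assumes X: "\<And>c. c \<in> C \<Longrightarrow> test_mat (n c) (d c) K (X c)" and Y: "\<And>c. c \<in> C \<Longrightarrow> op_bound (d c) K' (Y c)"
  shows "small_family C n (\<lambda>c. (lam c)\<^sup>2 * g2 c (X c) (Y c) - (ls c)\<^sup>2 * tr c (X c * D c * Y c * D c)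
    - tr c (X c * D c * \<Sigma> c * D c) * ((lam c)\<^sup>2 * g2 c (\<Sigma> c) (Y c)))"
proof -
  note XD = test_mat_mult_right[OF X D_bound]
  note XDY = test_mat_mult_right[OF XD Y] and XDS = test_mat_mult_right[OF XD g(8)]
  interpret n_sample C M H n d \<mu> lam "\<lambda>c. X c * D c" Y "max (K * M) K'"
    by (rule n_sampleI[OF XD Y])
  define X3 where "X3 c = h c (X c * D c * Y c) - lam c * g2 c (X c * D c) (Y c)
     - 1 / (1 + m c) * (g2 c (X c * D c * \<Sigma> c) (Y c) -
         1 / (1 + m c) * (h c (X c * D c * \<Sigma> c) * g2 c (\<Sigma> c) (Y c)))" for c
  have s3: "small_family C n X3"
    unfolding X3_def by (rule small_familyI[OF mean_equation2 g(2)])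
  define s1 where "s1 c = lam c * h c (X c * D c * Y c) - ls c * tr c (X c * D c * Y c * D c)" for c
  define s2 where "s2 c = lam c * h c (X c * D c * \<Sigma> c) - ls c * tr c (X c * D c * \<Sigma> c * D c)" for c
  have s1: "small_family C n s1" unfolding s1_def by (rule small_h[OF XDY])
  have s2: "small_family C n s2" unfolding s2_def by (rule small_h[OF XDS])
  \<comment> \<open>An exact decomposition into multiples of four small quantities: the residual
    \<open>X3\<close>, the two first order errors \<open>s1\<close> and \<open>s2\<close>, and kap -
    ls.\<close>
  have "small_family C n (\<lambda>c. - (lam c * kap c) * X3 c + kap c * s1 c + (ls c * tr c (X c * D c * Y c * D c)) * (kap c - ls c)
     - ((lam c * lam c) * g2 c (X c * D c) (Y c)) * (kap c - ls c) + ((lam c * lam c) * (1 / kap c) * g2 c (\<Sigma> c) (Y c)) * s2 c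
     - ((lam c * lam c) * (1 / kap c) * tr c (X c * D c * \<Sigma> c * D c) * g2 c (\<Sigma> c) (Y c)) * (kap c - ls c))"
    by (intro small_family_add small_family_diff small_family_mult small_kap s1 s2 s3 bounded_family_intros bounded_kap bounded_lam
        bounded_ls bounded_inv_kap bounded_tr[OF test_mat_mult_right[OF XDY D_bound]] bounded_tr[OF test_mat_mult_right[OF XDS D_bound]]
        bounded_g2[OF XD Y] bounded_g2[OF test_cov Y])
  thus ?thesis
  proof (rule small_family_cong)
    fix c assume c: "c \<in> C"
    define l k s where "l = lam c" and "k = kap c" and "s = ls c"
    define a1 a2 h1 h2 gX gD gS where "a1 = tr c (X c * D c * Y c * D c)" and "a2 = tr c (X c * D c * \<Sigma> c * D c)"
      and "h1 = h c (X c * D c * Y c)" and "h2 = h c (X c * D c * \<Sigma> c)"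
      and "gX = g2 c (X c) (Y c)" and "gD = g2 c (X c * D c) (Y c)" and "gS = g2 c (\<Sigma> c) (Y c)"
    have pos: "0 < l" "0 < k" using g(10)[OF c] kap_pos[OF c] by (auto simp: l_def k_def)
    have v: "1 / (1 + m c) = l / k" using pos m_nonneg[OF c] by (simp add: l_def k_def)
    have gx: "g2 c (X c * D c * \<Sigma> c) (Y c) = g2 c (X c) (Y c) - ls c * g2 c (X c * D c) (Y c)"
      by (rule g2_X_D_Sig[OF X Y c])
    have x3: "X3 c = h1 - l * gD - l / k * ((gX - s * gD) - l / k * (h2 * gS))"
      unfolding X3_def v gx h1_def h2_def l_def gD_def gX_def gS_def s_def ..
    have "l\<^sup>2 * gX - s\<^sup>2 * a1 - a2 * (l\<^sup>2 * gS) =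
      - (l * k) * (h1 - l * gD - l / k * ((gX - s * gD) - l / k * (h2 * gS))) + k * (l * h1 - s * a1) + (s * a1) * (k - s)
       - ((l * l) * gD) * (k - s) + ((l * l) * (1 / k) * gS) * (l * h2 - s * a2) - ((l * l) * (1 / k) * a2 * gS) * (k - s)"
      using pos by (simp add: field_simps power2_eq_square)
    thus "(lam c)\<^sup>2 * g2 c (X c) (Y c) - (ls c)\<^sup>2 * tr c (X c * D c * Y c * D c) - tr c (X c * D c * \<Sigma> c * D c) * ((lam c)\<^sup>2 * g2 c (\<Sigma> c) (Y c)) =
      - (lam c * kap c) * X3 c + kap c * s1 c + (ls c * tr c (X c * D c * Y c * D c)) * (kap c - ls c)
     - ((lam c * lam c) * g2 c (X c * D c) (Y c)) * (kap c - ls c) + ((lam c * lam c) * (1 / kap c) * g2 c (\<Sigma> c) (Y c)) * s2 c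
     - ((lam c * lam c) * (1 / kap c) * tr c (X c * D c * \<Sigma> c * D c) * g2 c (\<Sigma> c) (Y c)) * (kap c - ls c)"
      unfolding x3 s1_def s2_def l_def k_def s_def a1_def a2_def h1_def h2_def gX_def gD_def gS_def .
  qed
qed

text \<open>The ratio lam / ls is at least (1 / M) (1 / (2 M)).\<close>

lemma one_minus_t: "c \<in> C \<Longrightarrow> 0 < 1 - t c" "c \<in> C \<Longrightarrow> 1 / (1 - t c) \<le> 2 * M\<^sup>2"
proof -
  assume c: "c \<in> C"
  have lo: "1 / (2 * M\<^sup>2) \<le> lam c / ls c"
  proof -
    have "1 / M * (1 / (2 * M)) \<le> lam c * (1 / ls c)"
      using g(1,4)[OF c] less_imp_le[OF g(10)[OF c]] ls_props(1,3)[OF c] by (intro mult_mono divide_left_mono) auto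
    thus ?thesis by (simp add: power2_eq_square)
  qed
  have p: "0 < 1 / (2 * M\<^sup>2)" using g(1)[OF c] by simp
  show q: "0 < 1 - t c" using ls_props(6)[OF c] lo p by linarith
  have "1 / (2 * M\<^sup>2) \<le> 1 - t c" using ls_props(6)[OF c] lo by linarith
  hence "1 / (1 - t c) \<le> 1 / (1 / (2 * M\<^sup>2))" using p q by (intro frac_le) auto
  thus "1 / (1 - t c) \<le> 2 * M\<^sup>2" by simp
qed

lemma bounded_inv_t: "bounded_family C (\<lambda>c. 1 / (1 - t c))"
  by (rule bounded_familyI[where L = "2 * M\<^sup>2"]) (use one_minus_t in \<open>fastforce simp: abs_of_pos\<close>)

text \<open>With X = Sigma and Y = 1 the two-resolvent equation is linear in its unknown, with
  coefficient 1 - t. Inserting ls tr(Sigma D D) / n = 1 - lam / ls - t and m close to ls / lam - 1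
  collapses the result to t / (1 - t).\<close>

lemma small_variance: "small_family C n (\<lambda>c. m c - lam c * g2 c (\<Sigma> c) (1\<^sub>m (d c)) - t c / (1 - t c))"
proof -
  have e: "small_family C n (\<lambda>c. (lam c)\<^sup>2 * g2 c (\<Sigma> c) (1\<^sub>m (d c)) - (ls c)\<^sup>2 * tr c (\<Sigma> c * D c * 1\<^sub>m (d c) * D c)
    - t c * ((lam c)\<^sup>2 * g2 c (\<Sigma> c) (1\<^sub>m (d c))))"
    by (rule small_g2[OF test_cov op_bound_one])
  have "small_family C n (\<lambda>c. (1 / lam c) * (kap c - ls c) - ((1 / lam c) * (1 / (1 - t c))) *
     ((lam c)\<^sup>2 * g2 c (\<Sigma> c) (1\<^sub>m (d c)) - (ls c)\<^sup>2 * tr c (\<Sigma> c * D c * 1\<^sub>m (d c) * D c) - t c * ((lam c)\<^sup>2 * g2 c (\<Sigma> c) (1\<^sub>m (d c)))))"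
    by (intro small_family_diff small_family_mult small_kap e bounded_family_intros bounded_inv_lam bounded_inv_t)
  thus ?thesis
  proof (rule small_family_cong)
    fix c assume c: "c \<in> C"
    have "\<Sigma> c * D c * 1\<^sub>m (d c) * D c = \<Sigma> c * D c * D c"
      using c right_mult_one_mat[of "\<Sigma> c * D c" "d c" "d c"] by simp
    moreover have "t c = 1 - lam c / ls c - ls c * tr c (\<Sigma> c * D c * D c)"
      using ls_props(5,8)[OF c] by simp
    ultimately have a: "(ls c)\<^sup>2 * tr c (\<Sigma> c * D c * 1\<^sub>m (d c) * D c) = ls c * (1 - lam c / ls c - t c)"
      by (simp add: power2_eq_square)
    define l s u \<gamma> mm where "l = lam c" and "s = ls c" and "u = t c" and "\<gamma> = g2 c (\<Sigma> c) (1\<^sub>m (d c))" and "mm = m c"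
    have p: "0 < l" "0 < s" "0 < 1 - u" using g(10)[OF c] ls_props(1)[OF c] one_minus_t(1)[OF c] by (auto simp: l_def s_def u_def)
    have "mm - l * \<gamma> - u / (1 - u) = (1 / l) * (l * (1 + mm) - s) - ((1 / l) * (1 / (1 - u))) * (l\<^sup>2 * \<gamma> - s * (1 - l / s - u) - u * (l\<^sup>2 * \<gamma>))"
      using p by (simp add: field_simps power2_eq_square)
    thus "m c - lam c * g2 c (\<Sigma> c) (1\<^sub>m (d c)) - t c / (1 - t c) = (1 / lam c) * (kap c - ls c) - ((1 / lam c) * (1 / (1 - t c))) *
     ((lam c)\<^sup>2 * g2 c (\<Sigma> c) (1\<^sub>m (d c)) - (ls c)\<^sup>2 * tr c (\<Sigma> c * D c * 1\<^sub>m (d c) * D c) - t c * ((lam c)\<^sup>2 * g2 c (\<Sigma> c) (1\<^sub>m (d c))))"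
      unfolding a l_def s_def u_def \<gamma>_def mm_def .
  qed
qed

text \<open>The case X = Y = Sigma (\<open>e3\<close>) gives the unknown mean as ls^2 t / (1 - t);
  inserting it into the equation for general X (\<open>e2\<close>) gives the factor 1 + t / (1 - t)
  = 1 / (1 - t).\<close>

lemma small_bias:
  assumes X: "\<And>c. c \<in> C \<Longrightarrow> test_mat (n c) (d c) K (X c)"
  shows "small_family C n (\<lambda>c. (lam c)\<^sup>2 * g2 c (X c) (\<Sigma> c) - (ls c)\<^sup>2 * tr c (X c * D c * \<Sigma> c * D c) / (1 - t c))"
proof -
  note XDS = test_mat_mult_right[OF test_mat_mult_right[OF X D_bound] g(8)]
  define b where "b c = tr c (X c * D c * \<Sigma> c * D c)" for c
  define e2 where "e2 c = (lam c)\<^sup>2 * g2 c (X c) (\<Sigma> c) - (ls c)\<^sup>2 * b c - b c * ((lam c)\<^sup>2 * g2 c (\<Sigma> c) (\<Sigma> c))" for c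
  define e3 where "e3 c = (lam c)\<^sup>2 * g2 c (\<Sigma> c) (\<Sigma> c) - (ls c)\<^sup>2 * t c - t c * ((lam c)\<^sup>2 * g2 c (\<Sigma> c) (\<Sigma> c))" for c
  have s2: "small_family C n e2" unfolding e2_def b_def by (rule small_g2[OF X g(8)])
  have s3: "small_family C n e3" unfolding e3_def by (rule small_g2[OF test_cov g(8)])
  have bb: "bounded_family C b" unfolding b_def by (rule bounded_tr[OF test_mat_mult_right[OF XDS D_bound]])
  have "small_family C n (\<lambda>c. e2 c + (b c * (1 / (1 - t c))) * e3 c)"
    by (intro small_family_add small_family_mult s2 s3 bounded_family_intros bb bounded_inv_t)
  thus ?thesis
    unfolding b_def[symmetric]
  proof (rule small_family_cong)
    fix c assume c: "c \<in> C"
    define u where "u = t c"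
    have "0 < 1 - u" using one_minus_t(1)[OF c] by (simp add: u_def)
    thus "(lam c)\<^sup>2 * g2 c (X c) (\<Sigma> c) - (ls c)\<^sup>2 * b c / (1 - t c) = e2 c + (b c * (1 / (1 - t c))) * e3 c"
      unfolding e2_def e3_def u_def[symmetric] by (simp add: field_simps)
  qed
qed

lemma small_moments_bounded:
  assumes "small_family C n f" "\<And>c. c \<in> C \<Longrightarrow> prob_space (S c)"
  shows "moments_bounded C S (\<lambda>c x. real (n c) * f c)"
proof -
  from assms(1) obtain L where "\<And>c. c \<in> C \<Longrightarrow> \<bar>real (n c) * f c\<bar> \<le> L"
    unfolding small_family_def bounded_family_def by blast
  thus ?thesis using assms(2) by (intro moments_bounded_const[where K = L])
qed

text \<open>Fluctuations of the unnormalised traces and n times the error of the means are both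
  O(1).\<close>

theorem variance_equivalent:
  "moments_bounded C (\<lambda>c. PiM {..<n c} (\<lambda>_. \<mu> c)) (\<lambda>c x. real (n c) * (tr c (\<Sigma> c * minv (ridge_mat (n c) (d c) (lam c) x {..<n c})) - lam c * tr c (\<Sigma> c * minv (ridge_mat (n c) (d c) (lam c) x {..<n c}) * 1\<^sub>m (d c) * minv (ridge_mat (n c) (d c) (lam c) x {..<n c})) - t c / (1 - t c)))"
proof -
  interpret n_sample C M H n d \<mu> lam \<Sigma> "\<lambda>c. 1\<^sub>m (d c)" "max 1 1" by (rule n_sampleI[OF test_cov op_bound_one])
  have "moments_bounded C S (\<lambda>c x. (T1 c (R c x) - (\<integral>x. T1 c (R c x) \<partial>S c)) - lam c * (T2 c (R c x) - (\<integral>x. T2 c (R c x) \<partial>S c))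
      + real (n c) * (m c - lam c * g2 c (\<Sigma> c) (1\<^sub>m (d c)) - t c / (1 - t c)))"
    by (intro moments_bounded_add moments_bounded_diff concentration_T1 concentration_T2 small_moments_bounded small_variance prob_S
        moments_bounded_cmult[where K = M]) (use g(5,10) in \<open>fastforce simp: abs_of_pos\<close>)
  thus ?thesis
  proof (rule moments_bounded_cong)
    fix c x assume c: "c \<in> C"
    have nn: "real (n c) \<noteq> 0" using n_pos[OF c] by simp
    have "N * (1 / N * a - l * (1 / N * b) - w) = (a - a') - l * (b - b') + N * (1 / N * a' - l * (1 / N * b') - w)" if "N \<noteq> 0"
      for N a a' b b' l w :: real
      using that by (simp add: field_simps)
    from this[OF nn] show "real (n c) * (tr c (\<Sigma> c * R c x) - lam c * tr c (\<Sigma> c * R c x * 1\<^sub>m (d c) * R c x) - t c / (1 - t c)) =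
      (T1 c (R c x) - (\<integral>x. T1 c (R c x) \<partial>S c)) - lam c * (T2 c (R c x) - (\<integral>x. T2 c (R c x) \<partial>S c))
      + real (n c) * (m c - lam c * g2 c (\<Sigma> c) (1\<^sub>m (d c)) - t c / (1 - t c))"
      unfolding mean1_def mean2_def .
  qed
qed

theorem bias_equivalent:
  assumes X: "\<And>c. c \<in> C \<Longrightarrow> test_mat (n c) (d c) K (X c)"
  shows "moments_bounded C (\<lambda>c. PiM {..<n c} (\<lambda>_. \<mu> c)) (\<lambda>c x. real (n c) * ((lam c)\<^sup>2 * tr c (X c * minv (ridge_mat (n c) (d c) (lam c) x {..<n c}) * \<Sigma> c * minv (ridge_mat (n c) (d c) (lam c) x {..<n c})) -
    (ls c)\<^sup>2 * tr c (X c * D c * \<Sigma> c * D c) / (1 - t c)))"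
proof -
  interpret n_sample C M H n d \<mu> lam X \<Sigma> "max K 1" by (rule n_sampleI[OF X g(8)])
  have M2: "\<bar>(lam c)\<^sup>2\<bar> \<le> M\<^sup>2" if "c \<in> C" for c
    using g(5,10)[OF that] by (simp add: power_mono)
  have "moments_bounded C S (\<lambda>c x. (lam c)\<^sup>2 * (T2 c (R c x) - (\<integral>x. T2 c (R c x) \<partial>S c))
      + real (n c) * ((lam c)\<^sup>2 * g2 c (X c) (\<Sigma> c) - (ls c)\<^sup>2 * tr c (X c * D c * \<Sigma> c * D c) / (1 - t c)))"
    by (intro moments_bounded_add concentration_T2 small_moments_bounded small_bias[OF X] prob_S
        moments_bounded_cmult[where K = "M\<^sup>2"] M2)
  thus ?thesis
  proof (rule moments_bounded_cong)
    fix c x assume c: "c \<in> C"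
    have nn: "real (n c) \<noteq> 0" using n_pos[OF c] by simp
    have "N * (l * (1 / N * b) - w) = l * (b - b') + N * (l * (1 / N * b') - w)" if "N \<noteq> 0"
      for N b b' l w :: real
      using that by (simp add: field_simps)
    from this[OF nn] show "real (n c) * ((lam c)\<^sup>2 * tr c (X c * R c x * \<Sigma> c * R c x) - (ls c)\<^sup>2 * tr c (X c * D c * \<Sigma> c * D c) / (1 - t c)) =
      (lam c)\<^sup>2 * (T2 c (R c x) - (\<integral>x. T2 c (R c x) \<partial>S c))
      + real (n c) * ((lam c)\<^sup>2 * g2 c (X c) (\<Sigma> c) - (ls c)\<^sup>2 * tr c (X c * D c * \<Sigma> c * D c) / (1 - t c))"
      unfolding mean2_def .
  qed
qed

end

section \<open>Linear and quadratic forms in independent subgaussian coordinates\<close>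

lemma moments_bounded_sum:
  assumes "finite J" "\<And>c. c \<in> C \<Longrightarrow> prob_space (S c)" "\<And>j. j \<in> J \<Longrightarrow> moments_bounded C S (X j)"
  shows "moments_bounded C S (\<lambda>c w. \<Sum>j\<in>J. X j c w)"
  using assms(1,3)
proof (induction J rule: finite_induct)
  case empty
  show ?case using assms(2) by (auto intro: moments_bounded_const[where K = 0])
next
  case (insert j J)
  hence "moments_bounded C S (\<lambda>c w. X j c w + (\<Sum>j\<in>J. X j c w))" by (intro moments_bounded_add) auto
  thus ?case using insert.hyps by simp
qed

lemma moments_bounded_finite:
  assumes "moments_bounded C S X" "c \<in> C" shows "(\<integral>\<^sup>+w. ennreal (X c w ^ (2 * p)) \<partial>S c) < \<infinity>"
proof -
  from moments_boundedD(3)[OF assms(1), of p] obtain K where "(\<integral>\<^sup>+w. ennreal (X c w ^ (2 * p)) \<partial>S c) \<le> ennreal K"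
    using assms(2) by blast
  thus ?thesis by (rule le_less_trans) simp
qed

lemma moments_bounded_subset: "moments_bounded C S X \<Longrightarrow> E \<subseteq> C \<Longrightarrow> moments_bounded E S X"
  using moments_bounded_reindex[of C S X E "\<lambda>e. e"] by auto

text \<open>Setting one coordinate to zero changes the form by that coordinate times a linear form
  in the others, plus a diagonal term.\<close>

lemma quadratic_form_remove:
  fixes B :: "nat \<Rightarrow> nat \<Rightarrow> real" and w :: "nat \<Rightarrow> real"
  assumes i: "i < k"
  shows "(\<Sum>a<k. \<Sum>b<k. B a b * (w a * w b)) -
      (\<Sum>a<k. \<Sum>b<k. B a b * ((if a = i then 0 else w a) * (if b = i then 0 else w b))) =
    w i * (\<Sum>b<k. (if b = i then 0 else B i b + B b i) * w b) + B i i * (w i * w i)"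
proof -
  define v where "v a = (if a = i then 0 else w a)" for a
  define \<delta> where "\<delta> a = (if a = i then w i else 0)" for a
  have w: "w a = v a + \<delta> a" for a by (simp add: v_def \<delta>_def)
  have \<delta>1: "(\<Sum>a<k. \<delta> a * f a) = w i * f i" for f
  proof -
    have "(\<Sum>a<k. \<delta> a * f a) = (\<Sum>a<k. if a = i then w i * f i else 0)" by (intro sum.cong) (auto simp: \<delta>_def)
    thus ?thesis using i by simp
  qed
  have "(\<Sum>a<k. \<Sum>b<k. B a b * (w a * w b)) - (\<Sum>a<k. \<Sum>b<k. B a b * (v a * v b)) =
      (\<Sum>a<k. \<Sum>b<k. \<delta> a * (B a b * v b)) + (\<Sum>a<k. \<Sum>b<k. \<delta> b * (B a b * v a)) + (\<Sum>a<k. \<Sum>b<k. \<delta> a * (\<delta> b * B a b))"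
    unfolding w sum_subtractf[symmetric] sum.distrib[symmetric] by (intro sum.cong refl) (simp add: algebra_simps)
  also have "(\<Sum>a<k. \<Sum>b<k. \<delta> a * (B a b * v b)) = w i * (\<Sum>b<k. B i b * v b)"
    unfolding sum_distrib_left[symmetric] \<delta>1 ..
  also have "(\<Sum>a<k. \<Sum>b<k. \<delta> b * (B a b * v a)) = w i * (\<Sum>a<k. B a i * v a)"
    unfolding \<delta>1 sum_distrib_left ..
  also have "(\<Sum>a<k. \<Sum>b<k. \<delta> a * (\<delta> b * B a b)) = w i * (w i * B i i)"
    unfolding sum_distrib_left[symmetric] \<delta>1 ..
  also have "w i * (\<Sum>b<k. B i b * v b) + w i * (\<Sum>a<k. B a i * v a) = w i * (\<Sum>b<k. (if b = i then 0 else B i b + B b i) * w b)"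
    unfolding distrib_left[symmetric] sum.distrib[symmetric]
    by (intro arg_cong[where f = "(*) (w i)"] sum.cong refl) (simp add: v_def algebra_simps)
  finally show ?thesis by (simp add: v_def mult_ac)
qed

locale indep_coords =
  fixes C :: "'c set" and d :: "'c \<Rightarrow> nat" and N :: "'c \<Rightarrow> nat \<Rightarrow> real measure"
  assumes prob_N: "\<And>c j. c \<in> C \<Longrightarrow> prob_space (N c j)" and sets_N: "\<And>c j. c \<in> C \<Longrightarrow> sets (N c j) = sets borel"
    and coord: "moments_bounded {e. fst e \<in> C \<and> snd e < d (fst e)} (\<lambda>e. PiM {..<d (fst e)} (N (fst e))) (\<lambda>e w. w (snd e))"
    and mean0: "\<And>c j. c \<in> C \<Longrightarrow> j < d c \<Longrightarrow> (\<integral>w. w j \<partial>PiM {..<d c} (N c)) = 0"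
begin

abbreviation "Q c \<equiv> PiM {..<d c} (N c)"

lemma prob_Q: "c \<in> C \<Longrightarrow> prob_space (Q c)"
  by (rule prob_space_PiM) (rule prob_N)

lemma meas_coord: "c \<in> C \<Longrightarrow> j < d c \<Longrightarrow> (\<lambda>w. w j) \<in> borel_measurable (Q c)"
  using moments_boundedD(2)[OF coord, of "(c, j)"] by simp

lemma coord_single: "c \<in> C \<Longrightarrow> j < d c \<Longrightarrow> moments_bounded {c} Q (\<lambda>c w. w j)"
  using moments_bounded_reindex[OF coord, of "{c}" "\<lambda>c. (c, j)"] by simp

text \<open>Efron-Stein with the sum over the remaining coordinates as competitor. It is also the
  input for quadratic forms, whose influences contain linear forms.\<close>

lemma linear_forms:
  fixes E :: "'e set"
  assumes f: "\<And>e. e \<in> E \<Longrightarrow> f e \<in> C" and a: "\<And>e. e \<in> E \<Longrightarrow> (\<Sum>j<d (f e). (a e j)\<^sup>2) \<le> K"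
  shows "moments_bounded E (\<lambda>e. Q (f e)) (\<lambda>e w. \<Sum>j<d (f e). a e j * w j)"
proof -
  define F where "F e w = (\<Sum>j<d (f e). a e j * w j)" for e w
  have single: "moments_bounded {c} Q (\<lambda>c w. a e j * w j)" if "c \<in> C" "j < d c" for c e j
    by (rule moments_bounded_cmult[OF coord_single[OF that], where K = "\<bar>a e j\<bar>"]) simp
  have Fs: "moments_bounded {f e} Q (\<lambda>c w. F e w)" if e: "e \<in> E" for e
    unfolding F_def by (rule moments_bounded_sum) (use prob_Q f[OF e] single in auto)
  have "moments_bounded E (\<lambda>e. Q (f e)) (\<lambda>e w. F e w - (\<integral>w. F e w \<partial>Q (f e)))"
  \<comment> \<open>The summand 1 / d keeps the weights positive when a coefficient vanishes and
    adds at most 1 to their sum.\<close>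
  proof (rule moments_bounded_Efron_Stein_weighted[where T = "K + 1" and t = "\<lambda>e i. (a e i)\<^sup>2 + 1 / real (d (f e))"
        and G = "\<lambda>e i w. \<Sum>j\<in>{..<d (f e)} - {i}. a e j * w j"])
    fix e assume e: "e \<in> E"
    show "prob_space (N (f e) i)" for i by (rule prob_N[OF f[OF e]])
    show "F e \<in> borel_measurable (Q (f e))" using moments_boundedD(2)[OF Fs[OF e]] by simp
    show "(\<integral>\<^sup>+w. ennreal (F e w ^ (2 * p)) \<partial>Q (f e)) < \<infinity>" for p using moments_bounded_finite[OF Fs[OF e]] by simp
    show "(\<lambda>w. \<Sum>j\<in>{..<d (f e)} - {i}. a e j * w j) \<in> borel_measurable (Q (f e))" for i
      using meas_coord[OF f[OF e]] by (intro borel_measurable_sum borel_measurable_times borel_measurable_const) auto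
    show "(\<Sum>j\<in>{..<d (f e)} - {i}. a e j * (w(i := y)) j) = (\<Sum>j\<in>{..<d (f e)} - {i}. a e j * w j)" for i w y
      by (intro sum.cong) auto
    show "0 < (a e i)\<^sup>2 + 1 / real (d (f e))" if "i < d (f e)" for i
      using that by (intro add_nonneg_pos) auto
    have "(\<Sum>i<d (f e). (a e i)\<^sup>2 + 1 / real (d (f e))) = (\<Sum>i<d (f e). (a e i)\<^sup>2) + (\<Sum>i<d (f e). 1 / real (d (f e)))"
      by (rule sum.distrib)
    also have "(\<Sum>i<d (f e). 1 / real (d (f e))) \<le> 1" by simp
    finally show "(\<Sum>i<d (f e). (a e i)\<^sup>2 + 1 / real (d (f e))) \<le> K + 1" using a[OF e] by linarith
  next
    have "moments_bounded {e. fst e \<in> E \<and> snd e < d (f (fst e))} (\<lambda>e. Q (f (fst e)))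
        (\<lambda>e w. (a (fst e) (snd e) / sqrt ((a (fst e) (snd e))\<^sup>2 + 1 / real (d (f (fst e))))) * w (snd e))"
    proof (rule moments_bounded_cmult[where K = 1])
      show "moments_bounded {e. fst e \<in> E \<and> snd e < d (f (fst e))} (\<lambda>e. Q (f (fst e))) (\<lambda>e w. w (snd e))"
        using moments_bounded_reindex[OF coord, of "{e. fst e \<in> E \<and> snd e < d (f (fst e))}" "\<lambda>e. (f (fst e), snd e)"] f by simp
      fix e assume "e \<in> {e. fst e \<in> E \<and> snd e < d (f (fst e))}"
      hence d: "0 < real (d (f (fst e)))" by auto
      define x where "x = a (fst e) (snd e)"
      have "\<bar>x\<bar> \<le> sqrt (x\<^sup>2 + 1 / real (d (f (fst e))))"
        using d by (intro real_le_rsqrt) (simp add: power2_abs)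
      moreover have "0 < sqrt (x\<^sup>2 + 1 / real (d (f (fst e))))" using d by (simp add: add_nonneg_pos)
      ultimately show "\<bar>a (fst e) (snd e) / sqrt ((a (fst e) (snd e))\<^sup>2 + 1 / real (d (f (fst e))))\<bar> \<le> 1"
        unfolding x_def[symmetric] by (simp add: abs_divide)
    qed
    thus "moments_bounded {e. fst e \<in> E \<and> snd e < d (f (fst e))} (\<lambda>e. Q (f (fst e)))
       (\<lambda>e w. (F (fst e) w - (\<Sum>j\<in>{..<d (f (fst e))} - {snd e}. a (fst e) j * w j)) / sqrt ((a (fst e) (snd e))\<^sup>2 + 1 / real (d (f (fst e)))))"
    proof (rule moments_bounded_cong)
      fix e w assume "e \<in> {e. fst e \<in> E \<and> snd e < d (f (fst e))}"
      hence "F (fst e) w - (\<Sum>j\<in>{..<d (f (fst e))} - {snd e}. a (fst e) j * w j) = a (fst e) (snd e) * w (snd e)"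
        unfolding F_def by (subst sum.remove[where x = "snd e"]) auto
      thus "(F (fst e) w - (\<Sum>j\<in>{..<d (f (fst e))} - {snd e}. a (fst e) j * w j)) / sqrt ((a (fst e) (snd e))\<^sup>2 + 1 / real (d (f (fst e)))) =
        (a (fst e) (snd e) / sqrt ((a (fst e) (snd e))\<^sup>2 + 1 / real (d (f (fst e))))) * w (snd e)" by simp
    qed
  qed
  thus ?thesis
  proof (rule moments_bounded_cong)
    fix e w assume e: "e \<in> E"
    have i: "integrable (Q (f e)) (\<lambda>w. w j)" if "j < d (f e)" for j
      using moments_bounded_integrable[OF coord, of "(f e, j)"] f[OF e] that by simp
    have "(\<integral>w. F e w \<partial>Q (f e)) = (\<Sum>j<d (f e). a e j * (\<integral>w. w j \<partial>Q (f e)))"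
      unfolding F_def using i by (subst Bochner_Integration.integral_sum) auto
    also have "\<dots> = 0" using mean0[OF f[OF e]] by simp
    finally show "(\<Sum>j<d (f e). a e j * w j) = F e w - (\<integral>w. F e w \<partial>Q (f e))" by (simp add: F_def)
  qed
qed

text \<open>A Hanson-Wright type estimate at the level of moments. With bounded rows and columns
  each coordinate has influence d^(-1/2) times a bounded product, and d equal weights 1 / d absorb
  this.\<close>

lemma quadratic_forms:
  fixes E :: "'e set"
  assumes f: "\<And>e. e \<in> E \<Longrightarrow> f e \<in> C"
    and B: "\<And>e i. e \<in> E \<Longrightarrow> i < d (f e) \<Longrightarrow> (\<Sum>b<d (f e). (B e i b)\<^sup>2) \<le> K"
      "\<And>e i. e \<in> E \<Longrightarrow> i < d (f e) \<Longrightarrow> (\<Sum>b<d (f e). (B e b i)\<^sup>2) \<le> K"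
  shows "moments_bounded E (\<lambda>e. Q (f e)) (\<lambda>e w. 1 / sqrt (d (f e)) * (\<Sum>a<d (f e). \<Sum>b<d (f e). B e a b * (w a * w b)) -
     (\<integral>w. 1 / sqrt (d (f e)) * (\<Sum>a<d (f e). \<Sum>b<d (f e). B e a b * (w a * w b)) \<partial>Q (f e)))"
proof -
  define F where "F e w = 1 / sqrt (d (f e)) * (\<Sum>a<d (f e). \<Sum>b<d (f e). B e a b * (w a * w b))" for e w
  define G where "G e i w = 1 / sqrt (d (f e)) * (\<Sum>a<d (f e). \<Sum>b<d (f e). B e a b * ((if a = i then 0 else w a) * (if b = i then 0 else w b)))" for e i w
  have Fs: "moments_bounded {f e} Q (\<lambda>c w. F e w)" if e: "e \<in> E" for e
  proof -
    have pQ: "prob_space (Q c)" if "c \<in> {f e}" for c using that prob_Q[OF f[OF e]] by simp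
    have single: "moments_bounded {f e} Q (\<lambda>c w. B e a b * (w a * w b))" if "a < d (f e)" "b < d (f e)" for a b
      by (rule moments_bounded_cmult[where K = "\<bar>B e a b\<bar>"], rule moments_bounded_mult)
        (use that coord_single[OF f[OF e]] in auto)
    have "moments_bounded {f e} Q (\<lambda>c w. \<Sum>a<d (f e). \<Sum>b<d (f e). B e a b * (w a * w b))"
      by (intro moments_bounded_sum pQ single) auto
    thus ?thesis unfolding F_def by (rule moments_bounded_cmult[where K = "\<bar>1 / sqrt (d (f e))\<bar>"]) simp
  qed
  have E1f: "e \<in> {e. fst e \<in> E \<and> snd e < d (f (fst e))} \<Longrightarrow> f (fst e) \<in> C" for e using f by auto
  show ?thesis
    unfolding F_def[symmetric]
  proof (rule moments_bounded_Efron_Stein_weighted[where T = 1 and t = "\<lambda>e i. 1 / real (d (f e))" and G = G])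
    fix e assume e: "e \<in> E"
    show "prob_space (N (f e) i)" for i by (rule prob_N[OF f[OF e]])
    show "F e \<in> borel_measurable (Q (f e))" using moments_boundedD(2)[OF Fs[OF e]] by simp
    show "(\<integral>\<^sup>+w. ennreal (F e w ^ (2 * p)) \<partial>Q (f e)) < \<infinity>" for p using moments_bounded_finite[OF Fs[OF e]] by simp
    have m: "(\<lambda>w. if b = i then 0 else w b) \<in> borel_measurable (Q (f e))" if "b < d (f e)" for b i
      using meas_coord[OF f[OF e] that] by (cases "b = i") auto
    show "G e i \<in> borel_measurable (Q (f e))" for i
      unfolding G_def using m by (intro borel_measurable_times borel_measurable_const borel_measurable_sum) auto
    show "G e i (w(i := y)) = G e i w" for i w y
      unfolding G_def by (intro arg_cong2[where f = "(*)"] refl sum.cong) auto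
    show "0 < 1 / real (d (f e))" if "i < d (f e)" for i :: nat using that by simp
    show "(\<Sum>i<d (f e). 1 / real (d (f e))) \<le> 1" by simp
  next
    let ?E1 = "{e. fst e \<in> E \<and> snd e < d (f (fst e))}"
    define l where "l e w = (\<Sum>b<d (f (fst e)). (if b = snd e then 0 else B (fst e) (snd e) b + B (fst e) b (snd e)) * w b)" for e w
    have wi: "moments_bounded ?E1 (\<lambda>e. Q (f (fst e))) (\<lambda>e w. w (snd e))"
      using moments_bounded_reindex[OF coord, of ?E1 "\<lambda>e. (f (fst e), snd e)"] f by simp
    have l: "moments_bounded ?E1 (\<lambda>e. Q (f (fst e))) l"
      unfolding l_def
    proof (rule linear_forms[where K = "4 * K"])
      fix e assume e: "e \<in> ?E1"
      show "f (fst e) \<in> C" by (rule E1f[OF e])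
      have "(\<Sum>b<d (f (fst e)). (if b = snd e then 0 else B (fst e) (snd e) b + B (fst e) b (snd e))\<^sup>2) \<le>
          (\<Sum>b<d (f (fst e)). 2 * (B (fst e) (snd e) b)\<^sup>2 + 2 * (B (fst e) b (snd e))\<^sup>2)"
      proof (rule sum_mono)
        fix b
        have "(x + y)\<^sup>2 \<le> 2 * x\<^sup>2 + 2 * y\<^sup>2" for x y :: real
          using sum_squares_bound[of x y] by (simp add: power2_sum)
        thus "(if b = snd e then 0 else B (fst e) (snd e) b + B (fst e) b (snd e))\<^sup>2 \<le> 2 * (B (fst e) (snd e) b)\<^sup>2 + 2 * (B (fst e) b (snd e))\<^sup>2"
          by simp
      qed
      also have "\<dots> = 2 * (\<Sum>b<d (f (fst e)). (B (fst e) (snd e) b)\<^sup>2) + 2 * (\<Sum>b<d (f (fst e)). (B (fst e) b (snd e))\<^sup>2)"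
        by (simp add: sum.distrib sum_distrib_left)
      also have "\<dots> \<le> 4 * K" using B[of "fst e" "snd e"] e by simp
      finally show "(\<Sum>b<d (f (fst e)). (if b = snd e then 0 else B (fst e) (snd e) b + B (fst e) b (snd e))\<^sup>2) \<le> 4 * K" .
    qed
    have "moments_bounded ?E1 (\<lambda>e. Q (f (fst e))) (\<lambda>e w. w (snd e) * l e w + B (fst e) (snd e) (snd e) * (w (snd e) * w (snd e)))"
    proof (rule moments_bounded_add[OF moments_bounded_mult[OF wi l] moments_bounded_cmult[OF moments_bounded_mult[OF wi wi], where K = "1 + K"]])
      fix e assume e: "e \<in> ?E1"
      define x where "x = B (fst e) (snd e) (snd e)"
      have "x\<^sup>2 \<le> (\<Sum>b<d (f (fst e)). (B (fst e) (snd e) b)\<^sup>2)"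
        unfolding x_def using e by (intro member_le_sum) auto
      also have "\<dots> \<le> K" using B(1)[of "fst e" "snd e"] e by simp
      finally have "x\<^sup>2 \<le> K" .
      moreover have "\<bar>x\<bar> \<le> 1 + x\<^sup>2" using sum_squares_bound[of "\<bar>x\<bar>" 1] zero_le_power2[of x] by (simp add: power2_eq_square)
      ultimately show "\<bar>B (fst e) (snd e) (snd e)\<bar> \<le> 1 + K" by (simp add: x_def)
    qed
    thus "moments_bounded ?E1 (\<lambda>e. Q (f (fst e))) (\<lambda>e w. (F (fst e) w - G (fst e) (snd e) w) / sqrt (1 / real (d (f (fst e)))))"
    proof (rule moments_bounded_cong)
      fix e w assume e: "e \<in> ?E1"
      hence d: "sqrt (real (d (f (fst e)))) \<noteq> 0" by auto
      have "F (fst e) w - G (fst e) (snd e) w = 1 / sqrt (d (f (fst e))) *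
          (w (snd e) * l e w + B (fst e) (snd e) (snd e) * (w (snd e) * w (snd e)))"
        unfolding F_def G_def right_diff_distrib[symmetric] l_def
        by (intro arg_cong2[where f = "(*)"] refl quadratic_form_remove) (use e in auto)
      thus "(F (fst e) w - G (fst e) (snd e) w) / sqrt (1 / real (d (f (fst e)))) =
         w (snd e) * l e w + B (fst e) (snd e) (snd e) * (w (snd e) * w (snd e))"
        using d by (simp add: real_sqrt_divide)
    qed
  qed
qed

end

section \<open>Moments of standardised random vectors\<close>

lemma moments_bounded_Un:
  assumes A: "moments_bounded A S X" and B: "moments_bounded B S X" shows "moments_bounded (A \<union> B) S X"
proof (rule moments_boundedI)
  fix p
  from moments_boundedD(3)[OF A, of p] obtain K where
    K: "0 \<le> K" "\<And>c. c \<in> A \<Longrightarrow> (\<integral>\<^sup>+w. ennreal (X c w ^ (2 * p)) \<partial>S c) \<le> ennreal K" by auto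
  from moments_boundedD(3)[OF B, of p] obtain L where
    L: "0 \<le> L" "\<And>c. c \<in> B \<Longrightarrow> (\<integral>\<^sup>+w. ennreal (X c w ^ (2 * p)) \<partial>S c) \<le> ennreal L" by auto
  have "(\<integral>\<^sup>+w. ennreal (X c w ^ (2 * p)) \<partial>S c) \<le> ennreal (K + L)" if c: "c \<in> A \<union> B" for c
    using c
  proof
    assume "c \<in> A" thus ?thesis using L(1) by (intro order_trans[OF K(2) ennreal_leI]) auto
  next
    assume "c \<in> B" thus ?thesis using K(1) by (intro order_trans[OF L(2) ennreal_leI]) auto
  qed
  thus "\<exists>K\<ge>0. \<forall>c\<in>A \<union> B. (\<integral>\<^sup>+w. ennreal (X c w ^ (2 * p)) \<partial>S c) \<le> ennreal K"
    using K(1) L(1) by (intro exI[of _ "K + L"]) auto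
qed (use moments_boundedD(1,2)[OF A] moments_boundedD(1,2)[OF B] in auto)

text \<open>The convention 1 / 0 = 0 covers the zero vector.\<close>

lemma vec_normalize:
  assumes u: "u \<in> carrier_vec d"
  shows "vec_norm ((1 / vec_norm u) \<cdot>\<^sub>v u) \<le> 1" "u = vec_norm u \<cdot>\<^sub>v ((1 / vec_norm u) \<cdot>\<^sub>v u)"
proof -
  show "vec_norm ((1 / vec_norm u) \<cdot>\<^sub>v u) \<le> 1" by (simp add: vec_norm_smult[OF u])
  show "u = vec_norm u \<cdot>\<^sub>v ((1 / vec_norm u) \<cdot>\<^sub>v u)"
  proof (cases "vec_norm u = 0")
    case True
    hence "u = 0\<^sub>v d" by (rule vec_norm_eq_0[OF u])
    thus ?thesis by (auto intro!: eq_vecI)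
  qed (simp add: smult_smult_assoc)
qed

definition measurable_vec :: "'a measure \<Rightarrow> nat \<Rightarrow> ('a \<Rightarrow> real vec) \<Rightarrow> bool" where
  "measurable_vec P d Z \<longleftrightarrow> (\<forall>\<omega>\<in>space P. Z \<omega> \<in> carrier_vec d) \<and> (\<forall>j<d. (\<lambda>\<omega>. Z \<omega> $ j) \<in> borel_measurable P)"

lemma measurable_vec_linear:
  assumes "measurable_vec P d Z" "w \<in> carrier_vec d" shows "(\<lambda>\<omega>. w \<bullet> Z \<omega>) \<in> borel_measurable P"
proof -
  have "(\<lambda>\<omega>. \<Sum>j<d. w $ j * Z \<omega> $ j) \<in> borel_measurable P"
    using assms by (intro borel_measurable_sum borel_measurable_times) (auto simp: measurable_vec_def)
  moreover have "w \<bullet> Z \<omega> = (\<Sum>j<d. w $ j * Z \<omega> $ j)" if "\<omega> \<in> space P" for \<omega>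
    using assms that by (auto simp: measurable_vec_def scalar_prod_def atLeast0LessThan)
  ultimately show ?thesis by (simp cong: measurable_cong)
qed

text \<open>The common ground of the two kinds of assumption: linear forms of order 1, and centred
  quadratic forms of order sqrt n for bounded matrices.\<close>

locale standardized =
  fixes C :: "'c set" and P :: "'c \<Rightarrow> 'a measure" and Z :: "'c \<Rightarrow> 'a \<Rightarrow> real vec" and n d :: "'c \<Rightarrow> nat" and K :: real
  assumes prob_P: "\<And>c. c \<in> C \<Longrightarrow> prob_space (P c)"
    and Z: "\<And>c. c \<in> C \<Longrightarrow> measurable_vec (P c) (d c) (Z c)"
    and n: "\<And>c. c \<in> C \<Longrightarrow> 1 \<le> n c" and K: "0 \<le> K"
    and lin: "moments_bounded {e. fst e \<in> C \<and> snd e \<in> carrier_vec (d (fst e)) \<and> vec_norm (snd e) \<le> 1}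
      (\<lambda>e. P (fst e)) (\<lambda>e \<omega>. snd e \<bullet> Z (fst e) \<omega>)"
    and quad: "moments_bounded {e. fst e \<in> C \<and> op_bound (d (fst e)) K (snd e)}
      (\<lambda>e. P (fst e)) (\<lambda>e \<omega>. (Z (fst e) \<omega> \<bullet> (snd e *\<^sub>v Z (fst e) \<omega>) - mat_trace (snd e)) / sqrt (n (fst e)))"
begin

text \<open>The quadratic form of a scaled outer product is sqrt n times two linear forms. Only the
  product of the norms of u and v is controlled, so both vectors are normalised first.\<close>

lemma rank_one:
  "moments_bounded {e. fst e \<in> C \<and> (\<exists>u\<in>carrier_vec (d (fst e)). \<exists>v\<in>carrier_vec (d (fst e)).
       vec_norm u * vec_norm v \<le> K \<and> snd e = sqrt (n (fst e)) \<cdot>\<^sub>m outer_prod (d (fst e)) u v)}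
      (\<lambda>e. P (fst e)) (\<lambda>e \<omega>. (Z (fst e) \<omega> \<bullet> (snd e *\<^sub>v Z (fst e) \<omega>) - mat_trace (snd e)) / sqrt (n (fst e)))"
  (is "moments_bounded ?E _ _")
proof -
  define good where "good e uv \<longleftrightarrow> fst uv \<in> carrier_vec (d (fst e)) \<and> snd uv \<in> carrier_vec (d (fst e)) \<and>
       vec_norm (fst uv) * vec_norm (snd uv) \<le> K \<and> snd e = sqrt (n (fst e)) \<cdot>\<^sub>m outer_prod (d (fst e)) (fst uv) (snd uv)"
    for e :: "'c \<times> real mat" and uv
  \<comment> \<open>The index contains only the matrix; a factorisation is chosen for each.\<close>
  define uv where "uv e = (SOME uv. good e uv)" for e
  have uv: "good e (uv e)" if "e \<in> ?E" for e
  proof -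
    from that obtain u v where "good e (u, v)" by (auto simp: good_def)
    thus ?thesis unfolding uv_def by (rule someI)
  qed
  define u v where "u e = fst (uv e)" and "v e = snd (uv e)" for e
  define u' v' where "u' e = (1 / vec_norm (u e)) \<cdot>\<^sub>v u e" and "v' e = (1 / vec_norm (v e)) \<cdot>\<^sub>v v e" for e
  have uvE: "u e \<in> carrier_vec (d (fst e))" "v e \<in> carrier_vec (d (fst e))" "vec_norm (u e) * vec_norm (v e) \<le> K"
    "snd e = sqrt (n (fst e)) \<cdot>\<^sub>m outer_prod (d (fst e)) (u e) (v e)" if "e \<in> ?E" for e
    using uv[OF that] unfolding good_def u_def v_def by blast+
  have mu: "moments_bounded ?E (\<lambda>e. P (fst e)) (\<lambda>e \<omega>. u' e \<bullet> Z (fst e) \<omega>)"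
  proof -
    have "(fst e, u' e) \<in> {e. fst e \<in> C \<and> snd e \<in> carrier_vec (d (fst e)) \<and> vec_norm (snd e) \<le> 1}" if e: "e \<in> ?E" for e
      using uvE(1)[OF e] vec_normalize(1)[OF uvE(1)[OF e]] e by (auto simp: u'_def)
    from moments_bounded_reindex[OF lin, of ?E "\<lambda>e. (fst e, u' e)", OF this, unfolded fst_conv snd_conv] show ?thesis .
  qed
  have mv: "moments_bounded ?E (\<lambda>e. P (fst e)) (\<lambda>e \<omega>. v' e \<bullet> Z (fst e) \<omega>)"
  proof -
    have "(fst e, v' e) \<in> {e. fst e \<in> C \<and> snd e \<in> carrier_vec (d (fst e)) \<and> vec_norm (snd e) \<le> 1}" if e: "e \<in> ?E" for e
      using uvE(2)[OF e] vec_normalize(1)[OF uvE(2)[OF e]] e by (auto simp: v'_def)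
    from moments_bounded_reindex[OF lin, of ?E "\<lambda>e. (fst e, v' e)", OF this, unfolded fst_conv snd_conv] show ?thesis .
  qed
  have "moments_bounded ?E (\<lambda>e. P (fst e)) (\<lambda>e \<omega>. (vec_norm (u e) * vec_norm (v e)) * ((u' e \<bullet> Z (fst e) \<omega>) * (v' e \<bullet> Z (fst e) \<omega>)) - u e \<bullet> v e)"
  proof (intro moments_bounded_diff moments_bounded_cmult[where K = K] moments_bounded_mult[OF mu mv] moments_bounded_const[where K = K])
    fix e assume e: "e \<in> ?E"
    show "\<bar>vec_norm (u e) * vec_norm (v e)\<bar> \<le> K" using uvE(3)[OF e] by simp
    show "prob_space (P (fst e))" using e prob_P by auto
    show "\<bar>u e \<bullet> v e\<bar> \<le> K" using abs_scalar_prod_le[OF uvE(1,2)[OF e]] uvE(3)[OF e] by simp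
  qed
  thus ?thesis
  proof (rule moments_bounded_cong)
    fix e \<omega> assume e: "e \<in> ?E" and \<omega>: "\<omega> \<in> space (P (fst e))"
    have c: "fst e \<in> C" using e by auto
    have z: "Z (fst e) \<omega> \<in> carrier_vec (d (fst e))" using Z[OF c] \<omega> by (auto simp: measurable_vec_def)
    note uu = uvE(1)[OF e] and vv = uvE(2)[OF e]
    have nz: "sqrt (real (n (fst e))) \<noteq> 0" using n[OF c] by simp
    have "u e \<bullet> Z (fst e) \<omega> = vec_norm (u e) * (u' e \<bullet> Z (fst e) \<omega>)"
      by (subst vec_normalize(2)[OF uu]) (use uu z in \<open>simp add: u'_def\<close>)
    moreover have "v e \<bullet> Z (fst e) \<omega> = vec_norm (v e) * (v' e \<bullet> Z (fst e) \<omega>)"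
      by (subst vec_normalize(2)[OF vv]) (use vv z in \<open>simp add: v'_def\<close>)
    moreover have "Z (fst e) \<omega> \<bullet> (snd e *\<^sub>v Z (fst e) \<omega>) = sqrt (n (fst e)) * ((u e \<bullet> Z (fst e) \<omega>) * (v e \<bullet> Z (fst e) \<omega>))"
      unfolding uvE(4)[OF e] using uu vv z scalar_prod_comm_real[OF z uu]
      by (simp add: smult_mat_mult_vec[OF outer_prod_carrier z] outer_prod_mult_vec smult_smult_assoc)
    moreover have "mat_trace (snd e) = sqrt (n (fst e)) * (u e \<bullet> v e)"
      unfolding uvE(4)[OF e] using uu vv by (simp add: mat_trace_smult[OF outer_prod_carrier] mat_trace_outer_prod)
    ultimately show "(Z (fst e) \<omega> \<bullet> (snd e *\<^sub>v Z (fst e) \<omega>) - mat_trace (snd e)) / sqrt (n (fst e)) =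
        (vec_norm (u e) * vec_norm (v e)) * ((u' e \<bullet> Z (fst e) \<omega>) * (v' e \<bullet> Z (fst e) \<omega>)) - u e \<bullet> v e"
      using nz by (simp add: diff_divide_distrib)
  qed
qed

lemma test_forms: "moments_bounded {e. fst e \<in> C \<and> test_mat (n (fst e)) (d (fst e)) K (snd e)}
      (\<lambda>e. P (fst e)) (\<lambda>e \<omega>. (Z (fst e) \<omega> \<bullet> (snd e *\<^sub>v Z (fst e) \<omega>) - mat_trace (snd e)) / sqrt (n (fst e)))"
  by (rule moments_bounded_subset[OF moments_bounded_Un[OF quad rank_one]]) (auto simp: test_mat_def)

end

subsection \<open>Independent coordinates\<close>

lemma subgaussian_moment:
  assumes E: "0 \<le> E" and p: "1 \<le> p" and le: "real (2 * p) powr (- 1 / 2) * E powr (1 / real (2 * p)) \<le> C"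
  shows "E \<le> (C * real (2 * p) powr (1 / 2)) ^ (2 * p)"
proof -
  define q where "q = real (2 * p)"
  have q: "0 < q" using p by (simp add: q_def)
  have "E powr (1 / q) = q powr (1 / 2) * (q powr (- 1 / 2) * E powr (1 / q))"
    using q by (simp add: powr_add[symmetric] mult.assoc[symmetric])
  also have "\<dots> \<le> q powr (1 / 2) * C" using le by (intro mult_left_mono) (auto simp: q_def)
  finally have "E powr (1 / q) \<le> C * q powr (1 / 2)" by (simp add: mult.commute)
  hence "(E powr (1 / q)) ^ (2 * p) \<le> (C * q powr (1 / 2)) ^ (2 * p)" by (intro power_mono) auto
  moreover have "(E powr (1 / q)) ^ (2 * p) = E"
  proof -
    have "(E powr (1 / q)) ^ (2 * p) = (E powr (1 / q)) powr q"
      using p by (simp add: q_def powr_realpow'[symmetric] del: of_nat_mult)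
    also have "\<dots> = E" using E q by (simp add: powr_powr)
    finally show ?thesis .
  qed
  ultimately show ?thesis by (simp add: q_def)
qed

lemma moment_le_of_subgaussian:
  assumes "subgaussian_coordinates P d C Z" "j < d" "1 \<le> p"
  shows "(\<integral>\<^sup>+\<omega>. ennreal ((Z \<omega> $ j) ^ (2 * p)) \<partial>P) \<le> ennreal ((C * real (2 * p) powr (1 / 2)) ^ (2 * p))"
proof -
  have *: "integrable P (\<lambda>\<omega>. \<bar>Z \<omega> $ j\<bar> powr real (2 * p))"
    "real (2 * p) powr (- 1 / 2) * (\<integral>\<omega>. \<bar>Z \<omega> $ j\<bar> powr real (2 * p) \<partial>P) powr (1 / real (2 * p)) \<le> C"
    using assms unfolding subgaussian_coordinates_def by (auto simp del: of_nat_mult)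
  have "(\<integral>\<^sup>+\<omega>. ennreal ((Z \<omega> $ j) ^ (2 * p)) \<partial>P) = (\<integral>\<^sup>+\<omega>. ennreal (\<bar>Z \<omega> $ j\<bar> powr real (2 * p)) \<partial>P)"
    using assms(3) by (intro nn_integral_cong) (simp add: powr_realpow' power_even_abs del: of_nat_mult)
  also have "\<dots> = ennreal (\<integral>\<omega>. \<bar>Z \<omega> $ j\<bar> powr real (2 * p) \<partial>P)"
    by (rule nn_integral_eq_integral[OF *(1)]) simp
  also have "\<dots> \<le> ennreal ((C * real (2 * p) powr (1 / 2)) ^ (2 * p))"
    by (intro ennreal_leI subgaussian_moment *(2) assms(3) Bochner_Integration.integral_nonneg_AE) auto
  finally show ?thesis .
qed

lemma subgaussian_second_moment:
  assumes P: "prob_space P" and Z: "subgaussian_coordinates P d C Z"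
  shows "second_moment_mat P d Z = 1\<^sub>m d"
    and "\<And>j k. j < d \<Longrightarrow> k < d \<Longrightarrow> integrable P (\<lambda>\<omega>. Z \<omega> $ j * Z \<omega> $ k)"
proof -
  interpret prob_space P by fact
  have ind: "indep_vars (\<lambda>_. borel) (\<lambda>j \<omega>. Z \<omega> $ j) {..<d}"
    and mz: "\<And>j. j < d \<Longrightarrow> integrable P (\<lambda>\<omega>. Z \<omega> $ j)" "\<And>j. j < d \<Longrightarrow> integrable P (\<lambda>\<omega>. (Z \<omega> $ j)\<^sup>2)"
      "\<And>j. j < d \<Longrightarrow> expectation (\<lambda>\<omega>. Z \<omega> $ j) = 0"
    and var: "\<And>j. j < d \<Longrightarrow> variance (\<lambda>\<omega>. Z \<omega> $ j) = 1"
    using Z by (auto simp: subgaussian_coordinates_def mean_zero_square_integrable_def)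
  have off: "integrable P (\<lambda>\<omega>. Z \<omega> $ j * Z \<omega> $ k) \<and> expectation (\<lambda>\<omega>. Z \<omega> $ j * Z \<omega> $ k) = 0"
    if "j < d" "k < d" "j \<noteq> k" for j k
  proof -
    have s: "indep_vars (\<lambda>_. borel) (\<lambda>j \<omega>. Z \<omega> $ j) {j, k}" by (rule indep_vars_subset[OF ind]) (use that in auto)
    have i: "integrable P (\<lambda>\<omega>. Z \<omega> $ l)" if "l \<in> {j, k}" for l using that mz \<open>j < d\<close> \<open>k < d\<close> by auto
    show ?thesis
      using indep_vars_integrable[OF _ s i] indep_vars_lebesgue_integral[OF _ s i] that mz(3) by simp
  qed
  have diag: "expectation (\<lambda>\<omega>. Z \<omega> $ j * Z \<omega> $ j) = 1" if "j < d" for j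
    using var[OF that] mz(3)[OF that] by (simp add: power2_eq_square)
  show "second_moment_mat P d Z = 1\<^sub>m d"
    using off diag by (intro eq_matI) (auto simp: second_moment_mat_def)
  show "integrable P (\<lambda>\<omega>. Z \<omega> $ j * Z \<omega> $ k)" if "j < d" "k < d" for j k
    using off[OF that] mz(2)[OF that(1)] by (cases "j = k") (auto simp: power2_eq_square)
qed

lemma expectation_standard_quad:
  assumes Z: "measurable_vec P d Z" and int: "\<And>j k. j < d \<Longrightarrow> k < d \<Longrightarrow> integrable P (\<lambda>\<omega>. Z \<omega> $ j * Z \<omega> $ k)"
    and sm: "second_moment_mat P d Z = 1\<^sub>m d" and B: "B \<in> carrier_mat d d"
  shows "integrable P (\<lambda>\<omega>. Z \<omega> \<bullet> (B *\<^sub>v Z \<omega>))" "(\<integral>\<omega>. Z \<omega> \<bullet> (B *\<^sub>v Z \<omega>) \<partial>P) = mat_trace B"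
proof -
  have eq: "Z \<omega> \<bullet> (B *\<^sub>v Z \<omega>) = (\<Sum>a<d. \<Sum>b<d. B $$ (a, b) * (Z \<omega> $ a * Z \<omega> $ b))" if "\<omega> \<in> space P" for \<omega>
    using Z that by (intro quad_form_eq_sum[OF B]) (auto simp: measurable_vec_def)
  have i: "integrable P (\<lambda>\<omega>. B $$ (a, b) * (Z \<omega> $ a * Z \<omega> $ b))" if "a < d" "b < d" for a b
    using int that by simp
  have "integrable P (\<lambda>\<omega>. \<Sum>a<d. \<Sum>b<d. B $$ (a, b) * (Z \<omega> $ a * Z \<omega> $ b))"
    using i by (intro Bochner_Integration.integrable_sum) auto
  thus "integrable P (\<lambda>\<omega>. Z \<omega> \<bullet> (B *\<^sub>v Z \<omega>))" using eq by (simp cong: Bochner_Integration.integrable_cong)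
  have E: "(\<integral>\<omega>. Z \<omega> $ a * Z \<omega> $ b \<partial>P) = (if a = b then 1 else 0)" if "a < d" "b < d" for a b
    using arg_cong[OF sm, of "\<lambda>X. X $$ (a, b)"] that by (simp add: second_moment_mat_def)
  have "(\<integral>\<omega>. Z \<omega> \<bullet> (B *\<^sub>v Z \<omega>) \<partial>P) = (\<integral>\<omega>. (\<Sum>a<d. \<Sum>b<d. B $$ (a, b) * (Z \<omega> $ a * Z \<omega> $ b)) \<partial>P)"
    by (intro Bochner_Integration.integral_cong eq) auto
  also have "\<dots> = (\<Sum>a<d. \<integral>\<omega>. (\<Sum>b<d. B $$ (a, b) * (Z \<omega> $ a * Z \<omega> $ b)) \<partial>P)"
    using i by (intro Bochner_Integration.integral_sum Bochner_Integration.integrable_sum) auto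
  also have "\<dots> = (\<Sum>a<d. \<Sum>b<d. \<integral>\<omega>. B $$ (a, b) * (Z \<omega> $ a * Z \<omega> $ b) \<partial>P)"
    using i by (intro sum.cong refl Bochner_Integration.integral_sum) auto
  also have "\<dots> = (\<Sum>a<d. \<Sum>b<d. if a = b then B $$ (a, b) else 0)"
    by (intro sum.cong refl) (simp add: E)
  also have "\<dots> = mat_trace B" using B by (simp add: mat_trace_def)
  finally show "(\<integral>\<omega>. Z \<omega> \<bullet> (B *\<^sub>v Z \<omega>) \<partial>P) = mat_trace B" .
qed

text \<open>Independence identifies the law of the coordinates with a product measure on functions,
  where Efron-Stein is available; the estimates are then pulled back along
  \<open>enc\<close>.\<close>

lemma standardized_subgaussian:
  fixes C :: "'c set" and P :: "'c \<Rightarrow> 'a measure"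
  assumes P: "\<And>c. c \<in> C \<Longrightarrow> prob_space (P c)" and Z: "\<And>c. c \<in> C \<Longrightarrow> measurable_vec (P c) (d c) (Z c)"
    and sg: "\<And>c. c \<in> C \<Longrightarrow> subgaussian_coordinates (P c) (d c) Cx (Z c)"
    and nd: "\<And>c. c \<in> C \<Longrightarrow> 1 \<le> n c" "\<And>c. c \<in> C \<Longrightarrow> 1 \<le> d c" "\<And>c. c \<in> C \<Longrightarrow> real (d c) \<le> M * real (n c)" and K: "0 \<le> K"
  shows "standardized C P Z n d K"
proof -
  \<comment> \<open>Beyond d the law is a point mass at 0, because the product construction asks for
    a probability measure at every index.\<close>
  define N where "N c j = distr (P c) borel (\<lambda>\<omega>. if j < d c then Z c \<omega> $ j else 0)" for c j
  define enc where "enc c \<omega> = (\<lambda>j\<in>{..<d c}. Z c \<omega> $ j)" for c \<omega>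
  have Zm: "(\<lambda>\<omega>. Z c \<omega> $ j) \<in> borel_measurable (P c)" if "c \<in> C" "j < d c" for c j
    using Z[OF that(1)] that(2) by (auto simp: measurable_vec_def)
  have Nm: "(\<lambda>\<omega>. if j < d c then Z c \<omega> $ j else 0) \<in> borel_measurable (P c)" if "c \<in> C" for c j
    using Zm[OF that] by (cases "j < d c") auto
  have probN: "prob_space (N c j)" if "c \<in> C" for c j
    unfolding N_def by (rule prob_space.prob_space_distr[OF P[OF that] Nm[OF that]])
  have encm: "enc c \<in> P c \<rightarrow>\<^sub>M PiM {..<d c} (\<lambda>_. borel)" if "c \<in> C" for c
    unfolding enc_def using Zm[OF that] by (intro measurable_restrict) auto
  have setsQ: "sets (PiM {..<d c} (N c)) = sets (PiM {..<d c} (\<lambda>_. borel))" for c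
    by (rule sets_PiM_cong) (auto simp: N_def)
  have law: "distr (P c) (PiM {..<d c} (\<lambda>_. borel)) (enc c) = PiM {..<d c} (N c)" if c: "c \<in> C" for c
  proof -
    interpret prob_space "P c" by (rule P[OF c])
    have "indep_vars (\<lambda>_. borel) (\<lambda>j \<omega>. Z c \<omega> $ j) {..<d c}" using sg[OF c] by (simp add: subgaussian_coordinates_def)
    hence "distr (P c) (PiM {..<d c} (\<lambda>_. borel)) (enc c) = PiM {..<d c} (\<lambda>j. distr (P c) borel (\<lambda>\<omega>. Z c \<omega> $ j))"
      unfolding enc_def using nd(2)[OF c] Zm[OF c]
      by (subst (asm) indep_vars_iff_distr_eq_PiM') (auto simp: lessThan_empty_iff)
    also have "\<dots> = PiM {..<d c} (N c)" by (intro PiM_cong) (auto simp: N_def)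
    finally show ?thesis .
  qed
  have encm': "enc c \<in> P c \<rightarrow>\<^sub>M PiM {..<d c} (N c)" if "c \<in> C" for c
    using encm[OF that] measurable_cong_sets[OF refl setsQ[of c]] by blast
  have nnQ: "(\<integral>\<^sup>+w. f w \<partial>PiM {..<d c} (N c)) = (\<integral>\<^sup>+\<omega>. f (enc c \<omega>) \<partial>P c)"
    if "c \<in> C" "f \<in> borel_measurable (PiM {..<d c} (N c))" for c and f :: "_ \<Rightarrow> ennreal"
    unfolding law[OF that(1), symmetric] using encm[OF that(1)] that(2)
    by (intro nn_integral_distr) (auto simp: law[OF that(1)] cong: measurable_cong_sets[OF setsQ[symmetric] refl])
  have intQ: "(\<integral>w. f w \<partial>PiM {..<d c} (N c)) = (\<integral>\<omega>. f (enc c \<omega>) \<partial>P c)"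
    if "c \<in> C" "f \<in> borel_measurable (PiM {..<d c} (N c))" for c and f :: "_ \<Rightarrow> real"
    unfolding law[OF that(1), symmetric] using encm[OF that(1)] that(2)
    by (intro integral_distr) (auto simp: law[OF that(1)] cong: measurable_cong_sets[OF setsQ[symmetric] refl])
  have compQ: "(\<lambda>w. w j) \<in> borel_measurable (PiM {..<d c} (N c))" if "j < d c" for c j
    using measurable_component_singleton[of j "{..<d c}" "N c"] that
      measurable_cong_sets[OF refl, of "N c j" borel] by (auto simp: N_def)
  have transfer: "moments_bounded E (\<lambda>e. P (f e)) (\<lambda>e \<omega>. X e (enc (f e) \<omega>))"
    if mb: "moments_bounded E (\<lambda>e. PiM {..<d (f e)} (N (f e))) X" and f: "\<And>e. e \<in> E \<Longrightarrow> f e \<in> C" for E :: "'e set" and f X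
  proof (rule moments_boundedI)
    fix e assume e: "e \<in> E"
    show "prob_space (P (f e))" by (rule P[OF f[OF e]])
    show "(\<lambda>\<omega>. X e (enc (f e) \<omega>)) \<in> borel_measurable (P (f e))"
      by (rule measurable_compose[OF encm'[OF f[OF e]] moments_boundedD(2)[OF mb e]])
  next
    fix p
    from moments_boundedD(3)[OF mb, of p] obtain L where L: "0 \<le> L"
      "\<And>e. e \<in> E \<Longrightarrow> (\<integral>\<^sup>+w. ennreal (X e w ^ (2 * p)) \<partial>PiM {..<d (f e)} (N (f e))) \<le> ennreal L" by auto
    have "(\<integral>\<^sup>+\<omega>. ennreal (X e (enc (f e) \<omega>) ^ (2 * p)) \<partial>P (f e)) \<le> ennreal L" if e: "e \<in> E" for e
      using L(2)[OF e] moments_boundedD(2)[OF mb e] by (subst (asm) nnQ[OF f[OF e]]) auto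
    thus "\<exists>K\<ge>0. \<forall>e\<in>E. (\<integral>\<^sup>+\<omega>. ennreal (X e (enc (f e) \<omega>) ^ (2 * p)) \<partial>P (f e)) \<le> ennreal K" using L(1) by blast
  qed
  interpret IC: indep_coords C d N
  proof (rule indep_coords.intro)
    show "prob_space (N c j)" if "c \<in> C" for c j by (rule probN[OF that])
    show "sets (N c j) = sets borel" for c j by (simp add: N_def)
    show "moments_bounded {e. fst e \<in> C \<and> snd e < d (fst e)} (\<lambda>e. PiM {..<d (fst e)} (N (fst e))) (\<lambda>e w. w (snd e))"
    proof (rule moments_boundedI)
      fix p
      have "(\<integral>\<^sup>+w. ennreal (w j ^ (2 * p)) \<partial>PiM {..<d c} (N c)) \<le> ennreal (1 + (Cx * real (2 * p) powr (1 / 2)) ^ (2 * p))"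
        if c: "c \<in> C" and j: "j < d c" for c j
      proof -
        interpret prob_space "P c" by (rule P[OF c])
        have "(\<integral>\<^sup>+w. ennreal (w j ^ (2 * p)) \<partial>PiM {..<d c} (N c)) = (\<integral>\<^sup>+\<omega>. ennreal ((Z c \<omega> $ j) ^ (2 * p)) \<partial>P c)"
          using compQ[OF j] j by (subst nnQ[OF c]) (auto simp: enc_def)
        also have "\<dots> \<le> ennreal (1 + (Cx * real (2 * p) powr (1 / 2)) ^ (2 * p))"
        proof (cases "p = 0")
          case True thus ?thesis by (simp add: emeasure_space_1)
        next
          case False
          thus ?thesis by (intro order_trans[OF moment_le_of_subgaussian[OF sg[OF c] j] ennreal_leI]) auto
        qed
        finally show ?thesis .
      qed
      thus "\<exists>K\<ge>0. \<forall>e\<in>{e. fst e \<in> C \<and> snd e < d (fst e)}.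
          (\<integral>\<^sup>+w. ennreal (w (snd e) ^ (2 * p)) \<partial>PiM {..<d (fst e)} (N (fst e))) \<le> ennreal K"
        by (intro exI[of _ "1 + (Cx * real (2 * p) powr (1 / 2)) ^ (2 * p)"] conjI add_nonneg_nonneg zero_le_even_power) auto
    qed (use probN compQ in \<open>auto intro!: prob_space_PiM\<close>)
    show "(\<integral>w. w j \<partial>PiM {..<d c} (N c)) = 0" if "c \<in> C" "j < d c" for c j
      using sg[OF that(1)] that(2) intQ[OF that(1) compQ[OF that(2)]]
      by (simp add: enc_def subgaussian_coordinates_def mean_zero_square_integrable_def)
  qed
  show ?thesis
  proof (rule standardized.intro)
    show "moments_bounded {e. fst e \<in> C \<and> snd e \<in> carrier_vec (d (fst e)) \<and> vec_norm (snd e) \<le> 1}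
      (\<lambda>e. P (fst e)) (\<lambda>e \<omega>. snd e \<bullet> Z (fst e) \<omega>)" (is "moments_bounded ?E _ _")
    proof (rule moments_bounded_cong[OF transfer[OF IC.linear_forms[of ?E fst "\<lambda>e j. snd e $ j" 1]]])
      fix e assume e: "e \<in> ?E"
      have "(vec_norm (snd e))\<^sup>2 \<le> 1" using e by (simp add: power_le_one)
      moreover have "(vec_norm (snd e))\<^sup>2 = (\<Sum>j<d (fst e). (snd e $ j)\<^sup>2)"
        unfolding vec_norm_power2 using e by (auto simp: scalar_prod_def atLeast0LessThan power2_eq_square)
      ultimately show "(\<Sum>j<d (fst e). (snd e $ j)\<^sup>2) \<le> 1" by simp
    next
      fix e \<omega> assume e: "e \<in> ?E" "\<omega> \<in> space (P (fst e))"
      hence "Z (fst e) \<omega> \<in> carrier_vec (d (fst e))" using Z[of "fst e"] by (auto simp: measurable_vec_def)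
      thus "snd e \<bullet> Z (fst e) \<omega> = (\<Sum>j<d (fst e). snd e $ j * enc (fst e) \<omega> j)"
        by (auto simp: scalar_prod_def atLeast0LessThan enc_def)
    qed auto
    let ?E = "{e. fst e \<in> C \<and> op_bound (d (fst e)) K (snd e)}"
    define F where "F e w = 1 / sqrt (d (fst e)) * (\<Sum>a<d (fst e). \<Sum>b<d (fst e). snd e $$ (a, b) * (w a * w b))"
      for e :: "'c \<times> real mat" and w
    have "moments_bounded ?E (\<lambda>e. PiM {..<d (fst e)} (N (fst e))) (\<lambda>e w. F e w - (\<integral>w. F e w \<partial>PiM {..<d (fst e)} (N (fst e))))"
      unfolding F_def
    proof (rule IC.quadratic_forms[where K = "K\<^sup>2"])
      fix e i assume e: "e \<in> ?E" and i: "i < d (fst e)"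
      have B: "op_bound (d (fst e)) K (snd e)" using e by simp
      have colsq: "(\<Sum>b<d (fst e). (X $$ (b, i))\<^sup>2) \<le> K\<^sup>2" if X: "op_bound (d (fst e)) K X" for X
      proof -
        have "vec_norm (X *\<^sub>v unit_vec (d (fst e)) i) \<le> K * 1"
          using op_boundD(3)[OF X unit_vec_carrier[of "d (fst e)" i]] by (simp add: vec_norm_unit_vec[OF i])
        hence "(vec_norm (X *\<^sub>v unit_vec (d (fst e)) i))\<^sup>2 \<le> K\<^sup>2" by (intro power_mono) auto
        moreover have "(vec_norm (X *\<^sub>v unit_vec (d (fst e)) i))\<^sup>2 = (\<Sum>b<d (fst e). (X $$ (b, i))\<^sup>2)"
          unfolding vec_norm_power2 using op_boundD(1)[OF X] i
          by (simp add: scalar_prod_def[of "X *\<^sub>v unit_vec (d (fst e)) i"] atLeast0LessThan power2_eq_square)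
        ultimately show ?thesis by simp
      qed
      show "(\<Sum>b<d (fst e). (snd e $$ (b, i))\<^sup>2) \<le> K\<^sup>2" by (rule colsq[OF B])
      show "(\<Sum>b<d (fst e). (snd e $$ (i, b))\<^sup>2) \<le> K\<^sup>2"
        using colsq[OF op_bound_transpose[OF B]] op_boundD(1)[OF B] i by simp
    qed auto
    note mb = transfer[OF this]
    \<comment> \<open>The normalisation by sqrt d is converted to sqrt n, using that d / n is
      bounded.\<close>
    have "moments_bounded ?E (\<lambda>e. P (fst e)) (\<lambda>e \<omega>. sqrt (d (fst e)) / sqrt (n (fst e)) *
        (F e (enc (fst e) \<omega>) - (\<integral>w. F e w \<partial>PiM {..<d (fst e)} (N (fst e)))))"
    proof -
      have "\<bar>sqrt (d (fst e)) / sqrt (n (fst e))\<bar> \<le> sqrt \<bar>M\<bar>" if "e \<in> ?E" for e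
      proof -
        have "M * real (n (fst e)) \<le> \<bar>M\<bar> * real (n (fst e))" by (intro mult_right_mono) auto
        hence "real (d (fst e)) \<le> \<bar>M\<bar> * real (n (fst e))" using nd(3)[of "fst e"] that by force
        hence "real (d (fst e)) / real (n (fst e)) \<le> \<bar>M\<bar>" using nd(1)[of "fst e"] that by (simp add: divide_le_eq)
        thus ?thesis by (simp flip: real_sqrt_divide)
      qed
      thus ?thesis using mb by (intro moments_bounded_cmult[where K = "sqrt \<bar>M\<bar>"]) auto
    qed
    thus "moments_bounded ?E (\<lambda>e. P (fst e)) (\<lambda>e \<omega>. (Z (fst e) \<omega> \<bullet> (snd e *\<^sub>v Z (fst e) \<omega>) - mat_trace (snd e)) / sqrt (n (fst e)))"
    proof (rule moments_bounded_cong)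
      fix e \<omega> assume e: "e \<in> ?E" and \<omega>: "\<omega> \<in> space (P (fst e))"
      have c: "fst e \<in> C" and B: "snd e \<in> carrier_mat (d (fst e)) (d (fst e))" using e op_boundD(1) by auto
      have Fe: "F e (enc (fst e) \<omega>') = 1 / sqrt (d (fst e)) * (Z (fst e) \<omega>' \<bullet> (snd e *\<^sub>v Z (fst e) \<omega>'))" if "\<omega>' \<in> space (P (fst e))" for \<omega>'
        unfolding F_def using Z[OF c] that by (subst quad_form_eq_sum[OF B]) (auto simp: measurable_vec_def enc_def)
      have Fm: "F e \<in> borel_measurable (PiM {..<d (fst e)} (N (fst e)))"
        unfolding F_def using compQ by (intro borel_measurable_times borel_measurable_const borel_measurable_sum) auto
      have "(\<integral>w. F e w \<partial>PiM {..<d (fst e)} (N (fst e))) = (\<integral>\<omega>'. F e (enc (fst e) \<omega>') \<partial>P (fst e))" by (rule intQ[OF c Fm])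
      also have "\<dots> = (\<integral>\<omega>'. 1 / sqrt (d (fst e)) * (Z (fst e) \<omega>' \<bullet> (snd e *\<^sub>v Z (fst e) \<omega>')) \<partial>P (fst e))"
        by (intro Bochner_Integration.integral_cong Fe) auto
      also have "\<dots> = 1 / sqrt (d (fst e)) * mat_trace (snd e)"
        using expectation_standard_quad(2)[OF Z[OF c] subgaussian_second_moment(2)[OF P[OF c] sg[OF c]]
          subgaussian_second_moment(1)[OF P[OF c] sg[OF c]] B] by simp
      finally have I: "(\<integral>w. F e w \<partial>PiM {..<d (fst e)} (N (fst e))) = 1 / sqrt (d (fst e)) * mat_trace (snd e)" .
      have "sqrt (real (d (fst e))) \<noteq> 0" using nd(2)[OF c] by simp
      thus "(Z (fst e) \<omega> \<bullet> (snd e *\<^sub>v Z (fst e) \<omega>) - mat_trace (snd e)) / sqrt (n (fst e)) =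
        sqrt (d (fst e)) / sqrt (n (fst e)) * (F e (enc (fst e) \<omega>) - (\<integral>w. F e w \<partial>PiM {..<d (fst e)} (N (fst e))))"
        unfolding I Fe[OF \<omega>] right_diff_distrib[symmetric] by simp
    qed
  qed (use P Z nd K in auto)
qed

subsection \<open>Convex concentration\<close>

lemma exp_neg_le_power:
  assumes x: "0 < (x :: real)" shows "exp (- x) \<le> fact q / x ^ q"
proof -
  have "(\<Sum>k\<in>{q}. x ^ k /\<^sub>R fact k) \<le> exp x"
    unfolding exp_def using summable_exp_generic[of x] x by (intro sum_le_suminf) auto
  hence "x ^ q / fact q \<le> exp x" by (simp add: divide_inverse mult.commute)
  thus ?thesis using x by (simp add: exp_minus field_simps)
qed

text \<open>A discrete layer-cake argument over integer levels.\<close>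

lemma moments_bounded_of_gaussian_tail:
  assumes prob: "\<And>c. c \<in> C \<Longrightarrow> prob_space (S c)" and meas: "\<And>c. c \<in> C \<Longrightarrow> X c \<in> borel_measurable (S c)"
    and tail: "\<And>c t. c \<in> C \<Longrightarrow> 0 < t \<Longrightarrow> measure (S c) {w \<in> space (S c). t \<le> \<bar>X c w\<bar>} \<le> 2 * exp (- t\<^sup>2 / Q\<^sup>2)"
    and Q: "0 < Q"
  shows "moments_bounded C S X"
proof (rule moments_boundedI)
  fix p
  \<comment> \<open>For the moment of order 2 p the Gaussian tail is weakened to a power tail of
    order 2 p + 2, two more than the moment, which leaves a convergent sum of inverse
    squares.\<close>
  define A where "A = 2 * fact (Suc p) * Q ^ (2 * Suc p)"
  have A: "0 < A" using Q by (simp add: A_def)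
  have tail': "measure (S c) {w \<in> space (S c). t \<le> \<bar>X c w\<bar>} \<le> A / t ^ (2 * Suc p)" if c: "c \<in> C" and t: "0 < t" for c t
  proof -
    have "exp (- (t\<^sup>2 / Q\<^sup>2)) \<le> fact (Suc p) / (t\<^sup>2 / Q\<^sup>2) ^ Suc p" using t Q by (intro exp_neg_le_power) simp
    also have "\<dots> = fact (Suc p) * Q ^ (2 * Suc p) / t ^ (2 * Suc p)" unfolding power_divide power_mult[symmetric] by simp
    finally show ?thesis using tail[OF c t] by (simp add: A_def)
  qed
  define a where "a j = 4 ^ p * A * (1 / real (Suc j) ^ 2)" for j
  have "summable (\<lambda>j. 1 / real (Suc j) ^ 2)"
    using inverse_power_summable[of 2, where 'a = real] by (subst summable_Suc_iff) (simp add: inverse_eq_divide)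
  hence a: "summable a" unfolding a_def by (rule summable_mult)
  have a0: "0 \<le> a j" for j using A by (simp add: a_def)
  have "(\<integral>\<^sup>+w. ennreal (X c w ^ (2 * p)) \<partial>S c) \<le> ennreal (1 + suminf a)" if c: "c \<in> C" for c
  proof -
    interpret prob_space "S c" by (rule prob[OF c])
    note [measurable] = meas[OF c]
    define I where "I j = {w \<in> space (S c). real (Suc j) \<le> \<bar>X c w\<bar>}" for j
    have [measurable]: "I j \<in> sets (S c)" for j unfolding I_def by measurable
    have "(\<integral>\<^sup>+w. ennreal (X c w ^ (2 * p)) \<partial>S c) \<le> (\<integral>\<^sup>+w. 1 + (\<Sum>j. ennreal (real (j + 2) ^ (2 * p)) * indicator (I j) w) \<partial>S c)"
    proof (intro nn_integral_mono)
      fix w assume w: "w \<in> space (S c)"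
      have even: "X c w ^ (2 * p) = \<bar>X c w\<bar> ^ (2 * p)" by (simp add: power_even_abs)
      show "ennreal (X c w ^ (2 * p)) \<le> 1 + (\<Sum>j. ennreal (real (j + 2) ^ (2 * p)) * indicator (I j) w)"
      proof (cases "\<bar>X c w\<bar> < 1")
        case True
        hence "X c w ^ (2 * p) \<le> 1" unfolding even by (intro power_le_one) auto
        hence "ennreal (X c w ^ (2 * p)) \<le> 1" by (simp add: ennreal_le_1)
        thus ?thesis by (rule order_trans) simp
      next
        case False
        \<comment> \<open>The level with j + 1 <= |X| < j + 2, so that one summand of the series
          already dominates the power.\<close>
        define j where "j = nat \<lfloor>\<bar>X c w\<bar>\<rfloor> - 1"
        have "1 \<le> \<lfloor>\<bar>X c w\<bar>\<rfloor>" using False by (simp add: le_floor_iff)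
        hence j: "real (Suc j) = of_int \<lfloor>\<bar>X c w\<bar>\<rfloor>" by (simp add: j_def)
        have jw: "w \<in> I j" using w unfolding I_def j by simp
        have "\<bar>X c w\<bar> \<le> real (j + 2)" using j by linarith
        hence "X c w ^ (2 * p) \<le> real (j + 2) ^ (2 * p)" unfolding even by (intro power_mono) auto
        hence "ennreal (X c w ^ (2 * p)) \<le> ennreal (real (j + 2) ^ (2 * p)) * indicator (I j) w" using jw by (simp add: ennreal_leI)
        also have "\<dots> \<le> (\<Sum>j. ennreal (real (j + 2) ^ (2 * p)) * indicator (I j) w)"
          using sum_le_suminf[OF summableI, of "{j}" "\<lambda>j. ennreal (real (j + 2) ^ (2 * p)) * indicator (I j) w"]
          unfolding sum.insert[OF finite.emptyI empty_iff[THEN iffD1, THEN notI]] by (simp del: sum_mult_indicator)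
        finally show ?thesis by (rule order_trans) simp
      qed
    qed
    also have "\<dots> = 1 + (\<Sum>j. \<integral>\<^sup>+w. ennreal (real (j + 2) ^ (2 * p)) * indicator (I j) w \<partial>S c)"
      by (subst nn_integral_add) (auto simp: nn_integral_suminf emeasure_space_1)
    also have "\<dots> \<le> 1 + (\<Sum>j. ennreal (a j))"
    proof (intro add_left_mono suminf_le)
      fix j
      have le: "real (j + 2) ^ (2 * p) * (A / real (Suc j) ^ (2 * Suc p)) \<le> a j"
      proof -
        have "real (j + 2) ^ (2 * p) \<le> (2 * real (Suc j)) ^ (2 * p)" by (intro power_mono) auto
        also have "\<dots> = 4 ^ p * real (Suc j) ^ (2 * p)" by (simp only: power_mult_distrib power_mult) simp
        finally have "real (j + 2) ^ (2 * p) * (A / real (Suc j) ^ (2 * Suc p)) \<le> 4 ^ p * real (Suc j) ^ (2 * p) * (A / real (Suc j) ^ (2 * Suc p))"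
          using A by (intro mult_right_mono) auto
        also have "\<dots> = a j"
        proof -
          have "real (Suc j) ^ (2 * Suc p) = real (Suc j) ^ (2 * p) * real (Suc j) ^ 2" by (simp add: power_add[symmetric])
          thus ?thesis by (simp add: a_def del: of_nat_Suc)
        qed
        finally show ?thesis .
      qed
      have "(\<integral>\<^sup>+w. ennreal (real (j + 2) ^ (2 * p)) * indicator (I j) w \<partial>S c) = ennreal (real (j + 2) ^ (2 * p) * measure (S c) (I j))"
        by (simp add: nn_integral_cmult emeasure_eq_measure ennreal_mult)
      also have "\<dots> \<le> ennreal (a j)"
        by (intro ennreal_leI order_trans[OF mult_left_mono le]) (use tail'[OF c, of "real (Suc j)"] in \<open>auto simp: I_def simp del: of_nat_Suc\<close>)
      finally show "(\<integral>\<^sup>+w. ennreal (real (j + 2) ^ (2 * p)) * indicator (I j) w \<partial>S c) \<le> ennreal (a j)" .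
    qed auto
    also have "\<dots> = ennreal (1 + suminf a)"
      using suminf_nonneg[OF a a0] by (simp add: suminf_ennreal2[OF a0 a])
    finally show ?thesis .
  qed
  thus "\<exists>K\<ge>0. \<forall>c\<in>C. (\<integral>\<^sup>+w. ennreal (X c w ^ (2 * p)) \<partial>S c) \<le> ennreal K"
    using suminf_nonneg[OF a a0] by (intro exI[of _ "1 + suminf a"]) auto
qed (rule prob meas; assumption)+

lemma vec_norm_diff_le:
  assumes u: "u \<in> carrier_vec d" and v: "v \<in> carrier_vec d" shows "\<bar>vec_norm u - vec_norm v\<bar> \<le> vec_norm (u - v)"
proof -
  have "vec_norm u \<le> vec_norm (u - v) + vec_norm v"
    using vec_norm_add_le[of "u - v" d v] u v by (simp add: minus_add_uminus_vec[of _ d])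
  moreover have "vec_norm v \<le> vec_norm (v - u) + vec_norm u"
    using vec_norm_add_le[of "v - u" d u] u v by (simp add: minus_add_uminus_vec[of _ d])
  moreover have "vec_norm (v - u) = vec_norm (u - v)"
  proof -
    have "v - u = (- 1) \<cdot>\<^sub>v (u - v)" using u v by (intro eq_vecI) auto
    thus ?thesis using vec_norm_smult[of "u - v" d "- 1"] u v by simp
  qed
  ultimately show ?thesis by simp
qed

lemma convex_lipschitz_linear:
  assumes w: "w \<in> carrier_vec d" and le: "vec_norm w \<le> 1"
  shows "convex_fun_vec d (\<lambda>v. w \<bullet> v)" "one_lipschitz_vec d (\<lambda>v. w \<bullet> v)"
proof -
  show "convex_fun_vec d (\<lambda>v. w \<bullet> v)"
    using w by (simp add: convex_fun_vec_def scalar_prod_add_distrib[of _ d])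
  show "one_lipschitz_vec d (\<lambda>v. w \<bullet> v)"
    unfolding one_lipschitz_vec_def
  proof (intro ballI)
    fix u v :: "real vec" assume uv: "u \<in> carrier_vec d" "v \<in> carrier_vec d"
    have "\<bar>w \<bullet> u - w \<bullet> v\<bar> = \<bar>w \<bullet> (u - v)\<bar>" using w uv by (simp add: scalar_prod_minus_distrib[of _ d])
    also have "\<dots> \<le> vec_norm w * vec_norm (u - v)" by (rule abs_scalar_prod_le) (use w uv in auto)
    also have "\<dots> \<le> 1 * vec_norm (u - v)" by (intro mult_right_mono le) simp
    finally show "\<bar>w \<bullet> u - w \<bullet> v\<bar> \<le> vec_norm (u - v)" by simp
  qed
qed

lemma convex_lipschitz_norm:
  assumes W: "op_bound d 1 W"
  shows "convex_fun_vec d (\<lambda>v. vec_norm (W *\<^sub>v v))" "one_lipschitz_vec d (\<lambda>v. vec_norm (W *\<^sub>v v))"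
proof -
  note Wc = op_boundD(1)[OF W]
  show "convex_fun_vec d (\<lambda>v. vec_norm (W *\<^sub>v v))"
    unfolding convex_fun_vec_def
  proof (intro ballI)
    fix u v :: "real vec" and t :: real assume uv: "u \<in> carrier_vec d" "v \<in> carrier_vec d" and t: "t \<in> {0..1}"
    have "W *\<^sub>v ((1 - t) \<cdot>\<^sub>v u + t \<cdot>\<^sub>v v) = (1 - t) \<cdot>\<^sub>v (W *\<^sub>v u) + t \<cdot>\<^sub>v (W *\<^sub>v v)"
      using Wc uv by (simp add: mult_add_distrib_mat_vec[of W d d] mult_mat_vec[of W d d])
    moreover have "vec_norm \<dots> \<le> vec_norm ((1 - t) \<cdot>\<^sub>v (W *\<^sub>v u)) + vec_norm (t \<cdot>\<^sub>v (W *\<^sub>v v))"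
      by (rule vec_norm_add_le[where d = d]) (use Wc uv in auto)
    moreover have "vec_norm ((1 - t) \<cdot>\<^sub>v (W *\<^sub>v u)) = (1 - t) * vec_norm (W *\<^sub>v u)" "vec_norm (t \<cdot>\<^sub>v (W *\<^sub>v v)) = t * vec_norm (W *\<^sub>v v)"
      using Wc uv t by (simp_all add: vec_norm_smult[where d = d])
    ultimately show "vec_norm (W *\<^sub>v ((1 - t) \<cdot>\<^sub>v u + t \<cdot>\<^sub>v v)) \<le> (1 - t) * vec_norm (W *\<^sub>v u) + t * vec_norm (W *\<^sub>v v)" by simp
  qed
  show "one_lipschitz_vec d (\<lambda>v. vec_norm (W *\<^sub>v v))"
    unfolding one_lipschitz_vec_def
  proof (intro ballI)
    fix u v :: "real vec" assume uv: "u \<in> carrier_vec d" "v \<in> carrier_vec d"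
    have "\<bar>vec_norm (W *\<^sub>v u) - vec_norm (W *\<^sub>v v)\<bar> \<le> vec_norm (W *\<^sub>v u - W *\<^sub>v v)"
      by (rule vec_norm_diff_le[where d = d]) (use Wc uv in auto)
    also have "W *\<^sub>v u - W *\<^sub>v v = W *\<^sub>v (u - v)" using Wc uv by (simp add: mult_minus_distrib_mat_vec[of W d d])
    also have "vec_norm \<dots> \<le> 1 * vec_norm (u - v)" by (rule op_boundD(3)[OF W]) (use uv in auto)
    finally show "\<bar>vec_norm (W *\<^sub>v u) - vec_norm (W *\<^sub>v v)\<bar> \<le> vec_norm (u - v)" by simp
  qed
qed

lemma integrable_mult_of_squares:
  fixes f g :: "'a \<Rightarrow> real"
  assumes "f \<in> borel_measurable P" "g \<in> borel_measurable P" "integrable P (\<lambda>x. (f x)\<^sup>2)" "integrable P (\<lambda>x. (g x)\<^sup>2)"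
  shows "integrable P (\<lambda>x. f x * g x)"
proof (rule Bochner_Integration.integrable_bound)
  show "integrable P (\<lambda>x. (f x)\<^sup>2 + (g x)\<^sup>2)" using assms by simp
  have *: "\<bar>a * b\<bar> \<le> a\<^sup>2 + b\<^sup>2" for a b :: real
  proof -
    have "2 * (\<bar>a\<bar> * \<bar>b\<bar>) \<le> a\<^sup>2 + b\<^sup>2" using sum_squares_bound[of "\<bar>a\<bar>" "\<bar>b\<bar>"] by (simp add: mult.assoc)
    moreover have "0 \<le> \<bar>a\<bar> * \<bar>b\<bar>" by simp
    ultimately show ?thesis unfolding abs_mult by linarith
  qed
  show "AE x in P. norm (f x * g x) \<le> norm ((f x)\<^sup>2 + (g x)\<^sup>2)"
    by (intro AE_I2) (simp only: real_norm_def abs_of_nonneg[OF sum_power2_ge_zero] *)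
qed (use assms in auto)

text \<open>Quadratic forms are not Lipschitz, but z -> |W z| is convex and 1-Lipschitz when W has
  norm at most 1. Concentration of this norm controls its square, and polarisation reaches general
  matrices.\<close>

lemma standardized_convex_concentration:
  fixes C :: "'c set" and P :: "'c \<Rightarrow> 'a measure"
  assumes P: "\<And>c. c \<in> C \<Longrightarrow> prob_space (P c)" and Z: "\<And>c. c \<in> C \<Longrightarrow> measurable_vec (P c) (d c) (Z c)"
    and cc: "\<And>c. c \<in> C \<Longrightarrow> convex_concentration (P c) (d c) Cx (Z c)" and Cx: "0 < Cx"
    and nd: "\<And>c. c \<in> C \<Longrightarrow> 1 \<le> n c" "\<And>c. c \<in> C \<Longrightarrow> real (d c) \<le> M * real (n c)" and K: "0 \<le> K"
  shows "standardized C P Z n d K"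
proof -
  have tail: "measure (P c) {\<omega> \<in> space (P c). t \<le> \<bar>\<phi> (Z c \<omega>) - (\<integral>\<omega>'. \<phi> (Z c \<omega>') \<partial>P c)\<bar>} \<le> 2 * exp (- t\<^sup>2 / Cx\<^sup>2)"
    if "c \<in> C" "convex_fun_vec (d c) \<phi>" "one_lipschitz_vec (d c) \<phi>" "0 < t" for c \<phi> t
    using cc[OF that(1)] that(2-) unfolding convex_concentration_def by auto
  have sm: "second_moment_mat (P c) (d c) (Z c) = 1\<^sub>m (d c)"
    and mz: "\<And>j. j < d c \<Longrightarrow> integrable (P c) (\<lambda>\<omega>. Z c \<omega> $ j)" "\<And>j. j < d c \<Longrightarrow> integrable (P c) (\<lambda>\<omega>. (Z c \<omega> $ j)\<^sup>2)"
      "\<And>j. j < d c \<Longrightarrow> (\<integral>\<omega>. Z c \<omega> $ j \<partial>P c) = 0" if "c \<in> C" for c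
    using cc[OF that] by (auto simp: convex_concentration_def mean_zero_square_integrable_def)
  have Zc: "Z c \<omega> \<in> carrier_vec (d c)" if "c \<in> C" "\<omega> \<in> space (P c)" for c \<omega>
    using Z[OF that(1)] that(2) by (auto simp: measurable_vec_def)
  have int: "integrable (P c) (\<lambda>\<omega>. Z c \<omega> $ j * Z c \<omega> $ k)" if "c \<in> C" "j < d c" "k < d c" for c j k
    using that Z[OF that(1)] mz(2)[OF that(1)] by (intro integrable_mult_of_squares) (auto simp: measurable_vec_def)
  note equad = expectation_standard_quad[OF Z int sm]
  define N where "N c W \<omega> = vec_norm (W *\<^sub>v Z c \<omega>)" for c W \<omega>
  define m where "m c W = (\<integral>\<omega>. N c W \<omega> \<partial>P c)" for c W
  have N2: "(N c W \<omega>)\<^sup>2 = Z c \<omega> \<bullet> ((transpose_mat W * W) *\<^sub>v Z c \<omega>)" if "c \<in> C" "W \<in> carrier_mat (d c) (d c)" "\<omega> \<in> space (P c)" for c W \<omega>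
    using that Zc[OF that(1,3)] unfolding N_def vec_norm_power2
    by (simp add: scalar_prod_mult_mat_vec_transpose[where d = "d c"])
  have N2int: "integrable (P c) (\<lambda>\<omega>. (N c W \<omega>)\<^sup>2)" and EN2: "(\<integral>\<omega>. (N c W \<omega>)\<^sup>2 \<partial>P c) = mat_trace (transpose_mat W * W)"
    if "c \<in> C" "W \<in> carrier_mat (d c) (d c)" for c W
  proof -
    have W: "transpose_mat W * W \<in> carrier_mat (d c) (d c)" using that by simp
    show "integrable (P c) (\<lambda>\<omega>. (N c W \<omega>)\<^sup>2)"
      using equad(1)[OF that(1) that(1) _ _ that(1) W] N2[OF that] by (simp cong: Bochner_Integration.integrable_cong)
    show "(\<integral>\<omega>. (N c W \<omega>)\<^sup>2 \<partial>P c) = mat_trace (transpose_mat W * W)"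
      using equad(2)[OF that(1) that(1) _ _ that(1) W] N2[OF that] by (simp cong: Bochner_Integration.integral_cong)
  qed
  have Nmeas: "N c W \<in> borel_measurable (P c)" if "c \<in> C" "W \<in> carrier_mat (d c) (d c)" for c W
  proof -
    have "(\<lambda>\<omega>. sqrt ((N c W \<omega>)\<^sup>2)) \<in> borel_measurable (P c)" using N2int[OF that] by measurable
    thus ?thesis by (simp add: N_def[abs_def])
  qed
  have Nint: "integrable (P c) (N c W)" if c: "c \<in> C" and W: "W \<in> carrier_mat (d c) (d c)" for c W
  proof -
    interpret prob_space "P c" by (rule P[OF c])
    show ?thesis
    proof (rule Bochner_Integration.integrable_bound)
      show "integrable (P c) (\<lambda>\<omega>. 1 + (N c W \<omega>)\<^sup>2)" using N2int[OF c W] by simp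
      have "\<bar>a\<bar> \<le> 1 + a\<^sup>2" for a :: real
        using sum_squares_bound[of "\<bar>a\<bar>" 1] zero_le_power2[of a] unfolding power2_abs by simp
      thus "AE \<omega> in P c. norm (N c W \<omega>) \<le> norm (1 + (N c W \<omega>)\<^sup>2)" by auto
    qed (rule Nmeas[OF c W])
  qed
  let ?E = "{e. fst e \<in> C \<and> op_bound (d (fst e)) 1 (snd e)}"
  define Y where "Y e \<omega> = N (fst e) (snd e) \<omega> - m (fst e) (snd e)" for e :: "'c \<times> real mat" and \<omega>
  have eC: "fst e \<in> C" "snd e \<in> carrier_mat (d (fst e)) (d (fst e))" if "e \<in> ?E" for e using that op_boundD(1) by auto
  have mbY: "moments_bounded ?E (\<lambda>e. P (fst e)) Y"
  proof (rule moments_bounded_of_gaussian_tail[where Q = Cx])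
    fix e assume e: "e \<in> ?E"
    show "prob_space (P (fst e))" by (rule P[OF eC(1)[OF e]])
    show "Y e \<in> borel_measurable (P (fst e))" unfolding Y_def using Nmeas[OF eC[OF e]] by simp
    show "measure (P (fst e)) {w \<in> space (P (fst e)). t \<le> \<bar>Y e w\<bar>} \<le> 2 * exp (- t\<^sup>2 / Cx\<^sup>2)" if "0 < t" for t
      using tail[OF eC(1)[OF e] convex_lipschitz_norm that, of "snd e"] e by (simp add: Y_def N_def m_def)
  qed (rule Cx)
  obtain L where L: "0 \<le> L" "\<And>e. e \<in> ?E \<Longrightarrow> \<bar>\<integral>w. Y e w * Y e w \<partial>P (fst e)\<bar> \<le> L"
    using moments_bounded_expectation[OF moments_bounded_mult[OF mbY mbY]] by blast
  \<comment> \<open>With N = m + Y, centring N^2 leaves Y^2 + 2 m Y minus the variance of N. The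
    cross term is affordable because m^2 is at most the trace of W^T W, hence at most d, so m / sqrt
    n is bounded.\<close>
  have sq: "moments_bounded ?E (\<lambda>e. P (fst e)) (\<lambda>e \<omega>. ((N (fst e) (snd e) \<omega>)\<^sup>2 - (\<integral>\<omega>. (N (fst e) (snd e) \<omega>)\<^sup>2 \<partial>P (fst e))) / sqrt (n (fst e)))"
  proof (rule moments_bounded_cong)
    define k where "k e = (\<integral>w. Y e w * Y e w \<partial>P (fst e))" for e
    define r where "r e = 1 / sqrt (n (fst e))" for e :: "'c \<times> real mat"
    have r: "\<bar>r e\<bar> \<le> 1" if "e \<in> ?E" for e unfolding r_def by (rule inverse_sqrt_le_1[OF nd(1)[OF eC(1)[OF that]]])
    have mb: "0 \<le> m (fst e) (snd e)" "m (fst e) (snd e) * r e \<le> sqrt \<bar>M\<bar>"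
      and kk: "(\<integral>\<omega>. (N (fst e) (snd e) \<omega>)\<^sup>2 \<partial>P (fst e)) = (m (fst e) (snd e))\<^sup>2 + k e" if e: "e \<in> ?E" for e
    proof -
      interpret prob_space "P (fst e)" by (rule P[OF eC(1)[OF e]])
      show m0: "0 \<le> m (fst e) (snd e)" unfolding m_def by (simp add: N_def)
      have "k e = (\<integral>\<omega>. (N (fst e) (snd e) \<omega>)\<^sup>2 \<partial>P (fst e)) - (m (fst e) (snd e))\<^sup>2"
        using variance_eq[OF Nint[OF eC[OF e]] N2int[OF eC[OF e]]] by (simp add: k_def Y_def m_def power2_eq_square)
      thus kk: "(\<integral>\<omega>. (N (fst e) (snd e) \<omega>)\<^sup>2 \<partial>P (fst e)) = (m (fst e) (snd e))\<^sup>2 + k e" by simp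
      have "0 \<le> k e" by (simp add: k_def)
      hence "(m (fst e) (snd e))\<^sup>2 \<le> mat_trace (transpose_mat (snd e) * snd e)" using kk EN2[OF eC[OF e]] by simp
      also have "\<dots> \<le> real (d (fst e)) * (1 * 1)"
        using op_bound_trace[OF op_bound_mult[OF op_bound_transpose], of "d (fst e)" 1 "snd e" 1 "snd e"] e by simp
      also have "\<dots> \<le> \<bar>M\<bar> * real (n (fst e))"
        using nd(2)[OF eC(1)[OF e]] mult_right_mono[OF abs_ge_self[of M], of "real (n (fst e))"] by simp
      finally have "sqrt ((m (fst e) (snd e))\<^sup>2) \<le> sqrt (\<bar>M\<bar> * real (n (fst e)))" by (rule real_sqrt_le_mono)
      hence "m (fst e) (snd e) \<le> sqrt \<bar>M\<bar> * sqrt (n (fst e))" using m0 by (simp add: real_sqrt_mult)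
      moreover have "0 < sqrt (real (n (fst e)))" using nd(1)[OF eC(1)[OF e]] by simp
      ultimately show "m (fst e) (snd e) * r e \<le> sqrt \<bar>M\<bar>" by (simp add: r_def divide_le_eq)
    qed
    have "\<bar>2 * (m (fst e) (snd e) * r e)\<bar> \<le> 2 * sqrt \<bar>M\<bar>" if "e \<in> ?E" for e
    proof -
      have "0 \<le> r e" by (simp add: r_def)
      thus ?thesis using mb[OF that] by simp
    qed
    note t1 = moments_bounded_cmult[OF mbY this]
    have "\<bar>r e * k e\<bar> \<le> 1 * L" if "e \<in> ?E" for e
      unfolding abs_mult using L(2)[OF that] r[OF that] by (intro mult_mono) (auto simp: k_def)
    note t2 = moments_bounded_const[OF P[OF eC(1)] this]
    note t3 = moments_bounded_cmult[OF moments_bounded_mult[OF mbY mbY] r]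
    show "moments_bounded ?E (\<lambda>e. P (fst e)) (\<lambda>e \<omega>. (r e * (Y e \<omega> * Y e \<omega>) + 2 * (m (fst e) (snd e) * r e) * Y e \<omega>) - r e * k e)"
      by (rule moments_bounded_diff[OF moments_bounded_add[OF t3 t1] t2])
    show "((N (fst e) (snd e) \<omega>)\<^sup>2 - (\<integral>\<omega>. (N (fst e) (snd e) \<omega>)\<^sup>2 \<partial>P (fst e))) / sqrt (n (fst e)) =
      (r e * (Y e \<omega> * Y e \<omega>) + 2 * (m (fst e) (snd e) * r e) * Y e \<omega>) - r e * k e" if "e \<in> ?E" for e \<omega>
    proof -
      have "N (fst e) (snd e) \<omega> = Y e \<omega> + m (fst e) (snd e)" by (simp add: Y_def)
      moreover have "(a + b)\<^sup>2 - (b\<^sup>2 + c) = a * a + 2 * b * a - c" for a b c :: real by (simp add: power2_eq_square algebra_simps)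
      moreover have "(a * a + 2 * b * a - c) / q = 1 / q * (a * a) + 2 * (b * (1 / q)) * a - 1 / q * c" for a b c q :: real
        by (simp add: diff_divide_distrib add_divide_distrib)
      ultimately show ?thesis unfolding kk[OF that] r_def by metis
    qed
  qed
  show ?thesis
  proof (rule standardized.intro)
    let ?E' = "{e. fst e \<in> C \<and> snd e \<in> carrier_vec (d (fst e)) \<and> vec_norm (snd e) \<le> 1}"
    show "moments_bounded ?E' (\<lambda>e. P (fst e)) (\<lambda>e \<omega>. snd e \<bullet> Z (fst e) \<omega>)"
    proof (rule moments_bounded_of_gaussian_tail[where Q = Cx])
      fix e assume e: "e \<in> ?E'"
      hence c: "fst e \<in> C" and w: "snd e \<in> carrier_vec (d (fst e))" "vec_norm (snd e) \<le> 1" by auto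
      show "prob_space (P (fst e))" by (rule P[OF c])
      show "(\<lambda>\<omega>. snd e \<bullet> Z (fst e) \<omega>) \<in> borel_measurable (P (fst e))" by (rule measurable_vec_linear[OF Z[OF c] w(1)])
      have "(\<integral>\<omega>. snd e \<bullet> Z (fst e) \<omega> \<partial>P (fst e)) = (\<integral>\<omega>. (\<Sum>j<d (fst e). snd e $ j * Z (fst e) \<omega> $ j) \<partial>P (fst e))"
        using Zc[OF c, THEN carrier_vecD] by (intro Bochner_Integration.integral_cong) (auto simp: scalar_prod_def atLeast0LessThan)
      also have "\<dots> = 0" using mz(1,3)[OF c] by simp
      finally show "measure (P (fst e)) {w \<in> space (P (fst e)). t \<le> \<bar>snd e \<bullet> Z (fst e) w\<bar>} \<le> 2 * exp (- t\<^sup>2 / Cx\<^sup>2)" if "0 < t" for t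
        using tail[OF c convex_lipschitz_linear[OF w] that] by simp
    qed (rule Cx)
    let ?B = "{e. fst e \<in> C \<and> op_bound (d (fst e)) K (snd e)}"
    \<comment> \<open>Polarisation: 4 z . B z = |(1 + B) z|^2 - |(1 - B) z|^2, valid for
      non-symmetric B too. The factor 1 / (1 + K) brings the norm down to 1.\<close>
    define W where "W s e = (1 / (1 + K)) \<cdot>\<^sub>m (1\<^sub>m (d (fst e)) + s \<cdot>\<^sub>m snd e)" for s :: real and e :: "'c \<times> real mat"
    have Wb: "op_bound (d (fst e)) 1 (W s e)" if e: "e \<in> ?B" and s: "\<bar>s\<bar> = 1" for s e
    proof -
      have "op_bound (d (fst e)) (1 + \<bar>s\<bar> * K) (1\<^sub>m (d (fst e)) + s \<cdot>\<^sub>m snd e)"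
        using e by (intro op_bound_add op_bound_one op_bound_smult) auto
      from op_bound_smult[OF this, of "1 / (1 + K)"] show ?thesis using K by (simp add: W_def s)
    qed
    have WE: "(fst e, W s e) \<in> ?E" if e: "e \<in> ?B" and s: "\<bar>s\<bar> = 1" for s e using Wb[OF e s] e by simp
    have q: "moments_bounded ?B (\<lambda>e. P (fst e)) (\<lambda>e \<omega>. ((N (fst e) (W s e) \<omega>)\<^sup>2 - (\<integral>\<omega>. (N (fst e) (W s e) \<omega>)\<^sup>2 \<partial>P (fst e))) / sqrt (n (fst e)))"
      if s: "\<bar>s\<bar> = 1" for s
      using moments_bounded_reindex[OF sq, of ?B "\<lambda>e. (fst e, W s e)", OF WE[OF _ s]] by simp
    have "moments_bounded ?B (\<lambda>e. P (fst e)) (\<lambda>e \<omega>. (1 + K)\<^sup>2 / 4 *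
        (((N (fst e) (W 1 e) \<omega>)\<^sup>2 - (\<integral>\<omega>. (N (fst e) (W 1 e) \<omega>)\<^sup>2 \<partial>P (fst e))) / sqrt (n (fst e)) -
         ((N (fst e) (W (- 1) e) \<omega>)\<^sup>2 - (\<integral>\<omega>. (N (fst e) (W (- 1) e) \<omega>)\<^sup>2 \<partial>P (fst e))) / sqrt (n (fst e))))"
      by (rule moments_bounded_cmult[OF moments_bounded_diff[OF q q], where K = "(1 + K)\<^sup>2 / 4"]) auto
    thus "moments_bounded ?B (\<lambda>e. P (fst e)) (\<lambda>e \<omega>. (Z (fst e) \<omega> \<bullet> (snd e *\<^sub>v Z (fst e) \<omega>) - mat_trace (snd e)) / sqrt (n (fst e)))"
    proof (rule moments_bounded_cong)
      fix e \<omega> assume e: "e \<in> ?B" and \<omega>: "\<omega> \<in> space (P (fst e))"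
      have c: "fst e \<in> C" and B: "snd e \<in> carrier_mat (d (fst e)) (d (fst e))" using e op_boundD(1) by auto
      have WC: "W s e \<in> carrier_mat (d (fst e)) (d (fst e))" for s using B by (simp add: W_def)
      have pol: "Z (fst e) \<omega> \<bullet> (snd e *\<^sub>v Z (fst e) \<omega>) = (1 + K)\<^sup>2 / 4 * ((N (fst e) (W 1 e) \<omega>)\<^sup>2 - (N (fst e) (W (- 1) e) \<omega>)\<^sup>2)"
        if \<omega>: "\<omega> \<in> space (P (fst e))" for \<omega>
      proof -
        define v where "v = Z (fst e) \<omega>"
        have v: "v \<in> carrier_vec (d (fst e))" unfolding v_def by (rule Zc[OF c \<omega>])
        define b where "b = snd e *\<^sub>v v"
        have b: "b \<in> carrier_vec (d (fst e))" using B v by (simp add: b_def)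
        have NW: "(N (fst e) (W s e) \<omega>)\<^sup>2 = (v \<bullet> v + 2 * s * (v \<bullet> b) + s\<^sup>2 * (b \<bullet> b)) / (1 + K)\<^sup>2" for s
        proof -
          have eq: "W s e *\<^sub>v v = (1 / (1 + K)) \<cdot>\<^sub>v (v + s \<cdot>\<^sub>v b)"
            unfolding W_def b_def using B v
            by (simp add: smult_mat_mult_vec[where d = "d (fst e)"] add_mult_distrib_mat_vec[of _ "d (fst e)" "d (fst e)"])
          have "(v + s \<cdot>\<^sub>v b) \<bullet> (v + s \<cdot>\<^sub>v b) = v \<bullet> v + 2 * s * (v \<bullet> b) + s\<^sup>2 * (b \<bullet> b)"
            using v b scalar_prod_comm_real[OF b v]
            by (simp add: add_scalar_prod_distrib[of _ "d (fst e)"] scalar_prod_add_distrib[of _ "d (fst e)"] power2_eq_square algebra_simps)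
          hence "(vec_norm (v + s \<cdot>\<^sub>v b))\<^sup>2 = v \<bullet> v + 2 * s * (v \<bullet> b) + s\<^sup>2 * (b \<bullet> b)" by (simp add: vec_norm_power2)
          moreover have "vec_norm (W s e *\<^sub>v v) = 1 / (1 + K) * vec_norm (v + s \<cdot>\<^sub>v b)"
            unfolding eq using v b K by (subst vec_norm_smult[where d = "d (fst e)"]) auto
          ultimately show ?thesis unfolding N_def v_def[symmetric] by (simp add: power_mult_distrib power_divide)
        qed
        have "1 + K \<noteq> 0" using K by simp
        thus ?thesis unfolding NW v_def[symmetric] b_def[symmetric] by (simp add: field_simps)
      qed
      have "mat_trace (snd e) = (\<integral>\<omega>. Z (fst e) \<omega> \<bullet> (snd e *\<^sub>v Z (fst e) \<omega>) \<partial>P (fst e))"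
        using equad(2)[OF c c _ _ c B] by simp
      also have "\<dots> = (\<integral>\<omega>. (1 + K)\<^sup>2 / 4 * ((N (fst e) (W 1 e) \<omega>)\<^sup>2 - (N (fst e) (W (- 1) e) \<omega>)\<^sup>2) \<partial>P (fst e))"
        by (intro Bochner_Integration.integral_cong pol) auto
      also have "\<dots> = (1 + K)\<^sup>2 / 4 * ((\<integral>\<omega>. (N (fst e) (W 1 e) \<omega>)\<^sup>2 \<partial>P (fst e)) - (\<integral>\<omega>. (N (fst e) (W (- 1) e) \<omega>)\<^sup>2 \<partial>P (fst e)))"
        using N2int[OF c WC] by simp
      finally show "(Z (fst e) \<omega> \<bullet> (snd e *\<^sub>v Z (fst e) \<omega>) - mat_trace (snd e)) / sqrt (n (fst e)) = (1 + K)\<^sup>2 / 4 *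
        (((N (fst e) (W 1 e) \<omega>)\<^sup>2 - (\<integral>\<omega>. (N (fst e) (W 1 e) \<omega>)\<^sup>2 \<partial>P (fst e))) / sqrt (n (fst e)) -
         ((N (fst e) (W (- 1) e) \<omega>)\<^sup>2 - (\<integral>\<omega>. (N (fst e) (W (- 1) e) \<omega>)\<^sup>2 \<partial>P (fst e))) / sqrt (n (fst e)))"
        unfolding pol[OF \<omega>] by (simp add: diff_divide_distrib right_diff_distrib)
    qed
  qed (use P Z nd K in auto)
qed

subsection \<open>Linear images of standardised vectors\<close>

text \<open>Takes as index set all admissible laws on the given sample type at once, which makes the
  envelope H independent of n, d and the law.\<close>

lemma uniform_test_forms:
  assumes Cx: "0 < Cx"
  shows "\<exists>H. \<forall>K p n d (P :: 'a measure) Z A. prob_space P \<longrightarrow> measurable_vec P d Z \<longrightarrow> 1 \<le> n \<longrightarrow> 1 \<le> d \<longrightarrow> real d \<le> M * real n \<longrightarrow>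
    subgaussian_coordinates P d Cx Z \<or> convex_concentration P d Cx Z \<longrightarrow> test_mat n d K A \<longrightarrow>
    (\<integral>\<^sup>+\<omega>. ennreal (((Z \<omega> \<bullet> (A *\<^sub>v Z \<omega>) - mat_trace A) / sqrt n) ^ (2 * p)) \<partial>P) \<le> ennreal (H K p)"
proof -
  define Q where "Q L K p n d P Z A \<longleftrightarrow> prob_space P \<longrightarrow> measurable_vec P d Z \<longrightarrow> 1 \<le> n \<longrightarrow> 1 \<le> d \<longrightarrow> real d \<le> M * real n \<longrightarrow>
    subgaussian_coordinates P d Cx Z \<or> convex_concentration P d Cx Z \<longrightarrow> test_mat n d K A \<longrightarrow>
    (\<integral>\<^sup>+\<omega>. ennreal (((Z \<omega> \<bullet> (A *\<^sub>v Z \<omega>) - mat_trace A) / sqrt n) ^ (2 * p)) \<partial>P) \<le> ennreal L"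
    for L K p n d and P :: "'a measure" and Z A
  have "\<exists>L. \<forall>n d P Z A. Q L K p n d P Z A" for K p
  proof (cases "0 \<le> K")
    case False
    thus ?thesis using test_mat_nonneg by (auto simp: Q_def)
  next
    case K: True
    define B where "B T = {(n, d, P :: 'a measure, Z). prob_space P \<and> measurable_vec P d Z \<and> 1 \<le> n \<and> 1 \<le> d \<and> real d \<le> M * real n \<and> T P d Cx Z}"
      for T :: "'a measure \<Rightarrow> nat \<Rightarrow> real \<Rightarrow> ('a \<Rightarrow> real vec) \<Rightarrow> bool"
    let ?n = "\<lambda>c :: nat \<times> nat \<times> 'a measure \<times> ('a \<Rightarrow> real vec). fst c" and ?d = "\<lambda>c :: nat \<times> nat \<times> 'a measure \<times> ('a \<Rightarrow> real vec). fst (snd c)"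
      and ?P = "\<lambda>c :: nat \<times> nat \<times> 'a measure \<times> ('a \<Rightarrow> real vec). fst (snd (snd c))" and ?Z = "\<lambda>c :: nat \<times> nat \<times> 'a measure \<times> ('a \<Rightarrow> real vec). snd (snd (snd c))"
    have s1: "standardized (B subgaussian_coordinates) ?P ?Z ?n ?d K"
      by (rule standardized_subgaussian[where Cx = Cx and M = M]) (use K in \<open>auto simp: B_def\<close>)
    have s2: "standardized (B convex_concentration) ?P ?Z ?n ?d K"
      by (rule standardized_convex_concentration[where Cx = Cx and M = M]) (use K Cx in \<open>auto simp: B_def\<close>)
    have ex: "\<exists>L\<ge>0. \<forall>n d P Z A. (n, d, P, Z) \<in> B T \<longrightarrow> test_mat n d K A \<longrightarrow>
      (\<integral>\<^sup>+\<omega>. ennreal (((Z \<omega> \<bullet> (A *\<^sub>v Z \<omega>) - mat_trace A) / sqrt n) ^ (2 * p)) \<partial>P) \<le> ennreal L"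
      if "standardized (B T) ?P ?Z ?n ?d K" for T
    proof -
      from moments_boundedD(3)[OF standardized.test_forms[OF that], of p] obtain L where L: "0 \<le> L"
        "\<And>e. e \<in> {e. fst e \<in> B T \<and> test_mat (?n (fst e)) (?d (fst e)) K (snd e)} \<Longrightarrow>
          (\<integral>\<^sup>+\<omega>. ennreal (((?Z (fst e) \<omega> \<bullet> (snd e *\<^sub>v ?Z (fst e) \<omega>) - mat_trace (snd e)) / sqrt (?n (fst e))) ^ (2 * p)) \<partial>?P (fst e)) \<le> ennreal L"
        by blast
      show ?thesis
      proof (intro exI[of _ L] conjI allI impI L(1))
        fix n d P Z A assume "(n, d, P, Z) \<in> B T" "test_mat n d K A"
        thus "(\<integral>\<^sup>+\<omega>. ennreal (((Z \<omega> \<bullet> (A *\<^sub>v Z \<omega>) - mat_trace A) / sqrt n) ^ (2 * p)) \<partial>P) \<le> ennreal L"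
          using L(2)[of "((n, d, P, Z), A)"] by simp
      qed
    qed
    from ex[OF s1] obtain L1 where L1: "0 \<le> L1" "\<And>n d P Z A. (n, d, P, Z) \<in> B subgaussian_coordinates \<Longrightarrow> test_mat n d K A \<Longrightarrow>
      (\<integral>\<^sup>+\<omega>. ennreal (((Z \<omega> \<bullet> (A *\<^sub>v Z \<omega>) - mat_trace A) / sqrt n) ^ (2 * p)) \<partial>P) \<le> ennreal L1" by blast
    from ex[OF s2] obtain L2 where L2: "0 \<le> L2" "\<And>n d P Z A. (n, d, P, Z) \<in> B convex_concentration \<Longrightarrow> test_mat n d K A \<Longrightarrow>
      (\<integral>\<^sup>+\<omega>. ennreal (((Z \<omega> \<bullet> (A *\<^sub>v Z \<omega>) - mat_trace A) / sqrt n) ^ (2 * p)) \<partial>P) \<le> ennreal L2" by blast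
    have le: "ennreal L1 \<le> ennreal (L1 + L2)" "ennreal L2 \<le> ennreal (L1 + L2)" using L1(1) L2(1) by (auto intro: ennreal_leI)
    show ?thesis
    proof (intro exI[of _ "L1 + L2"] allI)
      fix n d P Z A show "Q (L1 + L2) K p n d P Z A"
        unfolding Q_def
      proof (intro impI)
        assume a: "prob_space P" "measurable_vec P d Z" "1 \<le> n" "1 \<le> d" "real d \<le> M * real n" and A: "test_mat n d K A"
        assume "subgaussian_coordinates P d Cx Z \<or> convex_concentration P d Cx Z"
        thus "(\<integral>\<^sup>+\<omega>. ennreal (((Z \<omega> \<bullet> (A *\<^sub>v Z \<omega>) - mat_trace A) / sqrt n) ^ (2 * p)) \<partial>P) \<le> ennreal (L1 + L2)"
        proof
          assume "subgaussian_coordinates P d Cx Z"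
          hence "(n, d, P, Z) \<in> B subgaussian_coordinates" using a by (simp add: B_def)
          from order_trans[OF L1(2)[OF this A] le(1)] show ?thesis .
        next
          assume "convex_concentration P d Cx Z"
          hence "(n, d, P, Z) \<in> B convex_concentration" using a by (simp add: B_def)
          from order_trans[OF L2(2)[OF this A] le(2)] show ?thesis .
        qed
      qed
    qed
  qed
  \<comment> \<open>One bound for each K and p is selected to obtain H as a function.\<close>
  hence "\<forall>n d P Z A. Q (SOME L. \<forall>n d P Z A. Q L K p n d P Z A) K p n d P Z A" for K p by (rule someI_ex)
  thus ?thesis unfolding Q_def by (intro exI[of _ "\<lambda>K p. SOME L. \<forall>n d P Z A. Q L K p n d P Z A"]) (simp add: Q_def)
qed

text \<open>The Frobenius bound makes the set under the supremum bounded above; without this the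
  value of \<open>SUP\<close> would carry no information.\<close>

lemma op_norm_bound:
  assumes A: "A \<in> carrier_mat d d" and le: "op_norm A \<le> a"
  shows "op_bound d a A"
proof -
  define F where "F = sqrt (\<Sum>i<d. \<Sum>j<d. (A $$ (i, j))\<^sup>2)"
  have F: "op_bound d F A" unfolding F_def by (rule op_bound_Frobenius[OF A])
  have bd: "bdd_above ((\<lambda>v. vec_norm (A *\<^sub>v v)) ` {v \<in> carrier_vec d. vec_norm v \<le> 1})"
  proof (rule bdd_aboveI2)
    fix v assume "v \<in> {v \<in> carrier_vec d. vec_norm v \<le> 1}"
    hence v: "v \<in> carrier_vec d" "vec_norm v \<le> 1" by auto
    have "vec_norm (A *\<^sub>v v) \<le> F * vec_norm v" by (rule op_boundD(3)[OF F v(1)])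
    also have "\<dots> \<le> F * 1" by (intro mult_left_mono v op_boundD(2)[OF F])
    finally show "vec_norm (A *\<^sub>v v) \<le> F" by simp
  qed
  have unit: "vec_norm (A *\<^sub>v v) \<le> a" if v: "v \<in> carrier_vec d" "vec_norm v \<le> 1" for v
  proof -
    have "vec_norm (A *\<^sub>v v) \<le> (SUP v\<in>{v \<in> carrier_vec d. vec_norm v \<le> 1}. vec_norm (A *\<^sub>v v))"
      by (rule cSUP_upper[OF _ bd]) (use v in auto)
    thus ?thesis using le A by (simp add: op_norm_def)
  qed
  have "0 \<le> a" using order_trans[OF vec_norm_nonneg unit[of "0\<^sub>v d"]] by (simp add: vec_norm_def)
  moreover have "vec_norm (A *\<^sub>v v) \<le> a * vec_norm v" if v: "v \<in> carrier_vec d" for v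
  proof -
    define w where "w = (1 / vec_norm v) \<cdot>\<^sub>v v"
    have w: "w \<in> carrier_vec d" "vec_norm w \<le> 1" "v = vec_norm v \<cdot>\<^sub>v w" using v vec_normalize[OF v] by (simp_all add: w_def)
    have "A *\<^sub>v v = vec_norm v \<cdot>\<^sub>v (A *\<^sub>v w)" using w(3) mult_mat_vec[OF A w(1), of "vec_norm v"] by simp
    hence "vec_norm (A *\<^sub>v v) = vec_norm v * vec_norm (A *\<^sub>v w)" using A w(1) by (simp add: vec_norm_smult[where d = d])
    also have "\<dots> \<le> vec_norm v * a" by (intro mult_left_mono unit w) simp
    finally show ?thesis by (simp add: mult.commute)
  qed
  ultimately show ?thesis using A by (simp add: op_bound_def)
qed

locale linear_image =
  fixes P :: "'a measure" and d :: nat and Z Y :: "'a \<Rightarrow> real vec" and S :: "real mat"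
  assumes prob: "prob_space P" and Z: "measurable_vec P d Z" and Y: "measurable_vec P d Y"
    and int: "\<And>j k. j < d \<Longrightarrow> k < d \<Longrightarrow> integrable P (\<lambda>\<omega>. Z \<omega> $ j * Z \<omega> $ k)"
    and sm: "second_moment_mat P d Z = 1\<^sub>m d" and S: "S \<in> carrier_mat d d"
    and Y_eq: "\<And>\<omega>. \<omega> \<in> space P \<Longrightarrow> Y \<omega> = S *\<^sub>v Z \<omega>"
    and norm_le: "op_norm (second_moment_mat P d Y) \<le> 1"
begin

abbreviation "\<mu> \<equiv> distr P (vec_borel d) Y"

lemma Zc: "\<omega> \<in> space P \<Longrightarrow> Z \<omega> \<in> carrier_vec d" and Yc: "\<omega> \<in> space P \<Longrightarrow> Y \<omega> \<in> carrier_vec d"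
  using Z Y by (auto simp: measurable_vec_def)

lemma meas_Y: "Y \<in> P \<rightarrow>\<^sub>M vec_borel d"
  using Y by (intro measurable_vec_borelI) (auto simp: measurable_vec_def)

lemma Y_products:
  assumes jk: "j < d" "k < d"
  shows "integrable P (\<lambda>\<omega>. Y \<omega> $ j * Y \<omega> $ k)" "(\<integral>\<omega>. Y \<omega> $ j * Y \<omega> $ k \<partial>P) = row S j \<bullet> row S k"
proof -
  have r: "row S i \<in> carrier_vec d" for i using S by (simp add: carrier_vecI)
  have eq: "Y \<omega> $ j * Y \<omega> $ k = Z \<omega> \<bullet> (outer_prod d (row S j) (row S k) *\<^sub>v Z \<omega>)" if "\<omega> \<in> space P" for \<omega>
    using jk S r Zc[OF that] scalar_prod_comm_real[OF Zc[OF that] r[of j]]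
    by (simp add: Y_eq[OF that] outer_prod_mult_vec[OF r r Zc[OF that]])
  note q = expectation_standard_quad[OF Z int sm outer_prod_carrier[of d "row S j" "row S k"]]
  show "integrable P (\<lambda>\<omega>. Y \<omega> $ j * Y \<omega> $ k)" using q(1) eq by (simp cong: Bochner_Integration.integrable_cong)
  show "(\<integral>\<omega>. Y \<omega> $ j * Y \<omega> $ k \<partial>P) = row S j \<bullet> row S k"
    using q(2) eq mat_trace_outer_prod[OF r[of j] r[of k]] by (simp cong: Bochner_Integration.integral_cong)
qed

lemma second_moment_eq: "second_moment_mat P d Y = S * transpose_mat S"
  using S by (intro eq_matI) (auto simp: second_moment_mat_def Y_products)

lemma cov_eq: "cov_mat d \<mu> = second_moment_mat P d Y"
proof (rule eq_matI)
  fix j k assume jk: "j < dim_row (second_moment_mat P d Y)" "k < dim_col (second_moment_mat P d Y)"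
  hence jk: "j < d" "k < d" by (auto simp: second_moment_mat_def)
  have "(\<lambda>v. v $ j * v $ k) \<in> borel_measurable (vec_borel d)" using jk by measurable
  from integral_distr[OF meas_Y this] show "cov_mat d \<mu> $$ (j, k) = second_moment_mat P d Y $$ (j, k)"
    using jk by (simp add: cov_mat_def second_moment_mat_def)
qed (auto simp: cov_mat_def second_moment_mat_def)

lemma psd:
  assumes v: "v \<in> carrier_vec d"
  shows "v \<bullet> (cov_mat d \<mu> *\<^sub>v v) = (vec_norm (transpose_mat S *\<^sub>v v))\<^sup>2"
  unfolding cov_eq second_moment_eq vec_norm_power2 using S v
  by (simp add: mult_mat_vec_assoc_square[where d = d] scalar_prod_mult_mat_vec_transpose[where d = d])

lemma cov_bound: "op_bound d 1 (cov_mat d \<mu>)"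
  by (rule op_norm_bound[OF cov_mat_carrier]) (use norm_le cov_eq in simp)

text \<open>The squared norm of S^T v is the covariance form of v, at most |v|^2; the bound then
  passes to S by transposition.\<close>

lemma S_bound: "op_bound d 1 S"
proof -
  have "vec_norm (transpose_mat S *\<^sub>v v) \<le> 1 * vec_norm v" if v: "v \<in> carrier_vec d" for v
  proof -
    have "(vec_norm (transpose_mat S *\<^sub>v v))\<^sup>2 \<le> vec_norm v * vec_norm (cov_mat d \<mu> *\<^sub>v v)"
      using abs_scalar_prod_le[OF v mult_mat_vec_carrier_square[OF cov_mat_carrier v]] unfolding psd[OF v, symmetric] by (rule order_trans[OF abs_ge_self])
    also have "\<dots> \<le> vec_norm v * (1 * vec_norm v)" by (intro mult_left_mono op_boundD(3)[OF cov_bound v]) simp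
    finally have "(vec_norm (transpose_mat S *\<^sub>v v))\<^sup>2 \<le> (vec_norm v)\<^sup>2" by (simp add: power2_eq_square)
    thus ?thesis by (simp add: power2_le_iff_abs_le)
  qed
  hence "op_bound d 1 (transpose_mat S)" using S by (simp add: op_bound_def)
  from op_bound_transpose[OF this] show ?thesis by simp
qed

lemma quad_form_eq:
  assumes A: "A \<in> carrier_mat d d" and \<omega>: "\<omega> \<in> space P"
  shows "Y \<omega> \<bullet> (A *\<^sub>v Y \<omega>) = Z \<omega> \<bullet> ((transpose_mat S * A * S) *\<^sub>v Z \<omega>)"
proof -
  have T: "transpose_mat S \<in> carrier_mat d d" using S by simp
  have AS: "A *\<^sub>v (S *\<^sub>v Z \<omega>) \<in> carrier_vec d" using A S Zc[OF \<omega>] by simp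
  show ?thesis
    using scalar_prod_mult_mat_vec_transpose[OF T Zc[OF \<omega>] AS] A S T Zc[OF \<omega>]
    by (simp add: Y_eq[OF \<omega>] mult_mat_vec_assoc_square[where d = d])
qed

lemma trace_eq:
  assumes A: "A \<in> carrier_mat d d" shows "mat_trace (cov_mat d \<mu> * A) = mat_trace (transpose_mat S * A * S)"
proof -
  have T: "transpose_mat S \<in> carrier_mat d d" using S by simp
  have "mat_trace (cov_mat d \<mu> * A) = mat_trace (S * (transpose_mat S * A))"
    unfolding cov_eq second_moment_eq by (simp add: mult_mat_assoc_square[OF S T A])
  also have "\<dots> = mat_trace (transpose_mat S * A * S)" by (rule mat_trace_comm[where d = d]) (use S T A in auto)
  finally show ?thesis .
qed

text \<open>The form of A in the observation is the form of S^T A S in the standardised vector, and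
  S^T A S is again a test matrix with the same bound.\<close>

lemma sample_modelI:
  assumes H: "\<And>K p A. test_mat n d K A \<Longrightarrow>
      (\<integral>\<^sup>+\<omega>. ennreal (((Z \<omega> \<bullet> (A *\<^sub>v Z \<omega>) - mat_trace A) / sqrt n) ^ (2 * p)) \<partial>P) \<le> ennreal (H K p)"
    and par: "1 \<le> M" "1 \<le> n" "real d \<le> M * real n" "1 / M \<le> lam" "lam \<le> M"
  shows "sample_model M H n d \<mu> lam"
  unfolding sample_model_def
proof (intro conjI par cov_bound allI impI)
  show "prob_space \<mu>" by (rule prob_space.prob_space_distr[OF prob meas_Y])
  show "sets \<mu> = sets (vec_borel d)" by simp
  show "integrable \<mu> (\<lambda>y. y $ j * y $ k)" if "j < d" "k < d" for j k
  proof -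
    have "(\<lambda>v. v $ j * v $ k) \<in> borel_measurable (vec_borel d)" using that by measurable
    thus ?thesis using Y_products(1)[OF that] by (simp add: integrable_distr_eq[OF meas_Y])
  qed
next
  fix p K A assume A: "test_mat n d K A"
  note Ac = test_mat_carrier[OF A]
  have B: "test_mat n d K (transpose_mat S * A * S)"
    using test_mat_mult_right[OF test_mat_mult_left[OF op_bound_transpose[OF S_bound] A] S_bound] by simp
  have m: "(\<lambda>y. y \<bullet> (A *\<^sub>v y)) \<in> borel_measurable (vec_borel d)" by (rule measurable_quad_form[OF refl Ac])
  have "(\<integral>\<^sup>+y. ennreal (((y \<bullet> (A *\<^sub>v y) - mat_trace (cov_mat d \<mu> * A)) / sqrt n) ^ (2 * p)) \<partial>\<mu>) =
    (\<integral>\<^sup>+\<omega>. ennreal (((Y \<omega> \<bullet> (A *\<^sub>v Y \<omega>) - mat_trace (cov_mat d \<mu> * A)) / sqrt n) ^ (2 * p)) \<partial>P)"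
    by (rule nn_integral_distr[OF meas_Y]) (use m in measurable)
  also have "\<dots> = (\<integral>\<^sup>+\<omega>. ennreal (((Z \<omega> \<bullet> ((transpose_mat S * A * S) *\<^sub>v Z \<omega>) - mat_trace (transpose_mat S * A * S)) / sqrt n) ^ (2 * p)) \<partial>P)"
    by (intro nn_integral_cong) (simp add: quad_form_eq[OF Ac] trace_eq[OF Ac])
  also have "\<dots> \<le> ennreal (H K p)" by (rule H[OF B])
  finally show "(\<integral>\<^sup>+y. ennreal (((y \<bullet> (A *\<^sub>v y) - mat_trace (cov_mat d \<mu> * A)) / sqrt n) ^ (2 * p)) \<partial>\<mu>) \<le> ennreal (H K p)" .
qed

end

lemma measurable_vec_of_borel: "X \<in> P \<rightarrow>\<^sub>M vec_borel d \<Longrightarrow> measurable_vec P d X"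
  using measurable_space[of X P "vec_borel d"] measurable_compose[OF _ measurable_vec_index]
  by (auto simp: measurable_vec_def)

lemma standardised_second_moment:
  assumes P: "prob_space P" and Z: "measurable_vec P d Z"
    and sc: "subgaussian_coordinates P d C Z \<or> convex_concentration P d C Z"
  shows "second_moment_mat P d Z = 1\<^sub>m d" and "\<And>j k. j < d \<Longrightarrow> k < d \<Longrightarrow> integrable P (\<lambda>\<omega>. Z \<omega> $ j * Z \<omega> $ k)"
proof -
  show "second_moment_mat P d Z = 1\<^sub>m d"
    using sc subgaussian_second_moment(1)[OF P] by (auto simp: convex_concentration_def)
  show "integrable P (\<lambda>\<omega>. Z \<omega> $ j * Z \<omega> $ k)" if jk: "j < d" "k < d" for j k
    using sc
  proof
    assume "subgaussian_coordinates P d C Z" thus ?thesis using subgaussian_second_moment(2)[OF P _ jk] by blast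
  next
    assume "convex_concentration P d C Z"
    thus ?thesis using jk Z
      by (intro integrable_mult_of_squares) (auto simp: convex_concentration_def mean_zero_square_integrable_def measurable_vec_def)
  qed
qed

lemma linear_imageI:
  assumes P: "prob_space P" and n: "0 < n" and x: "x 0 \<in> P \<rightarrow>\<^sub>M vec_borel d" and A3: "assumption_A3 P n d C x z"
    and le: "op_norm (second_moment_mat P d (x 0)) \<le> 1"
  shows "\<exists>S. linear_image P d (z 0) (x 0) S" "subgaussian_coordinates P d C (z 0) \<or> convex_concentration P d C (z 0)"
proof -
  interpret prob_space P by (rule P)
  define Q where "Q = mat_sqrt (second_moment_mat P d (x 0))"
  \<comment> \<open>\<open>mat_sqrt\<close> is a definite description, so its shape is recovered
    from the data: d rows because the observations have d entries, and of each row only the first d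
    entries matter, since \<open>scalar_prod\<close> sums over the length of its second
    argument.\<close>
  define S where "S = Matrix.mat d d (\<lambda>(i, k). row Q i $ k)"
  show sc: "subgaussian_coordinates P d C (z 0) \<or> convex_concentration P d C (z 0)"
    using A3 n by (auto simp: assumption_A3_def)
  have z: "measurable_vec P d (z 0)" using A3 n by (intro measurable_vec_of_borel) (auto simp: assumption_A3_def)
  have xz: "x 0 \<omega> = Q *\<^sub>v z 0 \<omega>" if "\<omega> \<in> space P" for \<omega> using A3 n that by (auto simp: assumption_A3_def Q_def)
  obtain \<omega>0 where w0: "\<omega>0 \<in> space P" using not_empty by blast
  have "x 0 \<omega>0 \<in> carrier_vec d" using measurable_space[OF x w0] by simp
  hence dim: "dim_row Q = d" unfolding xz[OF w0] by (metis carrier_vecD dim_mult_mat_vec)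
  have "x 0 \<omega> = S *\<^sub>v z 0 \<omega>" if "\<omega> \<in> space P" for \<omega>
  proof -
    have "dim_vec (z 0 \<omega>) = d" using z that by (auto simp: measurable_vec_def)
    thus ?thesis unfolding xz[OF that] using dim by (intro eq_vecI) (auto simp: S_def scalar_prod_def)
  qed
  hence "linear_image P d (z 0) (x 0) S"
    using P z measurable_vec_of_borel[OF x] standardised_second_moment[OF P z sc] le
    by (intro linear_image.intro) (auto simp: S_def)
  thus "\<exists>S. linear_image P d (z 0) (x 0) S" ..
qed

section \<open>Lower bounds\<close>

text \<open>The infimum of the Rayleigh quotient is an eigenvalue: otherwise the shifted matrix, being
  positive semidefinite and invertible, would be bounded below by a positive multiple of the identity.\<close>

lemma eigenvalue_below_Rayleigh:
  fixes A :: "real mat"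
  assumes A: "A \<in> carrier_mat d d" and sym: "transpose_mat A = A" and d: "0 < d"
    and psd: "\<And>v. v \<in> carrier_vec d \<Longrightarrow> 0 \<le> v \<bullet> (A *\<^sub>v v)"
  shows "\<exists>m. poly (char_poly A) m = 0 \<and> (\<forall>v\<in>carrier_vec d. m * (v \<bullet> v) \<le> v \<bullet> (A *\<^sub>v v))"
proof -
  define U where "U = {v \<in> carrier_vec d. vec_norm v = 1}"
  define q where "q v = v \<bullet> (A *\<^sub>v v)" for v
  define m where "m = (INF v\<in>U. q v)"
  have U: "U \<noteq> {}" using vec_norm_unit_vec[OF d] unit_vec_carrier[of d 0, where 'a = real] unfolding U_def by blast
  have bd: "bdd_below (q ` U)" by (rule bdd_belowI2[of _ 0]) (auto simp: U_def q_def psd)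
  have mU: "m \<le> q v" if "v \<in> U" for v unfolding m_def by (rule cINF_lower[OF bd that])
  have hom: "c * (v \<bullet> v) \<le> q v" if le: "\<And>u. u \<in> U \<Longrightarrow> c \<le> q u" and v: "v \<in> carrier_vec d" for c v
  proof (cases "vec_norm v = 0")
    case True
    hence "v = 0\<^sub>v d" by (rule vec_norm_eq_0[OF v])
    thus ?thesis using psd[OF v] by (simp add: q_def)
  next
    case False
    define u where "u = (1 / vec_norm v) \<cdot>\<^sub>v v"
    have u: "u \<in> carrier_vec d" "vec_norm u = 1" using v False by (simp_all add: u_def vec_norm_smult[where d = d])
    have "q v = (vec_norm v)\<^sup>2 * q u"
    proof -
      have "v = vec_norm v \<cdot>\<^sub>v u" using vec_normalize(2)[OF v] by (simp add: u_def)
      hence "q v = q (vec_norm v \<cdot>\<^sub>v u)" by simp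
      also have "\<dots> = (vec_norm v)\<^sup>2 * q u"
        using A u(1) by (simp add: q_def mult_mat_vec[of A d d] power2_eq_square)
      finally show ?thesis .
    qed
    moreover have "(vec_norm v)\<^sup>2 * c \<le> (vec_norm v)\<^sup>2 * q u" using u by (intro mult_left_mono le) (auto simp: U_def)
    ultimately show ?thesis by (simp add: vec_norm_power2 mult.commute)
  qed
  define B where "B = A + (- m) \<cdot>\<^sub>m 1\<^sub>m d"
  have B: "B \<in> carrier_mat d d" using A by (simp add: B_def)
  have Bv: "B *\<^sub>v v = A *\<^sub>v v + (- m) \<cdot>\<^sub>v v" if "v \<in> carrier_vec d" for v
    using A that by (simp add: B_def add_mult_distrib_mat_vec[of _ d d] smult_mat_mult_vec[where d = d])
  have qB: "v \<bullet> (B *\<^sub>v v) = q v - m * (v \<bullet> v)" if "v \<in> carrier_vec d" for v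
    using A that by (simp add: Bv q_def scalar_prod_add_distrib[of _ d])
  have "det B = 0"
  proof (rule ccontr)
    assume "det B \<noteq> 0"
    from det_non_zero_imp_unit[OF B this, of "()"] obtain N where N: "N \<in> carrier_mat d d" "B * N = 1\<^sub>m d"
      by (auto simp: Units_def ring_mat_def)
    define L where "L = 1 + sqrt (\<Sum>i<d. \<Sum>j<d. (N $$ (i, j))\<^sup>2)"
    have NL: "op_bound d L N" unfolding L_def by (rule op_bound_mono[OF op_bound_Frobenius[OF N(1)]]) simp
    have L: "0 < L" unfolding L_def by (intro add_pos_nonneg) (auto intro!: sum_nonneg)
    \<comment> \<open>A uniform gap above the infimum, contradicting its definition. Here L bounds
      the inverse of the shifted form B.\<close>
    have "m + 1 / L \<le> q v" if v: "v \<in> U" for v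
    proof -
      have vc: "v \<in> carrier_vec d" and v1: "v \<bullet> v = 1" using v vec_norm_power2[of v] by (auto simp: U_def)
      define w where "w = N *\<^sub>v v"
      have w: "w \<in> carrier_vec d" using N vc by (simp add: w_def)
      have Bw: "B *\<^sub>v w = v" using B N vc by (simp add: w_def flip: mult_mat_vec_assoc_square[where d = d])
      have Bsym: "transpose_mat B = B"
        using A sym by (simp add: B_def transpose_add[of _ d d]) (auto intro!: eq_matI)
      have wv: "w \<bullet> v \<le> L"
        using abs_scalar_prod_le[OF w vc] op_boundD(3)[OF NL vc] v by (simp add: w_def U_def)
      \<comment> \<open>The positive form of B is tested at v + s w with B w = v, which gives 0 <= q
        v - m + 2 s + s^2 (w . v). As w . v is at most L, the best choice is the minimiser -1 / L of
        2 s + s^2 L.\<close>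
      define s where "s = - (1 / L)"
      have sw: "s \<cdot>\<^sub>v w \<in> carrier_vec d" using w by simp
      have "0 \<le> (v + s \<cdot>\<^sub>v w) \<bullet> (B *\<^sub>v (v + s \<cdot>\<^sub>v w))"
        using qB[of "v + s \<cdot>\<^sub>v w"] hom[OF mU, of "v + s \<cdot>\<^sub>v w"] vc w by simp
      also have "B *\<^sub>v (v + s \<cdot>\<^sub>v w) = B *\<^sub>v v + s \<cdot>\<^sub>v v"
        using B vc w Bw by (simp add: mult_add_distrib_mat_vec[of B d d] mult_mat_vec[of B d d])
      also have "(v + s \<cdot>\<^sub>v w) \<bullet> (B *\<^sub>v v + s \<cdot>\<^sub>v v) = v \<bullet> (B *\<^sub>v v) + s * (v \<bullet> v) + s * (w \<bullet> (B *\<^sub>v v)) + s * s * (w \<bullet> v)"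
        using B vc w by (simp add: add_scalar_prod_distrib[of _ d] scalar_prod_add_distrib[of _ d] algebra_simps)
      also have "w \<bullet> (B *\<^sub>v v) = v \<bullet> v"
        using scalar_prod_mult_mat_vec_transpose[OF B w vc] Bw Bsym by simp
      finally have "0 \<le> q v - m + 2 * s + s * s * (w \<bullet> v)" using qB[OF vc] v1 by simp
      also have "\<dots> \<le> q v - m + 2 * s + s * s * L" using wv by (intro add_left_mono mult_left_mono) auto
      also have "s * s * L = 1 / L" using L by (simp add: s_def)
      finally show ?thesis by (simp add: s_def)
    qed
    hence "m + 1 / L \<le> m" unfolding m_def[symmetric] by (subst (2) m_def) (rule cINF_greatest[OF U])
    thus False using L by simp
  qed
  moreover have "char_matrix A m = B" using A by (simp add: char_matrix_def B_def)
  ultimately have "eigenvalue A m" by (simp add: eigenvalue_det[OF A])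
  hence "poly (char_poly A) m = 0" by (simp add: eigenvalue_root_char_poly[OF A])
  thus ?thesis using hom[OF mU] by (auto simp: q_def)
qed

text \<open>The roots of the characteristic polynomial are the values of \<open>\<sigma>\<close>, so
  the eigenvalue found below the Rayleigh quotient is one of them, hence at least the last.\<close>

lemma quad_form_ge_least_eigenvalue:
  fixes A :: "real mat"
  assumes A: "A \<in> carrier_mat d d" and sym: "transpose_mat A = A" and d: "0 < d"
    and psd: "\<And>v. v \<in> carrier_vec d \<Longrightarrow> 0 \<le> v \<bullet> (A *\<^sub>v v)"
    and ev: "decreasing_eigenvalues d A \<sigma>" and v: "v \<in> carrier_vec d"
  shows "\<sigma> d * (v \<bullet> v) \<le> v \<bullet> (A *\<^sub>v v)"
proof -
  obtain m where m: "poly (char_poly A) m = 0" "m * (v \<bullet> v) \<le> v \<bullet> (A *\<^sub>v v)"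
    using eigenvalue_below_Rayleigh[OF A sym d psd] v by blast
  then obtain l where "1 \<le> l" "l \<le> d" "m = \<sigma> l"
    using ev by (auto simp: decreasing_eigenvalues_def poly_prod)
  moreover from this have "\<sigma> d \<le> \<sigma> l" using ev by (simp add: decreasing_eigenvalues_def)
  ultimately have "\<sigma> d * (v \<bullet> v) \<le> m * (v \<bullet> v)" by (intro mult_right_mono) auto
  with m(2) show ?thesis by simp
qed

context psd_contraction
begin

text \<open>The matrix inverted by D has norm at most 1 + l.\<close>

lemma D_norm_lower:
  assumes l: "0 < l" and v: "v \<in> carrier_vec d"
  shows "vec_norm v \<le> (1 + l) * vec_norm (D l *\<^sub>v v)"
proof -
  interpret P: posdef_mat d l "W l" by (rule posdef_W[OF l])
  define u where "u = D l *\<^sub>v v"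
  have u: "u \<in> carrier_vec d" using v l by (simp add: u_def)
  have "vec_norm v = vec_norm (\<Sigma> *\<^sub>v u + l \<cdot>\<^sub>v u)" using W_vec[OF u, of l] v by (simp add: u_def)
  also have "\<dots> \<le> vec_norm (\<Sigma> *\<^sub>v u) + vec_norm (l \<cdot>\<^sub>v u)" by (rule vec_norm_add_le[where d = d]) (use u in auto)
  also have "\<dots> \<le> 1 * vec_norm u + l * vec_norm u"
    using l op_boundD(3)[OF Sig_bound u] by (simp add: vec_norm_smult[OF u])
  finally show ?thesis by (simp add: u_def algebra_simps)
qed

context
  fixes a :: real
  assumes a: "0 \<le> a" and Sig_lower: "\<And>v. v \<in> carrier_vec d \<Longrightarrow> a * (v \<bullet> v) \<le> v \<bullet> (\<Sigma> *\<^sub>v v)"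
begin

lemma Sig_norm_lower:
  assumes v: "v \<in> carrier_vec d" shows "a * vec_norm v \<le> vec_norm (\<Sigma> *\<^sub>v v)"
proof (cases "vec_norm v = 0")
  case False
  hence "0 < vec_norm v" using vec_norm_nonneg[of v] by linarith
  moreover have "vec_norm v * (a * vec_norm v) \<le> vec_norm v * vec_norm (\<Sigma> *\<^sub>v v)"
    using order_trans[OF Sig_lower[OF v] order_trans[OF abs_ge_self abs_scalar_prod_le[OF v]]] v
    by (simp add: vec_norm_power2[symmetric] power2_eq_square mult_ac)
  ultimately show ?thesis by simp
qed simp

lemma bias_form_lower:
  assumes l: "0 < l" and v: "v \<in> carrier_vec d"
  shows "a / (1 + l)\<^sup>2 * (v \<bullet> v) \<le> v \<bullet> ((D l * \<Sigma> * D l) *\<^sub>v v)"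
proof -
  interpret P: posdef_mat d l "W l" by (rule posdef_W[OF l])
  define u where "u = D l *\<^sub>v v"
  have u: "u \<in> carrier_vec d" using v l by (simp add: u_def)
  have "(vec_norm v)\<^sup>2 \<le> ((1 + l) * vec_norm u)\<^sup>2" using D_norm_lower[OF l v] by (intro power_mono) (auto simp: u_def)
  hence "v \<bullet> v \<le> (1 + l)\<^sup>2 * (u \<bullet> u)" by (simp add: power_mult_distrib vec_norm_power2)
  hence "a / (1 + l)\<^sup>2 * (v \<bullet> v) \<le> a / (1 + l)\<^sup>2 * ((1 + l)\<^sup>2 * (u \<bullet> u))" using a by (intro mult_left_mono) auto
  also have "\<dots> = a * (u \<bullet> u)" using l by simp
  also have "\<dots> \<le> u \<bullet> (\<Sigma> *\<^sub>v u)" by (rule Sig_lower[OF u])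
  also have "\<dots> = v \<bullet> ((D l * \<Sigma> * D l) *\<^sub>v v)"
    using P.minv_adj[of v "\<Sigma> *\<^sub>v u"] u v l by (simp add: u_def mult_mat_vec_assoc_square[where d = d])
  finally show ?thesis .
qed

text \<open>Each diagonal entry is the squared norm of Sigma D e for a unit vector e, bounded below
  factor by factor.\<close>

lemma variance_trace_lower:
  assumes l: "0 < l"
  shows "real d * (a / (1 + l))\<^sup>2 \<le> mat_trace (\<Sigma> * D l * \<Sigma> * D l)"
proof -
  interpret P: posdef_mat d l "W l" by (rule posdef_W[OF l])
  have "(a / (1 + l))\<^sup>2 \<le> unit_vec d j \<bullet> ((\<Sigma> * D l * \<Sigma> * D l) *\<^sub>v unit_vec d j)" if j: "j < d" for j
  proof -
    define e :: "real vec" where "e = unit_vec d j"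
    have e: "e \<in> carrier_vec d" "vec_norm e = 1" using vec_norm_unit_vec[OF j] by (simp_all add: e_def)
    define u where "u = \<Sigma> *\<^sub>v (D l *\<^sub>v e)"
    have De: "D l *\<^sub>v e \<in> carrier_vec d" and u: "u \<in> carrier_vec d" using e l by (simp_all add: u_def)
    have "a * (1 / (1 + l)) \<le> a * vec_norm (D l *\<^sub>v e)"
      using D_norm_lower[OF l e(1)] e(2) l a by (intro mult_left_mono) (auto simp: divide_le_eq mult.commute)
    also have "\<dots> \<le> vec_norm u" unfolding u_def by (rule Sig_norm_lower[OF De])
    finally have "(a / (1 + l))\<^sup>2 \<le> (vec_norm u)\<^sup>2" using a l by (intro power_mono) auto
    also have "\<dots> = e \<bullet> (D l *\<^sub>v (\<Sigma> *\<^sub>v u))"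
      unfolding vec_norm_power2 using P.minv_adj[OF e(1), of "\<Sigma> *\<^sub>v u"] Sig_adj[OF De u] u by (simp add: u_def)
    also have "\<dots> = e \<bullet> ((\<Sigma> * D l * \<Sigma> * D l) *\<^sub>v e)"
      using D_Sig_vec[OF l u] e l by (simp add: u_def mult_mat_vec_assoc_square[where d = d])
    finally show ?thesis by (simp add: e_def)
  qed
  hence "(\<Sum>j<d. (a / (1 + l))\<^sup>2) \<le> (\<Sum>j<d. unit_vec d j \<bullet> ((\<Sigma> * D l * \<Sigma> * D l) *\<^sub>v unit_vec d j))" by (intro sum_mono) auto
  thus ?thesis using l by (simp add: mat_trace_eq_sum_unit[where d = d])
qed

end

end

section \<open>Relative errors\<close>

lemma sample_cov_ridge_mat:
  fixes x :: "nat \<Rightarrow> real vec" and n d :: nat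
  defines "A \<equiv> sample_cov (Matrix.mat n d (\<lambda>(i, j). x i $ j))"
  shows "A \<in> carrier_mat d d" "A + lam \<cdot>\<^sub>m 1\<^sub>m d = ridge_mat n d lam x {..<n}"
    "resolvent A lam = minv (ridge_mat n d lam x {..<n})"
proof -
  show A: "A \<in> carrier_mat d d"
    unfolding A_def sample_cov_def by (intro smult_carrier_mat mult_carrier_mat[of _ d n]) auto
  show eq: "A + lam \<cdot>\<^sub>m 1\<^sub>m d = ridge_mat n d lam x {..<n}"
    by (rule eq_matI) (auto simp: A_def sample_cov_def ridge_mat_def scalar_prod_def atLeast0LessThan)
  show "resolvent A lam = minv (ridge_mat n d lam x {..<n})"
    using A eq by (simp add: resolvent_def carrier_matD)
qed

text \<open>The sample covariance times R is 1 - lam R. This brings the ridge variance to the form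
  covered by the equivalents.\<close>

lemma sample_cov_resolvent_trace:
  assumes S: "S \<in> carrier_mat d d" and lam: "0 < lam" and x: "\<And>j. j < n \<Longrightarrow> x j \<in> carrier_vec d"
  defines "A \<equiv> sample_cov (Matrix.mat n d (\<lambda>(i, j). x i $ j))" and "R \<equiv> minv (ridge_mat n d lam x {..<n})"
  shows "mat_trace (S * A * (R ^\<^sub>m 2)) = mat_trace (S * R) - lam * mat_trace (S * R * 1\<^sub>m d * R)"
proof -
  interpret R: posdef_mat d lam "ridge_mat n d lam x {..<n}" by (rule posdef_ridge_mat) (use lam x in auto)
  note A = sample_cov_ridge_mat(1)[of n d x, folded A_def] and W = sample_cov_ridge_mat(2)[of n d x, folded A_def]
  have Rc: "R \<in> carrier_mat d d" by (simp add: R_def)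
  have R2: "R ^\<^sub>m 2 = R * R" using Rc by (simp add: numeral_2_eq_2 left_mult_one_mat[OF Rc])
  have AR: "A *\<^sub>v (R *\<^sub>v v) = v + (- lam) \<cdot>\<^sub>v (R *\<^sub>v v)" if v: "v \<in> carrier_vec d" for v
  proof -
    define w where "w = R *\<^sub>v v"
    have w: "w \<in> carrier_vec d" using Rc v by (simp add: w_def)
    have "(A + lam \<cdot>\<^sub>m 1\<^sub>m d) *\<^sub>v w = v" unfolding W w_def R_def by (rule R.W_minv_vec[OF v])
    hence "A *\<^sub>v w + lam \<cdot>\<^sub>v w = v"
      using w A by (simp add: add_mult_distrib_mat_vec[of _ d d] smult_mat_mult_vec[where d = d])
    hence "v + (- lam) \<cdot>\<^sub>v w = A *\<^sub>v w" using w A by (auto intro!: eq_vecI)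
    thus ?thesis by (simp add: w_def)
  qed
  have "S * A * (R ^\<^sub>m 2) = S * R + (- lam) \<cdot>\<^sub>m (S * R * 1\<^sub>m d * R)"
    unfolding R2
  proof (rule eq_mat_mult_vec[where d = d])
    fix v :: "real vec" assume v: "v \<in> carrier_vec d"
    have "(S * A * (R * R)) *\<^sub>v v = S *\<^sub>v (R *\<^sub>v v + (- lam) \<cdot>\<^sub>v (R *\<^sub>v (R *\<^sub>v v)))"
      using S A Rc v AR[of "R *\<^sub>v v"] by (simp add: mult_mat_vec_assoc_square[where d = d])
    also have "\<dots> = (S * R + (- lam) \<cdot>\<^sub>m (S * R * 1\<^sub>m d * R)) *\<^sub>v v"
      using S Rc v by (simp add: mult_add_distrib_mat_vec[of S d d] mult_mat_vec[of S d d] add_mult_distrib_mat_vec[of _ d d]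
        smult_mat_mult_vec[where d = d] mult_mat_vec_assoc_square[where d = d])
    finally show "(S * A * (R * R)) *\<^sub>v v = (S * R + (- lam) \<cdot>\<^sub>m (S * R * 1\<^sub>m d * R)) *\<^sub>v v" .
  qed (use S A Rc in auto)
  thus ?thesis using S Rc by (simp add: mat_trace_add[where d = d] mat_trace_smult[where d = d])
qed

lemma trace_outer_sandwich:
  assumes b: "b \<in> carrier_vec d" and R: "R \<in> carrier_mat d d" and S: "S \<in> carrier_mat d d"
  shows "mat_trace ((k \<cdot>\<^sub>m outer_prod d b b) * R * S * R) = k * (b \<bullet> ((R * S * R) *\<^sub>v b))"
proof -
  define N where "N = R * S * R"
  have N: "N \<in> carrier_mat d d" using R S by (simp add: N_def)
  have "(k \<cdot>\<^sub>m outer_prod d b b) * R * S * R = (k \<cdot>\<^sub>m outer_prod d b b) * N"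
    unfolding N_def using R S by (simp add: mult_mat_assoc_square[where d = d])
  also have "\<dots> = k \<cdot>\<^sub>m outer_prod d b (transpose_mat N *\<^sub>v b)"
    by (simp add: mult_smult_assoc_mat[OF outer_prod_carrier N] outer_prod_mult[OF N b b])
  also have "mat_trace \<dots> = k * (b \<bullet> (transpose_mat N *\<^sub>v b))"
    using N b by (simp add: mat_trace_smult[where d = d] mat_trace_outer_prod)
  also have "b \<bullet> (transpose_mat N *\<^sub>v b) = b \<bullet> (N *\<^sub>v b)"
    using scalar_prod_mult_mat_vec_transpose[OF N b b] scalar_prod_comm_real[of "transpose_mat N *\<^sub>v b" d b] N b by simp
  finally show ?thesis by (simp add: N_def)
qed

lemma quad_form_smult:
  assumes "N \<in> carrier_mat d d" "b \<in> carrier_vec d"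
  shows "(s \<cdot>\<^sub>v b) \<bullet> (N *\<^sub>v (s \<cdot>\<^sub>v b)) = (s :: real)\<^sup>2 * (b \<bullet> (N *\<^sub>v b))"
  using assms by (simp add: mult_mat_vec[of N d d] power2_eq_square)

text \<open>The variance error with the noise level removed, scaled by n so that it is O(1).\<close>

definition variance_error :: "nat \<Rightarrow> nat \<Rightarrow> real mat \<Rightarrow> real \<Rightarrow> (nat \<Rightarrow> real vec) \<Rightarrow> real" where
  "variance_error n d S lam x = (let R = minv (ridge_mat n d lam x {..<n}); T = trace_square n S lam / real n in
     real n * (1 / real n * mat_trace (S * R) - lam * (1 / real n * mat_trace (S * R * 1\<^sub>m d * R)) - T / (1 - T)))"

text \<open>The bias error in a direction b of norm at most 1. The test matrix carries sqrt n, so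
  after scaling by n the quantity is sqrt n times the error of the bias.\<close>

definition bias_error :: "nat \<Rightarrow> nat \<Rightarrow> real mat \<Rightarrow> real \<Rightarrow> real vec \<Rightarrow> (nat \<Rightarrow> real vec) \<Rightarrow> real" where
  "bias_error n d S lam b x = (let R = minv (ridge_mat n d lam x {..<n}); l = lambda_star n S lam; D = resolvent S l;
       T = trace_square n S lam / real n; X = sqrt (real n) \<cdot>\<^sub>m outer_prod d b b in
     real n * (lam\<^sup>2 * (1 / real n * mat_trace (X * R * S * R)) - l\<^sup>2 * (1 / real n * mat_trace (X * D * S * D)) / (1 - T)))"

context effective
begin

lemma variance_error_bounded:
  "moments_bounded C (\<lambda>c. PiM {..<n c} (\<lambda>_. \<mu> c)) (\<lambda>c. variance_error (n c) (d c) (\<Sigma> c) (lam c))"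
  by (rule moments_bounded_cong[OF variance_equivalent]) (simp add: variance_error_def Let_def ls_props(9)[symmetric])

lemma bias_error_bounded:
  assumes b: "\<And>c. c \<in> C \<Longrightarrow> b c \<in> carrier_vec (d c) \<and> vec_norm (b c) \<le> 1"
  shows "moments_bounded C (\<lambda>c. PiM {..<n c} (\<lambda>_. \<mu> c)) (\<lambda>c. bias_error (n c) (d c) (\<Sigma> c) (lam c) (b c))"
proof (rule moments_bounded_cong[OF bias_equivalent[where X = "\<lambda>c. sqrt (real (n c)) \<cdot>\<^sub>m outer_prod (d c) (b c) (b c)" and K = 1]])
  fix c assume c: "c \<in> C"
  have "vec_norm (b c) * vec_norm (b c) \<le> 1 * 1" using b[OF c] by (intro mult_mono) auto
  thus "test_mat (n c) (d c) 1 (sqrt (real (n c)) \<cdot>\<^sub>m outer_prod (d c) (b c) (b c))"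
    using b[OF c] by (auto simp: test_mat_def)
qed (simp add: bias_error_def Let_def ls_props(9)[symmetric])

context
  fixes c and x :: "nat \<Rightarrow> real vec" assumes c: "c \<in> C" and x: "\<And>j. j < n c \<Longrightarrow> x j \<in> carrier_vec (d c)"
begin

lemma ridge_variance_error:
  "ridge_variance \<tau> (\<Sigma> c) (Matrix.mat (n c) (d c) (\<lambda>(i, j). x i $ j)) (lam c) - eff_variance (n c) \<tau> (\<Sigma> c) (lam c) =
    \<tau>\<^sup>2 / n c * variance_error (n c) (d c) (\<Sigma> c) (lam c) x"
proof -
  define T where "T = trace_square (n c) (\<Sigma> c) (lam c) / real (n c)"
  have n0: "real (n c) \<noteq> 0" using n_pos[OF c] by simp
  have T: "trace_square (n c) (\<Sigma> c) (lam c) = real (n c) * T" using n0 by (simp add: T_def)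
  have e: "eff_variance (n c) \<tau> (\<Sigma> c) (lam c) = \<tau>\<^sup>2 * (T / (1 - T))"
  proof -
    have "real (n c) - real (n c) * T = real (n c) * (1 - T)" by (simp add: algebra_simps)
    thus ?thesis unfolding eff_variance_def T using n0 by simp
  qed
  have dim: "dim_row (Matrix.mat (n c) (d c) (\<lambda>(i, j). x i $ j)) = n c" by simp
  have "ridge_variance \<tau> (\<Sigma> c) (Matrix.mat (n c) (d c) (\<lambda>(i, j). x i $ j)) (lam c) = \<tau>\<^sup>2 / n c *
     (mat_trace (\<Sigma> c * minv (ridge_mat (n c) (d c) (lam c) x {..<n c}))
      - lam c * mat_trace (\<Sigma> c * minv (ridge_mat (n c) (d c) (lam c) x {..<n c}) * 1\<^sub>m (d c) * minv (ridge_mat (n c) (d c) (lam c) x {..<n c})))"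
    unfolding ridge_variance_def sample_cov_ridge_mat(3) dim
    by (rule arg_cong[OF sample_cov_resolvent_trace]) (use g(10)[OF c] x in auto)
  moreover have "s / r * (a - l * b) - s * u = s / r * (r * (1 / r * a - l * (1 / r * b) - u))" if "r \<noteq> 0" for s r a l b u :: real
    using that by (simp add: field_simps)
  ultimately show ?thesis
    unfolding e variance_error_def Let_def T_def[symmetric] using n0 by (simp only:)
qed

lemma ridge_bias_error:
  assumes b: "b \<in> carrier_vec (d c)"
  shows "ridge_bias (s \<cdot>\<^sub>v b) (\<Sigma> c) (Matrix.mat (n c) (d c) (\<lambda>(i, j). x i $ j)) (lam c) - eff_bias (n c) (s \<cdot>\<^sub>v b) (\<Sigma> c) (lam c) =
    s\<^sup>2 / sqrt (n c) * bias_error (n c) (d c) (\<Sigma> c) (lam c) b x"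
    and "eff_bias (n c) (s \<cdot>\<^sub>v b) (\<Sigma> c) (lam c) = s\<^sup>2 * ((ls c)\<^sup>2 * (b \<bullet> ((D c * \<Sigma> c * D c) *\<^sub>v b)) / (1 - t c))"
proof -
  interpret psd: psd_contraction "d c" "\<Sigma> c" by (rule psdc[OF c])
  interpret R: posdef_mat "d c" "lam c" "ridge_mat (n c) (d c) (lam c) x {..<n c}"
    by (rule posdef_ridge_mat) (use g(10)[OF c] x in auto)
  define R where "R = minv (ridge_mat (n c) (d c) (lam c) x {..<n c})"
  have Rc: "R \<in> carrier_mat (d c) (d c)" by (simp add: R_def)
  have Dc: "D c \<in> carrier_mat (d c) (d c)" using ls_props(1)[OF c] by (simp add: psd.resolvent_eq)
  have n0: "0 < sqrt (real (n c))" using n_pos[OF c] by simp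
  have comm: "D c *\<^sub>v (\<Sigma> c *\<^sub>v v) = \<Sigma> c *\<^sub>v (D c *\<^sub>v v)" if "v \<in> carrier_vec (d c)" for v
    unfolding psd.resolvent_eq using psd.D_Sig_vec[OF ls_props(1)[OF c] that] by simp
  have D2: "(D c ^\<^sub>m 2) * \<Sigma> c = D c * \<Sigma> c * D c"
  proof (rule eq_mat_mult_vec[where d = "d c"])
    fix v :: "real vec" assume v: "v \<in> carrier_vec (d c)"
    show "((D c ^\<^sub>m 2) * \<Sigma> c) *\<^sub>v v = (D c * \<Sigma> c * D c) *\<^sub>v v"
      using Dc v comm[OF v] by (simp add: numeral_2_eq_2 left_mult_one_mat[OF Dc] mult_mat_vec_assoc_square[where d = "d c"])
  qed (use Dc in \<open>simp_all add: numeral_2_eq_2\<close>)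
  have DSD: "D c * \<Sigma> c * D c \<in> carrier_mat (d c) (d c)" and RSR: "R * \<Sigma> c * R \<in> carrier_mat (d c) (d c)" using Dc Rc by auto
  show eff: "eff_bias (n c) (s \<cdot>\<^sub>v b) (\<Sigma> c) (lam c) = s\<^sup>2 * ((ls c)\<^sup>2 * (b \<bullet> ((D c * \<Sigma> c * D c) *\<^sub>v b)) / (1 - t c))"
    unfolding eff_bias_def D2 quad_form_smult[OF DSD b] ls_props(9)[OF c] by simp
  have rb: "ridge_bias (s \<cdot>\<^sub>v b) (\<Sigma> c) (Matrix.mat (n c) (d c) (\<lambda>(i, j). x i $ j)) (lam c) = s\<^sup>2 * ((lam c)\<^sup>2 * (b \<bullet> ((R * \<Sigma> c * R) *\<^sub>v b)))"
    unfolding ridge_bias_def sample_cov_ridge_mat(3) R_def[symmetric] quad_form_smult[OF RSR b] by simp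
  have "sqrt (real (n c)) * sqrt (real (n c)) = real (n c)" by simp
  moreover have "s2 * (l * p) - s2 * (k * q / u) = s2 / r * (r * r * (l * (1 / (r * r) * (r * p)) - k * (1 / (r * r) * (r * q)) / u))"
    if "0 < r" for s2 l p k q u r :: real
    using that by (simp add: field_simps)
  ultimately show "ridge_bias (s \<cdot>\<^sub>v b) (\<Sigma> c) (Matrix.mat (n c) (d c) (\<lambda>(i, j). x i $ j)) (lam c) - eff_bias (n c) (s \<cdot>\<^sub>v b) (\<Sigma> c) (lam c) =
    s\<^sup>2 / sqrt (n c) * bias_error (n c) (d c) (\<Sigma> c) (lam c) b x"
    unfolding rb eff bias_error_def Let_def R_def[symmetric] trace_outer_sandwich[OF b Rc cov_mat_carrier]
      trace_outer_sandwich[OF b Dc cov_mat_carrier] ls_props(9)[OF c, symmetric]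
    using n0 by metis
qed

end

text \<open>The passage from absolute to relative errors: the prefactors of the absolute errors, the
  noise variance and the squared norm of b, are controlled by the effective quantities. The
  constants become those of the final result.\<close>

lemma effective_lower_bounds:
  assumes c: "c \<in> C" and lo: "\<And>v. v \<in> carrier_vec (d c) \<Longrightarrow> 1 / M * (v \<bullet> v) \<le> v \<bullet> (\<Sigma> c *\<^sub>v v)"
  shows "1 / M \<le> real (d c) / real (n c) \<Longrightarrow> \<tau>\<^sup>2 \<le> M ^ 3 * (1 + 2 * M)\<^sup>2 * eff_variance (n c) \<tau> (\<Sigma> c) (lam c)"
    and "b \<in> carrier_vec (d c) \<Longrightarrow> (vec_norm b)\<^sup>2 \<le> M * (1 + M)\<^sup>2 * eff_bias (n c) b (\<Sigma> c) (lam c)"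
proof -
  interpret psd: psd_contraction "d c" "\<Sigma> c" by (rule psdc[OF c])
  note l = ls_props[OF c]
  have M: "1 \<le> M" by (rule g(1)[OF c])
  have T1: "0 < 1 - t c" and n0: "0 < real (n c)" using one_minus_t(1)[OF c] n_pos[OF c] by auto
  have a: "0 \<le> 1 / M" using M by simp
  have ge: "y \<le> y / (1 - t c)" if "0 \<le> y" for y using that T1 l(7) by (simp add: le_divide_eq mult_left_le)
  {
    assume dn: "1 / M \<le> real (d c) / real (n c)"
    \<comment> \<open>From ls <= 2 M. With d / n >= 1 / M this gives t >= 1 / (M^3 (1 + 2 M)^2), the
      reciprocal of the constant.\<close>
    have "1 / (M * (1 + 2 * M)) \<le> 1 / M / (1 + ls c)" using l(1,3) M by (simp add: frac_le mult_left_mono)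
    hence "(1 / (M * (1 + 2 * M)))\<^sup>2 \<le> (1 / M / (1 + ls c))\<^sup>2" using M by (intro power_mono) auto
    hence "1 / M * (1 / (M * (1 + 2 * M)))\<^sup>2 \<le> real (d c) / real (n c) * (1 / M / (1 + ls c))\<^sup>2"
      using dn a by (intro mult_mono) auto
    also have "\<dots> = 1 / real (n c) * (real (d c) * (1 / M / (1 + ls c))\<^sup>2)" by simp
    also have "\<dots> \<le> t c"
      unfolding psd.resolvent_eq by (intro mult_left_mono psd.variance_trace_lower[OF a lo l(1)]) auto
    finally have "1 / M * (1 / (M * (1 + 2 * M)))\<^sup>2 \<le> t c / (1 - t c)" using ge[OF l(7)] by linarith
    hence "M ^ 3 * (1 + 2 * M)\<^sup>2 * (1 / M * (1 / (M * (1 + 2 * M)))\<^sup>2) \<le> M ^ 3 * (1 + 2 * M)\<^sup>2 * (t c / (1 - t c))"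
      using M by (intro mult_left_mono) auto
    also have "M ^ 3 * (1 + 2 * M)\<^sup>2 * (1 / M * (1 / (M * (1 + 2 * M)))\<^sup>2) = 1"
      using M by (simp add: power2_eq_square power3_eq_cube)
    finally have "\<tau>\<^sup>2 * 1 \<le> \<tau>\<^sup>2 * (M ^ 3 * (1 + 2 * M)\<^sup>2 * (t c / (1 - t c)))" by (intro mult_left_mono) auto
    also have "\<dots> = M ^ 3 * (1 + 2 * M)\<^sup>2 * eff_variance (n c) \<tau> (\<Sigma> c) (lam c)"
    proof -
      have "trace_square (n c) (\<Sigma> c) (lam c) = real (n c) * t c" using l(9) n0 by simp
      moreover have "real (n c) - real (n c) * t c = real (n c) * (1 - t c)" by (simp add: algebra_simps)
      ultimately have "eff_variance (n c) \<tau> (\<Sigma> c) (lam c) = \<tau>\<^sup>2 * (t c / (1 - t c))"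
        unfolding eff_variance_def using n0 by simp
      thus ?thesis by simp
    qed
    finally show "\<tau>\<^sup>2 \<le> M ^ 3 * (1 + 2 * M)\<^sup>2 * eff_variance (n c) \<tau> (\<Sigma> c) (lam c)" by simp
  }
  assume b: "b \<in> carrier_vec (d c)"
  define N where "N = (b \<bullet> ((D c * \<Sigma> c * D c) *\<^sub>v b))"
  have "1 / M / (1 + ls c)\<^sup>2 * (b \<bullet> b) \<le> N"
    unfolding N_def psd.resolvent_eq by (rule psd.bias_form_lower[OF a lo l(1) b])
  hence N: "(ls c)\<^sup>2 * (1 / M / (1 + ls c)\<^sup>2 * (b \<bullet> b)) \<le> (ls c)\<^sup>2 * N" by (intro mult_left_mono) auto
  \<comment> \<open>Bounds (1 + ls) / ls by 1 + M, the source of the factor (1 + M)^2; the remaining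
    M comes from the lower bound 1 / M on the spectrum.\<close>
  have "1 \<le> M * ls c" using l(1,4) by (simp add: divide_le_eq)
  hence "1 + ls c \<le> (1 + M) * ls c" by (simp add: algebra_simps)
  hence "(1 + ls c)\<^sup>2 \<le> ((1 + M) * ls c)\<^sup>2" using l(1) by (intro power_mono) auto
  hence "1 \<le> (1 + M)\<^sup>2 * ((ls c)\<^sup>2 / (1 + ls c)\<^sup>2)" using l(1) by (simp add: power_mult_distrib le_divide_eq)
  hence "1 * (b \<bullet> b) \<le> (1 + M)\<^sup>2 * ((ls c)\<^sup>2 / (1 + ls c)\<^sup>2) * (b \<bullet> b)" by (intro mult_right_mono) auto
  also have "\<dots> = M * (1 + M)\<^sup>2 * ((ls c)\<^sup>2 * (1 / M / (1 + ls c)\<^sup>2 * (b \<bullet> b)))" using M by simp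
  also have "\<dots> \<le> M * (1 + M)\<^sup>2 * ((ls c)\<^sup>2 * N)" using M by (intro mult_left_mono N) auto
  also have "\<dots> \<le> M * (1 + M)\<^sup>2 * ((ls c)\<^sup>2 * N / (1 - t c))"
  proof (intro mult_left_mono ge)
    have "0 \<le> (ls c)\<^sup>2 * (1 / M / (1 + ls c)\<^sup>2 * (b \<bullet> b))" using M by simp
    thus "0 \<le> (ls c)\<^sup>2 * N" using N by linarith
  qed (use M in auto)
  also have "(ls c)\<^sup>2 * N / (1 - t c) = eff_bias (n c) b (\<Sigma> c) (lam c)"
    using ridge_bias_error(2)[OF c _ b, of "\<lambda>_. 0\<^sub>v (d c)" 1] b by (simp add: N_def)
  finally show "(vec_norm b)\<^sup>2 \<le> M * (1 + M)\<^sup>2 * eff_bias (n c) b (\<Sigma> c) (lam c)" by (simp add: vec_norm_power2)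
qed

end

text \<open>At t = n^(1/k) the moment of order 2 k D gives the tail K n^(-2 D), and K <= n <= n^(1 +
  D) absorbs the constant K into the sample size threshold.\<close>

lemma moments_bounded_deviation:
  assumes X: "moments_bounded C S X" and n: "\<And>c. c \<in> C \<Longrightarrow> 1 \<le> n c" and k: "1 \<le> (k :: nat)"
  shows "\<exists>N. \<forall>c\<in>C. N \<le> real (n c) \<longrightarrow>
    measure (S c) {w \<in> space (S c). real (n c) powr (1 / real k) < \<bar>X c w\<bar>} \<le> real (n c) powr (1 - real D)"
proof -
  from moments_bounded_tail[OF X, of "k * D"] obtain K where K: "0 \<le> K"
    "\<And>c t. c \<in> C \<Longrightarrow> 0 < t \<Longrightarrow> measure (S c) {w \<in> space (S c). t < \<bar>X c w\<bar>} \<le> K / t ^ (2 * (k * D))" by blast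
  show ?thesis
  proof (intro exI[of _ K] ballI impI)
    fix c assume c: "c \<in> C" and Kn: "K \<le> real (n c)"
    have n1: "1 \<le> real (n c)" using n[OF c] by simp
    define t where "t = real (n c) powr (1 / real k)"
    have "t ^ (2 * (k * D)) = real (n c) powr (1 / real k * real (2 * (k * D)))"
      unfolding t_def using n1 by (simp add: powr_powr flip: powr_realpow)
    also have "1 / real k * real (2 * (k * D)) = 2 * real D" using k by simp
    finally have t: "t ^ (2 * (k * D)) = real (n c) powr (2 * real D)" .
    have "K \<le> real (n c) powr (1 + real D)"
      using Kn powr_mono[of 1 "1 + real D" "real (n c)"] n1 by simp
    also have "1 + real D = (1 - real D) + 2 * real D" by simp
    finally have "K \<le> real (n c) powr (1 - real D) * t ^ (2 * (k * D))" by (simp only: powr_add t)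
    hence "K / t ^ (2 * (k * D)) \<le> real (n c) powr (1 - real D)" using n1 by (simp add: divide_le_eq t)
    thus "measure (S c) {w \<in> space (S c). real (n c) powr (1 / real k) < \<bar>X c w\<bar>} \<le> real (n c) powr (1 - real D)"
      using K(2)[OF c, of t] n1 by (simp add: t_def)
  qed
qed

lemma relative_error:
  fixes e :: real
  assumes "\<bar>e\<bar> \<le> s / q" "s \<le> C * E" "1 \<le> L" "0 < q" "0 \<le> s"
  shows "\<bar>e\<bar> \<le> C * (L / q) * E"
proof -
  have "s / q \<le> L * (C * E) / q"
  proof (rule divide_right_mono)
    have "1 * s \<le> L * (C * E)" using assms by (intro mult_mono) auto
    thus "s \<le> L * (C * E)" by simp
  qed (use assms in simp)
  with assms(1) show ?thesis by (simp add: mult_ac)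
qed

text \<open>Laws of single observations together with a direction in which the bias is tested.\<close>

definition models :: "real \<Rightarrow> (real \<Rightarrow> nat \<Rightarrow> real) \<Rightarrow> (nat \<times> nat \<times> real vec measure \<times> real \<times> real vec) set" where
  "models M H = {(n, d, \<mu>, lam, b). sample_model M H n d \<mu> lam \<and>
     (\<forall>v\<in>carrier_vec d. 0 \<le> v \<bullet> (cov_mat d \<mu> *\<^sub>v v)) \<and> b \<in> carrier_vec d \<and> vec_norm b \<le> 1}"

text \<open>The family is the set of all models for given M and H, so a single threshold N serves
  every law, dimension, regularisation and direction.\<close>

lemma deviation_bounds:
  assumes k: "1 \<le> (k :: nat)"
  shows "\<exists>N. \<forall>n d \<mu> lam b. (n, d, \<mu>, lam, b) \<in> models M H \<longrightarrow> N \<le> real n \<longrightarrow>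
    measure (PiM {..<n} (\<lambda>_. \<mu>)) {w \<in> space (PiM {..<n} (\<lambda>_. \<mu>)). real n powr (1 / real k) < \<bar>variance_error n d (cov_mat d \<mu>) lam w\<bar>} \<le> real n powr (1 - real D) \<and>
    measure (PiM {..<n} (\<lambda>_. \<mu>)) {w \<in> space (PiM {..<n} (\<lambda>_. \<mu>)). real n powr (1 / real k) < \<bar>bias_error n d (cov_mat d \<mu>) lam b w\<bar>} \<le> real n powr (1 - real D)"
    and "(n, d, \<mu>, lam, b) \<in> models M H \<Longrightarrow> variance_error n d (cov_mat d \<mu>) lam \<in> borel_measurable (PiM {..<n} (\<lambda>_. \<mu>))"
    and "(n, d, \<mu>, lam, b) \<in> models M H \<Longrightarrow> bias_error n d (cov_mat d \<mu>) lam b \<in> borel_measurable (PiM {..<n} (\<lambda>_. \<mu>))"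
proof -
  let ?n = "\<lambda>c :: nat \<times> nat \<times> real vec measure \<times> real \<times> real vec. fst c"
    and ?d = "\<lambda>c :: nat \<times> nat \<times> real vec measure \<times> real \<times> real vec. fst (snd c)"
    and ?\<mu> = "\<lambda>c :: nat \<times> nat \<times> real vec measure \<times> real \<times> real vec. fst (snd (snd c))"
    and ?lam = "\<lambda>c :: nat \<times> nat \<times> real vec measure \<times> real \<times> real vec. fst (snd (snd (snd c)))"
    and ?b = "\<lambda>c :: nat \<times> nat \<times> real vec measure \<times> real \<times> real vec. snd (snd (snd (snd c)))"
  interpret E: effective "models M H" M H ?n ?d ?\<mu> ?lam
    by (rule effective.intro) (auto simp: models_def)
  have b: "?b c \<in> carrier_vec (?d c) \<and> vec_norm (?b c) \<le> 1" if "c \<in> models M H" for c using that by (auto simp: models_def)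
  note V = E.variance_error_bounded and B = E.bias_error_bounded[OF b]
  obtain N1 where N1: "\<And>c. c \<in> models M H \<Longrightarrow> N1 \<le> real (?n c) \<Longrightarrow>
      measure (PiM {..<?n c} (\<lambda>_. ?\<mu> c)) {w \<in> space (PiM {..<?n c} (\<lambda>_. ?\<mu> c)). real (?n c) powr (1 / real k) < \<bar>variance_error (?n c) (?d c) (cov_mat (?d c) (?\<mu> c)) (?lam c) w\<bar>} \<le> real (?n c) powr (1 - real D)"
    using moments_bounded_deviation[where n = ?n and k = k and D = D, OF V E.g(2) k] by blast
  obtain N2 where N2: "\<And>c. c \<in> models M H \<Longrightarrow> N2 \<le> real (?n c) \<Longrightarrow>
      measure (PiM {..<?n c} (\<lambda>_. ?\<mu> c)) {w \<in> space (PiM {..<?n c} (\<lambda>_. ?\<mu> c)). real (?n c) powr (1 / real k) < \<bar>bias_error (?n c) (?d c) (cov_mat (?d c) (?\<mu> c)) (?lam c) (?b c) w\<bar>} \<le> real (?n c) powr (1 - real D)"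
    using moments_bounded_deviation[where n = ?n and k = k and D = D, OF B E.g(2) k] by blast
  show "\<exists>N. \<forall>n d \<mu> lam b. (n, d, \<mu>, lam, b) \<in> models M H \<longrightarrow> N \<le> real n \<longrightarrow>
    measure (PiM {..<n} (\<lambda>_. \<mu>)) {w \<in> space (PiM {..<n} (\<lambda>_. \<mu>)). real n powr (1 / real k) < \<bar>variance_error n d (cov_mat d \<mu>) lam w\<bar>} \<le> real n powr (1 - real D) \<and>
    measure (PiM {..<n} (\<lambda>_. \<mu>)) {w \<in> space (PiM {..<n} (\<lambda>_. \<mu>)). real n powr (1 / real k) < \<bar>bias_error n d (cov_mat d \<mu>) lam b w\<bar>} \<le> real n powr (1 - real D)"
  proof (intro exI[of _ "max N1 N2"] allI impI)
    fix n d \<mu> lam b assume c: "(n, d, \<mu>, lam, b) \<in> models M H" and N: "max N1 N2 \<le> real n"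
    show "measure (PiM {..<n} (\<lambda>_. \<mu>)) {w \<in> space (PiM {..<n} (\<lambda>_. \<mu>)). real n powr (1 / real k) < \<bar>variance_error n d (cov_mat d \<mu>) lam w\<bar>} \<le> real n powr (1 - real D) \<and>
      measure (PiM {..<n} (\<lambda>_. \<mu>)) {w \<in> space (PiM {..<n} (\<lambda>_. \<mu>)). real n powr (1 / real k) < \<bar>bias_error n d (cov_mat d \<mu>) lam b w\<bar>} \<le> real n powr (1 - real D)"
      using N1[OF c] N2[OF c] N by simp
  qed
  show "variance_error n d (cov_mat d \<mu>) lam \<in> borel_measurable (PiM {..<n} (\<lambda>_. \<mu>))" if "(n, d, \<mu>, lam, b) \<in> models M H"
    using moments_boundedD(2)[OF V that] by simp
  show "bias_error n d (cov_mat d \<mu>) lam b \<in> borel_measurable (PiM {..<n} (\<lambda>_. \<mu>))" if "(n, d, \<mu>, lam, b) \<in> models M H"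
    using moments_boundedD(2)[OF B that] by simp
qed

text \<open>Moves the problem to the product measure on which the estimates live.\<close>

lemma sample_law:
  assumes "linear_model P n d \<beta> \<tau> x \<epsilon> y" and n: "0 < n"
  shows "\<And>i. i < n \<Longrightarrow> x i \<in> P \<rightarrow>\<^sub>M vec_borel d"
    and "distr P (PiM {..<n} (\<lambda>_. vec_borel d)) (\<lambda>\<omega>. \<lambda>i\<in>{..<n}. x i \<omega>) = PiM {..<n} (\<lambda>_. distr P (vec_borel d) (x 0))"
proof -
  interpret linear_model P n d \<beta> \<tau> x \<epsilon> y by fact
  show m: "x i \<in> P \<rightarrow>\<^sub>M vec_borel d" if "i < n" for i
    using x_indep that by (simp add: indep_vars_def)
  have "distr P (PiM {..<n} (\<lambda>_. vec_borel d)) (\<lambda>\<omega>. \<lambda>i\<in>{..<n}. x i \<omega>) = PiM {..<n} (\<lambda>i. distr P (vec_borel d) (x i))"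
  proof (rule iffD1[OF indep_vars_iff_distr_eq_PiM' x_indep])
    show "{..<n} \<noteq> {}" using n by (simp add: lessThan_empty_iff)
    show "x i \<in> P \<rightarrow>\<^sub>M vec_borel d" if "i \<in> {..<n}" for i by (rule m) (use that in blast)
  qed
  also have "\<dots> = PiM {..<n} (\<lambda>_. distr P (vec_borel d) (x 0))"
    by (rule PiM_cong[OF refl]) (rule x_ident, blast)
  finally show "distr P (PiM {..<n} (\<lambda>_. vec_borel d)) (\<lambda>\<omega>. \<lambda>i\<in>{..<n}. x i \<omega>) = PiM {..<n} (\<lambda>_. distr P (vec_borel d) (x 0))" .
qed

text \<open>The constants in front of the rates come from the lower bounds on the effective
  quantities and depend on M. The order k, the exponent D and the constant of (A3) enter through the
  sample size threshold, which absorbs the moment constants.\<close>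

theorem proposition4p1:
  shows "\<forall>k\<ge>1::nat. \<exists>C\<^sub>k>0::real. \<forall>M>1::real. \<forall>C\<^sub>x>0::real. \<forall>D\<ge>1::nat.
    \<exists>N>0::real. \<exists>C\<^sub>V>0::real. \<exists>C\<^sub>B>0::real.
    \<forall>(n::nat) (d::nat) (P :: 'a measure) (\<beta> :: real vec) (\<tau>::real) (x :: nat \<Rightarrow> 'a \<Rightarrow> real vec)
      (\<epsilon> :: nat \<Rightarrow> 'a \<Rightarrow> real) (y :: nat \<Rightarrow> 'a \<Rightarrow> real) (z :: nat \<Rightarrow> 'a \<Rightarrow> real vec)
      (\<sigma> :: nat \<Rightarrow> real) (d\<^sub>\<Sigma>::real) (lam::real) (\<Sigma> :: real mat).
      real n \<ge> N \<longrightarrow>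
      linear_model P n d \<beta> \<tau> x \<epsilon> y \<longrightarrow>
      \<Sigma> = second_moment_mat P d (x 0) \<longrightarrow>
      assumption_A1 P n d x \<beta> \<sigma> \<longrightarrow>
      assumption_A2 n d \<sigma> d\<^sub>\<Sigma> \<longrightarrow>
      assumption_A3 P n d C\<^sub>x x z \<longrightarrow>
      1 / M \<le> real d / real n \<longrightarrow> real d / real n \<le> M \<longrightarrow>
      \<sigma> d \<ge> 1 / M \<longrightarrow>
      1 / M \<le> lam \<longrightarrow> lam \<le> M \<longrightarrow>
      measure P {\<omega> \<in> space P.
          \<bar>ridge_variance \<tau> \<Sigma> (design_mat n d x \<omega>) lam - eff_variance n \<tau> \<Sigma> lam\<bar>
            \<le> C\<^sub>V * ((ln (real n)) ^ 8 / real n powr (1 - 1 / real k)) * eff_variance n \<tau> \<Sigma> lam \<and>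
          \<bar>ridge_bias \<beta> \<Sigma> (design_mat n d x \<omega>) lam - eff_bias n \<beta> \<Sigma> lam\<bar>
            \<le> C\<^sub>B * ((ln (real n)) ^ 8 / real n powr (1 / 2 - 1 / real k)) * eff_bias n \<beta> \<Sigma> lam}
        \<ge> 1 - C\<^sub>k * real n powr (1 - real D)"
proof (intro allI impI, rule exI[of _ 2], rule conjI, simp, intro allI impI)
  fix k :: nat and M Cx :: real and D :: nat
  assume k: "1 \<le> k" and M: "1 < M" and Cx: "0 < Cx"
  obtain H where H: "\<And>K p n d (P :: 'a measure) Z A. prob_space P \<Longrightarrow> measurable_vec P d Z \<Longrightarrow> 1 \<le> n \<Longrightarrow> 1 \<le> d \<Longrightarrow> real d \<le> M * real n \<Longrightarrow>
      subgaussian_coordinates P d Cx Z \<or> convex_concentration P d Cx Z \<Longrightarrow> test_mat n d K A \<Longrightarrow>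
      (\<integral>\<^sup>+\<omega>. ennreal (((Z \<omega> \<bullet> (A *\<^sub>v Z \<omega>) - mat_trace A) / sqrt n) ^ (2 * p)) \<partial>P) \<le> ennreal (H K p)"
    using uniform_test_forms[OF Cx, of M, where 'a = 'a] by blast
  obtain N where N: "\<And>n d \<mu> lam b. (n, d, \<mu>, lam, b) \<in> models M H \<Longrightarrow> N \<le> real n \<Longrightarrow>
    measure (PiM {..<n} (\<lambda>_. \<mu>)) {w \<in> space (PiM {..<n} (\<lambda>_. \<mu>)). real n powr (1 / real k) < \<bar>variance_error n d (cov_mat d \<mu>) lam w\<bar>} \<le> real n powr (1 - real D) \<and>
    measure (PiM {..<n} (\<lambda>_. \<mu>)) {w \<in> space (PiM {..<n} (\<lambda>_. \<mu>)). real n powr (1 / real k) < \<bar>bias_error n d (cov_mat d \<mu>) lam b w\<bar>} \<le> real n powr (1 - real D)"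
    using deviation_bounds(1)[OF k, of M H D] by blast
  define CV CB where "CV = M ^ 3 * (1 + 2 * M)\<^sup>2" and "CB = M * (1 + M)\<^sup>2"
  have C: "0 < CV" "0 < CB" using M by (auto simp: CV_def CB_def intro!: mult_pos_pos)
  show "\<exists>N>0::real. \<exists>C\<^sub>V>0::real. \<exists>C\<^sub>B>0::real. 
    \<forall>(n::nat) (d::nat) (P :: 'a measure) (\<beta> :: real vec) (\<tau>::real) (x :: nat \<Rightarrow> 'a \<Rightarrow> real vec)
      (\<epsilon> :: nat \<Rightarrow> 'a \<Rightarrow> real) (y :: nat \<Rightarrow> 'a \<Rightarrow> real) (z :: nat \<Rightarrow> 'a \<Rightarrow> real vec)
      (\<sigma> :: nat \<Rightarrow> real) (d\<^sub>\<Sigma>::real) (lam::real) (\<Sigma> :: real mat).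
      real n \<ge> N \<longrightarrow>
      linear_model P n d \<beta> \<tau> x \<epsilon> y \<longrightarrow>
      \<Sigma> = second_moment_mat P d (x 0) \<longrightarrow>
      assumption_A1 P n d x \<beta> \<sigma> \<longrightarrow>
      assumption_A2 n d \<sigma> d\<^sub>\<Sigma> \<longrightarrow>
      assumption_A3 P n d Cx x z \<longrightarrow>
      1 / M \<le> real d / real n \<longrightarrow> real d / real n \<le> M \<longrightarrow>
      \<sigma> d \<ge> 1 / M \<longrightarrow>
      1 / M \<le> lam \<longrightarrow> lam \<le> M \<longrightarrow>
      measure P {\<omega> \<in> space P.
          \<bar>ridge_variance \<tau> \<Sigma> (design_mat n d x \<omega>) lam - eff_variance n \<tau> \<Sigma> lam\<bar>
            \<le> C\<^sub>V * ((ln (real n)) ^ 8 / real n powr (1 - 1 / real k)) * eff_variance n \<tau> \<Sigma> lam \<and>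
          \<bar>ridge_bias \<beta> \<Sigma> (design_mat n d x \<omega>) lam - eff_bias n \<beta> \<Sigma> lam\<bar>
            \<le> C\<^sub>B * ((ln (real n)) ^ 8 / real n powr (1 / 2 - 1 / real k)) * eff_bias n \<beta> \<Sigma> lam}
        \<ge> 1 - 2 * real n powr (1 - real D)"
  \<comment> \<open>The bound 3 exceeds e, so ln n >= 1 and the logarithmic factor can be inserted
    on the right.\<close>
  proof (rule exI[of _ "max N 3"], rule conjI, simp, rule exI[of _ CV], rule conjI, rule C, rule exI[of _ CB], rule conjI, rule C, intro allI impI)
    fix n d :: nat and P :: "'a measure" and \<beta> :: "real vec" and \<tau> and x z :: "nat \<Rightarrow> 'a \<Rightarrow> real vec" and \<epsilon> y :: "nat \<Rightarrow> 'a \<Rightarrow> real"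
      and \<sigma> :: "nat \<Rightarrow> real" and d\<^sub>\<Sigma> lam :: real and \<Sigma> :: "real mat"
    assume nN: "max N 3 \<le> real n" and lm: "linear_model P n d \<beta> \<tau> x \<epsilon> y" and \<Sigma>: "\<Sigma> = second_moment_mat P d (x 0)"
      and A1: "assumption_A1 P n d x \<beta> \<sigma>" and A3: "assumption_A3 P n d Cx x z" and dn: "1 / M \<le> real d / real n" "real d / real n \<le> M"
      and \<sigma>: "1 / M \<le> \<sigma> d" and lam: "1 / M \<le> lam" "lam \<le> M"
    interpret linear_model P n d \<beta> \<tau> x \<epsilon> y by (rule lm)
    have n: "0 < n" "1 \<le> n" using nN by auto
    have "0 < 1 / M" using M by simp
    with dn(1) have "0 < real d / real n" by linarith
    hence d: "0 < d" by (cases d) auto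
    have dM: "real d \<le> M * real n" using dn(2) n by (simp add: divide_le_eq)
    note xm = sample_law(1)[OF lm n(1)]
    have A1': "op_norm (second_moment_mat P d (x 0)) \<le> 1" "decreasing_eigenvalues d (second_moment_mat P d (x 0)) \<sigma>"
      using A1 by (simp_all add: assumption_A1_def Let_def)
    obtain S where S: "linear_image P d (z 0) (x 0) S" using linear_imageI(1)[OF prob_space_axioms n(1) xm[OF n(1)] A3 A1'(1)] by blast
    note sc = linear_imageI(2)[OF prob_space_axioms n(1) xm[OF n(1)] A3 A1'(1)]
    interpret L: linear_image P d "z 0" "x 0" S by (rule S)
    define \<mu> where "\<mu> = distr P (vec_borel d) (x 0)"
    have \<Sigma>\<mu>: "cov_mat d \<mu> = \<Sigma>" using L.cov_eq by (simp add: \<Sigma> \<mu>_def)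
    have model: "sample_model M H n d \<mu> lam"
      unfolding \<mu>_def using M n d dM lam by (intro L.sample_modelI H[OF prob_space_axioms L.Z _ _ _ sc]) auto
    have psd: "0 \<le> v \<bullet> (cov_mat d \<mu> *\<^sub>v v)" if "v \<in> carrier_vec d" for v using L.psd[OF that] by (simp add: \<mu>_def)
    have lower: "1 / M * (v \<bullet> v) \<le> v \<bullet> (cov_mat d \<mu> *\<^sub>v v)" if v: "v \<in> carrier_vec d" for v
    proof -
      have "1 / M * (v \<bullet> v) \<le> \<sigma> d * (v \<bullet> v)" using \<sigma> by (intro mult_right_mono) auto
      also have "\<dots> \<le> v \<bullet> (cov_mat d \<mu> *\<^sub>v v)"
        using A1'(2) by (intro quad_form_ge_least_eigenvalue cov_mat_carrier transpose_cov_mat d psd v) (simp_all add: \<Sigma>\<mu> \<Sigma>)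
      finally show ?thesis .
    qed
    \<comment> \<open>The family admits directions of norm at most 1 only; the bias is quadratic in
      the coefficient vector, so its length factors out as s^2.\<close>
    define s b where "s = vec_norm \<beta>" and "b = (1 / vec_norm \<beta>) \<cdot>\<^sub>v \<beta>"
    have b: "b \<in> carrier_vec d" "vec_norm b \<le> 1" and \<beta>: "\<beta> = s \<cdot>\<^sub>v b"
      using vec_normalize[OF beta_carrier] beta_carrier by (simp_all add: s_def b_def)
    have mem: "(n, d, \<mu>, lam, b) \<in> models M H" using model psd b by (simp add: models_def)
    interpret E: effective "{()}" M H "\<lambda>_. n" "\<lambda>_. d" "\<lambda>_. \<mu>" "\<lambda>_. lam" by (rule effective.intro) (use model psd in auto)
    have EV: "\<tau>\<^sup>2 \<le> CV * eff_variance n \<tau> \<Sigma> lam" and EB: "s\<^sup>2 \<le> CB * eff_bias n \<beta> \<Sigma> lam"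
      using E.effective_lower_bounds[OF _ lower, of "()"] dn(1) beta_carrier by (simp_all add: \<Sigma>\<mu> CV_def CB_def s_def)
    define Y where "Y \<omega> = (\<lambda>i\<in>{..<n}. x i \<omega>)" for \<omega>
    have Ym: "Y \<in> P \<rightarrow>\<^sub>M PiM {..<n} (\<lambda>_. vec_borel d)" unfolding Y_def using xm by (intro measurable_restrict) auto
    have law: "distr P (PiM {..<n} (\<lambda>_. vec_borel d)) Y = PiM {..<n} (\<lambda>_. \<mu>)" unfolding Y_def \<mu>_def by (rule sample_law(2)[OF lm n(1)])
    have sets: "sets (PiM {..<n} (\<lambda>_. \<mu>)) = sets (PiM {..<n} (\<lambda>_. vec_borel d))" by (rule sets_PiM_cong) (auto simp: \<mu>_def)
    have Ym': "Y \<in> P \<rightarrow>\<^sub>M PiM {..<n} (\<lambda>_. \<mu>)" using Ym measurable_cong_sets[OF refl sets] by blast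
    define v where "v \<omega> = variance_error n d \<Sigma> lam (Y \<omega>)" for \<omega>
    define w where "w \<omega> = bias_error n d \<Sigma> lam b (Y \<omega>)" for \<omega>
    note Vm = deviation_bounds(2)[OF k mem, unfolded \<Sigma>\<mu>] and Bm = deviation_bounds(3)[OF k mem, unfolded \<Sigma>\<mu>]
    have [measurable]: "v \<in> borel_measurable P" unfolding v_def by (rule measurable_compose[OF Ym' Vm])
    have [measurable]: "w \<in> borel_measurable P" unfolding w_def by (rule measurable_compose[OF Ym' Bm])
    define t where "t = real n powr (1 / real k)"
    have transfer: "prob {\<omega> \<in> space P. t < \<bar>f (Y \<omega>)\<bar>} = measure (PiM {..<n} (\<lambda>_. \<mu>)) {w \<in> space (PiM {..<n} (\<lambda>_. \<mu>)). t < \<bar>f w\<bar>}"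
      if f: "f \<in> borel_measurable (PiM {..<n} (\<lambda>_. \<mu>))" for f
    proof -
      let ?A = "{w \<in> space (PiM {..<n} (\<lambda>_. \<mu>)). t < \<bar>f w\<bar>}"
      have A: "?A \<in> sets (PiM {..<n} (\<lambda>_. \<mu>))" using f by measurable
      have "measure (distr P (PiM {..<n} (\<lambda>_. vec_borel d)) Y) ?A = prob (Y -` ?A \<inter> space P)"
        using A sets by (intro measure_distr Ym) simp
      also have "Y -` ?A \<inter> space P = {\<omega> \<in> space P. t < \<bar>f (Y \<omega>)\<bar>}" using measurable_space[OF Ym'] by auto
      finally show ?thesis by (simp add: law)
    qed
    \<comment> \<open>The two exceptional events, one for each error. Each has probability at most
      n^(1 - D), hence the constant 2.\<close>
    define A1 A2 where "A1 = {\<omega> \<in> space P. t < \<bar>v \<omega>\<bar>}" and "A2 = {\<omega> \<in> space P. t < \<bar>w \<omega>\<bar>}"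
    have [measurable]: "A1 \<in> events" "A2 \<in> events" unfolding A1_def A2_def by measurable
    have p: "prob A1 \<le> real n powr (1 - real D)" "prob A2 \<le> real n powr (1 - real D)"
      unfolding A1_def A2_def v_def w_def transfer[OF Vm] transfer[OF Bm] unfolding t_def
      using N[OF mem] nN by (simp_all add: \<Sigma>\<mu>)
    have L8: "1 \<le> ln (real n) ^ 8"
    proof (rule one_le_power)
      have "exp 1 \<le> real n" using exp_le nN by simp
      hence "ln (exp 1) \<le> ln (real n)" by (subst ln_le_cancel_iff) (use n in auto)
      thus "1 \<le> ln (real n)" by simp
    qed
    have carr: "Y \<omega> j \<in> carrier_vec d" if "\<omega> \<in> space P" "j < n" for \<omega> j using measurable_space[OF xm[OF that(2)] that(1)] that(2) by (simp add: Y_def)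
    have design: "design_mat n d x \<omega> = Matrix.mat n d (\<lambda>(i, j). Y \<omega> i $ j)" for \<omega>
      unfolding design_mat_def by (rule cong_mat) (auto simp: Y_def)
    have diffV: "ridge_variance \<tau> \<Sigma> (design_mat n d x \<omega>) lam - eff_variance n \<tau> \<Sigma> lam = \<tau>\<^sup>2 / n * v \<omega>" if "\<omega> \<in> space P" for \<omega>
      using E.ridge_variance_error[of "()" "Y \<omega>" \<tau>] carr[OF that] by (simp add: \<Sigma>\<mu> design v_def)
    have diffB: "ridge_bias \<beta> \<Sigma> (design_mat n d x \<omega>) lam - eff_bias n \<beta> \<Sigma> lam = s\<^sup>2 / sqrt n * w \<omega>" if "\<omega> \<in> space P" for \<omega>
      using E.ridge_bias_error(1)[of "()" "Y \<omega>" b s] carr[OF that] b(1) by (simp add: \<Sigma>\<mu> \<beta>[symmetric] design w_def)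
    let ?G = "{\<omega> \<in> space P.
          \<bar>ridge_variance \<tau> \<Sigma> (design_mat n d x \<omega>) lam - eff_variance n \<tau> \<Sigma> lam\<bar>
            \<le> CV * ((ln (real n)) ^ 8 / real n powr (1 - 1 / real k)) * eff_variance n \<tau> \<Sigma> lam \<and>
          \<bar>ridge_bias \<beta> \<Sigma> (design_mat n d x \<omega>) lam - eff_bias n \<beta> \<Sigma> lam\<bar>
            \<le> CB * ((ln (real n)) ^ 8 / real n powr (1 / 2 - 1 / real k)) * eff_bias n \<beta> \<Sigma> lam}"
    have "?G = {\<omega> \<in> space P. \<bar>\<tau>\<^sup>2 / n * v \<omega>\<bar> \<le> CV * ((ln (real n)) ^ 8 / real n powr (1 - 1 / real k)) * eff_variance n \<tau> \<Sigma> lam \<and>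
      \<bar>s\<^sup>2 / sqrt n * w \<omega>\<bar> \<le> CB * ((ln (real n)) ^ 8 / real n powr (1 / 2 - 1 / real k)) * eff_bias n \<beta> \<Sigma> lam}"
      using diffV diffB by (intro Collect_cong conj_cong refl) simp_all
    also have "\<dots> \<in> events" by measurable
    finally have G: "?G \<in> events" .
    have "space P - (A1 \<union> A2) \<subseteq> ?G"
    proof
      fix \<omega> assume \<omega>: "\<omega> \<in> space P - (A1 \<union> A2)"
      hence sp: "\<omega> \<in> space P" and vt: "\<bar>v \<omega>\<bar> \<le> t" and wt: "\<bar>w \<omega>\<bar> \<le> t" by (auto simp: A1_def A2_def)
      have n': "0 < real n" using n by simp
      \<comment> \<open>The threshold n^(1/k) divided by the scaling of each error, n here and sqrt
        n next, produces the stated rates.\<close>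
      have t1: "t / real n = 1 / real n powr (1 - 1 / real k)" using n' by (simp add: t_def powr_diff)
      have t2: "t / sqrt (real n) = 1 / real n powr (1 / 2 - 1 / real k)" using n' by (simp add: t_def powr_diff powr_half_sqrt)
      have "\<bar>\<tau>\<^sup>2 / n * v \<omega>\<bar> \<le> \<tau>\<^sup>2 * (t / real n)" using vt n' by (simp add: abs_mult divide_right_mono mult_left_mono)
      hence 1: "\<bar>\<tau>\<^sup>2 / n * v \<omega>\<bar> \<le> \<tau>\<^sup>2 / real n powr (1 - 1 / real k)" by (simp add: t1)
      have "\<bar>s\<^sup>2 / sqrt n * w \<omega>\<bar> \<le> s\<^sup>2 * (t / sqrt (real n))" using wt n' by (simp add: abs_mult divide_right_mono mult_left_mono)
      hence 2: "\<bar>s\<^sup>2 / sqrt n * w \<omega>\<bar> \<le> s\<^sup>2 / real n powr (1 / 2 - 1 / real k)" by (simp add: t2)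
      show "\<omega> \<in> ?G"
        using sp relative_error[OF 1 EV L8] relative_error[OF 2 EB L8] n'
        unfolding mem_Collect_eq diffV[OF sp] diffB[OF sp] by (intro conjI) simp_all
    qed
    hence "prob (space P - (A1 \<union> A2)) \<le> prob ?G" using G by (rule finite_measure_mono)
    moreover have "prob (space P - (A1 \<union> A2)) = 1 - prob (A1 \<union> A2)" by (rule prob_compl) measurable
    moreover have "prob (A1 \<union> A2) \<le> prob A1 + prob A2" by (rule measure_Un_le) measurable
    ultimately show "1 - 2 * real n powr (1 - real D) \<le> prob ?G" using p by linarith
  qed
qed

end
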